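(* Let $d\in\{1,2,3\}$, $\nu>0$, and let $\alpha>0$ be fixed (not depending on $n$). Suppose that $m_j\in \mathcal W_2^{\nu+d/2}(\mathcal S)$ for $j=1,\ldots,p$ and that $M_n$ has rank $p$ for all $n\ge p$. Suppose that $\Omega_\beta$ is symmetric positive semidefinite and that the conditional prior density $\pi(\theta|\alpha)$ is a proper density in $\theta\in(0,\infty)$ which is continuously differentiable in $\theta$, continuous in $\alpha$, finite for all $\theta,\alpha\in(0,\infty)$, does not depend on $n$, and satisfies $\pi(\theta_0|\alpha)>0$ for all $\alpha>0$. Then: (a) the REML $\widetilde\theta_\alpha$ satisfies $\sqrt n\,(\widetilde\theta_\alpha-\theta_0)\to \mathcal N(0,2\theta_0^2)$ in distribution as $n\to\infty$; (b) almost surely $P_{(\beta_0,\sigma_0^2,\alpha_0)}$, $$\limsup_{n\to\infty}\ \frac{\left\|\Pi(d\theta|Y_n,\alpha)-\mathcal N\big(d\theta\,\big|\,\widetilde\theta_\alpha,\,2\theta_0^2/n\big)\right\|_{TV}}{n^{-1/2}(\log n)^3}<\infty ,$$ so in particular this total variation distance converges to $0$ as $n\to\infty$. Here $\Pi(\cdot|Y_n,\alpha)$ is the conditional posterior of $\theta$ given $\alpha$, with density $$\pi(\theta|Y_n,\alpha)=\frac{\exp\{\mathcal L_n(\theta/\alpha^{2\nu},\alpha)\}\,\pi(\theta|\alpha)}{\int_0^\infty \exp\{\mathcal L_n(\theta'/\alpha^{2\nu},\alpha)\}\,\pi(\theta'|\alpha)\,d\theta'} .$$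
   Context: Setup. $0<T<\infty$, $\mathcal S=[0,T]^d$, $\nu>0$ is known, $p\ge 1$ is fixed, and $m=(m_1,\ldots,m_p)^\top$ are known functions on $\mathcal S$. For $\alpha>0$ the Matérn correlation function is $K_{\alpha,\nu}(x)=\frac{2^{1-\nu}}{\Gamma(\nu)}(\alpha\|x\|)^{\nu}\mathcal K_\nu(\alpha\|x\|)$ with $K_{\alpha,\nu}(0)=1$, where $\mathcal K_\nu$ is the modified Bessel function of the second kind. The true process is $Y(s)=m(s)^\top\beta_0+X(s)$, $s\in\mathcal S$, where $X$ is a mean-zero Gaussian process with covariance $\mathrm{Cov}(X(s),X(t))=\sigma_0^2K_{\alpha_0,\nu}(s-t)$; $\beta_0\in\mathbb R^p$, $\sigma_0^2>0$, $\alpha_0>0$ are the fixed true values, $P_{(\beta_0,\sigma_0^2,\alpha_0)}$ is the law of $Y$, and $\theta_0=\sigma_0^2\alpha_0^{2\nu}$. For each $n$, $\mathcal S_n=\{s_1,\ldots,s_n\}\subset\mathcal S$ consists of $n$ distinct points (otherwise arbitrary), $Y_n=(Y(s_1),\ldots,Y(s_n))^\top$, $M_n$ is the $n\times p$ matrix with rows $m(s_i)^\top$, and $R_\alpha$ is the $n\times n$ matrix with entries $K_{\alpha,\nu}(s_i-s_j)$. $\Omega_\beta$ is a fixed symmetric positive semidefinite $p\times p$ matrix; it is the scaled precision matrix of the prior $\beta|\sigma^2,\alpha\sim\mathcal N(0_p,\sigma^2\Omega_\beta^{-1})$ ($\Omega_\beta=0$ is allowed and means the flat prior). The restricted log-likelihood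 obtained by integrating out $\beta$ is $$\mathcal L_n(\sigma^2,\alpha)=-\tfrac{1}{2\sigma^2}Y_n^\top Q_\alpha Y_n-\tfrac{n-p}{2}\log\sigma^2-\tfrac12\log|R_\alpha|-\tfrac12\log|M_n^\top R_\alpha^{-1}M_n+\Omega_\beta|,$$ $$Q_\alpha=R_\alpha^{-1}-R_\alpha^{-1}M_n(M_n^\top R_\alpha^{-1}M_n+\Omega_\beta)^{-1}M_n^\top R_\alpha^{-1}.$$ The microergodic parameter is $\theta=\sigma^2\alpha^{2\nu}$, and the REML is $\widetilde\theta_\alpha=\frac{\alpha^{2\nu}}{n-p}Y_n^\top Q_\alpha Y_n$. $\|P_1-P_2\|_{TV}=\sup_A|P_1(A)-P_2(A)|$ over measurable sets. $\mathcal N(d\theta|\mu,v)$ is the normal measure with mean $\mu$ and variance $v$. $\mathcal W_2^{k}(\mathcal S)$ is the $L_2$-Sobolev space of order $k$ on $\mathcal S$: for integer $k$, functions whose partial derivatives of order $\le k$ lie in $L_2(\mathcal S)$; for general real $k>0$, restrictions to $\mathcal S$ of $g\in L_2(\mathbb R^d)$ with $\int(1+\|\omega\|^2)^k|\widehat g(\omega)|^2d\omega<\infty$. *)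

theory Defs
  imports
    "HOL-Probability.Probability"
    "Jordan_Normal_Form.Gauss_Jordan_Elimination"
    "Jordan_Normal_Form.DL_Rank"
begin

section \<open>Matern correlation function\<close>

text \<open>
  The modified Bessel function of the second kind at \<open>x > 0\<close>, through the integral representation
  \<open>K\<^sub>\<nu>(x) = \<integral>\<^sub>0\<^sup>\<infinity> exp (- x cosh t) cosh (\<nu> t) dt\<close> (DLMF 10.32.9), which holds for every real
  order, integer or not.
\<close>

definition bessel_K :: "real \<Rightarrow> real \<Rightarrow> real" where
  "bessel_K \<nu> x = (LBINT t:{0<..}. exp (- x * cosh t) * cosh (\<nu> * t))"

definition matern :: "real \<Rightarrow> real \<Rightarrow> 'a::euclidean_space \<Rightarrow> real" where
  "matern \<alpha> \<nu> x =
     (if x = 0 then 1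
      else 2 powr (1 - \<nu>) / Gamma \<nu> * (\<alpha> * norm x) powr \<nu> * bessel_K \<nu> (\<alpha> * norm x))"

section \<open>Sobolev spaces\<close>

definition truncated_fourier :: "real \<Rightarrow> ('a::euclidean_space \<Rightarrow> real) \<Rightarrow> 'a \<Rightarrow> complex" where
  "truncated_fourier r g \<omega> =
     (LINT x:cball 0 r|lborel. complex_of_real (g x) * cis (- inner x \<omega>))"

text \<open>
  The Fourier transform on \<open>L\<^sub>2\<close> (Plancherel), which need not be given by a convergent integral:
  \<open>h\<close> is the \<open>L\<^sub>2\<close>-limit of the transforms of the truncations of \<open>g\<close> to balls. It is determined up
  to null sets, and the normalising constant is immaterial for Sobolev regularity.
\<close>

definition is_L2_fourier :: "('a::euclidean_space \<Rightarrow> real) \<Rightarrow> ('a \<Rightarrow> complex) \<Rightarrow> bool" where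
  "is_L2_fourier g h \<longleftrightarrow>
     h \<in> borel_measurable lborel \<and>
     (\<integral>\<^sup>+ \<omega>. ennreal ((cmod (h \<omega>))\<^sup>2) \<partial>lborel) < \<infinity> \<and>
     ((\<lambda>r. \<integral>\<^sup>+ \<omega>. ennreal ((cmod (h \<omega> - truncated_fourier r g \<omega>))\<^sup>2) \<partial>lborel) \<longlongrightarrow> 0) at_top"

text \<open>
  \<open>L\<^sub>2\<close>-Sobolev space of real order \<open>k > 0\<close>: restrictions to \<open>S\<close> of functions in \<open>W\<^sub>2\<^sup>k\<close> of the whole
  space. Elements are \<open>L\<^sub>2\<close>-classes, so a function belongs to it if it agrees almost everywhere on
  \<open>S\<close> with such a restriction.
\<close>

definition sobolev_space :: "real \<Rightarrow> 'a::euclidean_space set \<Rightarrow> ('a \<Rightarrow> real) set" where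
  "sobolev_space k S =
     {f. \<exists>g h. g \<in> borel_measurable lborel \<and>
               (\<integral>\<^sup>+ x. ennreal ((g x)\<^sup>2) \<partial>lborel) < \<infinity> \<and>
               is_L2_fourier g h \<and>
               (\<integral>\<^sup>+ \<omega>. ennreal ((1 + (norm \<omega>)\<^sup>2) powr k * (cmod (h \<omega>))\<^sup>2) \<partial>lborel) < \<infinity> \<and>
               (AE x in lborel. x \<in> S \<longrightarrow> f x = g x)}"

section \<open>Gaussian processes and total variation\<close>

definition normal_measure :: "real \<Rightarrow> real \<Rightarrow> real measure" where
  "normal_measure \<mu> v =
     (if v > 0 then density lborel (normal_density \<mu> (sqrt v)) else return borel \<mu>)"

definition gaussian_process :: "'w measure \<Rightarrow> 'a set \<Rightarrow> ('a \<Rightarrow> 'w \<Rightarrow> real) \<Rightarrow> bool" where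
  "gaussian_process P S X \<longleftrightarrow>
     (\<forall>t\<in>S. X t \<in> borel_measurable P) \<and>
     (\<forall>F c. finite F \<and> F \<subseteq> S \<longrightarrow>
        (\<exists>\<mu> v. 0 \<le> v \<and> distr P borel (\<lambda>w. \<Sum>t\<in>F. c t * X t w) = normal_measure \<mu> v))"

definition covariance :: "'w measure \<Rightarrow> ('w \<Rightarrow> real) \<Rightarrow> ('w \<Rightarrow> real) \<Rightarrow> real" where
  "covariance P U V = (LINT w|P. (U w - (LINT w|P. U w)) * (V w - (LINT w|P. V w)))"

definition tv_dist :: "'a measure \<Rightarrow> 'a measure \<Rightarrow> real" where
  "tv_dist P Q = (SUP A\<in>sets P. \<bar>measure P A - measure Q A\<bar>)"

section \<open>Restricted likelihood, REML and conditional posterior\<close>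

text \<open>
  Throughout, \<open>s\<close> lists the design points as \<open>s 0, \<dots>, s (n - 1)\<close>, and \<open>m j\<close> for \<open>j < p\<close> are the
  regression functions.
\<close>

abbreviation minv :: "real mat \<Rightarrow> real mat" where
  "minv A \<equiv> the (mat_inverse A)"

definition psd_mat :: "nat \<Rightarrow> real mat \<Rightarrow> bool" where
  "psd_mat p A \<longleftrightarrow>
     A \<in> carrier_mat p p \<and> A\<^sup>T = A \<and> (\<forall>x\<in>carrier_vec p. 0 \<le> x \<bullet> (A *\<^sub>v x))"

definition corr_mat :: "real \<Rightarrow> nat \<Rightarrow> (nat \<Rightarrow> 'a::euclidean_space) \<Rightarrow> real \<Rightarrow> real mat" where
  "corr_mat \<nu> n s \<alpha> = mat n n (\<lambda>(i, j). matern \<alpha> \<nu> (s i - s j))"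

definition design_mat ::
  "nat \<Rightarrow> (nat \<Rightarrow> 'a \<Rightarrow> real) \<Rightarrow> nat \<Rightarrow> (nat \<Rightarrow> 'a) \<Rightarrow> real mat" where
  "design_mat p m n s = mat n p (\<lambda>(i, j). m j (s i))"

definition gls_mat :: "real mat \<Rightarrow> real mat \<Rightarrow> real mat \<Rightarrow> real mat" where
  "gls_mat R M \<Omega> = M\<^sup>T * minv R * M + \<Omega>"

definition Q_mat :: "real mat \<Rightarrow> real mat \<Rightarrow> real mat \<Rightarrow> real mat" where
  "Q_mat R M \<Omega> = minv R - minv R * M * minv (gls_mat R M \<Omega>) * M\<^sup>T * minv R"

definition restricted_loglik ::
  "real \<Rightarrow> nat \<Rightarrow> (nat \<Rightarrow> 'a::euclidean_space \<Rightarrow> real) \<Rightarrow> real mat \<Rightarrow>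
   nat \<Rightarrow> (nat \<Rightarrow> 'a) \<Rightarrow> real vec \<Rightarrow> real \<Rightarrow> real \<Rightarrow> real" where
  "restricted_loglik \<nu> p m \<Omega> n s y \<sigma>sq \<alpha> =
     (let R = corr_mat \<nu> n s \<alpha>; M = design_mat p m n s in
        - (1 / (2 * \<sigma>sq)) * (y \<bullet> (Q_mat R M \<Omega> *\<^sub>v y))
        - (real n - real p) / 2 * ln \<sigma>sq
        - 1 / 2 * ln (Determinant.det R)
        - 1 / 2 * ln (Determinant.det (gls_mat R M \<Omega>)))"

definition reml ::
  "real \<Rightarrow> nat \<Rightarrow> (nat \<Rightarrow> 'a::euclidean_space \<Rightarrow> real) \<Rightarrow> real mat \<Rightarrow>
   nat \<Rightarrow> (nat \<Rightarrow> 'a) \<Rightarrow> real vec \<Rightarrow> real \<Rightarrow> real" where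
  "reml \<nu> p m \<Omega> n s y \<alpha> =
     \<alpha> powr (2 * \<nu>) / (real n - real p)
       * (y \<bullet> (Q_mat (corr_mat \<nu> n s \<alpha>) (design_mat p m n s) \<Omega> *\<^sub>v y))"

definition posterior_density ::
  "real \<Rightarrow> nat \<Rightarrow> (nat \<Rightarrow> 'a::euclidean_space \<Rightarrow> real) \<Rightarrow> real mat \<Rightarrow> (real \<Rightarrow> real \<Rightarrow> real) \<Rightarrow>
   nat \<Rightarrow> (nat \<Rightarrow> 'a) \<Rightarrow> real vec \<Rightarrow> real \<Rightarrow> real \<Rightarrow> real" where
  "posterior_density \<nu> p m \<Omega> prior n s y \<alpha> \<theta> =
     exp (restricted_loglik \<nu> p m \<Omega> n s y (\<theta> / \<alpha> powr (2 * \<nu>)) \<alpha>) * prior \<theta> \<alpha> /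
     (LBINT t:{0<..}.
        exp (restricted_loglik \<nu> p m \<Omega> n s y (t / \<alpha> powr (2 * \<nu>)) \<alpha>) * prior t \<alpha>)"

text \<open>The posterior lives on \<open>(0, \<infinity>)\<close>; it is regarded as a measure on the real line, like the normal law.\<close>

definition posterior ::
  "real \<Rightarrow> nat \<Rightarrow> (nat \<Rightarrow> 'a::euclidean_space \<Rightarrow> real) \<Rightarrow> real mat \<Rightarrow> (real \<Rightarrow> real \<Rightarrow> real) \<Rightarrow>
   nat \<Rightarrow> (nat \<Rightarrow> 'a) \<Rightarrow> real vec \<Rightarrow> real \<Rightarrow> real measure" where
  "posterior \<nu> p m \<Omega> prior n s y \<alpha> =
     density lborel
       (\<lambda>\<theta>. ennreal (indicator {0<..} \<theta> * posterior_density \<nu> p m \<Omega> prior n s y \<alpha> \<theta>))"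

end

theory Submission
  imports Defs "HOL-Real_Asymp.Real_Asymp"
begin

text \<open>
  Variances of linear combinations of \<open>X\<close> at the design points are weighted \<open>L\<^sub>2\<close> norms ("energies")
  of trigonometric polynomials, the weight being the spectral density
  \<open>(\<alpha>\<^sup>2 + \<bar>\<omega>\<bar>\<^sup>2) powr - (\<nu> + d / 2)\<close>. With \<open>\<sigma>\<^sup>2 \<alpha> powr (2 * \<nu>) = \<theta>\<^sub>0\<close> held fixed, the weights for \<open>\<alpha>\<close> and
  \<open>\<alpha>\<^sub>0\<close> have ratio \<open>1 + O(\<bar>\<omega>\<bar> powr - 2)\<close>. Point evaluations are bounded by the energy (the points lie in a
  fixed cube), so splitting \<open>1 / (1 + \<bar>\<omega>\<bar>\<^sup>2)\<close> into \<open>e + e powr (- 3 / 4) * (1 + \<bar>\<omega>\<bar>\<^sup>2) powr (- 7 / 4)\<close> with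
  \<open>e = n powr (- 4 / 7)\<close>, where the second term is integrable because \<open>d \<le> 3\<close>, shows that whitening the data with \<open>\<alpha>\<close>
  instead of \<open>\<alpha>\<^sub>0\<close> changes the total variance by only \<open>O(n powr (3 / 7)) = o(sqrt n)\<close>. The regression part costs at most \<open>p\<close> squared normal variables of bounded variance.
  Hence \<open>(n - p)\<close> times the REML is \<open>\<theta>\<^sub>0\<close> times a chi-square variable with \<open>n\<close> degrees of freedom
  up to \<open>o(sqrt n)\<close>, which gives (a) by the central limit theorem and, with exponential moments and
  Borel-Cantelli, \<open>REML - \<theta>\<^sub>0 = O(ln n / sqrt n)\<close> almost surely. For such values of the REML the posterior, whose
  likelihood is an inverse gamma kernel, is within \<open>O(n powr (- 1 / 2) * ln n ^ 3)\<close> of the normal law.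
\<close>

section \<open>Spectral form of the Matern correlation\<close>

text \<open>Why 7/4: write x for \<open>1 / (1 + w)\<close>, with \<open>w\<close> the squared norm
  of the frequency, and bound it by \<open>e + e powr (1 - q) * x powr q\<close>. The first term
  costs \<open>n * e\<close>, one \<open>e\<close> for each of the n normalised coordinates. The
  second costs a multiple of \<open>e powr (1 - q)\<close>, provided that \<open>x powr q\<close> is
  integrable over the frequencies, that is, q > d/2. Balancing gives
  \<open>e = n powr (- 1 / q)\<close> and total cost \<open>n powr (1 - 1 / q)\<close>, which is
  o(sqrt n) exactly when q < 2. Dimension three therefore leaves the window 3/2 < q < 2, and 7/4 is
  its midpoint. The obstacle throughout is that the design is arbitrary and may be unrelated for
  different n: there is no limiting spectrum of the correlation matrices and no filtration. Hence
  every estimate is made for fixed n, with constants that do not depend on the design, and almost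
  sure statements come from summable tail probabilities. Gaussianity is given as normality of each
  finite linear combination, so the law of a quadratic form has to be recovered from the laws of
  linear ones.\<close>

lemma Gamma_conv_nn_integral_scaled:
  fixes c s :: real
  assumes c: "c > 0" and s: "s > 0"
  shows "(\<integral>\<^sup>+ r. ennreal (indicator {0<..} r * (r powr (s - 1) * exp (- (c * r)))) \<partial>lborel)
       = ennreal (Gamma s * c powr (- s))"
proof -
  let ?I = "\<integral>\<^sup>+ r. ennreal (indicator {0<..} r * (r powr (s - 1) * exp (- (c * r)))) \<partial>lborel"
  have "ennreal (Gamma s) = (\<integral>\<^sup>+ t. ennreal (indicat_real {0..} t * t powr (s - 1) / exp t) \<partial>lborel)"
    by (rule Gamma_conv_nn_integral_real[OF s])
  also have "\<dots> = ennreal \<bar>c\<bar> * (\<integral>\<^sup>+ r. ennreal (indicat_real {0..} (0 + c * r) * (0 + c * r) powr (s - 1) / exp (0 + c * r)) \<partial>lborel)"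
    using c by (intro nn_integral_real_affine) auto
  also have "\<dots> = ennreal c * (\<integral>\<^sup>+ r. ennreal (c powr (s - 1)) * ennreal (indicator {0<..} r * (r powr (s - 1) * exp (- (c * r)))) \<partial>lborel)"
    using c by (intro arg_cong2[where f="(*)"] nn_integral_cong)
      (auto simp: indicator_def powr_mult exp_minus divide_simps zero_le_mult_iff ennreal_mult'[symmetric] intro!: arg_cong[where f=ennreal])
  also have "\<dots> = ennreal c * (ennreal (c powr (s - 1)) * ?I)"
    by (subst nn_integral_cmult) auto
  also have "\<dots> = ennreal (c powr s) * ?I"
    using c by (simp add: mult.assoc[symmetric] ennreal_mult'[symmetric] powr_diff)
  finally have *: "ennreal (Gamma s) = ennreal (c powr s) * ?I" .
  have "ennreal (Gamma s * c powr (- s)) = ennreal (c powr (- s)) * (ennreal (c powr s) * ?I)"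
    unfolding *[symmetric] using s by (simp add: ennreal_mult'[symmetric] mult.commute)
  also have "\<dots> = ?I"
    using c by (simp add: mult.assoc[symmetric] ennreal_mult'[symmetric] powr_minus)
  finally show ?thesis by simp
qed

lemma borel_measurable_cis [measurable (raw)]:
  "f \<in> borel_measurable M \<Longrightarrow> (\<lambda>x. cis (f x)) \<in> borel_measurable M"
  by (rule measurable_compose[OF _ borel_measurable_continuous_onI]) (auto intro!: continuous_intros)

text \<open>The scaling by \<open>sqrt (2 * r)\<close> reduces the integral to the characteristic
  function of the standard normal law at the point \<open>x / sqrt (2 * r)\<close>.\<close>

lemma gaussian_fourier_real:
  fixes r x :: real
  assumes r: "r > 0"
  shows "integrable lborel (\<lambda>t. complex_of_real (exp (- (r * t\<^sup>2))) * cis (t * x))"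
    and "(LINT t|lborel. complex_of_real (exp (- (r * t\<^sup>2))) * cis (t * x))
       = complex_of_real (sqrt (pi / r) * exp (- x\<^sup>2 / (4 * r)))"
proof -
  define u where "u = x / sqrt (2 * r)"
  define c where "c = sqrt (2 * r)"
  have c: "c > 0" using r by (simp add: c_def)
  have c2: "c\<^sup>2 = 2 * r" using r by (simp add: c_def)
  let ?g = "\<lambda>t. complex_of_real (std_normal_density t) * cis (t * u)"
  have int: "integrable lborel ?g"
    by (rule Bochner_Integration.integrable_bound[where f="std_normal_density"])
       (auto simp: norm_mult)
  have "(LINT t|lborel. ?g t) = char std_normal_distribution u"
    unfolding char_def by (subst integral_density)
      (auto simp: scaleR_conv_of_real cis_conv_exp mult.commute)
  also have "\<dots> = exp (- u\<^sup>2 / 2)"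
    by (simp add: char_std_normal_distribution)
  finally have 1: "(LINT t|lborel. ?g t) = exp (- u\<^sup>2 / 2)" .
  have eq: "?g (0 + c * t) = complex_of_real (1 / sqrt (2 * pi)) * (complex_of_real (exp (- (r * t\<^sup>2))) * cis (t * x))" for t
  proof -
    have 0: "c * t * u = t * x" using c by (simp add: u_def c_def[symmetric])
    moreover have "(c * t)\<^sup>2 / 2 = r * t\<^sup>2" by (simp add: power_mult_distrib c2)
    ultimately show ?thesis by (simp add: std_normal_density_def 0)
  qed
  have "integrable lborel (\<lambda>t. ?g (0 + c * t))"
    using lborel_integrable_real_affine[OF int, of c 0] c by simp
  then have "integrable lborel (\<lambda>t. complex_of_real (sqrt (2 * pi)) * ?g (0 + c * t))"
    by (rule integrable_mult_right)
  then show "integrable lborel (\<lambda>t. complex_of_real (exp (- (r * t\<^sup>2))) * cis (t * x))"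
    unfolding eq by simp
  have "(LINT t|lborel. ?g t) = \<bar>c\<bar> *\<^sub>R (LINT t|lborel. ?g (0 + c * t))"
    using c by (intro lborel_integral_real_affine) auto
  also have "\<dots> = c *\<^sub>R (complex_of_real (1 / sqrt (2 * pi)) * (LINT t|lborel. complex_of_real (exp (- (r * t\<^sup>2))) * cis (t * x)))"
    using c unfolding eq by simp
  finally have "exp (- u\<^sup>2 / 2) = complex_of_real (c / sqrt (2 * pi)) * (LINT t|lborel. complex_of_real (exp (- (r * t\<^sup>2))) * cis (t * x))"
    unfolding 1 by (simp add: scaleR_conv_of_real)
  then have "complex_of_real (sqrt (2 * pi) / c * exp (- u\<^sup>2 / 2)) = (LINT t|lborel. complex_of_real (exp (- (r * t\<^sup>2))) * cis (t * x))"
    using c by (simp add: field_simps)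
  moreover have "sqrt (2 * pi) / c = sqrt (pi / r)"
    using r by (simp add: c_def real_sqrt_divide real_sqrt_mult)
  moreover have "- u\<^sup>2 / 2 = - x\<^sup>2 / (4 * r)"
    using r by (simp add: u_def power_divide)
  ultimately show "(LINT t|lborel. complex_of_real (exp (- (r * t\<^sup>2))) * cis (t * x))
       = complex_of_real (sqrt (pi / r) * exp (- x\<^sup>2 / (4 * r)))" by simp
qed

text \<open>Lebesgue measure on a Euclidean space is the image of the product measure over
  \<open>Basis\<close>, so an integrand that factors over the coordinates has an integral that
  factors. The Gaussian transform and the multidimensional cutoff below are of this kind.\<close>

lemma lborel_integral_prod:
  fixes f :: "'a::euclidean_space \<Rightarrow> real \<Rightarrow> complex"
  assumes int: "\<And>b. b \<in> Basis \<Longrightarrow> integrable lborel (f b)"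
  shows "integrable lborel (\<lambda>x::'a. \<Prod>b\<in>Basis. f b (inner x b))" (is ?A)
    and "(LINT x|lborel. (\<Prod>b\<in>Basis. f b (inner x b))) = (\<Prod>b\<in>Basis. (LINT t|lborel. f b t))" (is ?B)
proof -
  have le: "interval_measure (\<lambda>x. x) = (lborel :: real measure)"
    by (simp add: lborel_eq_real)
  interpret product_sigma_finite "\<lambda>b::'a. lborel :: real measure" by standard
  have [measurable]: "f b \<in> borel_measurable borel" if "b \<in> Basis" for b
    using borel_measurable_integrable[OF int[OF that]] by simp
  have I: "integrable (Pi\<^sub>M Basis (\<lambda>b::'a. lborel :: real measure)) (\<lambda>x. \<Prod>b\<in>Basis. f b (x b))"
    by (rule product_integrable_prod) (auto intro: int)
  have eq: "(\<Prod>b\<in>Basis. f b (inner (\<Sum>c\<in>Basis. x c *\<^sub>R c) b)) = (\<Prod>b\<in>Basis. f b (x b))" for x :: "'a \<Rightarrow> real"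
    by (intro prod.cong) auto
  have m: "(\<lambda>x::'a. \<Prod>b\<in>Basis. f b (inner x b)) \<in> borel_measurable borel"
    by measurable
  have m2: "(\<lambda>x. \<Sum>c\<in>Basis. x c *\<^sub>R (c::'a)) \<in> Pi\<^sub>M Basis (\<lambda>b::'a. lborel :: real measure) \<rightarrow>\<^sub>M borel"
    by measurable
  have lb: "(lborel :: 'a measure) = distr (Pi\<^sub>M Basis (\<lambda>b::'a. lborel :: real measure)) borel (\<lambda>f. \<Sum>b\<in>Basis. f b *\<^sub>R b)"
    by (subst lborel_def) (simp only: le)
  show ?A unfolding lb
    by (subst integrable_distr_eq[OF m2 m]) (simp only: eq I)
  show ?B unfolding lb
    by (subst integral_distr[OF m2 m]) (simp only: eq product_integral_prod[OF finite_Basis int])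
qed

lemma norm_power2_Basis: "(norm (x::'a::euclidean_space))\<^sup>2 = (\<Sum>b\<in>Basis. (inner x b)\<^sup>2)"
  by (subst power2_norm_eq_inner, subst euclidean_inner) (simp add: power2_eq_square)

lemma cis_sum: "finite A \<Longrightarrow> cis (\<Sum>a\<in>A. f a) = (\<Prod>a\<in>A. cis (f a))"
  by (induction A rule: finite_induct) (auto simp: cis_mult[symmetric])

lemma gaussian_fourier:
  fixes x :: "'a::euclidean_space"
  assumes r: "r > 0"
  shows "integrable lborel (\<lambda>\<omega>::'a. exp (- (r * (norm \<omega>)\<^sup>2)))"
    and "(LINT \<omega>|lborel. exp (- (r * (norm \<omega>)\<^sup>2)) * cos (inner \<omega> x))
       = (pi / r) powr (real DIM('a) / 2) * exp (- (norm x)\<^sup>2 / (4 * r))"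
proof -
  have eq: "(\<Prod>b\<in>Basis. complex_of_real (exp (- (r * (inner \<omega> b)\<^sup>2))) * cis (inner \<omega> b * inner y b))
     = complex_of_real (exp (- (r * (norm \<omega>)\<^sup>2))) * cis (inner \<omega> y)" for \<omega> y :: 'a
    by (simp add: prod.distrib cis_sum[symmetric] euclidean_inner[of \<omega> y] norm_power2_Basis
         exp_sum[symmetric] sum_distrib_left sum_negf flip: of_real_prod)
  let ?h = "\<lambda>y \<omega>::'a. complex_of_real (exp (- (r * (norm \<omega>)\<^sup>2))) * cis (inner \<omega> y)"
  have P1: "integrable lborel (?h y)" for y
    using lborel_integral_prod(1)[of "\<lambda>b t. complex_of_real (exp (- (r * t\<^sup>2))) * cis (t * inner y b)"]
      gaussian_fourier_real(1)[OF r] unfolding eq by simp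
  have P2: "(LINT \<omega>|lborel. ?h y \<omega>) = (\<Prod>b\<in>Basis. (LINT t|lborel. complex_of_real (exp (- (r * t\<^sup>2))) * cis (t * inner y b)))" for y
    using lborel_integral_prod(2)[of "\<lambda>b t. complex_of_real (exp (- (r * t\<^sup>2))) * cis (t * inner y b)"]
      gaussian_fourier_real(1)[OF r] unfolding eq by simp
  have "integrable lborel (\<lambda>\<omega>::'a. complex_of_real (exp (- (r * (norm \<omega>)\<^sup>2))) * cis (inner \<omega> 0))"
    by (rule P1)
  from integrable_Re[OF this] show "integrable lborel (\<lambda>\<omega>::'a. exp (- (r * (norm \<omega>)\<^sup>2)))"
    by simp
  have "(LINT \<omega>|lborel. exp (- (r * (norm \<omega>)\<^sup>2)) * cos (inner \<omega> x))
     = Re (LINT \<omega>|lborel. complex_of_real (exp (- (r * (norm \<omega>)\<^sup>2))) * cis (inner \<omega> x))"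
    unfolding integral_Re[OF P1, symmetric] by simp
  also have "\<dots> = Re (\<Prod>b\<in>Basis. complex_of_real (sqrt (pi / r) * exp (- (inner x b)\<^sup>2 / (4 * r))))"
    unfolding P2 gaussian_fourier_real(2)[OF r] ..
  also have "\<dots> = (\<Prod>b\<in>Basis. sqrt (pi / r) * exp (- (inner x b)\<^sup>2 / (4 * r)))"
    by (simp only: of_real_prod[symmetric] Re_complex_of_real)
  also have "\<dots> = sqrt (pi / r) ^ DIM('a) * exp (- (norm x)\<^sup>2 / (4 * r))"
    by (simp add: prod.distrib norm_power2_Basis exp_sum[symmetric] sum_divide_distrib sum_negf)
  also have "sqrt (pi / r) ^ DIM('a) = (pi / r) powr (real DIM('a) / 2)"
  proof -
    have "sqrt (pi / r) ^ DIM('a) = sqrt (pi / r) powr real DIM('a)"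
      using r by (subst powr_realpow) auto
    also have "\<dots> = ((pi / r) powr (1/2)) powr real DIM('a)"
      using r by (subst powr_half_sqrt) auto
    finally show ?thesis by (simp add: powr_powr)
  qed
  finally show "(LINT \<omega>|lborel. exp (- (r * (norm \<omega>)\<^sup>2)) * cos (inner \<omega> x))
       = (pi / r) powr (real DIM('a) / 2) * exp (- (norm x)\<^sup>2 / (4 * r))" .
qed

text \<open>The substitution is made on the intervals from \<open>exp (- n)\<close> to
  \<open>exp n\<close> and extended by continuity from below of the two measures with these
  densities. It carries the half-line to the whole line, where the Bessel integrand appears before
  being folded at 0.\<close>

lemma nn_integral_exp_substitution:
  fixes f :: "real \<Rightarrow> real"
  assumes [measurable]: "f \<in> borel_measurable borel" 
  shows "(\<integral>\<^sup>+ r. ennreal (f r * indicator {0<..} r) \<partial>lborel) = (\<integral>\<^sup>+ t. ennreal (f (exp t) * exp t) \<partial>lborel)"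
proof -
  let ?A = "\<lambda>n::nat. {exp (- real n)..exp (real n)}" and ?B = "\<lambda>n::nat. {- real n..real n}"
  let ?M = "density lborel (\<lambda>r. ennreal (f r))" and ?N = "density lborel (\<lambda>t. ennreal (f (exp t) * exp t))"
  have eq: "emeasure ?M (?A n) = emeasure ?N (?B n)" for n
  proof -
    have "emeasure ?M (?A n) = (\<integral>\<^sup>+ r. ennreal (f r * indicator (?A n) r) \<partial>lborel)"
      by (subst emeasure_density) (auto intro!: nn_integral_cong simp: indicator_def)
    also have "\<dots> = (\<integral>\<^sup>+ t. ennreal (f (exp t) * exp t * indicator (?B n) t) \<partial>lborel)"
      by (intro nn_integral_substitution)
        (auto intro!: derivative_eq_intros continuous_intros simp: set_borel_measurable_def)
    also have "\<dots> = emeasure ?N (?B n)"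
      by (subst emeasure_density) (auto intro!: nn_integral_cong simp: indicator_def)
    finally show ?thesis .
  qed
  have iA: "incseq ?A" by (auto simp: incseq_def intro: order_trans)
  have iB: "incseq ?B" by (auto simp: incseq_def)
  have A: "(\<Union>n. ?A n) = {0<..}"
  proof (intro equalityI subsetI)
    fix x :: real assume "x \<in> (\<Union>n. ?A n)"
    then show "x \<in> {0<..}" by (auto intro: less_le_trans[OF exp_gt_zero])
  next
    fix x :: real assume "x \<in> {0<..}"
    then have x: "x > 0" by simp
    obtain n :: nat where n: "\<bar>ln x\<bar> \<le> real n" using real_arch_simple by blast
    then have "exp (- real n) \<le> exp (ln x)" "exp (ln x) \<le> exp (real n)" by auto
    then show "x \<in> (\<Union>n. ?A n)" using x by auto
  qed
  have B: "(\<Union>n. ?B n) = UNIV"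
  proof (intro equalityI subsetI UNIV_I)
    fix x :: real
    obtain n :: nat where "\<bar>x\<bar> \<le> real n" using real_arch_simple by blast
    then show "x \<in> (\<Union>n. ?B n)" by (auto intro!: exI[of _ n])
  qed
  have "(\<integral>\<^sup>+ r. ennreal (f r * indicator {0<..} r) \<partial>lborel) = emeasure ?M (\<Union>n. ?A n)"
    unfolding A by (subst emeasure_density) (auto intro!: nn_integral_cong simp: indicator_def)
  also have "\<dots> = (SUP n. emeasure ?M (?A n))"
    by (rule SUP_emeasure_incseq[symmetric]) (use iA in auto)
  also have "\<dots> = (SUP n. emeasure ?N (?B n))" unfolding eq ..
  also have "\<dots> = emeasure ?N (\<Union>n. ?B n)"
    by (rule SUP_emeasure_incseq) (use iB in auto)
  also have "\<dots> = (\<integral>\<^sup>+ t. ennreal (f (exp t) * exp t) \<partial>lborel)"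
    unfolding B by (subst emeasure_density) auto
  finally show ?thesis .
qed

text \<open>Folding the line at 0: \<open>cosh t\<close> is even, so adding the values at
  \<open>t\<close> and \<open>- t\<close> turns \<open>exp (\<nu> * t)\<close> into
  \<open>2 * cosh (\<nu> * t)\<close>.\<close>

lemma bessel_K_nn_integral:
  "2 * (\<integral>\<^sup>+ t. ennreal (exp (- z * cosh t) * cosh (\<nu> * t) * indicator {0<..} t) \<partial>lborel)
   = (\<integral>\<^sup>+ t. ennreal (exp (\<nu> * t - z * cosh t)) \<partial>lborel)"
proof -
  let ?h = "\<lambda>t. exp (\<nu> * t - z * cosh t)"
  have [measurable]: "(\<lambda>t::real. cosh t) \<in> borel_measurable borel"
    by (intro borel_measurable_continuous_onI continuous_intros)
  have [measurable]: "(\<lambda>t::real. cosh (\<nu> * t)) \<in> borel_measurable borel"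
    by (intro borel_measurable_continuous_onI continuous_intros)
  have "(\<integral>\<^sup>+ t. ennreal (?h t) \<partial>lborel)
     = (\<integral>\<^sup>+ t. ennreal (?h t * indicator {0<..} t) + ennreal (?h t * indicator {..<0} t) \<partial>lborel)"
    by (intro nn_integral_cong_AE eventually_mono[OF AE_lborel_singleton[of 0]]) (auto simp: indicator_def)
  also have "\<dots> = (\<integral>\<^sup>+ t. ennreal (?h t * indicator {0<..} t) \<partial>lborel) + (\<integral>\<^sup>+ t. ennreal (?h t * indicator {..<0} t) \<partial>lborel)"
    by (rule nn_integral_add) auto
  also have "(\<integral>\<^sup>+ t. ennreal (?h t * indicator {..<0} t) \<partial>lborel) = ennreal \<bar>-1\<bar> * (\<integral>\<^sup>+ t. ennreal (?h (0 + (-1) * t) * indicator {..<0} (0 + (-1) * t)) \<partial>lborel)"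
    by (rule nn_integral_real_affine) auto
  also have "\<dots> = (\<integral>\<^sup>+ t. ennreal (?h (- t) * indicator {0<..} t) \<partial>lborel)"
    by (auto intro!: nn_integral_cong simp: indicator_def)
  also have "(\<integral>\<^sup>+ t. ennreal (?h t * indicator {0<..} t) \<partial>lborel) + (\<integral>\<^sup>+ t. ennreal (?h (- t) * indicator {0<..} t) \<partial>lborel)
     = (\<integral>\<^sup>+ t. ennreal (?h t * indicator {0<..} t) + ennreal (?h (- t) * indicator {0<..} t) \<partial>lborel)"
    by (rule nn_integral_add[symmetric]) auto
  also have "\<dots> = (\<integral>\<^sup>+ t. 2 * ennreal (exp (- z * cosh t) * cosh (\<nu> * t) * indicator {0<..} t) \<partial>lborel)"
  proof (intro nn_integral_cong)
    fix t :: real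
    have "?h t + ?h (- t) = 2 * (exp (- z * cosh t) * cosh (\<nu> * t))"
      by (simp add: cosh_def[of "\<nu> * t"] exp_diff exp_minus field_simps)
    then show "ennreal (?h t * indicator {0<..} t) + ennreal (?h (- t) * indicator {0<..} t)
      = 2 * ennreal (exp (- z * cosh t) * cosh (\<nu> * t) * indicator {0<..} t)"
      by (auto simp: indicator_def ennreal_plus[symmetric] numeral_mult_ennreal simp del: ennreal_plus)
  qed
  also have "\<dots> = 2 * (\<integral>\<^sup>+ t. ennreal (exp (- z * cosh t) * cosh (\<nu> * t) * indicator {0<..} t) \<partial>lborel)"
    by (rule nn_integral_cmult) auto
  finally show ?thesis ..
qed

text \<open>The substitution \<open>r = norm x / (2 \<alpha>) * exp t\<close> turns the gamma mixture into the Bessel integral.\<close>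

lemma matern_mixture:
  fixes x :: "'a::euclidean_space"
  assumes a: "\<alpha> > 0" and n: "\<nu> > 0"
  shows "(\<integral>\<^sup>+ r. ennreal (r powr (\<nu> - 1) * exp (- (\<alpha>\<^sup>2 * r)) * exp (- (norm x)\<^sup>2 / (4 * r)) * indicator {0<..} r) \<partial>lborel)
       = ennreal (Gamma \<nu> * \<alpha> powr (- 2 * \<nu>) * matern \<alpha> \<nu> x)"
    and "matern \<alpha> \<nu> x \<ge> 0"
proof -
  let ?I = "(\<integral>\<^sup>+ r. ennreal (r powr (\<nu> - 1) * exp (- (\<alpha>\<^sup>2 * r)) * exp (- (norm x)\<^sup>2 / (4 * r)) * indicator {0<..} r) \<partial>lborel)"
  have G: "Gamma \<nu> > 0" using n by simp
  have pa: "(\<alpha>\<^sup>2) powr (- \<nu>) = \<alpha> powr (- 2 * \<nu>)"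
    using a by (simp add: powr_powr powr_numeral[symmetric] del: powr_numeral)
  have pb: "(\<alpha>\<^sup>2) powr \<nu> = \<alpha> powr (\<nu> * 2)"
    using a by (simp add: powr_powr powr_numeral[symmetric] mult.commute del: powr_numeral)
  have "?I \<le> (\<integral>\<^sup>+ r. ennreal (indicator {0<..} r * (r powr (\<nu> - 1) * exp (- (\<alpha>\<^sup>2 * r)))) \<partial>lborel)"
    by (intro nn_integral_mono ennreal_leI) (auto simp: indicator_def mult_left_le)
  also have "\<dots> < \<top>" using Gamma_conv_nn_integral_scaled[of "\<alpha>\<^sup>2" \<nu>] a n by simp
  finally have fin: "?I < \<top>" .
  have "?I = ennreal (Gamma \<nu> * \<alpha> powr (- 2 * \<nu>) * matern \<alpha> \<nu> x) \<and> matern \<alpha> \<nu> x \<ge> 0"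
  proof (cases "x = 0")
    case True
    have "?I = (\<integral>\<^sup>+ r. ennreal (indicator {0<..} r * (r powr (\<nu> - 1) * exp (- (\<alpha>\<^sup>2 * r)))) \<partial>lborel)"
      using True by (intro nn_integral_cong) (auto simp: mult_ac)
    also have "\<dots> = ennreal (Gamma \<nu> * \<alpha> powr (- 2 * \<nu>))"
      using Gamma_conv_nn_integral_scaled[of "\<alpha>\<^sup>2" \<nu>] a n pa by simp
    finally show ?thesis using True by (simp add: matern_def)
  next
    case False
    define z where "z = \<alpha> * norm x"
    have z: "z > 0" using False a by (simp add: z_def)
    \<comment> \<open>The minimiser of
      \<open>\<alpha>\<^sup>2 * r + (norm x)\<^sup>2 / (4 * r)\<close>. There the two terms agree,
      so at \<open>c * exp t\<close> they are \<open>z / 2 * exp t\<close> and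
      \<open>z / 2 * exp (- t)\<close> and add up to \<open>z * cosh t\<close>.\<close>
    define c where "c = z / (2 * \<alpha>\<^sup>2)"
    have c: "c > 0" using z a by (simp add: c_def)
    define f where "f = (\<lambda>r. r powr (\<nu> - 1) * exp (- (\<alpha>\<^sup>2 * r)) * exp (- (norm x)\<^sup>2 / (4 * r)))"
    have [measurable]: "f \<in> borel_measurable borel" by (simp add: f_def)
    let ?E = "\<integral>\<^sup>+ t. ennreal (exp (\<nu> * t - z * cosh t)) \<partial>lborel"
    let ?K = "\<integral>\<^sup>+ t. ennreal (exp (- z * cosh t) * cosh (\<nu> * t) * indicator {0<..} t) \<partial>lborel"
    have [measurable]: "(\<lambda>t::real. cosh t) \<in> borel_measurable borel"
      by (intro borel_measurable_continuous_onI continuous_intros)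
    have [measurable]: "(\<lambda>t::real. cosh (\<nu> * t)) \<in> borel_measurable borel"
      by (intro borel_measurable_continuous_onI continuous_intros)
    have ff: "f (exp (ln c + 1 * t)) * exp (ln c + 1 * t) = c powr \<nu> * exp (\<nu> * t - z * cosh t)" for t
    proof -
      have e: "exp (ln c + 1 * t) = c * exp t" using c by (simp add: exp_add)
      have 1: "(c * exp t) powr (\<nu> - 1) * (c * exp t) = c powr \<nu> * exp (\<nu> * t)"
        using c by (simp add: powr_mult powr_diff exp_powr_real)
      have 2: "\<alpha>\<^sup>2 * (c * exp t) = z / 2 * exp t"
        using a by (simp add: c_def)
      have 3: "(norm x)\<^sup>2 / (4 * (c * exp t)) = z / 2 * exp (- t)"
        using a False by (simp add: c_def z_def exp_minus field_simps power2_eq_square)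
      have 4: "- (\<alpha>\<^sup>2 * (c * exp t)) - (norm x)\<^sup>2 / (4 * (c * exp t)) = - (z * cosh t)"
        unfolding 2 3 by (simp add: cosh_def algebra_simps)
      have "f (c * exp t) * (c * exp t) = ((c * exp t) powr (\<nu> - 1) * (c * exp t)) * exp (- (\<alpha>\<^sup>2 * (c * exp t)) - (norm x)\<^sup>2 / (4 * (c * exp t)))"
      proof -
        have "exp (- A - B) = exp (- A) * exp (- B)" for A B :: real by (simp add: exp_add[symmetric])
        then show ?thesis by (simp add: f_def mult_ac)
      qed
      also have "\<dots> = c powr \<nu> * exp (\<nu> * t - z * cosh t)"
        unfolding 1 4 by (simp add: exp_diff exp_minus divide_simps)
      finally show ?thesis unfolding e .
    qed
    have "?I = (\<integral>\<^sup>+ r. ennreal (f r * indicator {0<..} r) \<partial>lborel)" by (simp add: f_def)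
    also have "\<dots> = (\<integral>\<^sup>+ t. ennreal (f (exp t) * exp t) \<partial>lborel)"
      by (rule nn_integral_exp_substitution) simp
    also have "\<dots> = ennreal \<bar>1\<bar> * (\<integral>\<^sup>+ t. ennreal (f (exp (ln c + 1 * t)) * exp (ln c + 1 * t)) \<partial>lborel)"
      by (rule nn_integral_real_affine) auto
    also have "\<dots> = (\<integral>\<^sup>+ t. ennreal (c powr \<nu>) * ennreal (exp (\<nu> * t - z * cosh t)) \<partial>lborel)"
      unfolding ff by (simp add: ennreal_mult')
    also have "\<dots> = ennreal (c powr \<nu>) * ?E"
      by (rule nn_integral_cmult) auto
    finally have IE: "?I = ennreal (c powr \<nu>) * (2 * ?K)" unfolding bessel_K_nn_integral[symmetric] .
    \<comment> \<open>\<open>bessel_K\<close> is a Lebesgue integral and would be 0 by default if it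
      diverged. Finiteness of the mixture shows that it takes its genuine value.\<close>
    then have fK: "?K < \<top>" using fin c by (auto simp: ennreal_mult_less_top top_unique less_top[symmetric] ennreal_mult_eq_top_iff)
    have "bessel_K \<nu> z = enn2real ?K"
      unfolding bessel_K_def set_lebesgue_integral_def
      by (subst integral_eq_nn_integral) (auto simp: mult_ac intro!: arg_cong[where f=enn2real] nn_integral_cong)
    then have K: "?K = ennreal (bessel_K \<nu> z)" "bessel_K \<nu> z \<ge> 0" using fK by auto
    have "c powr \<nu> = z powr \<nu> / (2 powr \<nu> * \<alpha> powr (\<nu> * 2))"
      using z by (simp add: c_def powr_divide powr_mult pb)
    moreover have "\<alpha> powr (- 2 * \<nu>) = 1 / \<alpha> powr (\<nu> * 2)"
      using powr_minus_divide[of \<alpha> "\<nu> * 2"] by (simp add: mult.commute)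
    moreover have "2 powr (1 - \<nu>) = 2 / 2 powr \<nu>"
      by (simp add: powr_diff)
    moreover have "Z / (p * q) * 2 = 1 / q * (2 / p * Z)" for Z p q :: real
      by (simp add: mult.commute)
    ultimately have cp: "c powr \<nu> * 2 = \<alpha> powr (- 2 * \<nu>) * (2 powr (1 - \<nu>) * z powr \<nu>)"
      by (simp only:)
    have mt: "Gamma \<nu> * \<alpha> powr (- 2 * \<nu>) * matern \<alpha> \<nu> x = c powr \<nu> * 2 * bessel_K \<nu> z"
      unfolding cp using False G by (simp add: matern_def z_def)
    have "?I = ennreal (c powr \<nu> * 2 * bessel_K \<nu> z)"
      unfolding IE K by (simp add: ennreal_mult'[symmetric] K(2) numeral_mult_ennreal mult.assoc)
    moreover have "matern \<alpha> \<nu> x \<ge> 0"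
      using False G K(2) z a by (simp add: matern_def z_def)
    ultimately show ?thesis unfolding mt by simp
  qed
  then show "?I = ennreal (Gamma \<nu> * \<alpha> powr (- 2 * \<nu>) * matern \<alpha> \<nu> x)" "matern \<alpha> \<nu> x \<ge> 0" by auto
qed

definition spec :: "real \<Rightarrow> real \<Rightarrow> 'a::euclidean_space \<Rightarrow> real" where
  "spec a b \<omega> = (a\<^sup>2 + (norm \<omega>)\<^sup>2) powr (- b)"

lemma borel_measurable_spec [measurable]: "spec a b \<in> borel_measurable borel"
  unfolding spec_def[abs_def] by measurable

lemma spec_nonneg [simp]: "spec a b \<omega> \<ge> 0"
  by (simp add: spec_def)

lemma spec_pos: "a > 0 \<Longrightarrow> spec a b \<omega> > 0"
  using add_pos_nonneg[of "a\<^sup>2" "(norm \<omega>)\<^sup>2"] by (simp add: spec_def)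

text \<open>\<open>F\<close> is the integrand of a double mixture. Integrated over \<open>r\<close>
  it gives a multiple of the spectral density; integrated over \<omega> against a cosine it gives
  the integrand of \<open>matern_mixture\<close>. The spectral representation is the equality of the
  two iterated integrals, and Bessel functions no longer occur in its proof.\<close>

context
  fixes a b :: real and F :: "real \<Rightarrow> 'a::euclidean_space \<Rightarrow> real"
  assumes a: "a > 0" and b: "b > DIM('a) / 2"
  defines "F \<equiv> \<lambda>r \<omega>. indicator {0<..} r * (r powr (b - 1) * exp (- ((a\<^sup>2 + (norm \<omega>)\<^sup>2) * r)))"
begin

private lemma F_r: "(\<integral>\<^sup>+ r. ennreal (F r \<omega>) \<partial>lborel) = ennreal (Gamma b * spec a b \<omega>)"
proof -
  have "a\<^sup>2 + (norm \<omega>)\<^sup>2 > 0" using a by (simp add: add_pos_nonneg)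
  moreover have "b > 0" using b by (smt (verit) divide_nonneg_nonneg of_nat_0_le_iff)
  ultimately show ?thesis unfolding F_def spec_def by (rule Gamma_conv_nn_integral_scaled)
qed

private lemma F_nonneg: "F r \<omega> \<ge> 0" by (simp add: F_def)

private lemma F_measurable_fst [measurable]: "(\<lambda>r. F r \<omega>) \<in> borel_measurable borel"
  unfolding F_def by measurable

private lemma F_eq: "F r \<omega> = indicator {0<..} r * r powr (b - 1) * exp (- (a\<^sup>2 * r)) * exp (- (r * (norm \<omega>)\<^sup>2))"
  by (simp add: F_def exp_add[symmetric] algebra_simps)

private lemma F_measurable [measurable]: "case_prod F \<in> borel_measurable (lborel \<Otimes>\<^sub>M lborel)"
  unfolding F_def by measurable

private lemma F_fubini: "ennreal (Gamma b) * (\<integral>\<^sup>+ \<omega>. ennreal (spec a b (\<omega>::'a)) \<partial>lborel)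
      = (\<integral>\<^sup>+ r. (\<integral>\<^sup>+ \<omega>. ennreal (F r \<omega>) \<partial>lborel) \<partial>lborel)"
proof -
  have "b > 0" using b by (smt (verit) divide_nonneg_nonneg of_nat_0_le_iff)
  then have "ennreal (Gamma b) * (\<integral>\<^sup>+ \<omega>. ennreal (spec a b (\<omega>::'a)) \<partial>lborel) = (\<integral>\<^sup>+ \<omega>. (\<integral>\<^sup>+ r. ennreal (F r \<omega>) \<partial>lborel) \<partial>lborel)"
    unfolding F_r by (subst nn_integral_cmult[symmetric]) (auto simp: ennreal_mult')
  also have "\<dots> = (\<integral>\<^sup>+ r. (\<integral>\<^sup>+ \<omega>. ennreal (F r \<omega>) \<partial>lborel) \<partial>lborel)"
    by (rule lborel_pair.Fubini') measurable
  finally show ?thesis .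
qed

private lemma F_cos: "(LINT \<omega>|lborel. F r \<omega> * cos (inner \<omega> x))
   = pi powr (DIM('a) / 2) * (r powr (b - DIM('a) / 2 - 1) * exp (- (a\<^sup>2 * r)) * exp (- (norm x)\<^sup>2 / (4 * r)) * indicator {0<..} r)"
proof (cases "r > 0")
  case True
  have "(LINT \<omega>|lborel. F r \<omega> * cos (inner \<omega> x)) = r powr (b - 1) * exp (- (a\<^sup>2 * r)) * (LINT \<omega>|lborel. exp (- (r * (norm \<omega>)\<^sup>2)) * cos (inner \<omega> x))"
    unfolding F_eq using True by (simp add: mult.assoc)
  also have "\<dots> = r powr (b - 1) * exp (- (a\<^sup>2 * r)) * ((pi / r) powr (DIM('a) / 2) * exp (- (norm x)\<^sup>2 / (4 * r)))"
    by (subst gaussian_fourier(2)[OF True]) simp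
  also have "\<dots> = pi powr (DIM('a) / 2) * (r powr (b - DIM('a) / 2 - 1) * exp (- (a\<^sup>2 * r)) * exp (- (norm x)\<^sup>2 / (4 * r)))"
  proof -
    have "r powr (b - DIM('a) / 2 - 1) = r powr ((b - 1) - DIM('a) / 2)" by (simp add: algebra_simps)
    also have "\<dots> = r powr (b - 1) / r powr (DIM('a) / 2)" by (rule powr_diff)
    finally have "r powr (b - DIM('a) / 2 - 1) = r powr (b - 1) / r powr (DIM('a) / 2)" .
    then show ?thesis using True by (simp only: powr_divide) simp
  qed
  finally show ?thesis using True by simp
qed (simp add: F_def)

private lemma F_omega: "(\<integral>\<^sup>+ \<omega>. ennreal (F r \<omega>) \<partial>lborel)
   = ennreal (pi powr (DIM('a) / 2)) * ennreal (indicator {0<..} r * (r powr (b - DIM('a) / 2 - 1) * exp (- (a\<^sup>2 * r))))"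
proof (cases "r > 0")
  case True
  have "integrable lborel (F r)"
    unfolding F_eq using gaussian_fourier(1)[OF True] by (intro integrable_mult_right) auto
  then have "(\<integral>\<^sup>+ \<omega>. ennreal (F r \<omega>) \<partial>lborel) = ennreal (LINT \<omega>|lborel. F r \<omega>)"
    by (intro nn_integral_eq_integral) (auto simp: F_nonneg)
  also have "(LINT \<omega>|lborel. F r \<omega>) = (LINT \<omega>|lborel. F r \<omega> * cos (inner \<omega> 0))" by simp
  also have "\<dots> = pi powr (DIM('a) / 2) * (r powr (b - DIM('a) / 2 - 1) * exp (- (a\<^sup>2 * r)))"
    unfolding F_cos using True by simp
  finally show ?thesis using True by (simp add: ennreal_mult')
qed (simp add: F_def)

text \<open>Integrating out \<omega> costs \<open>r powr (- d / 2)\<close>, so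
  \<open>b > d / 2\<close> is the condition for the remaining gamma integral to converge at 0. By
  Tonelli this also yields integrability of the spectral density.\<close>

private lemma F_total: "(\<integral>\<^sup>+ r. (\<integral>\<^sup>+ \<omega>. ennreal (F r \<omega>) \<partial>lborel) \<partial>lborel) < \<infinity>"
  unfolding F_omega
  using Gamma_conv_nn_integral_scaled[of "a\<^sup>2" "b - DIM('a) / 2"] a b
  by (subst nn_integral_cmult) (auto simp: ennreal_mult_less_top)

lemma integrable_spec: "integrable lborel (spec a b :: 'a \<Rightarrow> real)"
proof (rule integrableI_nonneg)
  have "b > 0" using b by (smt (verit) divide_nonneg_nonneg of_nat_0_le_iff)
  then have "ennreal (Gamma b) > 0" by simp
  then show "(\<integral>\<^sup>+ \<omega>. ennreal (spec a b (\<omega>::'a)) \<partial>lborel) < \<infinity>"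
    using F_total unfolding F_fubini[symmetric] by (auto simp: ennreal_mult_less_top)
qed auto

private lemma F_integrable: "integrable (lborel \<Otimes>\<^sub>M lborel) (\<lambda>(r, \<omega>). F r \<omega> * cos (inner \<omega> x))"
proof -
  have "integrable (lborel \<Otimes>\<^sub>M lborel) (case_prod F)"
  proof (rule integrableI_nonneg)
    show "(\<integral>\<^sup>+ y. ennreal (case y of (r, \<omega>) \<Rightarrow> F r \<omega>) \<partial>(lborel \<Otimes>\<^sub>M lborel)) < \<infinity>"
      using F_total by (subst lborel.nn_integral_fst[symmetric]) auto
  qed (auto simp: F_nonneg)
  then show ?thesis
    by (rule Bochner_Integration.integrable_bound) (auto simp: abs_mult F_nonneg mult_left_le intro!: AE_I2)
qed

lemma matern_spectral_aux:
  assumes n: "b = \<nu> + DIM('a) / 2" "\<nu> > 0"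
  shows "Gamma b * (LINT \<omega>|lborel. spec a b \<omega> * cos (inner \<omega> (x::'a))) = pi powr (DIM('a) / 2) * (Gamma \<nu> * a powr (- 2 * \<nu>) * matern a \<nu> x)"
proof -
  have "(LINT r|lborel. F r \<omega> * cos (inner \<omega> x)) = Gamma b * (spec a b \<omega> * cos (inner \<omega> x))" for \<omega>
  proof -
    have "Gamma b \<ge> 0" using n by (simp add: Gamma_real_nonneg add_nonneg_nonneg)
    then have "(LINT r|lborel. F r \<omega>) = Gamma b * spec a b \<omega>"
      by (subst integral_eq_nn_integral) (auto simp: F_nonneg F_r)
    then show ?thesis by simp
  qed
  then have "Gamma b * (LINT \<omega>|lborel. spec a b \<omega> * cos (inner \<omega> (x::'a))) = (LINT \<omega>|lborel. (LINT r|lborel. F r \<omega> * cos (inner \<omega> x)))"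
    by (simp only: integral_mult_right_zero)
  also have "\<dots> = (LINT r|lborel. (LINT \<omega>|lborel. F r \<omega> * cos (inner \<omega> x)))"
    by (rule lborel_pair.Fubini_integral[OF F_integrable])
  also have "\<dots> = pi powr (DIM('a) / 2) * (LINT r|lborel. r powr (\<nu> - 1) * exp (- (a\<^sup>2 * r)) * exp (- (norm x)\<^sup>2 / (4 * r)) * indicator {0<..} r)"
    unfolding F_cos n by simp
  also have "(LINT r|lborel. r powr (\<nu> - 1) * exp (- (a\<^sup>2 * r)) * exp (- (norm x)\<^sup>2 / (4 * r)) * indicator {0<..} r)
     = Gamma \<nu> * a powr (- 2 * \<nu>) * matern a \<nu> x"
    using matern_mixture[OF a n(2), of x] n
    by (subst integral_eq_nn_integral) auto
  finally show ?thesis .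
qed

end

text \<open>With the factor \<open>a powr (- 2 * \<nu>)\<close> on the left, the constant on the
  right is free of \<open>a\<close>. This is why
  \<open>\<sigma>\<^sup>2 * a powr (2 * \<nu>)\<close> is the parameter to hold fixed: a change of
  \<open>a\<close> then changes nothing but \<open>spec\<close>, and \<open>spec\<close> only at low
  frequencies.\<close>

lemma matern_spectral:
  fixes x :: "'a::euclidean_space"
  assumes a: "a > 0" and n: "\<nu> > 0"
  defines "b \<equiv> \<nu> + DIM('a) / 2"
  shows "a powr (- 2 * \<nu>) * matern a \<nu> x
       = Gamma b / (pi powr (DIM('a) / 2) * Gamma \<nu>) * (LINT \<omega>|lborel. spec a b \<omega> * cos (inner \<omega> x))"
proof -
  have "x = c / d * y" if "c * y = d' * (g * x)" "d = d' * g" "d \<noteq> 0" for x c d d' g y :: real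
    using that by (simp add: field_simps)
  moreover have "pi powr (DIM('a) / 2) * Gamma \<nu> \<noteq> 0" using Gamma_real_pos[OF n] by simp
  moreover have "Gamma b * (LINT \<omega>|lborel. spec a b \<omega> * cos (inner \<omega> x)) = pi powr (DIM('a) / 2) * (Gamma \<nu> * (a powr (- 2 * \<nu>) * matern a \<nu> x))"
    using matern_spectral_aux[of a b \<nu> x] a n by (simp add: b_def mult.assoc)
  ultimately show ?thesis by blast
qed

section \<open>Energies of trigonometric polynomials\<close>

lemma char_uniform_bound:
  defines "U \<equiv> density lborel (\<lambda>x. ennreal (indicator {-1..1} x / 2))"
  shows "prob_space U" and "AE x in U. \<bar>x\<bar> \<le> (1::real)" and "t \<noteq> 0 \<Longrightarrow> cmod (char U t) \<le> 1 / \<bar>t\<bar>"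
proof -
  show "prob_space U"
  proof
    have "emeasure U (space U) = (\<integral>\<^sup>+ x. ennreal (1 / 2) * indicator {-1..1::real} x \<partial>lborel)"
      unfolding U_def by (subst emeasure_density) (auto intro!: nn_integral_cong simp: indicator_def)
    also have "\<dots> = ennreal (1 / 2) * ennreal 2" by (subst nn_integral_cmult_indicator) auto
    also have "\<dots> = ennreal (1 / 2 * 2)" by (rule ennreal_mult'[symmetric]) simp
    also have "\<dots> = 1" by simp
    finally show "emeasure U (space U) = 1" .
  qed
  then interpret prob_space U .
  show "AE x in U. \<bar>x\<bar> \<le> (1::real)"
    unfolding U_def by (subst AE_density) (auto simp: indicator_def intro!: AE_I2 split: if_splits)
  show "cmod (char U t) \<le> 1 / \<bar>t\<bar>" if False: "t \<noteq> 0"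
  proof -
    have "char U t = (CLINT x|lborel. (indicator {-1..1} x / 2) *\<^sub>R iexp (t * x))"
      unfolding char_def U_def by (subst integral_density) auto
    also have "\<dots> = (CLINT x|lborel. indicator {-1..1} x *\<^sub>R (iexp (t * x) / 2))"
      by (intro Bochner_Integration.integral_cong) (auto simp: scaleR_conv_of_real)
    also have "\<dots> = iexp (t * 1) / (2 * \<i> * t) - iexp (t * (-1)) / (2 * \<i> * t)"
    proof (rule integral_FTC_Icc)
      fix x :: real
      have "((\<lambda>x. exp (\<i> * complex_of_real t * x) / (2 * \<i> * t)) has_field_derivative (iexp (t * x) / 2)) (at (complex_of_real x))"
        using False by (auto intro!: derivative_eq_intros simp: mult_ac)
      from has_vector_derivative_real_field[OF this]
      show "((\<lambda>x. iexp (t * x) / (2 * \<i> * t)) has_vector_derivative iexp (t * x) / 2) (at x within {-1..1})"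
        by (auto simp: mult_ac intro: has_vector_derivative_at_within)
    qed (auto intro!: continuous_intros)
    finally have "cmod (char U t) \<le> cmod (iexp (t * 1) / (2 * \<i> * t)) + cmod (iexp (t * (-1)) / (2 * \<i> * t))"
      using norm_triangle_ineq4 by metis
    also have "\<dots> = 1 / \<bar>t\<bar>" using False by (simp add: norm_divide norm_mult)
    finally show ?thesis .
  qed
qed

lemma PiM_indep_coordinates:
  fixes D :: "real measure" and I :: "'i set"
  assumes "real_distribution D" and I: "I \<noteq> {}"
  shows "prob_space.indep_vars (\<Pi>\<^sub>M i\<in>I. D) (\<lambda>i. borel) (\<lambda>i \<omega>. \<omega> i) I"
    and "i \<in> I \<Longrightarrow> distr (\<Pi>\<^sub>M i\<in>I. D) borel (\<lambda>\<omega>. \<omega> i) = D"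
    and "i \<in> I \<Longrightarrow> (\<lambda>\<omega>. \<omega> i) \<in> (\<Pi>\<^sub>M i\<in>I. D) \<rightarrow>\<^sub>M borel"
proof -
  interpret D: real_distribution D by fact
  interpret product_prob_space "\<lambda>_. D" I by standard
  show d: "distr (\<Pi>\<^sub>M i\<in>I. D) borel (\<lambda>\<omega>. \<omega> i) = D" if "i \<in> I" for i
    using distr_PiM_component[of I "\<lambda>_. D" i] that D.prob_space_axioms
    by (metis D.events_eq_borel distr_cong)
  have s: "sets (Pi\<^sub>M I (\<lambda>i. D)) = sets (Pi\<^sub>M I (\<lambda>i. borel))"
    by (intro sets_PiM_cong) auto
  show m: "(\<lambda>\<omega>. \<omega> i) \<in> (\<Pi>\<^sub>M i\<in>I. D) \<rightarrow>\<^sub>M borel" if "i \<in> I" for i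
    using that by (subst measurable_cong_sets[OF s refl]) measurable
  show "prob_space.indep_vars (\<Pi>\<^sub>M i\<in>I. D) (\<lambda>i. borel) (\<lambda>i \<omega>. \<omega> i) I"
  proof (subst indep_vars_iff_distr_eq_PiM'[OF I])
    have "distr (Pi\<^sub>M I (\<lambda>i. D)) (Pi\<^sub>M I (\<lambda>i. borel)) (\<lambda>x. restrict x I) = distr (Pi\<^sub>M I (\<lambda>i. D)) (Pi\<^sub>M I (\<lambda>i. D)) (\<lambda>x. x)"
      by (intro distr_cong) (auto simp: s space_PiM)
    also have "\<dots> = Pi\<^sub>M I (\<lambda>i. D)" by (rule distr_id)
    also have "\<dots> = (\<Pi>\<^sub>M i\<in>I. distr (Pi\<^sub>M I (\<lambda>i. D)) borel (\<lambda>x. x i))"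
      by (intro PiM_cong) (auto simp: d)
    finally show "distr (Pi\<^sub>M I (\<lambda>i. D)) (Pi\<^sub>M I (\<lambda>i. borel)) (\<lambda>x. \<lambda>i\<in>I. x i) = (\<Pi>\<^sub>M i\<in>I. distr (Pi\<^sub>M I (\<lambda>i. D)) borel (\<lambda>x. x i))" .
  qed (use m in auto)
qed

text \<open>The law of a sum of N independent uniform variables on [-1, 1]: its support grows
  linearly in N, while its characteristic function is the N-th power of one bounded by
  \<open>1 / \<bar>t\<bar>\<close>.\<close>

lemma compactly_supported_char_decay:
  assumes N: "N > 0"
  obtains M where "real_distribution M" "AE x in M. \<bar>x\<bar> \<le> real N" "\<And>t. t \<noteq> 0 \<Longrightarrow> cmod (char M t) \<le> (1 / \<bar>t\<bar>) ^ N"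
proof -
  define U where "U = density lborel (\<lambda>x::real. ennreal (indicator {-1..1} x / 2))"
  note U = char_uniform_bound[folded U_def]
  have U': "real_distribution U" using U(1) unfolding real_distribution_def real_distribution_axioms_def by (simp add: U_def)
  let ?P = "\<Pi>\<^sub>M i\<in>{..<N}. U"
  have ne: "{..<N} \<noteq> {}" using N by auto
  note P = PiM_indep_coordinates[OF U' ne]
  interpret P: prob_space ?P by (intro prob_space_PiM U)
  define M where "M = distr ?P borel (\<lambda>\<omega>. \<Sum>i<N. \<omega> i)"
  have meas: "(\<lambda>\<omega>. \<Sum>i<N. \<omega> i) \<in> ?P \<rightarrow>\<^sub>M borel" using P(3) by (intro borel_measurable_sum) auto
  have "AE \<omega> in ?P. \<forall>i\<in>{..<N}. \<bar>\<omega> i\<bar> \<le> 1"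
    by (intro eventually_ball_finite ballI AE_PiM_component U) auto
  then have "AE \<omega> in ?P. \<bar>\<Sum>i<N. \<omega> i\<bar> \<le> real N"
  proof eventually_elim
    case (elim \<omega>)
    have "\<bar>\<Sum>i<N. \<omega> i\<bar> \<le> (\<Sum>i<N. \<bar>\<omega> i\<bar>)" by (rule sum_abs)
    also have "\<dots> \<le> (\<Sum>i<N. 1)" using elim by (intro sum_mono) auto
    finally show ?case by simp
  qed
  then have "AE x in M. \<bar>x\<bar> \<le> real N"
    unfolding M_def by (subst AE_distr_iff[OF meas]) auto
  moreover have "cmod (char M t) \<le> (1 / \<bar>t\<bar>) ^ N" if "t \<noteq> 0" for t
  proof -
    have "char M t = (\<Prod>i<N. char (distr ?P borel (\<lambda>\<omega>. \<omega> i)) t)"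
      unfolding M_def by (rule P.char_distr_sum[OF P(1)])
    also have "\<dots> = (\<Prod>i<N. char U t)" by (intro prod.cong) (auto simp: P(2))
    finally show ?thesis using U(3)[OF that] by (simp add: norm_power power_mono)
  qed
  moreover have "real_distribution M" unfolding M_def by (rule P.real_distribution_distr[OF meas])
  ultimately show ?thesis using that by blast
qed

lemma integrable_inverse_1_plus_square: "integrable lborel (\<lambda>t::real. 1 / (1 + t\<^sup>2))"
proof -
  have "spec 1 1 t = 1 / (1 + t\<^sup>2)" for t :: real
    using add_pos_nonneg[of 1 "t\<^sup>2"] by (simp add: spec_def powr_minus_divide)
  then show ?thesis using integrable_spec[of 1 1, where 'a=real] by (simp cong: Bochner_Integration.integrable_cong)
qed

text \<open>\<rho> is the product of the transform of the indicator of [-L, L] with the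
  characteristic function of a law carried by [-2m, 2m], that is, the transform of a smoothed
  indicator. Its inverse transform at \<open>x\<close> is the mass which that law gives to the
  window of half-width \<open>L\<close> around \<open>- x\<close>, and this is 1 as long as the
  window covers the support.\<close>

lemma plateau_multiplier:
  fixes m :: nat and T :: real
  assumes m: "m > 0" and T: "T \<ge> 0"
  obtains \<rho> :: "real \<Rightarrow> complex" and C where "\<rho> \<in> borel_measurable borel" "C > 0" "\<And>t. cmod (\<rho> t) \<le> C / (1 + t\<^sup>2) ^ m"
    "\<And>x. \<bar>x\<bar> \<le> T \<Longrightarrow> (CLINT t|lborel. \<rho> t * cis (t * x)) = 1"
proof -
  obtain M where M: "real_distribution M" "AE x in M. \<bar>x\<bar> \<le> real (2 * m)" "\<And>t. t \<noteq> 0 \<Longrightarrow> cmod (char M t) \<le> (1 / \<bar>t\<bar>) ^ (2 * m)"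
    using compactly_supported_char_decay[of "2 * m"] m by auto
  interpret real_distribution M by fact
  \<comment> \<open>\<open>T + 2 * m\<close> makes the window cover the support for all admissible
    \<open>x\<close>; the additional 1 keeps its endpoints off the support, so that they carry no
    atoms, as Levy inversion requires.\<close>
  define L where "L = T + real (2 * m) + 1"
  have L: "L > 0" using T by (simp add: L_def)
  define g where "g = (\<lambda>t. (iexp (t * L) - iexp (- (t * L))) / (\<i> * t))"
  define \<rho> where "\<rho> = (\<lambda>t. 1 / (2 * pi) * (g t * char M t))"
  define C where "C = L / pi * 2 ^ m + L"
  have C: "C > 0" using L by (simp add: C_def add_nonneg_pos)
  have [measurable]: "char M \<in> borel_measurable borel"
    by (rule char_measurable)
  have meas: "\<rho> \<in> borel_measurable borel" unfolding \<rho>_def g_def by measurable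
  have gb: "cmod (g t) \<le> 2 * L" for t
  proof (cases "t = 0")
    case False
    then show ?thesis using Levy_Inversion_aux2[of "- L" L t] L by (simp add: g_def)
  qed (use L in \<open>simp add: g_def\<close>)
  have bound: "cmod (\<rho> t) \<le> C / (1 + t\<^sup>2) ^ m" for t
  proof -
    have "cmod (char M t) \<le> 2 ^ m / (1 + t\<^sup>2) ^ m"
    proof (cases "\<bar>t\<bar> \<le> 1")
      case True
      then have "t\<^sup>2 \<le> 1" by (simp add: abs_square_le_1)
      then have "(1 + t\<^sup>2) ^ m \<le> 2 ^ m" by (intro power_mono) auto
      then have "1 \<le> 2 ^ m / (1 + t\<^sup>2) ^ m" by (simp add: add_pos_nonneg)
      then show ?thesis using cmod_char_le_1[of t] by linarith
    next
      case False
      then have t: "t \<noteq> 0" "t\<^sup>2 \<ge> 1" by (auto simp: abs_square_le_1[symmetric] not_le) 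
      have "cmod (char M t) \<le> (1 / \<bar>t\<bar>) ^ (2 * m)" by (rule M(3)[OF t(1)])
      also have "\<dots> = (1 / t\<^sup>2) ^ m" by (simp add: power_mult power_divide)
      also have "\<dots> \<le> (2 / (1 + t\<^sup>2)) ^ m" 
        using t by (intro power_mono) (auto simp: field_simps)
      finally show ?thesis by (simp add: power_divide)
    qed
    then have "cmod (g t) * cmod (char M t) \<le> (2 * L) * (2 ^ m / (1 + t\<^sup>2) ^ m)"
      using gb[of t] L by (intro mult_mono) auto
    then have "1 / (2 * pi) * (cmod (g t) * cmod (char M t)) \<le> 1 / (2 * pi) * ((2 * L) * (2 ^ m / (1 + t\<^sup>2) ^ m))"
      by (intro mult_left_mono) auto
    also have "1 / (2 * pi) * (cmod (g t) * cmod (char M t)) = cmod (\<rho> t)"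
      by (simp add: \<rho>_def norm_mult norm_divide)
    also have "1 / (2 * pi) * ((2 * L) * (2 ^ m / (1 + t\<^sup>2) ^ m)) = (L / pi * 2 ^ m) / (1 + t\<^sup>2) ^ m"
      by simp
    finally have "cmod (\<rho> t) \<le> (L / pi * 2 ^ m) / (1 + t\<^sup>2) ^ m" .
    also have "\<dots> \<le> C / (1 + t\<^sup>2) ^ m"
      using L by (intro divide_right_mono) (auto simp: C_def)
    finally show ?thesis .
  qed
  have int: "integrable lborel (\<lambda>t. \<rho> t * cis (t * x))" for x
  proof (rule Bochner_Integration.integrable_bound)
    show "integrable lborel (\<lambda>t::real. C * (1 / (1 + t\<^sup>2)))"
      using integrable_inverse_1_plus_square by (intro integrable_mult_right) 
    show "AE t in lborel. norm (\<rho> t * cis (t * x)) \<le> norm (C * (1 / (1 + t\<^sup>2)))"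
    proof (intro AE_I2)
      fix t :: real
      have p: "1 + t\<^sup>2 > 0" by (simp add: add_pos_nonneg)
      have "1 + t\<^sup>2 \<le> (1 + t\<^sup>2) ^ m" using m by (intro self_le_power) auto
      then have "C / (1 + t\<^sup>2) ^ m \<le> C / (1 + t\<^sup>2)"
        using p C by (intro divide_left_mono) auto
      then show "norm (\<rho> t * cis (t * x)) \<le> norm (C * (1 / (1 + t\<^sup>2)))"
        using bound[of t] C p by (simp add: norm_mult)
    qed
  qed (use meas in measurable)
  have one: "(CLINT t|lborel. \<rho> t * cis (t * x)) = 1" if x: "\<bar>x\<bar> \<le> T" for x
  proof -
    let ?a = "- x - L" and ?b = "- x + L"
    have in1: "AE y in M. y \<in> {?a<..?b}"
      using M(2) by eventually_elim (use x in \<open>auto simp: L_def\<close>)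
    have a0: "AE y in M. y \<notin> {?a}"
      using M(2) by eventually_elim (use x in \<open>auto simp: L_def\<close>)
    have b0: "AE y in M. y \<notin> {?b}"
      using M(2) by eventually_elim (use x in \<open>auto simp: L_def\<close>)
    have "measure M {?a} = 0" using a0 by (subst prob_eq_0) auto
    moreover have "measure M {?b} = 0" using b0 by (subst prob_eq_0) auto
    ultimately have lim: "(\<lambda>n. 1 / (2 * pi) * (CLBINT t=- real n..real n. (iexp (-(t * ?a)) - iexp (-(t * ?b))) / (\<i> * t) * char M t))
      \<longlonglongrightarrow> complex_of_real (measure M {?a<..?b})"
      using Levy_Inversion[of ?a ?b] L by simp
    have m1: "measure M {?a<..?b} = 1" using in1 by (subst prob_eq_1) auto
    have eq: "1 / (2 * pi) * ((iexp (-(t * ?a)) - iexp (-(t * ?b))) / (\<i> * t) * char M t) = \<rho> t * cis (t * x)" for t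
    proof -
      have "iexp (-(t * ?a)) = iexp (t * L) * cis (t * x)" "iexp (-(t * ?b)) = iexp (- (t * L)) * cis (t * x)"
        by (simp_all only: cis_conv_exp[symmetric] cis_mult) (simp_all add: algebra_simps)
      then show ?thesis
        by (simp only: \<rho>_def g_def left_diff_distrib[symmetric]) simp
    qed
    \<comment> \<open>Levy inversion yields a limit of integrals over growing intervals. Since
      \<rho> is integrable, this limit is the integral over the line.\<close>
    have "(\<lambda>n. CLINT t|lborel. indicator {- real n..real n} t *\<^sub>R (\<rho> t * cis (t * x))) \<longlonglongrightarrow> (CLINT t|lborel. \<rho> t * cis (t * x))"
    proof (rule integral_dominated_convergence[where w="\<lambda>t. norm (\<rho> t * cis (t * x))"])
      show "AE t in lborel. (\<lambda>n. indicator {- real n..real n} t *\<^sub>R (\<rho> t * cis (t * x))) \<longlonglongrightarrow> \<rho> t * cis (t * x)"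
      proof (intro AE_I2 tendsto_eventually)
        fix t :: real
        obtain k :: nat where "\<bar>t\<bar> \<le> real k" using real_arch_simple by blast
        then show "\<forall>\<^sub>F n in sequentially. indicator {- real n..real n} t *\<^sub>R (\<rho> t * cis (t * x)) = \<rho> t * cis (t * x)"
          by (intro eventually_sequentiallyI[of k]) (auto simp: indicator_def)
      qed
    qed (use int meas in \<open>auto simp: indicator_def\<close>)
    moreover have "(CLINT t|lborel. indicator {- real n..real n} t *\<^sub>R (\<rho> t * cis (t * x)))
       = 1 / (2 * pi) * (CLBINT t=- real n..real n. (iexp (-(t * ?a)) - iexp (-(t * ?b))) / (\<i> * t) * char M t)" for n
      unfolding eq[symmetric]
      by (subst interval_integral_Icc)
         (auto simp only: set_lebesgue_integral_def mult_scaleR_right[symmetric] integral_mult_right_zero)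
    ultimately show ?thesis using lim m1 by (auto intro: LIMSEQ_unique)
  qed
  show ?thesis using that[OF meas C bound one] .
qed

text \<open>The Fourier transform of the signed measure with mass \<open>c j\<close> at the point
  \<open>s j\<close>; the weights of a linear combination of the observations are treated as such a
  measure.\<close>

definition trig_poly :: "nat \<Rightarrow> (nat \<Rightarrow> 'a::euclidean_space) \<Rightarrow> (nat \<Rightarrow> real) \<Rightarrow> 'a \<Rightarrow> complex" where
  "trig_poly n s c u = (\<Sum>j<n. complex_of_real (c j) * cis (inner u (s j)))"

lemma borel_measurable_trig_poly [measurable]: "trig_poly n s c \<in> borel_measurable borel"
  unfolding trig_poly_def[abs_def] by measurable

lemma trig_poly_bound: "cmod (trig_poly n s c u) \<le> (\<Sum>j<n. \<bar>c j\<bar>)"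
  unfolding trig_poly_def by (intro order_trans[OF norm_sum] sum_mono) (auto simp: norm_mult)

lemma cmod_trig_poly_square:
  "(cmod (trig_poly n s c u))\<^sup>2 = (\<Sum>i<n. \<Sum>j<n. c i * c j * cos (inner u (s i - s j)))"
proof -
  have "(cmod (trig_poly n s c u))\<^sup>2 = (\<Sum>i<n. c i * cos (inner u (s i)))\<^sup>2 + (\<Sum>i<n. c i * sin (inner u (s i)))\<^sup>2"
    by (simp add: cmod_power2 trig_poly_def)
  also have "\<dots> = (\<Sum>i<n. \<Sum>j<n. (c i * cos (inner u (s i))) * (c j * cos (inner u (s j)))
      + (c i * sin (inner u (s i))) * (c j * sin (inner u (s j))))"
    unfolding power2_eq_square sum_product sum.distrib ..
  also have "\<dots> = (\<Sum>i<n. \<Sum>j<n. c i * c j * cos (inner u (s i - s j)))"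
    unfolding inner_diff_right cos_diff by (intro sum.cong refl) (simp add: algebra_simps)
  finally show ?thesis .
qed

lemma integrable_spec_trig_poly:
  fixes s :: "nat \<Rightarrow> 'a::euclidean_space"
  assumes "a > 0" "b > DIM('a) / 2"
  shows "integrable lborel (\<lambda>u. spec a b u * (cmod (trig_poly n s c u))\<^sup>2)"
proof (rule Bochner_Integration.integrable_bound)
  show "integrable lborel (\<lambda>u::'a. (\<Sum>j<n. \<bar>c j\<bar>)\<^sup>2 * spec a b u)"
    using integrable_spec[OF assms] by (rule integrable_mult_right)
  show "AE u in lborel. norm (spec a b u * (cmod (trig_poly n s c u))\<^sup>2) \<le> norm ((\<Sum>j<n. \<bar>c j\<bar>)\<^sup>2 * spec a b u)"
    using power_mono[OF trig_poly_bound norm_ge_zero, of n s c _ 2]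
    by (intro AE_I2) (auto simp: abs_mult mult.commute mult_left_mono)
qed auto

lemma one_plus_sum_le_prod:
  fixes f :: "'b \<Rightarrow> real"
  assumes "finite A" "\<And>x. x \<in> A \<Longrightarrow> f x \<ge> 0"
  shows "1 + sum f A \<le> (\<Prod>x\<in>A. 1 + f x)"
  using assms
proof (induction A rule: finite_induct)
  case (insert x A)
  have "1 + sum f (insert x A) \<le> (1 + f x) * (1 + sum f A)"
    using insert by (simp add: algebra_simps sum_nonneg)
  also have "\<dots> \<le> (1 + f x) * (\<Prod>x\<in>A. 1 + f x)"
    using insert by (intro mult_left_mono) auto
  finally show ?case using insert by simp
qed simp

text \<open>The tensor power of the one-dimensional cutoff. The weight
  \<open>(a\<^sup>2 + (norm v)\<^sup>2) powr b\<close> does not factor, but it is dominated by the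
  product of the \<open>(1 + (inner v e)\<^sup>2) powr b\<close>, so that the weighted norm reduces
  to one-dimensional integrals.\<close>

lemma plateau_multiplier_euclidean:
  fixes T a b :: real
  assumes T: "T \<ge> 0" and a: "a > 0" and b: "b > 0"
  obtains \<rho> :: "'a::euclidean_space \<Rightarrow> complex" where "\<rho> \<in> borel_measurable borel"
    "integrable lborel (\<lambda>v. (cmod (\<rho> v))\<^sup>2 * (a\<^sup>2 + (norm v)\<^sup>2) powr b)"
    "\<And>x. \<forall>e\<in>Basis. \<bar>inner x e\<bar> \<le> T \<Longrightarrow> integrable lborel (\<lambda>v. \<rho> v * cis (inner v x))"
    "\<And>x. \<forall>e\<in>Basis. \<bar>inner x e\<bar> \<le> T \<Longrightarrow> (CLINT v|lborel. \<rho> v * cis (inner v x)) = 1"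
proof -
  \<comment> \<open>The square of the cutoff decays like \<open>(1 + t\<^sup>2) ^ (2 * m)\<close> in
    each coordinate. Spending at most \<open>m\<close> of these powers on the weight leaves at least
    one for integrability.\<close>
  obtain m :: nat where m: "b \<le> real m" using real_arch_simple by blast
  then have m0: "m > 0" using b by (cases m) auto
  obtain \<rho> :: "real \<Rightarrow> complex" and C where [measurable]: "\<rho> \<in> borel_measurable borel" and C: "C > 0"
    and bound: "\<And>t. cmod (\<rho> t) \<le> C / (1 + t\<^sup>2) ^ m"
    and one: "\<And>x. \<bar>x\<bar> \<le> T \<Longrightarrow> (CLINT t|lborel. \<rho> t * cis (t * x)) = 1"
    by (rule plateau_multiplier[OF m0 T]) (rule that)
  have pos: "1 + t\<^sup>2 > (0::real)" "1 + t\<^sup>2 \<ge> (1::real)" for t :: real by (auto simp: add_pos_nonneg)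
  have pw: "1 + t\<^sup>2 \<le> (1 + t\<^sup>2) ^ m" for t :: real using m0 by (intro self_le_power) auto
  have bound1: "cmod (\<rho> t) \<le> C * (1 / (1 + t\<^sup>2))" for t
  proof -
    have "C / (1 + t\<^sup>2) ^ m \<le> C / (1 + t\<^sup>2)"
      by (intro divide_left_mono pw mult_pos_pos zero_less_power pos) (use C in auto)
    then show ?thesis using bound[of t] by simp
  qed
  have int1: "integrable lborel (\<lambda>t. \<rho> t * cis (t * x))" for x
    using bound1 C
    by (intro Bochner_Integration.integrable_bound[OF integrable_mult_right[OF integrable_inverse_1_plus_square, of C]])
       (auto simp: norm_mult intro!: AE_I2 order_trans[OF bound1])
  define R where "R = (\<lambda>v::'a. \<Prod>e\<in>Basis. \<rho> (inner v e))"
  have [measurable]: "R \<in> borel_measurable borel" unfolding R_def by measurable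
  have R_cis: "(\<Prod>e\<in>Basis. \<rho> (inner v e) * cis (inner v e * inner x e)) = R v * cis (inner v x)" for v x :: 'a
    by (simp add: prod.distrib cis_sum[symmetric] euclidean_inner[of v x] R_def)
  have i: "integrable lborel (\<lambda>v. R v * cis (inner v x))" for x
    using lborel_integral_prod(1)[of "\<lambda>e t. \<rho> t * cis (t * inner x e)"] int1 unfolding R_cis by simp
  have o: "(CLINT v|lborel. R v * cis (inner v x)) = 1" if "\<forall>e\<in>Basis. \<bar>inner x e\<bar> \<le> T" for x
    using lborel_integral_prod(2)[of "\<lambda>e t. \<rho> t * cis (t * inner x e)"] int1 that
    unfolding R_cis by (simp add: one)
  let ?w = "\<lambda>t::real. C\<^sup>2 * (1 / (1 + t\<^sup>2))"
  have iw: "integrable lborel (\<lambda>v::'a. \<Prod>e\<in>Basis. ?w (inner v e))"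
  proof -
    have "integrable lborel (\<lambda>v::'a. \<Prod>e\<in>Basis. complex_of_real (?w (inner v e)))"
      by (rule lborel_integral_prod(1)[of "\<lambda>e t. complex_of_real (?w t)"])
        (intro integrable_of_real integrable_mult_right integrable_inverse_1_plus_square)
    from integrable_Re[OF this] show ?thesis by (simp only: of_real_prod[symmetric] Re_complex_of_real)
  qed
  have le: "(cmod (R v))\<^sup>2 * (a\<^sup>2 + (norm v)\<^sup>2) powr b \<le> (1 + a\<^sup>2) powr b * (\<Prod>e\<in>Basis. ?w (inner v e))" for v
  proof -
    have one1: "(cmod (\<rho> t))\<^sup>2 * (1 + t\<^sup>2) powr b \<le> ?w t" for t
    proof -
      have "(cmod (\<rho> t))\<^sup>2 \<le> (C / (1 + t\<^sup>2) ^ m)\<^sup>2" using bound by (intro power_mono) auto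
      moreover have "(1 + t\<^sup>2) powr b \<le> (1 + t\<^sup>2) ^ m"
        unfolding powr_realpow[OF pos(1)[of t], symmetric] using m pos(2)[of t] by (rule powr_mono)
      ultimately have "(cmod (\<rho> t))\<^sup>2 * (1 + t\<^sup>2) powr b \<le> (C / (1 + t\<^sup>2) ^ m)\<^sup>2 * (1 + t\<^sup>2) ^ m"
        by (intro mult_mono) auto
      also have "\<dots> = C\<^sup>2 * (1 / (1 + t\<^sup>2) ^ m)"
        using pos(1)[of t] by (simp add: power_divide power2_eq_square[of "(1 + t\<^sup>2) ^ m"])
      also have "\<dots> \<le> ?w t"
        by (intro mult_left_mono divide_left_mono pw mult_pos_pos zero_less_power pos) auto
      finally show ?thesis .
    qed
    have "a\<^sup>2 + (norm v)\<^sup>2 \<le> (1 + a\<^sup>2) * (1 + (norm v)\<^sup>2)" by (simp add: algebra_simps)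
    also have "\<dots> \<le> (1 + a\<^sup>2) * (\<Prod>e\<in>Basis. 1 + (inner v e)\<^sup>2)"
      unfolding norm_power2_Basis by (intro mult_left_mono one_plus_sum_le_prod) auto
    finally have "(a\<^sup>2 + (norm v)\<^sup>2) powr b \<le> ((1 + a\<^sup>2) * (\<Prod>e\<in>Basis. 1 + (inner v e)\<^sup>2)) powr b"
      using b by (intro powr_mono2) auto
    also have "\<dots> = (1 + a\<^sup>2) powr b * (\<Prod>e\<in>Basis. (1 + (inner v e)\<^sup>2) powr b)"
      by (simp add: powr_mult prod_nonneg prod_powr_distrib)
    finally have "(cmod (R v))\<^sup>2 * (a\<^sup>2 + (norm v)\<^sup>2) powr b \<le> (cmod (R v))\<^sup>2 * ((1 + a\<^sup>2) powr b * (\<Prod>e\<in>Basis. (1 + (inner v e)\<^sup>2) powr b))"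
      by (intro mult_left_mono) auto
    also have "\<dots> = (1 + a\<^sup>2) powr b * (\<Prod>e\<in>Basis. (cmod (\<rho> (inner v e)))\<^sup>2 * (1 + (inner v e)\<^sup>2) powr b)"
      by (simp add: R_def prod_norm[symmetric] prod_power_distrib prod.distrib)
    also have "\<dots> \<le> (1 + a\<^sup>2) powr b * (\<Prod>e\<in>Basis. ?w (inner v e))"
      by (intro mult_left_mono prod_mono conjI one1) auto
    finally show ?thesis .
  qed
  have i2: "integrable lborel (\<lambda>v. (cmod (R v))\<^sup>2 * (a\<^sup>2 + (norm v)\<^sup>2) powr b)"
  proof (rule Bochner_Integration.integrable_bound[OF integrable_mult_right[OF iw, of "(1 + a\<^sup>2) powr b"]])
    show "AE v in lborel. norm ((cmod (R v))\<^sup>2 * (a\<^sup>2 + (norm v)\<^sup>2) powr b) \<le> norm ((1 + a\<^sup>2) powr b * (\<Prod>e\<in>Basis. ?w (inner v e)))"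
    proof (intro AE_I2)
      fix v :: 'a
      have "norm ((cmod (R v))\<^sup>2 * (a\<^sup>2 + (norm v)\<^sup>2) powr b) = (cmod (R v))\<^sup>2 * (a\<^sup>2 + (norm v)\<^sup>2) powr b"
        by simp
      also note le
      also have "(1 + a\<^sup>2) powr b * (\<Prod>e\<in>Basis. ?w (inner v e)) \<le> norm ((1 + a\<^sup>2) powr b * (\<Prod>e\<in>Basis. ?w (inner v e)))"
        unfolding real_norm_def by (rule abs_ge_self)
      finally show "norm ((cmod (R v))\<^sup>2 * (a\<^sup>2 + (norm v)\<^sup>2) powr b) \<le> norm ((1 + a\<^sup>2) powr b * (\<Prod>e\<in>Basis. ?w (inner v e)))" .
    qed
  qed measurable
  show ?thesis using that[of R] i o i2 by simp
qed

text \<open>Point evaluation of the Fourier transform of a measure supported in a fixed cube is controlled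
  by its energy: on the cube the measure may be multiplied by a smooth function equal to one there,
  which turns the evaluation into an average over nearby frequencies.\<close>

lemma trig_poly_energy_bound:
  fixes T a b :: real
  assumes T: "T \<ge> 0" and a: "a > 0" and b: "b > DIM('a::euclidean_space) / 2"
  obtains C where "C > 0" "\<And>n (s :: nat \<Rightarrow> 'a) c \<omega>. (\<forall>j<n. \<forall>e\<in>Basis. \<bar>inner (s j) e\<bar> \<le> T) \<Longrightarrow>
     spec a b \<omega> * (cmod (trig_poly n s c \<omega>))\<^sup>2 \<le> C * (LINT u|lborel. spec a b u * (cmod (trig_poly n s c u))\<^sup>2)"
proof -
  have b0: "b > 0" using b by (smt (verit) divide_nonneg_nonneg of_nat_0_le_iff)
  obtain \<rho> :: "'a \<Rightarrow> complex" where [measurable]: "\<rho> \<in> borel_measurable borel"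
    and i2: "integrable lborel (\<lambda>v. (cmod (\<rho> v))\<^sup>2 * (a\<^sup>2 + (norm v)\<^sup>2) powr b)"
    and i: "\<And>x. \<forall>e\<in>Basis. \<bar>inner x e\<bar> \<le> T \<Longrightarrow> integrable lborel (\<lambda>v. \<rho> v * cis (inner v x))"
    and one: "\<And>x. \<forall>e\<in>Basis. \<bar>inner x e\<bar> \<le> T \<Longrightarrow> (CLINT v|lborel. \<rho> v * cis (inner v x)) = 1"
    by (rule plateau_multiplier_euclidean[OF T a b0]) (rule that)
  define I where "I = (LINT v|lborel. (cmod (\<rho> v))\<^sup>2 * (a\<^sup>2 + (norm v)\<^sup>2) powr b)"
  have I0: "I \<ge> 0" unfolding I_def by (intro Bochner_Integration.integral_nonneg) auto
  define C where "C = (2 / a\<^sup>2) powr b * I + 1"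
  have C: "C > 0" using I0 by (simp add: C_def add_nonneg_pos)
  have main: "spec a b \<omega> * (cmod (trig_poly n s c \<omega>))\<^sup>2 \<le> C * (LINT u|lborel. spec a b u * (cmod (trig_poly n s c u))\<^sup>2)"
    if s: "\<forall>j<n. \<forall>e\<in>Basis. \<bar>inner (s j) e\<bar> \<le> T" for n and s :: "nat \<Rightarrow> 'a" and c \<omega>
  proof -
    let ?S = "trig_poly n s c"
    define J where "J = (LINT u|lborel. spec a b u * (cmod (?S u))\<^sup>2)"
    have J0: "J \<ge> 0" unfolding J_def by (intro Bochner_Integration.integral_nonneg) auto
    have ptw: "\<rho> v * ?S (\<omega> + v) = (\<Sum>j<n. complex_of_real (c j) * cis (inner \<omega> (s j)) * (\<rho> v * cis (inner v (s j))))" for v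
      by (simp add: trig_poly_def sum_distrib_left inner_add_left cis_mult[symmetric] mult_ac)
    have int: "integrable lborel (\<lambda>v. \<rho> v * ?S (\<omega> + v))"
      unfolding ptw using s i by (intro Bochner_Integration.integrable_sum integrable_mult_right) auto
    have "(CLINT v|lborel. \<rho> v * ?S (\<omega> + v)) = (\<Sum>j<n. CLINT v|lborel. complex_of_real (c j) * cis (inner \<omega> (s j)) * (\<rho> v * cis (inner v (s j))))"
      unfolding ptw using s i by (intro Bochner_Integration.integral_sum integrable_mult_right) auto
    also have "\<dots> = (\<Sum>j<n. complex_of_real (c j) * cis (inner \<omega> (s j)))"
      using s one by (intro sum.cong) auto
    also have "\<dots> = ?S \<omega>" by (simp add: trig_poly_def)
    finally have S: "?S \<omega> = (CLINT v|lborel. \<rho> v * ?S (\<omega> + v))" ..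
    \<comment> \<open>The weights for Cauchy-Schwarz: the square of \<open>?g\<close> integrates to
      the energy \<open>J\<close> by translation invariance, and all dependence on \<omega> is left
      in \<open>?f\<close>.\<close>
    let ?f = "\<lambda>v. ennreal (cmod (\<rho> v) / sqrt (spec a b (\<omega> + v)))" and ?g = "\<lambda>v. ennreal (sqrt (spec a b (\<omega> + v)) * cmod (?S (\<omega> + v)))"
    have sp: "spec a b u > 0" for u :: 'a using a by (rule spec_pos)
    have "ennreal (cmod (?S \<omega>)) \<le> (\<integral>\<^sup>+ v. ennreal (cmod (\<rho> v * ?S (\<omega> + v))) \<partial>lborel)"
      unfolding S using int by (rule integral_norm_bound_ennreal)
    also have "\<dots> = (\<integral>\<^sup>+ v. ?f v * ?g v \<partial>lborel)"
    proof (intro nn_integral_cong)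
      fix v
      have "cmod (\<rho> v) / sqrt (spec a b (\<omega> + v)) * (sqrt (spec a b (\<omega> + v)) * cmod (?S (\<omega> + v))) = cmod (\<rho> v * ?S (\<omega> + v))"
        using sp[of "\<omega> + v"] by (simp add: norm_mult)
      moreover have "?f v * ?g v = ennreal (cmod (\<rho> v) / sqrt (spec a b (\<omega> + v)) * (sqrt (spec a b (\<omega> + v)) * cmod (?S (\<omega> + v))))"
        by (rule ennreal_mult[symmetric]) auto
      ultimately show "ennreal (cmod (\<rho> v * ?S (\<omega> + v))) = ?f v * ?g v"
        by (simp only:)
    qed
    finally have "(ennreal (cmod (?S \<omega>)))\<^sup>2 \<le> (\<integral>\<^sup>+ v. ?f v * ?g v \<partial>lborel)\<^sup>2"
      by (intro power_mono) auto
    also have "\<dots> \<le> (\<integral>\<^sup>+ v. ?f v ^ 2 \<partial>lborel) * (\<integral>\<^sup>+ v. ?g v ^ 2 \<partial>lborel)"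
      by (intro Cauchy_Schwarz_nn_integral) auto
    also have "(\<integral>\<^sup>+ v. ?g v ^ 2 \<partial>lborel) = (\<integral>\<^sup>+ v. ennreal (spec a b (\<omega> + v) * (cmod (?S (\<omega> + v)))\<^sup>2) \<partial>lborel)"
      by (intro nn_integral_cong) (simp add: ennreal_power power_mult_distrib)
    also have "\<dots> = (\<integral>\<^sup>+ u. ennreal (spec a b u * (cmod (?S u))\<^sup>2) \<partial>distr lborel borel ((+) \<omega>))"
      by (subst nn_integral_distr) auto
    also have "\<dots> = ennreal J"
      unfolding lborel_distr_plus J_def using integrable_spec_trig_poly[OF a b, of n s c]
      by (intro nn_integral_eq_integral) auto
    also have "(\<integral>\<^sup>+ v. ?f v ^ 2 \<partial>lborel) \<le> (\<integral>\<^sup>+ v. ennreal ((2 / a\<^sup>2) powr b / spec a b \<omega>) * ennreal ((cmod (\<rho> v))\<^sup>2 * (a\<^sup>2 + (norm v)\<^sup>2) powr b) \<partial>lborel)"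
    proof (intro nn_integral_mono)
      fix v :: 'a
      \<comment> \<open>A Peetre-type inequality:
        \<open>a\<^sup>2 + (norm (\<omega> + v))\<^sup>2\<close> is at most a constant times the
        product of the corresponding expressions in \<omega> and in \<open>v\<close>. The factor in
        \<omega> leaves the integral and later cancels against \<open>spec a b \<omega>\<close>,
        which makes the final constant uniform in \<omega>.\<close>
      have "(norm (\<omega> + v))\<^sup>2 \<le> (norm \<omega> + norm v)\<^sup>2" by (intro power_mono norm_triangle_ineq) auto
      also have "\<dots> \<le> 2 * (norm \<omega>)\<^sup>2 + 2 * (norm v)\<^sup>2"
        using sum_squares_bound[of "norm \<omega>" "norm v"] by (simp add: power2_sum)
      finally have 1: "(norm (\<omega> + v))\<^sup>2 \<le> 2 * (norm \<omega>)\<^sup>2 + 2 * (norm v)\<^sup>2" .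
      have 2: "2 / k * (k + A) * (k + B) = 2 * k + 2 * A + 2 * B + 2 * A * B / k" if "k > 0" for k A B :: real
        using that by (simp add: divide_simps) (simp add: algebra_simps)
      have "2 * (norm \<omega>)\<^sup>2 * (norm v)\<^sup>2 / a\<^sup>2 \<ge> 0" "a\<^sup>2 > 0" using a by auto
      then have "a\<^sup>2 + (norm (\<omega> + v))\<^sup>2 \<le> 2 / a\<^sup>2 * (a\<^sup>2 + (norm \<omega>)\<^sup>2) * (a\<^sup>2 + (norm v)\<^sup>2)"
        using 1 unfolding 2[OF \<open>a\<^sup>2 > 0\<close>] by linarith
      then have "(a\<^sup>2 + (norm (\<omega> + v))\<^sup>2) powr b \<le> (2 / a\<^sup>2 * (a\<^sup>2 + (norm \<omega>)\<^sup>2) * (a\<^sup>2 + (norm v)\<^sup>2)) powr b"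
        using b0 by (intro powr_mono2) auto
      also have "\<dots> = (2 / a\<^sup>2) powr b * (a\<^sup>2 + (norm \<omega>)\<^sup>2) powr b * (a\<^sup>2 + (norm v)\<^sup>2) powr b"
        using a by (simp only: powr_mult) 
      finally have p: "1 / spec a b (\<omega> + v) \<le> (2 / a\<^sup>2) powr b / spec a b \<omega> * (a\<^sup>2 + (norm v)\<^sup>2) powr b"
        by (simp add: spec_def powr_minus_divide)
      have "?f v ^ 2 = ennreal ((cmod (\<rho> v))\<^sup>2 * (1 / spec a b (\<omega> + v)))"
        using sp[of "\<omega> + v"] by (simp add: ennreal_power power_divide)
      also have "\<dots> \<le> ennreal ((cmod (\<rho> v))\<^sup>2 * ((2 / a\<^sup>2) powr b / spec a b \<omega> * (a\<^sup>2 + (norm v)\<^sup>2) powr b))"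
        using p by (intro ennreal_leI mult_left_mono) auto
      also have "\<dots> = ennreal ((2 / a\<^sup>2) powr b / spec a b \<omega>) * ennreal ((cmod (\<rho> v))\<^sup>2 * (a\<^sup>2 + (norm v)\<^sup>2) powr b)"
        by (subst ennreal_mult[symmetric]) (auto simp: mult_ac)
      finally show "?f v ^ 2 \<le> ennreal ((2 / a\<^sup>2) powr b / spec a b \<omega>) * ennreal ((cmod (\<rho> v))\<^sup>2 * (a\<^sup>2 + (norm v)\<^sup>2) powr b)" .
    qed
    also have "\<dots> = ennreal ((2 / a\<^sup>2) powr b / spec a b \<omega>) * ennreal I"
      unfolding I_def by (subst nn_integral_cmult) (auto simp: nn_integral_eq_integral[OF i2])
    also have "\<dots> = ennreal ((2 / a\<^sup>2) powr b / spec a b \<omega> * I)"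
      by (rule ennreal_mult'[symmetric]) simp
    finally have "(ennreal (cmod (?S \<omega>)))\<^sup>2 \<le> ennreal ((2 / a\<^sup>2) powr b / spec a b \<omega> * I) * ennreal J"
      by (simp add: mult_right_mono)
    also have "\<dots> = ennreal ((2 / a\<^sup>2) powr b / spec a b \<omega> * I * J)"
      using I0 by (intro ennreal_mult'[symmetric]) simp
    finally have "(cmod (?S \<omega>))\<^sup>2 \<le> (2 / a\<^sup>2) powr b / spec a b \<omega> * I * J"
      using I0 J0 by (simp add: ennreal_power ennreal_le_iff)
    then have "spec a b \<omega> * (cmod (?S \<omega>))\<^sup>2 \<le> spec a b \<omega> * ((2 / a\<^sup>2) powr b / spec a b \<omega> * I * J)"
      by (intro mult_left_mono) auto
    also have "\<dots> = (2 / a\<^sup>2) powr b * I * J" using sp[of \<omega>] by simp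
    also have "\<dots> \<le> C * J" using J0 by (simp add: C_def algebra_simps)
    finally show ?thesis unfolding J_def .
  qed
  show ?thesis using that[OF C main] .
qed

definition energy :: "real \<Rightarrow> real \<Rightarrow> nat \<Rightarrow> (nat \<Rightarrow> 'a::euclidean_space) \<Rightarrow> (nat \<Rightarrow> real) \<Rightarrow> real" where
  "energy a b n s c = (LINT u|lborel. spec a b u * (cmod (trig_poly n s c u))\<^sup>2)"

lemma energy_nonneg: "energy a b n s c \<ge> 0"
  unfolding energy_def by (intro Bochner_Integration.integral_nonneg) auto

lemma matern_quadratic_form:
  fixes s :: "nat \<Rightarrow> 'a::euclidean_space"
  assumes a: "a > 0" and n: "\<nu> > 0"
  defines "b \<equiv> \<nu> + DIM('a) / 2"
  shows "a powr (- 2 * \<nu>) * (\<Sum>i<n. \<Sum>j<n. c i * c j * matern a \<nu> (s i - s j))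
       = Gamma b / (pi powr (DIM('a) / 2) * Gamma \<nu>) * energy a b n s c"
proof -
  have b: "b > DIM('a) / 2" using n by (simp add: b_def)
  have i: "integrable lborel (\<lambda>u. spec a b u * cos (inner u (x::'a)))" for x
    by (rule Bochner_Integration.integrable_bound[OF integrable_spec[OF a b]])
       (auto simp: abs_mult mult_left_le)
  have "energy a b n s c = (LINT u|lborel. (\<Sum>i<n. \<Sum>j<n. c i * c j * (spec a b u * cos (inner u (s i - s j)))))"
    unfolding energy_def cmod_trig_poly_square by (simp add: sum_distrib_left mult_ac)
  also have "\<dots> = (\<Sum>i<n. \<Sum>j<n. c i * c j * (LINT u|lborel. spec a b u * cos (inner u (s i - s j))))"
    by (simp add: Bochner_Integration.integral_sum Bochner_Integration.integrable_sum i)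
  finally have e: "energy a b n s c = (\<Sum>i<n. \<Sum>j<n. c i * c j * (LINT u|lborel. spec a b u * cos (inner u (s i - s j))))" .
  have "a powr (- 2 * \<nu>) * (\<Sum>i<n. \<Sum>j<n. c i * c j * matern a \<nu> (s i - s j))
     = (\<Sum>i<n. \<Sum>j<n. c i * c j * (a powr (- 2 * \<nu>) * matern a \<nu> (s i - s j)))"
    by (simp only: sum_distrib_left mult_ac)
  also have "\<dots> = Gamma b / (pi powr (DIM('a) / 2) * Gamma \<nu>) * energy a b n s c"
    unfolding e matern_spectral[where 'a='a, OF a n, folded b_def] by (simp only: sum_distrib_left mult_ac)
  finally show ?thesis .
qed

text \<open>Zero energy makes the trigonometric polynomial vanish almost everywhere. Tested against
  a Gaussian weight, it then yields the coefficients summed with Gaussian factors centred at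
  \<open>s k\<close>, and as the width shrinks only \<open>c k\<close> survives because the points
  are distinct. This gives positive definiteness of the correlation matrices.\<close>

lemma energy_eq_0D:
  fixes s :: "nat \<Rightarrow> 'a::euclidean_space"
  assumes a: "a > 0" and b: "b > DIM('a) / 2" and inj: "inj_on s {..<n}" and e: "energy a b n s c = 0" and k: "k < n"
  shows "c k = 0"
proof -
  have "AE u in lborel. spec a b u * (cmod (trig_poly n s c u))\<^sup>2 = 0"
    using e integral_nonneg_eq_0_iff_AE[OF integrable_spec_trig_poly[OF a b, of n s c]]
    by (simp add: energy_def)
  then have S0: "AE u in lborel. trig_poly n s c u = 0"
  proof eventually_elim
    case (elim u)
    then show ?case using spec_pos[OF a, of b u] by simp
  qed
  have g: "(\<Sum>j<n. c j * exp (- (norm (s j - s k))\<^sup>2 / (4 * r))) = 0" if r: "r > 0" for r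
  proof -
    have i: "integrable lborel (\<lambda>u::'a. exp (- (r * (norm u)\<^sup>2)) * cos (inner u x))" for x
      by (rule Bochner_Integration.integrable_bound[OF gaussian_fourier(1)[OF r]])
         (auto simp: abs_mult mult_left_le)
    have "(pi / r) powr (DIM('a) / 2) * (\<Sum>j<n. c j * exp (- (norm (s j - s k))\<^sup>2 / (4 * r)))
       = (\<Sum>j<n. c j * (LINT u|lborel. exp (- (r * (norm u)\<^sup>2)) * cos (inner u (s j - s k))))"
      unfolding gaussian_fourier(2)[OF r] by (simp only: sum_distrib_left mult_ac)
    also have "\<dots> = (LINT u|lborel. (\<Sum>j<n. c j * (exp (- (r * (norm u)\<^sup>2)) * cos (inner u (s j - s k)))))"
      by (simp add: Bochner_Integration.integral_sum i)
    also have "\<dots> = (LINT u|(lborel :: 'a measure). 0)"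
    proof (rule Bochner_Integration.integral_cong_AE)
      show "AE u in lborel. (\<Sum>j<n. c j * (exp (- (r * (norm u)\<^sup>2)) * cos (inner u (s j - s k)))) = 0"
        using S0
      proof eventually_elim
        case (elim u)
        have "(\<Sum>j<n. c j * cos (inner u (s j - s k))) = Re (trig_poly n s c u * cis (- inner u (s k)))"
        proof -
          have "(\<Sum>j<n. c j * cos (inner u (s j - s k)))
             = (\<Sum>j<n. c j * cos (inner u (s j)) * cos (inner u (s k)) + c j * sin (inner u (s j)) * sin (inner u (s k)))"
            by (intro sum.cong refl) (simp add: inner_diff_right cos_diff distrib_left)
          also have "\<dots> = (\<Sum>j<n. c j * cos (inner u (s j))) * cos (inner u (s k)) + (\<Sum>j<n. c j * sin (inner u (s j))) * sin (inner u (s k))"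
            by (simp only: sum.distrib sum_distrib_right)
          finally show ?thesis by (simp add: trig_poly_def)
        qed
        also have "\<dots> = 0" using elim by simp
        finally have "(\<Sum>j<n. c j * cos (inner u (s j - s k))) = 0" .
        moreover have "(\<Sum>j<n. c j * (exp (- (r * (norm u)\<^sup>2)) * cos (inner u (s j - s k)))) = exp (- (r * (norm u)\<^sup>2)) * (\<Sum>j<n. c j * cos (inner u (s j - s k)))"
          by (simp only: sum_distrib_left mult_ac)
        ultimately show ?case by simp
      qed
    qed auto
    finally show ?thesis using r by simp
  qed
  have lim: "((\<lambda>r. \<Sum>j<n. c j * exp (- (norm (s j - s k))\<^sup>2 / (4 * r))) \<longlongrightarrow> (\<Sum>j<n. c j * (if j = k then 1 else 0))) (at_right 0)"
  proof (intro tendsto_sum tendsto_mult tendsto_const)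
    fix j assume j: "j \<in> {..<n}"
    show "((\<lambda>r. exp (- (norm (s j - s k))\<^sup>2 / (4 * r))) \<longlongrightarrow> (if j = k then 1 else 0)) (at_right 0)"
    proof (cases "j = k")
      case False
      then have "s j \<noteq> s k" using inj j k by (auto dest: inj_onD)
      then have p: "(norm (s j - s k))\<^sup>2 / 4 > 0" by simp
      have "filterlim (\<lambda>r::real. (norm (s j - s k))\<^sup>2 / 4 * inverse r) at_top (at_right 0)"
        by (rule filterlim_tendsto_pos_mult_at_top[OF tendsto_const p filterlim_inverse_at_top_right])
      then have "((\<lambda>r. exp (- ((norm (s j - s k))\<^sup>2 / 4 * inverse r))) \<longlongrightarrow> 0) (at_right 0)"
        by (intro filterlim_compose[OF exp_at_bot]) (simp add: filterlim_uminus_at_bot)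
      then show ?thesis using False by (simp add: field_simps)
    qed simp
  qed
  have "\<forall>\<^sub>F r in at_right 0. (\<Sum>j<n. c j * exp (- (norm (s j - s k))\<^sup>2 / (4 * r))) = 0"
    using eventually_at_right_less[of 0] by eventually_elim (rule g)
  then have "((\<lambda>r. \<Sum>j<n. c j * exp (- (norm (s j - s k))\<^sup>2 / (4 * r))) \<longlongrightarrow> 0) (at_right 0)"
    by (rule tendsto_eventually)
  from tendsto_unique[OF _ lim this] have "(\<Sum>j<n. c j * (if j = k then 1 else 0)) = 0" by simp
  then show ?thesis using k by (simp add: if_distrib cong: if_cong)
qed

section \<open>Comparison of the spectral densities of two scale parameters\<close>

lemma energy_mono:
  assumes K: "\<And>\<omega>::'a::euclidean_space. spec a b \<omega> \<le> K * spec a' b \<omega>" and a: "a > 0" "a' > 0" and b: "b > DIM('a) / 2"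
  shows "energy a b n (s :: nat \<Rightarrow> 'a) c \<le> K * energy a' b n s c"
proof -
  have "energy a b n s c \<le> (LINT u|lborel. K * (spec a' b u * (cmod (trig_poly n s c u))\<^sup>2))"
    unfolding energy_def
  proof (rule integral_mono)
    show "spec a b u * (cmod (trig_poly n s c u))\<^sup>2 \<le> K * (spec a' b u * (cmod (trig_poly n s c u))\<^sup>2)" for u
      using mult_right_mono[OF K[of u], of "(cmod (trig_poly n s c u))\<^sup>2"] by (simp add: mult_ac)
  qed (intro integrable_mult_right integrable_spec_trig_poly a b)+
  then show ?thesis by (simp add: energy_def)
qed

lemma spec_antimono:
  assumes "0 < a'" "a' \<le> a" "b \<ge> 0"
  shows "spec a b \<omega> \<le> spec a' b \<omega>"
  unfolding spec_def using assms by (intro powr_mono2') (auto intro!: add_pos_nonneg power_mono)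

lemma spec_comparable:
  assumes a: "a > 0" "a' > 0" and b: "b \<ge> 0"
  shows "spec a b \<omega> \<le> max 1 ((a' / a) powr (2 * b)) * spec a' b \<omega>"
proof (cases "a' \<le> a")
  case True
  have "spec a b \<omega> \<le> 1 * spec a' b \<omega>" using spec_antimono[OF a(2) True b, of \<omega>] by simp
  also have "\<dots> \<le> max 1 ((a' / a) powr (2 * b)) * spec a' b \<omega>" by (intro mult_right_mono) auto
  finally show ?thesis .
next
  case False
  define k where "k = a' / a"
  have k: "k \<ge> 1" "a' = k * a" using False a by (auto simp: k_def)
  have "a'\<^sup>2 + (norm \<omega>)\<^sup>2 \<le> k\<^sup>2 * (a\<^sup>2 + (norm \<omega>)\<^sup>2)"
    using k mult_right_mono[of 1 "k\<^sup>2" "(norm \<omega>)\<^sup>2"] by (simp add: power_mult_distrib distrib_left)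
  then have "(k\<^sup>2 * (a\<^sup>2 + (norm \<omega>)\<^sup>2)) powr (- b) \<le> spec a' b \<omega>"
    unfolding spec_def using a b by (intro powr_mono2') (auto intro!: add_pos_nonneg)
  moreover have "(k\<^sup>2 * (a\<^sup>2 + (norm \<omega>)\<^sup>2)) powr (- b) = (k\<^sup>2) powr (- b) * spec a b \<omega>"
    unfolding spec_def using k by (simp add: powr_mult)
  moreover have "(k\<^sup>2) powr (- b) = 1 / k powr (2 * b)"
    using k by (simp add: powr_minus_divide powr_powr powr_numeral[symmetric] del: powr_numeral)
  ultimately have "spec a b \<omega> / k powr (2 * b) \<le> spec a' b \<omega>" by simp
  then have "spec a b \<omega> \<le> k powr (2 * b) * spec a' b \<omega>"
    using k by (simp add: divide_le_eq mult.commute)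
  also have "\<dots> \<le> max 1 (k powr (2 * b)) * spec a' b \<omega>" by (intro mult_right_mono) auto
  finally show ?thesis by (simp add: k_def)
qed

text \<open>The quotient of the two densities is \<open>z powr b\<close>, where \<open>z\<close> is
  a quotient of two affine functions of the squared frequency with equal slopes. So
  \<open>z - 1\<close> is of order \<open>1 / (1 + w)\<close>, and the mean value theorem transfers
  this to \<open>z powr b - 1\<close>.\<close>

lemma spec_relative_diff:
  assumes a: "a > 0" "a' > 0" and b: "b > 0"
  obtains K where "K > 0" "\<And>\<omega>::'a::euclidean_space. \<bar>spec a' b \<omega> - spec a b \<omega>\<bar> \<le> K * spec a b \<omega> / (1 + (norm \<omega>)\<^sup>2)"
proof -
  define lo hi where "lo = min 1 (a\<^sup>2 / a'\<^sup>2)" and "hi = max 1 (a\<^sup>2 / a'\<^sup>2)"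
  have lo: "lo > 0" "hi > 0" "lo \<le> 1" "hi \<ge> 1" using a by (auto simp: lo_def hi_def)
  \<comment> \<open>\<open>x powr (b - 1)\<close> is increasing or decreasing according to the sign
    of \<open>b - 1\<close>. The sum of its values at both ends of the range of \<open>z\<close>
    bounds it in either case.\<close>
  define K where "K = b * (lo powr (b - 1) + hi powr (b - 1)) * (\<bar>a\<^sup>2 - a'\<^sup>2\<bar> / min 1 (a'\<^sup>2)) + 1"
  have K: "K > 0" using b a by (simp add: K_def add_nonneg_pos)
  have "\<bar>spec a' b \<omega> - spec a b \<omega>\<bar> \<le> K * spec a b \<omega> / (1 + (norm \<omega>)\<^sup>2)" for \<omega> :: 'a
  proof -
    define w where "w = (norm \<omega>)\<^sup>2"
    have w: "w \<ge> 0" by (simp add: w_def)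
    define z where "z = (a\<^sup>2 + w) / (a'\<^sup>2 + w)"
    have p: "a\<^sup>2 + w > 0" "a'\<^sup>2 + w > 0" using a w by (auto intro!: add_pos_nonneg)
    have z0: "z > 0" using p by (simp add: z_def)
    have zl: "lo \<le> z" "z \<le> hi"
    proof -
      have "lo * (a'\<^sup>2 + w) \<le> a\<^sup>2 / a'\<^sup>2 * a'\<^sup>2 + 1 * w"
        unfolding distrib_left using w a by (intro add_mono mult_right_mono) (auto simp: lo_def)
      then show "lo \<le> z" using p a by (simp add: z_def le_divide_eq)
      have "a\<^sup>2 / a'\<^sup>2 * a'\<^sup>2 + 1 * w \<le> hi * (a'\<^sup>2 + w)"
        unfolding distrib_left using w a by (intro add_mono mult_right_mono) (auto simp: hi_def)
      then show "z \<le> hi" using p a by (simp add: z_def divide_le_eq)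
    qed
    have "spec a' b \<omega> = z powr b * spec a b \<omega>"
      unfolding spec_def w_def[symmetric] z_def using p by (simp add: powr_divide powr_minus_divide)
    then have d: "\<bar>spec a' b \<omega> - spec a b \<omega>\<bar> = \<bar>z powr b - 1\<bar> * spec a b \<omega>"
      by (simp add: left_diff_distrib[of "z powr b" 1, simplified, symmetric] abs_mult)
    have der: "((\<lambda>x. x powr b) has_real_derivative b * x powr (b - 1)) (at x)" if "x > 0" for x
      using that by (auto intro!: derivative_eq_intros)
    have "\<exists>x. lo \<le> x \<and> x \<le> hi \<and> \<bar>z powr b - 1\<bar> = \<bar>z - 1\<bar> * (b * x powr (b - 1))"
    proof (cases z "1::real" rule: linorder_cases)
      case less
      obtain x where "z < x" "x < 1" "1 powr b - z powr b = (1 - z) * (b * x powr (b - 1))"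
        using MVT2[OF less, of "\<lambda>x. x powr b" "\<lambda>x. b * x powr (b - 1)"] der z0 by auto
      then show ?thesis using zl lo b less by (intro exI[of _ x]) (auto simp: abs_minus_commute[of _ 1] abs_mult)
    next
      case equal
      then show ?thesis using lo by (intro exI[of _ 1]) auto
    next
      case greater
      obtain x where "1 < x" "x < z" "z powr b - 1 powr b = (z - 1) * (b * x powr (b - 1))"
        using MVT2[OF greater, of "\<lambda>x. x powr b" "\<lambda>x. b * x powr (b - 1)"] der z0 by auto
      then show ?thesis using zl lo b greater by (intro exI[of _ x]) (auto simp: abs_mult)
    qed
    then obtain x where x: "lo \<le> x" "x \<le> hi" and eq: "\<bar>z powr b - 1\<bar> = \<bar>z - 1\<bar> * (b * x powr (b - 1))" by blast
    have xb: "x powr (b - 1) \<le> lo powr (b - 1) + hi powr (b - 1)"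
    proof (cases "b \<ge> 1")
      case True
      then have "x powr (b - 1) \<le> hi powr (b - 1)" using x lo by (intro powr_mono2) auto
      then show ?thesis using powr_ge_zero[of lo "b - 1"] powr_ge_zero[of hi "b - 1"] by linarith
    next
      case False
      then have "x powr (b - 1) \<le> lo powr (b - 1)" using x lo by (intro powr_mono2') auto
      then show ?thesis using powr_ge_zero[of lo "b - 1"] powr_ge_zero[of hi "b - 1"] by linarith
    qed
    have "z - 1 = (a\<^sup>2 - a'\<^sup>2) / (a'\<^sup>2 + w)" using p by (simp add: z_def field_simps)
    then have "\<bar>z - 1\<bar> = \<bar>a\<^sup>2 - a'\<^sup>2\<bar> / (a'\<^sup>2 + w)" using p by simp
    also have "\<dots> \<le> \<bar>a\<^sup>2 - a'\<^sup>2\<bar> / (min 1 (a'\<^sup>2) * (1 + w))"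
    proof (rule divide_left_mono)
      have "min 1 (a'\<^sup>2) * (1 + w) = min 1 (a'\<^sup>2) * 1 + min 1 (a'\<^sup>2) * w" by (rule distrib_left)
      also have "\<dots> \<le> a'\<^sup>2 + 1 * w" using w by (intro add_mono mult_right_mono) auto
      finally show "min 1 (a'\<^sup>2) * (1 + w) \<le> a'\<^sup>2 + w" by simp
      show "0 < (a'\<^sup>2 + w) * (min 1 (a'\<^sup>2) * (1 + w))" using p a w by (intro mult_pos_pos) auto
    qed simp
    finally have "\<bar>z powr b - 1\<bar> \<le> \<bar>a\<^sup>2 - a'\<^sup>2\<bar> / (min 1 (a'\<^sup>2) * (1 + w)) * (b * (lo powr (b - 1) + hi powr (b - 1)))"
      unfolding eq using xb b by (intro mult_mono) auto
    also have "\<dots> = (K - 1) / (1 + w)" by (simp add: K_def)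
    also have "\<dots> \<le> K / (1 + w)" using w by (intro divide_right_mono) auto
    finally have "\<bar>z powr b - 1\<bar> * spec a b \<omega> \<le> K / (1 + w) * spec a b \<omega>" by (intro mult_right_mono) auto
    then show ?thesis unfolding d by (simp add: w_def)
  qed
  then show ?thesis using that K by blast
qed

lemma trig_poly_linear:
  "trig_poly n s (\<lambda>j. \<Sum>k<l. y k * \<beta> k j) u = (\<Sum>k<l. complex_of_real (y k) * trig_poly n s (\<beta> k) u)"
proof -
  have "trig_poly n s (\<lambda>j. \<Sum>k<l. y k * \<beta> k j) u = (\<Sum>j<n. \<Sum>k<l. complex_of_real (y k) * (complex_of_real (\<beta> k j) * cis (inner u (s j))))"
    unfolding trig_poly_def of_real_sum of_real_mult sum_distrib_right
    by (intro sum.cong refl) (simp add: mult_ac)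
  also have "\<dots> = (\<Sum>k<l. \<Sum>j<n. complex_of_real (y k) * (complex_of_real (\<beta> k j) * cis (inner u (s j))))"
    by (rule sum.swap)
  finally show ?thesis by (simp add: trig_poly_def sum_distrib_left)
qed

text \<open>Where v = \<open>1 / (1 + w)\<close> exceeds \<open>e\<close>, the factor
  \<open>v powr (- 3 / 4)\<close> in \<open>v = v powr (- 3 / 4) * v powr (7 / 4)\<close> is at most
  \<open>e powr (- 3 / 4)\<close>.\<close>

lemma inverse_split:
  fixes w e :: real
  assumes w: "w \<ge> 0" and e: "e > 0"
  shows "1 / (1 + w) \<le> e + e powr (- 3 / 4) * (1 + w) powr (- (7 / 4))"
proof (cases "1 / (1 + w) \<le> e")
  case True
  then show ?thesis by (simp add: add_increasing2)
next
  case False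
  define v where "v = 1 / (1 + w)"
  have v: "v > 0" "e \<le> v" using w False by (auto simp: v_def)
  have "v = v powr (- 3 / 4) * v powr (7 / 4)" using v by (simp add: powr_add[symmetric])
  also have "\<dots> \<le> e powr (- 3 / 4) * v powr (7 / 4)"
    using v e by (intro mult_right_mono powr_mono2') auto
  also have "v powr (7 / 4) = (1 + w) powr (- (7 / 4))"
    using w by (simp add: v_def powr_divide powr_minus_divide)
  finally show ?thesis using e by (simp add: v_def)
qed

text \<open>For a system orthonormal in energy, the sum of the squared values at one frequency is up
  to a factor 2 the squared norm of evaluation there, hence bounded independently of n by
  \<open>trig_poly_energy_bound\<close>. The \<open>e\<close> part of the split is paid once per
  coordinate; the other part is the integral of this bounded sum against an integrable weight, and
  so does not grow with the number of coordinates.\<close>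

lemma energy_orthonormal_diff_bound:
  fixes T a a' b k0 :: real
  assumes T: "T \<ge> 0" and a: "a > 0" "a' > 0" and b: "b > DIM('a::euclidean_space) / 2" and d: "DIM('a) \<le> 3" and k0: "k0 > 0"
  obtains C where "C > 0" "\<And>n (s :: nat \<Rightarrow> 'a) \<beta>. n \<ge> 1 \<Longrightarrow> (\<forall>j<n. \<forall>e\<in>Basis. \<bar>inner (s j) e\<bar> \<le> T) \<Longrightarrow>
     (\<And>y. k0 * energy a b n s (\<lambda>j. \<Sum>k<n. y k * \<beta> k j) = (\<Sum>k<n. (y k)\<^sup>2)) \<Longrightarrow>
     (\<Sum>k<n. \<bar>k0 * energy a' b n s (\<beta> k) - k0 * energy a b n s (\<beta> k)\<bar>) \<le> C * real n powr (3 / 7)"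
proof -
  have b0: "b > 0" using b by (smt (verit) divide_nonneg_nonneg of_nat_0_le_iff)
  obtain C1 where C1: "C1 > 0" and en: "\<And>n (s :: nat \<Rightarrow> 'a) c \<omega>. (\<forall>j<n. \<forall>e\<in>Basis. \<bar>inner (s j) e\<bar> \<le> T) \<Longrightarrow>
     spec a b \<omega> * (cmod (trig_poly n s c \<omega>))\<^sup>2 \<le> C1 * (LINT u|lborel. spec a b u * (cmod (trig_poly n s c u))\<^sup>2)"
    by (rule trig_poly_energy_bound[OF T a(1) b]) (rule that)
  obtain C2 where C2: "C2 > 0" and rd: "\<And>\<omega>::'a. \<bar>spec a' b \<omega> - spec a b \<omega>\<bar> \<le> C2 * spec a b \<omega> / (1 + (norm \<omega>)\<^sup>2)"
    by (rule spec_relative_diff[OF a b0]) (rule that)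
  have i74: "integrable lborel (spec 1 (7/4) :: 'a \<Rightarrow> real)"
    using d by (intro integrable_spec) auto
  define I where "I = (LINT u|lborel. spec 1 (7/4) (u::'a))"
  have I: "I \<ge> 0" unfolding I_def by (intro Bochner_Integration.integral_nonneg) auto
  define C where "C = C2 * (1 + 2 * C1 * I)"
  have C: "C > 0" using C1 C2 I by (simp add: C_def add_pos_nonneg)
  have main: "(\<Sum>k<n. \<bar>k0 * energy a' b n s (\<beta> k) - k0 * energy a b n s (\<beta> k)\<bar>) \<le> C * real n powr (3 / 7)"
    if n: "n \<ge> 1" and s: "\<forall>j<n. \<forall>e\<in>Basis. \<bar>inner (s j) e\<bar> \<le> T"
      and on: "\<And>y. k0 * energy a b n s (\<lambda>j. \<Sum>k<n. y k * \<beta> k j) = (\<Sum>k<n. (y k)\<^sup>2)" for n and s :: "nat \<Rightarrow> 'a" and \<beta>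
  proof -
    define P where "P u k = (cmod (trig_poly n s (\<beta> k) u))\<^sup>2" for u k
    have en1: "k0 * energy a b n s (\<beta> k) = 1" if "k < n" for k
    proof -
      have "(\<lambda>j. \<Sum>l<n. (if l = k then 1 else 0) * \<beta> l j) = \<beta> k" using that by (auto simp: if_distrib[of "\<lambda>x. x * _"] cong: if_cong)
      moreover have "(\<Sum>l<n. (if l = k then 1 else 0)\<^sup>2) = (1::real)" using that by (simp add: if_distrib[of "\<lambda>x. x\<^sup>2"] cong: if_cong)
      ultimately show ?thesis using on[of "\<lambda>l. if l = k then 1 else 0"] by simp
    qed
    have key: "spec a b u * (\<Sum>k<n. P u k) \<le> 2 * C1 / k0" for u
    proof -
      \<comment> \<open>Duality, with the values \<open>z\<close> themselves as coefficients: the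
        combination with weights \<open>z\<close> has energy proportional to \<open>Y\<close> but
        squared value at least \<open>Y\<^sup>2\<close>. As coefficients are real, real and
        imaginary parts are treated separately, whence the factor 2 in \<open>key\<close>.\<close>
      have half: "spec a b u * (\<Sum>k<n. (z k)\<^sup>2) \<le> C1 / k0"
        if z: "\<And>y. (\<Sum>k<n. y k * z k)\<^sup>2 \<le> (cmod (\<Sum>k<n. complex_of_real (y k) * trig_poly n s (\<beta> k) u))\<^sup>2" for z
      proof -
        define Y where "Y = (\<Sum>k<n. (z k)\<^sup>2)"
        have Y0: "Y \<ge> 0" by (simp add: Y_def sum_nonneg)
        have "Y\<^sup>2 = (\<Sum>k<n. z k * z k)\<^sup>2" by (simp add: Y_def power2_eq_square)
        also have "\<dots> \<le> (cmod (\<Sum>k<n. complex_of_real (z k) * trig_poly n s (\<beta> k) u))\<^sup>2" by (rule z)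
        also have "\<dots> = (cmod (trig_poly n s (\<lambda>j. \<Sum>k<n. z k * \<beta> k j) u))\<^sup>2" by (simp only: trig_poly_linear)
        finally have "spec a b u * Y\<^sup>2 \<le> spec a b u * (cmod (trig_poly n s (\<lambda>j. \<Sum>k<n. z k * \<beta> k j) u))\<^sup>2"
          by (intro mult_left_mono) auto
        also have "\<dots> \<le> C1 * energy a b n s (\<lambda>j. \<Sum>k<n. z k * \<beta> k j)" unfolding energy_def by (rule en[OF s])
        also have "\<dots> = C1 / k0 * Y" using on[of z] k0 unfolding Y_def[symmetric] by (simp add: field_simps)
        finally have "(spec a b u * Y) * Y \<le> C1 / k0 * Y" by (simp add: power2_eq_square mult_ac)
        then have "spec a b u * Y \<le> C1 / k0"
          using Y0 C1 k0 by (cases "Y = 0") (auto intro: mult_right_le_imp_le)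
        then show ?thesis by (simp add: Y_def)
      qed
      have re: "(\<Sum>k<n. y k * Re (trig_poly n s (\<beta> k) u))\<^sup>2 \<le> (cmod (\<Sum>k<n. complex_of_real (y k) * trig_poly n s (\<beta> k) u))\<^sup>2" for y
        by (simp add: cmod_power2)
      have im: "(\<Sum>k<n. y k * Im (trig_poly n s (\<beta> k) u))\<^sup>2 \<le> (cmod (\<Sum>k<n. complex_of_real (y k) * trig_poly n s (\<beta> k) u))\<^sup>2" for y
        by (simp add: cmod_power2)
      have "spec a b u * (\<Sum>k<n. P u k) = spec a b u * (\<Sum>k<n. (Re (trig_poly n s (\<beta> k) u))\<^sup>2) + spec a b u * (\<Sum>k<n. (Im (trig_poly n s (\<beta> k) u))\<^sup>2)"
        by (simp add: P_def cmod_power2 sum.distrib distrib_left)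
      then show ?thesis using half[OF re] half[OF im] by simp
    qed
    \<comment> \<open>The balancing choice: \<open>n * e\<close> and \<open>e powr (- 3 / 4)\<close>
      both become \<open>n powr (3 / 7)\<close>.\<close>
    define e where "e = real n powr (- 4 / 7)"
    have e: "e > 0" using n by (simp add: e_def)
    define c where "c = e powr (- 3 / 4)"
    have ip: "integrable lborel (\<lambda>u. spec a b u * P u k)" "integrable lborel (\<lambda>u. spec a' b u * P u k)" for k
      unfolding P_def using a b by (auto intro: integrable_spec_trig_poly)
    have pt: "\<bar>spec a' b u - spec a b u\<bar> \<le> C2 * (e * spec a b u + c * (spec 1 (7/4) u * spec a b u))" for u :: 'a
    proof -
      have "1 / (1 + (norm u)\<^sup>2) \<le> e + c * spec 1 (7/4) u"
        using inverse_split[of "(norm u)\<^sup>2" e] e by (simp add: spec_def c_def)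
      then have "C2 * spec a b u * (1 / (1 + (norm u)\<^sup>2)) \<le> C2 * spec a b u * (e + c * spec 1 (7/4) u)"
        using C2 by (intro mult_left_mono) auto
      then show ?thesis using rd[of u] by (simp add: algebra_simps)
    qed
    have i7: "integrable lborel (\<lambda>u. spec 1 (7/4) u * (spec a b u * P u k))" if "k < n" for k
    proof (rule Bochner_Integration.integrable_bound[OF integrable_mult_left[OF i74, of "2 * C1 / k0"]])
      show "AE u in lborel. norm (spec 1 (7/4) u * (spec a b u * P u k)) \<le> norm (spec 1 (7/4) u * (2 * C1 / k0))"
      proof (intro AE_I2)
        fix u :: 'a
        have "P u k \<le> (\<Sum>k<n. P u k)" using that by (intro member_le_sum) (auto simp: P_def)
        then have "spec a b u * P u k \<le> spec a b u * (\<Sum>k<n. P u k)" by (intro mult_left_mono) auto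
        also note key
        finally have "spec a b u * P u k \<le> 2 * C1 / k0" .
        moreover have "spec a b u * P u k \<ge> 0" by (simp add: P_def)
        ultimately have "\<bar>spec a b u * P u k\<bar> \<le> \<bar>2 * C1 / k0\<bar>" by linarith
        then show "norm (spec 1 (7/4) u * (spec a b u * P u k)) \<le> norm (spec 1 (7/4) u * (2 * C1 / k0))"
          unfolding real_norm_def abs_mult[of "spec 1 (7/4) u"] by (intro mult_left_mono) auto
      qed
    qed (auto simp: P_def)
    have one: "\<bar>k0 * energy a' b n s (\<beta> k) - k0 * energy a b n s (\<beta> k)\<bar>
       \<le> C2 * e + k0 * C2 * c * (LINT u|lborel. spec 1 (7/4) u * (spec a b u * P u k))" if k: "k < n" for k
    proof -
      have "energy a' b n s (\<beta> k) - energy a b n s (\<beta> k) = (LINT u|lborel. spec a' b u * P u k - spec a b u * P u k)"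
        unfolding energy_def P_def[symmetric] using ip by (intro Bochner_Integration.integral_diff[symmetric]) 
      then have "\<bar>energy a' b n s (\<beta> k) - energy a b n s (\<beta> k)\<bar> \<le> (LINT u|lborel. \<bar>spec a' b u * P u k - spec a b u * P u k\<bar>)"
        by (simp only: integral_abs_bound)
      also have "\<dots> \<le> (LINT u|lborel. C2 * e * (spec a b u * P u k) + C2 * c * (spec 1 (7/4) u * (spec a b u * P u k)))"
      proof (rule integral_mono)
        fix u :: 'a
        have "\<bar>spec a' b u * P u k - spec a b u * P u k\<bar> = \<bar>spec a' b u - spec a b u\<bar> * P u k"
          by (simp add: left_diff_distrib[symmetric] abs_mult P_def)
        also have "\<dots> \<le> C2 * (e * spec a b u + c * (spec 1 (7/4) u * spec a b u)) * P u k"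
          using pt by (intro mult_right_mono) (auto simp: P_def)
        finally show "\<bar>spec a' b u * P u k - spec a b u * P u k\<bar> \<le> C2 * e * (spec a b u * P u k) + C2 * c * (spec 1 (7/4) u * (spec a b u * P u k))"
          by (simp add: algebra_simps)
      qed (use ip i7[OF k] in auto)
      also have "\<dots> = C2 * e * energy a b n s (\<beta> k) + C2 * c * (LINT u|lborel. spec 1 (7/4) u * (spec a b u * P u k))"
        unfolding energy_def P_def[symmetric] using ip i7[OF k] by simp
      finally have "k0 * \<bar>energy a' b n s (\<beta> k) - energy a b n s (\<beta> k)\<bar> \<le> k0 * (C2 * e * energy a b n s (\<beta> k) + C2 * c * (LINT u|lborel. spec 1 (7/4) u * (spec a b u * P u k)))"
        using k0 by (intro mult_left_mono) auto
      also have "\<dots> = C2 * e * (k0 * energy a b n s (\<beta> k)) + k0 * C2 * c * (LINT u|lborel. spec 1 (7/4) u * (spec a b u * P u k))"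
        by (simp add: algebra_simps)
      moreover have "\<bar>k0 * energy a' b n s (\<beta> k) - k0 * energy a b n s (\<beta> k)\<bar> = k0 * \<bar>energy a' b n s (\<beta> k) - energy a b n s (\<beta> k)\<bar>"
        using k0 by (simp add: right_diff_distrib[symmetric] abs_mult)
      ultimately show ?thesis using en1[OF k] by simp
    qed
    have "(\<Sum>k<n. \<bar>k0 * energy a' b n s (\<beta> k) - k0 * energy a b n s (\<beta> k)\<bar>)
       \<le> (\<Sum>k<n. C2 * e + k0 * C2 * c * (LINT u|lborel. spec 1 (7/4) u * (spec a b u * P u k)))"
      using one by (intro sum_mono) auto
    also have "\<dots> = C2 * (real n * e) + k0 * C2 * c * (LINT u|lborel. spec 1 (7/4) u * (spec a b u * (\<Sum>k<n. P u k)))"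
      using i7 by (simp add: sum.distrib sum_distrib_left)
    also have "(LINT u|lborel. spec 1 (7/4) u * (spec a b u * (\<Sum>k<n. P u k))) \<le> (LINT u|lborel. spec 1 (7/4) (u::'a) * (2 * C1 / k0))"
    proof (rule integral_mono)
      show "integrable lborel (\<lambda>u. spec 1 (7/4) u * (spec a b u * (\<Sum>k<n. P u k)))"
        unfolding sum_distrib_left using i7 by (intro Bochner_Integration.integrable_sum) auto
      show "spec 1 (7/4) u * (spec a b u * (\<Sum>k<n. P u k)) \<le> spec 1 (7/4) u * (2 * C1 / k0)" for u :: 'a
        by (intro mult_left_mono key) auto
    qed (intro integrable_mult_left i74)
    also have "\<dots> = I * (2 * C1 / k0)" by (simp add: I_def)
    finally have "(\<Sum>k<n. \<bar>k0 * energy a' b n s (\<beta> k) - k0 * energy a b n s (\<beta> k)\<bar>) \<le> C2 * (real n * e) + k0 * C2 * c * (I * (2 * C1 / k0))"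
      using k0 C2 by (simp add: c_def mult_left_mono)
    also have "\<dots> = C2 * (real n * e) + C2 * (2 * C1 * I) * c" using k0 by (simp add: mult_ac)
    also have "real n * e = real n powr (3 / 7)"
      using n powr_add[of "real n" 1 "- 4 / 7"] by (simp add: e_def)
    also have "c = real n powr (3 / 7)" by (simp add: c_def e_def powr_powr)
    finally show ?thesis by (simp add: C_def algebra_simps)
  qed
  show ?thesis using that[OF C main] .
qed

section \<open>Laplace approximation\<close>

text \<open>The function \<open>ln x + 1 / x - 1\<close> is the exponent of the inverse gamma
  kernel, with minimum 0 and second derivative 1 at 1. The remainder vanishes at 0 and its
  derivative is \<open>- z\<^sup>2 * (2 + z) / (1 + z)\<^sup>2\<close>, so one use of the mean value
  theorem suffices; 10 is 5/2 times 4, the bounds for \<open>2 + z\<close> and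
  \<open>1 / (1 + z)\<^sup>2\<close>.\<close>

lemma ln_plus_inverse_cubic:
  fixes y :: real
  assumes y: "\<bar>y\<bar> \<le> 1 / 2"
  shows "\<bar>ln (1 + y) + 1 / (1 + y) - 1 - y\<^sup>2 / 2\<bar> \<le> 10 * \<bar>y\<bar> ^ 3"
proof (cases "y = 0")
  case False
  define u where "u = (\<lambda>z::real. ln (1 + z) + 1 / (1 + z) - 1 - z\<^sup>2 / 2)"
  define u' where "u' = (\<lambda>z::real. 1 / (1 + z) - 1 / (1 + z)\<^sup>2 - z)"
  have der: "(u has_real_derivative u' z) (at z)" if "\<bar>z\<bar> \<le> 1 / 2" for z
  proof -
    have p: "1 + z > 0" using that by (auto simp: abs_le_iff)
    have 1: "((\<lambda>z. ln (1 + z)) has_real_derivative 1 / (1 + z)) (at z)"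
      using p by (auto intro!: derivative_eq_intros)
    have 2: "((\<lambda>z. 1 / (1 + z)) has_real_derivative - (1 / (1 + z)\<^sup>2)) (at z)"
      using p by (auto intro!: derivative_eq_intros simp: power2_eq_square)
    have 3: "((\<lambda>z. z\<^sup>2 / 2) has_real_derivative z) (at z)"
      by (auto intro!: derivative_eq_intros)
    show ?thesis
      unfolding u_def u'_def
      using DERIV_diff[OF DERIV_diff[OF DERIV_add[OF 1 2] DERIV_const[of 1]] 3] by simp
  qed
  have "\<exists>z. \<bar>z\<bar> \<le> \<bar>y\<bar> \<and> u y - u 0 = y * u' z"
  proof (cases "y > 0")
    case True
    obtain z where "0 < z" "z < y" "u y - u 0 = (y - 0) * u' z"
      using MVT2[of 0 y u u'] True der y by auto
    then show ?thesis by (intro exI[of _ z]) auto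
  next
    case neg: False
    then have "y < 0" using False by simp
    then obtain z where z: "y < z" "z < 0" "u 0 - u y = (0 - y) * u' z"
      using MVT2[of y 0 u u'] der y by auto
    then show ?thesis by (intro exI[of _ z]) auto
  qed
  then obtain z where z: "\<bar>z\<bar> \<le> \<bar>y\<bar>" "u y = y * u' z" by (auto simp: u_def)
  have z1: "1 + z \<ge> 1 / 2" "z \<le> 1/2" using z(1) y by auto
  have u'z: "u' z = - (z\<^sup>2 * (2 + z)) / (1 + z)\<^sup>2"
    using z1 by (simp add: u'_def power2_eq_square divide_simps) (simp add: algebra_simps)
  have "1 / (1 + z)\<^sup>2 \<le> 1 / (1 / 2)\<^sup>2"
    using z1 by (intro divide_left_mono power_mono) auto
  then have i4: "1 / (1 + z)\<^sup>2 \<le> 4" by (simp add: power2_eq_square)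
  have "\<bar>u' z\<bar> = z\<^sup>2 * ((2 + z) * (1 / (1 + z)\<^sup>2))"
    using z1 unfolding u'z by (simp add: abs_mult)
  also have "\<dots> \<le> z\<^sup>2 * ((5 / 2) * 4)"
    using z1 i4 by (intro mult_left_mono mult_mono) auto
  also have "\<dots> \<le> y\<^sup>2 * 10"
    using z(1) abs_le_square_iff[of z y] by simp
  finally have "\<bar>u' z\<bar> \<le> y\<^sup>2 * 10" .
  then have "\<bar>u y\<bar> \<le> \<bar>y\<bar> * (y\<^sup>2 * 10)"
    unfolding z(2) abs_mult by (intro mult_left_mono) auto
  also have "\<dots> = 10 * \<bar>y\<bar> ^ 3" by (simp add: power3_eq_cube power2_eq_square abs_mult)
  finally show ?thesis by (simp add: u_def)
qed simp

lemma ln_plus_inverse_antimono: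
  fixes x y :: real
  assumes "0 < x" "x \<le> y" "y \<le> 1"
  shows "ln y + 1 / y \<le> ln x + 1 / x"
proof (rule DERIV_nonpos_imp_nonincreasing[of x y "\<lambda>z. ln z + 1 / z", OF assms(2)])
  fix z assume z: "x \<le> z" "z \<le> y"
  have "((\<lambda>z. ln z + 1 / z) has_real_derivative (1 / z - 1 / z\<^sup>2)) (at z)"
    using z assms by (auto intro!: derivative_eq_intros simp: power2_eq_square)
  moreover have "1 / z - 1 / z\<^sup>2 = (z - 1) / z\<^sup>2" using z assms by (simp add: power2_eq_square field_simps)
  moreover have "(z - 1) / z\<^sup>2 \<le> 0" using z assms by (intro divide_nonpos_nonneg) auto
  ultimately show "\<exists>d. ((\<lambda>z. ln z + 1 / z) has_real_derivative d) (at z) \<and> d \<le> 0" by metis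
qed

lemma ln_plus_inverse_mono:
  fixes x y :: real
  assumes "1 \<le> x" "x \<le> y"
  shows "ln x + 1 / x \<le> ln y + 1 / y"
proof (rule DERIV_nonneg_imp_nondecreasing[of x y "\<lambda>z. ln z + 1 / z", OF assms(2)])
  fix z assume z: "x \<le> z" "z \<le> y"
  have "((\<lambda>z. ln z + 1 / z) has_real_derivative (1 / z - 1 / z\<^sup>2)) (at z)"
    using z assms by (auto intro!: derivative_eq_intros simp: power2_eq_square)
  moreover have "1 / z - 1 / z\<^sup>2 = (z - 1) / z\<^sup>2" using z assms by (simp add: power2_eq_square field_simps)
  moreover have "(z - 1) / z\<^sup>2 \<ge> 0" using z assms by (intro divide_nonneg_nonneg) auto
  ultimately show "\<exists>d. ((\<lambda>z. ln z + 1 / z) has_real_derivative d) (at z) \<and> d \<ge> 0" by metis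
qed

text \<open>By monotonicity on either side of 1 only the points \<open>1 + \<eta>\<close> and
  \<open>1 - \<eta>\<close> matter. The bound \<open>\<eta> \<le> 1 / 40\<close> keeps the cubic
  remainder below half of the quadratic term.\<close>

lemma ln_plus_inverse_lower:
  fixes x \<eta> :: real
  assumes x: "x > 0" and \<eta>: "0 < \<eta>" "\<eta> \<le> 1 / 40" and far: "\<bar>x - 1\<bar> \<ge> \<eta>"
  shows "ln x + 1 / x - 1 \<ge> \<eta>\<^sup>2 / 4"
proof -
  have b: "ln (1 + y) + 1 / (1 + y) - 1 \<ge> \<eta>\<^sup>2 / 4" if "\<bar>y\<bar> = \<eta>" for y
  proof -
    have "10 * \<eta> ^ 3 \<le> \<eta>\<^sup>2 / 4"
      using \<eta> mult_right_mono[of "40 * \<eta>" 1 "\<eta>\<^sup>2"] by (simp add: power3_eq_cube power2_eq_square)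
    moreover have "y\<^sup>2 = \<eta>\<^sup>2" using that by (metis power2_abs)
    ultimately show ?thesis using ln_plus_inverse_cubic[of y] that \<eta> by (simp add: abs_le_iff)
  qed
  show ?thesis
  proof (cases "x \<ge> 1")
    case True
    then have "1 + \<eta> \<le> x" using far by auto
    then have "ln (1 + \<eta>) + 1 / (1 + \<eta>) \<le> ln x + 1 / x" using \<eta> by (intro ln_plus_inverse_mono) auto
    then show ?thesis using b[of \<eta>] \<eta> by auto
  next
    case False
    then have "x \<le> 1 + (- \<eta>)" using far by auto
    then have "ln (1 + (- \<eta>)) + 1 / (1 + (- \<eta>)) \<le> ln x + 1 / x" using \<eta> x by (intro ln_plus_inverse_antimono) auto
    then show ?thesis using b[of "- \<eta>"] \<eta> by auto
  qed
qed

text \<open>The error of the numerator and that of the normalising constant are each at most the L1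
  distance, hence the factor 2. The splitting of the difference of quotients is chosen so that only
  the explicitly known mass of \<open>g\<close> stands in the denominator; the mass of
  \<open>f\<close> need only be positive.\<close>

lemma normalized_density_dist:
  fixes f g :: "'a \<Rightarrow> real"
  assumes f: "integrable M f" and g: "integrable M g" and f0: "\<And>x. f x \<ge> 0" and g0: "\<And>x. g x \<ge> 0"
    and F: "integral\<^sup>L M f > 0" and G: "integral\<^sup>L M g > 0" and A: "A \<in> sets M"
  shows "\<bar>measure (density M (\<lambda>x. ennreal (f x / integral\<^sup>L M f))) A - measure (density M (\<lambda>x. ennreal (g x / integral\<^sup>L M g))) A\<bar>
       \<le> 2 * (LINT x|M. \<bar>f x - g x\<bar>) / integral\<^sup>L M g"
proof -
  let ?F = "integral\<^sup>L M f" and ?G = "integral\<^sup>L M g"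
  have md: "measure (density M (\<lambda>x. ennreal (h x / H))) A = (LINT x|M. indicator A x * h x) / H"
    if "integrable M h" "\<And>x. h x \<ge> 0" "H > 0" for h :: "'a \<Rightarrow> real" and H
  proof -
    have [measurable]: "h \<in> borel_measurable M" using that by auto
    have "measure (density M (\<lambda>x. ennreal (h x / H))) A = enn2real (\<integral>\<^sup>+ x. ennreal (indicator A x * h x / H) \<partial>M)"
      unfolding measure_def using A
      by (subst emeasure_density) (auto intro!: arg_cong[where f=enn2real] nn_integral_cong simp: indicator_def)
    also have "\<dots> = (LINT x|M. indicator A x * h x / H)"
      using that A by (subst integral_eq_nn_integral) auto
    finally show ?thesis by simp
  qed
  have iA: "integrable M (\<lambda>x. indicator A x * h x)" if "integrable M h" for h :: "'a \<Rightarrow> real"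
    using integrable_mult_indicator[OF A that] by simp
  let ?fA = "LINT x|M. indicator A x * f x" and ?gA = "LINT x|M. indicator A x * g x"
  define D where "D = (LINT x|M. \<bar>f x - g x\<bar>)"
  have iD: "integrable M (\<lambda>x. \<bar>f x - g x\<bar>)" using f g by auto
  have 1: "\<bar>?F - ?G\<bar> \<le> D"
    unfolding D_def Bochner_Integration.integral_diff[OF f g, symmetric] by (rule integral_abs_bound)
  have 2: "\<bar>?fA - ?gA\<bar> \<le> D"
  proof -
    have "\<bar>?fA - ?gA\<bar> = \<bar>LINT x|M. indicator A x * f x - indicator A x * g x\<bar>"
      by (simp add: Bochner_Integration.integral_diff[OF iA[OF f] iA[OF g]])
    also have "\<dots> \<le> (LINT x|M. \<bar>indicator A x * f x - indicator A x * g x\<bar>)" by (rule integral_abs_bound)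
    also have "\<dots> \<le> D" unfolding D_def
      using iA[OF f] iA[OF g] iD by (intro integral_mono) (auto simp: indicator_def)
    finally show ?thesis .
  qed
  have fA1: "0 \<le> ?fA"
    using f0 by (intro Bochner_Integration.integral_nonneg) auto
  have fA2: "?fA \<le> ?F"
    by (intro integral_mono iA f) (auto simp: indicator_def f0)
  note fA = fA1 fA2
  have "a / b - c / d = (a / b) * ((d - b) / d) + (a - c) / d" if "b > 0" "d > 0" for a b c d :: real
    using that by (simp add: diff_divide_distrib right_diff_distrib)
  from this[OF F G] have "\<bar>?fA / ?F - ?gA / ?G\<bar> \<le> \<bar>(?fA / ?F) * ((?G - ?F) / ?G)\<bar> + \<bar>(?fA - ?gA) / ?G\<bar>"
    by (simp only: abs_triangle_ineq)
  also have "\<bar>(?fA / ?F) * ((?G - ?F) / ?G)\<bar> \<le> 1 * (D / ?G)"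
    unfolding abs_mult
  proof (rule mult_mono)
    show "\<bar>?fA / ?F\<bar> \<le> 1" using fA F by simp
    show "\<bar>(?G - ?F) / ?G\<bar> \<le> D / ?G" using 1 G by (simp add: abs_minus_commute divide_right_mono)
  qed auto
  also have "\<bar>(?fA - ?gA) / ?G\<bar> \<le> D / ?G" using 2 G by (simp add: divide_right_mono)
  finally have "\<bar>?fA / ?F - ?gA / ?G\<bar> \<le> 2 * D / ?G" by simp
  then show ?thesis unfolding md[OF f f0 F] md[OF g g0 G] D_def .
qed

lemma abs_exp_minus_one_le:
  fixes u :: real
  assumes "\<bar>u\<bar> \<le> 1"
  shows "\<bar>exp u - 1\<bar> \<le> 2 * \<bar>u\<bar>"
proof (cases "u \<ge> 0")
  case True
  then have "u\<^sup>2 \<le> u" using assms by (simp add: power2_eq_square mult_left_le)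
  moreover have "exp u \<le> 1 + u + u\<^sup>2" using True assms by (intro exp_bound) auto
  moreover have "exp u \<ge> 1" using True by simp
  ultimately show ?thesis using True by linarith
next
  case False
  moreover have "exp u < 1" using False by simp
  ultimately show ?thesis using exp_ge_add_one_self[of u] by linarith
qed

text \<open>There are two errors: the cubic remainder at \<open>y = w / t\<close>, where |y| is at
  most 32 \<delta>, which contributes 163840 = 10 * 32^3 / 2, and the replacement of
  \<open>(n - p) / t\<^sup>2\<close> by \<open>n / \<theta>\<^sub>0\<^sup>2\<close> in the quadratic
  term. The latter splits into the effect of \<open>p\<close> and that of the distance from
  \<open>t\<close> to \<open>\<theta>\<^sub>0\<close>; with \<open>w\<^sup>2 / 4\<close> at most
  \<open>64 * \<theta>\<^sub>0\<^sup>2 * \<delta>\<^sup>2\<close> they give 256 and 640.\<close>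

lemma laplace_exponent_diff:
  fixes \<theta>\<^sub>0 t w n p C \<delta> :: real
  assumes th: "\<theta>\<^sub>0 > 0" and n: "n \<ge> 1" and p: "0 \<le> p" "p \<le> n" and d: "0 < \<delta>" "\<delta> \<le> 1 / 1280" "n * \<delta> \<ge> 1"
    and C: "C \<ge> 0" "C * \<delta> \<le> \<theta>\<^sub>0 / 2" and t: "\<bar>t - \<theta>\<^sub>0\<bar> \<le> C * \<delta>" and w: "\<bar>w\<bar> \<le> 16 * \<theta>\<^sub>0 * \<delta>"
  shows "\<bar>n * w\<^sup>2 / (4 * \<theta>\<^sub>0\<^sup>2) - (n - p) / 2 * (ln (1 + w / t) + 1 / (1 + w / t) - 1)\<bar>
      \<le> (163840 + 256 * p + 640 * C / \<theta>\<^sub>0) * (n * \<delta> ^ 3)"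
proof -
  define y where "y = w / t"
  have t1: "\<theta>\<^sub>0 / 2 \<le> t" "t \<le> 3 / 2 * \<theta>\<^sub>0" using t C by (auto simp: abs_le_iff)
  have t0: "t > 0" using t1 th by linarith
  have "\<bar>y\<bar> = \<bar>w\<bar> / t" using t0 by (simp add: y_def)
  also have "\<dots> \<le> 16 * \<theta>\<^sub>0 * \<delta> / (\<theta>\<^sub>0 / 2)" using w t1 t0 th d by (intro frac_le) auto
  also have "\<dots> = 32 * \<delta>" using th by simp
  finally have y: "\<bar>y\<bar> \<le> 32 * \<delta>" .
  have "\<bar>ln (1 + y) + 1 / (1 + y) - 1 - y\<^sup>2 / 2\<bar> \<le> 10 * \<bar>y\<bar> ^ 3"
    using y d by (intro ln_plus_inverse_cubic) auto
  also have "\<dots> \<le> 10 * (32 * \<delta>) ^ 3" using y by (intro mult_left_mono power_mono) auto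
  finally have 1: "\<bar>ln (1 + y) + 1 / (1 + y) - 1 - y\<^sup>2 / 2\<bar> \<le> 327680 * \<delta> ^ 3" by (simp add: power_mult_distrib)
  have "\<bar>(n - p) / 2 * (ln (1 + y) + 1 / (1 + y) - 1 - y\<^sup>2 / 2)\<bar> \<le> n / 2 * (327680 * \<delta> ^ 3)"
    unfolding abs_mult using 1 p n by (intro mult_mono) auto
  then have A: "\<bar>(n - p) / 2 * (ln (1 + y) + 1 / (1 + y) - 1) - (n - p) / 2 * (y\<^sup>2 / 2)\<bar> \<le> 163840 * (n * \<delta> ^ 3)"
    by (simp add: right_diff_distrib)
  have t2: "1 / t\<^sup>2 \<le> 4 / \<theta>\<^sub>0\<^sup>2"
  proof -
    have "(\<theta>\<^sub>0 / 2)\<^sup>2 \<le> t\<^sup>2" using t1 th by (intro power_mono) auto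
    then have "1 / t\<^sup>2 \<le> 1 / (\<theta>\<^sub>0 / 2)\<^sup>2" using th t0 by (intro divide_left_mono) auto
    then show ?thesis by (simp add: power_divide)
  qed
  have "1 / t\<^sup>2 - 1 / \<theta>\<^sub>0\<^sup>2 = (\<theta>\<^sub>0 - t) * (\<theta>\<^sub>0 + t) * (1 / t\<^sup>2) / \<theta>\<^sub>0\<^sup>2"
    using th t0 by (simp add: field_simps power2_eq_square)
  then have "\<bar>1 / t\<^sup>2 - 1 / \<theta>\<^sub>0\<^sup>2\<bar> = \<bar>t - \<theta>\<^sub>0\<bar> * (\<theta>\<^sub>0 + t) * (1 / t\<^sup>2) / \<theta>\<^sub>0\<^sup>2"
    using th t0 by (simp add: abs_mult abs_minus_commute)
  also have "\<dots> \<le> (C * \<delta>) * (5 / 2 * \<theta>\<^sub>0) * (4 / \<theta>\<^sub>0\<^sup>2) / \<theta>\<^sub>0\<^sup>2"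
    using t t1 t2 th t0 by (intro divide_right_mono mult_mono) (auto intro: order_trans)
  also have "\<dots> = 10 * C * \<delta> / \<theta>\<^sub>0 ^ 3" using th by (simp add: field_simps power2_eq_square power3_eq_cube)
  finally have B0: "\<bar>1 / t\<^sup>2 - 1 / \<theta>\<^sub>0\<^sup>2\<bar> \<le> 10 * C * \<delta> / \<theta>\<^sub>0 ^ 3" .
  have "\<bar>n / \<theta>\<^sub>0\<^sup>2 - (n - p) / t\<^sup>2\<bar> = \<bar>p * (1 / t\<^sup>2) - n * (1 / t\<^sup>2 - 1 / \<theta>\<^sub>0\<^sup>2)\<bar>"
    by (simp add: diff_divide_distrib right_diff_distrib)
  also have "\<dots> \<le> \<bar>p * (1 / t\<^sup>2)\<bar> + \<bar>n * (1 / t\<^sup>2 - 1 / \<theta>\<^sub>0\<^sup>2)\<bar>" by (rule abs_triangle_ineq4)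
  also have "\<dots> \<le> p * (4 / \<theta>\<^sub>0\<^sup>2) + n * (10 * C * \<delta> / \<theta>\<^sub>0 ^ 3)"
  proof (rule add_mono)
    show "\<bar>p * (1 / t\<^sup>2)\<bar> \<le> p * (4 / \<theta>\<^sub>0\<^sup>2)" using mult_left_mono[OF t2 p(1)] p by simp
    show "\<bar>n * (1 / t\<^sup>2 - 1 / \<theta>\<^sub>0\<^sup>2)\<bar> \<le> n * (10 * C * \<delta> / \<theta>\<^sub>0 ^ 3)" unfolding abs_mult using n B0 by (intro mult_mono) auto
  qed
  finally have B1: "\<bar>n / \<theta>\<^sub>0\<^sup>2 - (n - p) / t\<^sup>2\<bar> \<le> p * (4 / \<theta>\<^sub>0\<^sup>2) + n * (10 * C * \<delta> / \<theta>\<^sub>0 ^ 3)" .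
  have "w\<^sup>2 \<le> (16 * \<theta>\<^sub>0 * \<delta>)\<^sup>2" using w th d by (intro power2_le_iff_abs_le[THEN iffD2]) auto
  then have "\<bar>w\<^sup>2 / 4 * (n / \<theta>\<^sub>0\<^sup>2 - (n - p) / t\<^sup>2)\<bar> \<le> (16 * \<theta>\<^sub>0 * \<delta>)\<^sup>2 / 4 * (p * (4 / \<theta>\<^sub>0\<^sup>2) + n * (10 * C * \<delta> / \<theta>\<^sub>0 ^ 3))"
    unfolding abs_mult using B1 by (intro mult_mono) auto
  also have "\<dots> = 256 * p * \<delta>\<^sup>2 + 640 * C / \<theta>\<^sub>0 * (n * \<delta> ^ 3)"
    using th by (simp add: power2_eq_square power3_eq_cube field_simps)
  also have "256 * p * \<delta>\<^sup>2 \<le> 256 * p * (n * \<delta> ^ 3)"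
  proof (rule mult_left_mono)
    have "1 * \<delta>\<^sup>2 \<le> (n * \<delta>) * \<delta>\<^sup>2" using d by (intro mult_right_mono) auto
    then show "\<delta>\<^sup>2 \<le> n * \<delta> ^ 3" by (simp add: power2_eq_square power3_eq_cube mult_ac)
  qed (use p in auto)
  finally have B: "\<bar>w\<^sup>2 / 4 * (n / \<theta>\<^sub>0\<^sup>2 - (n - p) / t\<^sup>2)\<bar> \<le> 256 * p * (n * \<delta> ^ 3) + 640 * C / \<theta>\<^sub>0 * (n * \<delta> ^ 3)" by simp
  have yy: "y\<^sup>2 = w\<^sup>2 / t\<^sup>2" by (simp add: y_def power_divide)
  have split: "n * w\<^sup>2 / (4 * \<theta>\<^sub>0\<^sup>2) - (n - p) / 2 * (ln (1 + y) + 1 / (1 + y) - 1)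
     = w\<^sup>2 / 4 * (n / \<theta>\<^sub>0\<^sup>2 - (n - p) / t\<^sup>2) - ((n - p) / 2 * (ln (1 + y) + 1 / (1 + y) - 1) - (n - p) / 2 * (y\<^sup>2 / 2))"
    unfolding yy by (simp add: right_diff_distrib left_diff_distrib diff_divide_distrib mult.commute)
  have "\<bar>n * w\<^sup>2 / (4 * \<theta>\<^sub>0\<^sup>2) - (n - p) / 2 * (ln (1 + y) + 1 / (1 + y) - 1)\<bar>
     \<le> (256 * p * (n * \<delta> ^ 3) + 640 * C / \<theta>\<^sub>0 * (n * \<delta> ^ 3)) + 163840 * (n * \<delta> ^ 3)"
    unfolding split by (rule order_trans[OF abs_triangle_ineq4 add_mono[OF B A]])
  also have "\<dots> = (163840 + 256 * p + 640 * C / \<theta>\<^sub>0) * (n * \<delta> ^ 3)"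
    by (simp only: distrib_right add_ac)
  finally show ?thesis by (simp only: y_def)
qed

text \<open>Inside the window \<open>\<bar>\<theta> - t\<bar> \<le> 16 * \<theta>\<^sub>0 *
  \<delta>\<close> the kernel is the Gaussian times \<open>exp u * \<rho>\<close>, with
  \<open>exp u\<close> within \<open>2 * K2 * n * \<delta> ^ 3\<close> of 1, the prior ratio \<rho>
  within \<open>K3 * n * \<delta> ^ 3\<close> of 1, and \<rho> at most 2. This gives
  \<open>4 * K2 + K3\<close>. Outside, \<open>\<theta> / t\<close> is at least 8 \<delta> away from
  1, since \<open>t\<close> is at most \<open>3 / 2 * \<theta>\<^sub>0\<close>; this makes the
  exponent at least \<open>n * \<delta>\<^sup>2\<close>, hence at least \<open>ln n\<close>. There
  the prior itself serves as the integrable bound.\<close>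

lemma laplace_pointwise:
  fixes \<theta>\<^sub>0 t n p C \<delta> \<theta> L :: real and q :: "real \<Rightarrow> real"
  defines "K2 \<equiv> 163840 + 256 * p + 640 * C / \<theta>\<^sub>0" and "K3 \<equiv> L / q \<theta>\<^sub>0 * (16 * \<theta>\<^sub>0 + C)"
  assumes th: "\<theta>\<^sub>0 > 0" and n: "n \<ge> 1" and p: "0 \<le> p" "2 * p \<le> n" and d: "0 < \<delta>" "\<delta> \<le> 1 / 1280" "n * \<delta> \<ge> 1" "n * \<delta>\<^sup>2 \<ge> 1" "n * \<delta>\<^sup>2 \<ge> ln n"
    and C: "C \<ge> 0" "C * \<delta> \<le> \<theta>\<^sub>0 / 2" and t: "\<bar>t - \<theta>\<^sub>0\<bar> \<le> C * \<delta>"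
    and q0: "q \<theta>\<^sub>0 > 0" and q: "q \<theta> \<ge> 0" and \<theta>: "\<theta> > 0"
    and L: "L \<ge> 0" and lip: "\<bar>\<theta> - \<theta>\<^sub>0\<bar> \<le> (16 * \<theta>\<^sub>0 + C) * \<delta> \<Longrightarrow> \<bar>q \<theta> - q \<theta>\<^sub>0\<bar> \<le> L * \<bar>\<theta> - \<theta>\<^sub>0\<bar>"
    and K2: "K2 * (n * \<delta> ^ 3) \<le> 1" and K3: "K3 * (n * \<delta> ^ 3) \<le> 1"
  shows "\<bar>exp (- ((n - p) / 2 * (ln (\<theta> / t) + 1 / (\<theta> / t) - 1))) * q \<theta> / q \<theta>\<^sub>0 - exp (- (n * (\<theta> - t)\<^sup>2 / (4 * \<theta>\<^sub>0\<^sup>2)))\<bar>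
    \<le> (4 * K2 + K3) * (n * \<delta> ^ 3) * exp (- (n * (\<theta> - t)\<^sup>2 / (4 * \<theta>\<^sub>0\<^sup>2))) + 1 / n * exp (- (n * (\<theta> - t)\<^sup>2 / (8 * \<theta>\<^sub>0\<^sup>2))) + 1 / n * (q \<theta> / q \<theta>\<^sub>0)"
    (is "\<bar>?E1 * q \<theta> / q \<theta>\<^sub>0 - ?g\<bar> \<le> ?a * ?g + 1 / n * ?g2 + ?r")
proof -
  have t1: "\<theta>\<^sub>0 / 2 \<le> t" "t \<le> 3 / 2 * \<theta>\<^sub>0" using t C by (auto simp: abs_le_iff)
  have t0: "t > 0" using t1 th by linarith
  define w where "w = \<theta> - t"
  have tw: "\<theta> / t = 1 + w / t" using t0 by (simp add: w_def field_simps)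
  have K2p: "K2 \<ge> 0" using p C th by (simp add: K2_def)
  have K3p: "K3 \<ge> 0" using L q0 C th by (simp add: K3_def)
  have e0: "n * \<delta> ^ 3 \<ge> 0" using n d by simp
  have r: "?r \<ge> 0" using q q0 n by simp
  show ?thesis
  proof (cases "\<bar>w\<bar> \<le> 16 * \<theta>\<^sub>0 * \<delta>")
    case True
    define u where "u = n * w\<^sup>2 / (4 * \<theta>\<^sub>0\<^sup>2) - (n - p) / 2 * (ln (\<theta> / t) + 1 / (\<theta> / t) - 1)"
    have u: "\<bar>u\<bar> \<le> K2 * (n * \<delta> ^ 3)"
      unfolding u_def K2_def tw using th n p d C t True by (intro laplace_exponent_diff) auto
    have E: "?E1 = ?g * exp u" by (simp add: u_def w_def exp_add[symmetric])
    define \<rho> where "\<rho> = q \<theta> / q \<theta>\<^sub>0"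
    have "\<bar>\<theta> - \<theta>\<^sub>0\<bar> \<le> \<bar>w\<bar> + \<bar>t - \<theta>\<^sub>0\<bar>" by (simp add: w_def)
    also have "\<dots> \<le> (16 * \<theta>\<^sub>0 + C) * \<delta>" using True t by (simp add: distrib_right)
    finally have near: "\<bar>\<theta> - \<theta>\<^sub>0\<bar> \<le> (16 * \<theta>\<^sub>0 + C) * \<delta>" .
    have "\<bar>\<rho> - 1\<bar> = \<bar>q \<theta> - q \<theta>\<^sub>0\<bar> / q \<theta>\<^sub>0" using q0 by (simp add: \<rho>_def divide_simps)
    also have "\<dots> \<le> L * ((16 * \<theta>\<^sub>0 + C) * \<delta>) / q \<theta>\<^sub>0"
      using lip[OF near] near L q0 by (intro divide_right_mono) (auto intro: order_trans mult_left_mono)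
    also have "\<dots> = K3 * \<delta>" by (simp add: K3_def)
    also have "\<dots> \<le> K3 * (n * \<delta> ^ 3)"
    proof (rule mult_left_mono[OF _ K3p])
      have "1 * \<delta> \<le> (n * \<delta>\<^sup>2) * \<delta>" using d by (intro mult_right_mono) auto
      then show "\<delta> \<le> n * \<delta> ^ 3" by (simp add: power2_eq_square power3_eq_cube mult_ac)
    qed
    finally have rho: "\<bar>\<rho> - 1\<bar> \<le> K3 * (n * \<delta> ^ 3)" .
    have rho2: "\<bar>\<rho>\<bar> \<le> 2" using rho K3 by linarith
    have eu: "\<bar>exp u - 1\<bar> \<le> 2 * (K2 * (n * \<delta> ^ 3))" using abs_exp_minus_one_le[of u] u K2 by linarith
    have "\<bar>exp u * \<rho> - 1\<bar> = \<bar>(exp u - 1) * \<rho> + (\<rho> - 1)\<bar>" by (simp add: algebra_simps)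
    also have "\<dots> \<le> \<bar>exp u - 1\<bar> * \<bar>\<rho>\<bar> + \<bar>\<rho> - 1\<bar>" unfolding abs_mult[symmetric] by (rule abs_triangle_ineq)
    also have "\<dots> \<le> 2 * (K2 * (n * \<delta> ^ 3)) * 2 + K3 * (n * \<delta> ^ 3)"
      using eu rho rho2 by (intro add_mono mult_mono) auto
    also have "\<dots> = ?a" by (simp add: algebra_simps)
    finally have *: "\<bar>exp u * \<rho> - 1\<bar> \<le> ?a" .
    have "?E1 * q \<theta> / q \<theta>\<^sub>0 - ?g = ?g * (exp u * \<rho> - 1)" unfolding E by (simp add: \<rho>_def algebra_simps)
    then have "\<bar>?E1 * q \<theta> / q \<theta>\<^sub>0 - ?g\<bar> = ?g * \<bar>exp u * \<rho> - 1\<bar>" by (simp add: abs_mult)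
    also have "\<dots> \<le> ?g * ?a" using * by (intro mult_left_mono) auto
    finally show ?thesis using r n by (simp add: mult.commute) (smt (verit) divide_nonneg_nonneg exp_ge_zero)
  next
    case False
    then have far: "\<bar>w\<bar> \<ge> 16 * \<theta>\<^sub>0 * \<delta>" by simp
    have lnn: "exp (- (n * \<delta>\<^sup>2)) \<le> 1 / n"
    proof -
      have "exp (- (n * \<delta>\<^sup>2)) \<le> exp (- ln n)" using d by simp
      also have "\<dots> = 1 / n" using n by (simp add: exp_minus inverse_eq_divide)
      finally show ?thesis .
    qed
    have "\<bar>\<theta> / t - 1\<bar> = \<bar>w\<bar> / t" using t0 tw by simp
    moreover have "8 * \<delta> \<le> \<bar>w\<bar> / t"
    proof -
      have "8 * \<delta> * t \<le> 8 * \<delta> * (3 / 2 * \<theta>\<^sub>0)" using t1 d by (intro mult_left_mono) auto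
      also have "\<dots> \<le> 16 * \<theta>\<^sub>0 * \<delta>" using th d by simp
      also note far
      finally show ?thesis using t0 by (simp add: le_divide_eq)
    qed
    ultimately have "ln (\<theta> / t) + 1 / (\<theta> / t) - 1 \<ge> (8 * \<delta>)\<^sup>2 / 4"
      using \<theta> t0 d by (intro ln_plus_inverse_lower) auto
    then have "n / 4 * ((8 * \<delta>)\<^sup>2 / 4) \<le> (n - p) / 2 * (ln (\<theta> / t) + 1 / (\<theta> / t) - 1)"
      using n p by (intro mult_mono) auto
    moreover have "n * \<delta>\<^sup>2 \<le> n / 4 * ((8 * \<delta>)\<^sup>2 / 4)" using n by (simp add: power_mult_distrib)
    ultimately have "?E1 \<le> exp (- (n * \<delta>\<^sup>2))" by simp
    then have E1: "?E1 \<le> 1 / n" using lnn by linarith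
    have "(16 * \<theta>\<^sub>0 * \<delta>)\<^sup>2 \<le> w\<^sup>2" using far th d abs_le_square_iff[of "16 * \<theta>\<^sub>0 * \<delta>" w] by simp
    then have "n * (16 * \<theta>\<^sub>0 * \<delta>)\<^sup>2 / (8 * \<theta>\<^sub>0\<^sup>2) \<le> n * w\<^sup>2 / (8 * \<theta>\<^sub>0\<^sup>2)"
      using n by (intro divide_right_mono mult_left_mono) auto
    moreover have "n * \<delta>\<^sup>2 \<le> n * (16 * \<theta>\<^sub>0 * \<delta>)\<^sup>2 / (8 * \<theta>\<^sub>0\<^sup>2)" using th n by (simp add: power_mult_distrib)
    ultimately have "exp (- (n * w\<^sup>2 / (8 * \<theta>\<^sub>0\<^sup>2))) \<le> exp (- (n * \<delta>\<^sup>2))" by simp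
    then have "exp (- (n * w\<^sup>2 / (8 * \<theta>\<^sub>0\<^sup>2))) \<le> 1 / n" using lnn by linarith
    \<comment> \<open>One half of the Gaussian exponent pays for the factor \<open>1 / n\<close>,
      the other half stays and keeps the bound integrable.\<close>
    moreover have "?g = exp (- (n * w\<^sup>2 / (8 * \<theta>\<^sub>0\<^sup>2))) * ?g2"
      by (simp add: w_def exp_add[symmetric])
    ultimately have g: "?g \<le> 1 / n * ?g2" by (simp only:) (intro mult_right_mono; simp)
    have f: "?E1 * q \<theta> / q \<theta>\<^sub>0 \<le> ?r"
      using mult_right_mono[OF E1, of "q \<theta> / q \<theta>\<^sub>0"] q q0 by simp
    have f0: "?E1 * q \<theta> / q \<theta>\<^sub>0 \<ge> 0" using q q0 by simp
    have "?a * ?g \<ge> 0" using K2p K3p e0 by simp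
    moreover have "?g \<ge> 0" by simp
    ultimately show ?thesis using f f0 g by linarith
  qed
qed

lemma gaussian_eq_normal_density:
  fixes v :: real
  assumes v: "v > 0"
  shows "exp (- ((x - t)\<^sup>2 / (2 * v))) = sqrt (2 * pi * v) * normal_density t (sqrt v) x"
    and "integrable lborel (\<lambda>x. exp (- ((x - t)\<^sup>2 / (2 * v))))"
    and "(LINT x|lborel. exp (- ((x - t)\<^sup>2 / (2 * v)))) = sqrt (2 * pi * v)"
proof -
  show eq: "exp (- ((x - t)\<^sup>2 / (2 * v))) = sqrt (2 * pi * v) * normal_density t (sqrt v) x" for x
    using v by (simp add: normal_density_def)
  show "integrable lborel (\<lambda>x. exp (- ((x - t)\<^sup>2 / (2 * v))))" "(LINT x|lborel. exp (- ((x - t)\<^sup>2 / (2 * v)))) = sqrt (2 * pi * v)"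
    unfolding eq using v by auto
qed

lemma ln_plus_inverse_ge_1: "x > 0 \<Longrightarrow> ln x + 1 / x - 1 \<ge> (0::real)"
  using ln_le_minus_one[of "1 / x"] by (simp add: ln_div)

text \<open>Laplace approximation with rate: outside a window of width \<open>ln n / sqrt n\<close> both densities are
  of order \<open>1 / n\<close>; inside, the cubic Taylor remainder of the exponent is of order \<open>n * (ln n / sqrt n)^3\<close>.\<close>

lemma laplace_tv:
  fixes \<theta>\<^sub>0 C r L :: real and p :: nat and q :: "real \<Rightarrow> real"
  assumes th: "\<theta>\<^sub>0 > 0" and C: "C \<ge> 0" and q: "\<And>\<theta>. \<theta> > 0 \<Longrightarrow> q \<theta> \<ge> 0"
    and qi: "integrable lborel (\<lambda>\<theta>. indicator {0<..} \<theta> * q \<theta>)" and q1: "(LINT \<theta>|lborel. indicator {0<..} \<theta> * q \<theta>) = 1"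
    and q0: "q \<theta>\<^sub>0 > 0" and r: "r > 0" and L: "L \<ge> 0"
    and lip: "\<And>\<theta>. \<theta> > 0 \<Longrightarrow> \<bar>\<theta> - \<theta>\<^sub>0\<bar> < r \<Longrightarrow> \<bar>q \<theta> - q \<theta>\<^sub>0\<bar> \<le> L * \<bar>\<theta> - \<theta>\<^sub>0\<bar>"
  defines "f \<equiv> \<lambda>(n::nat) t \<theta>. indicator {0<..} \<theta> * (exp (- ((real n - real p) / 2 * (ln (\<theta> / t) + 1 / (\<theta> / t) - 1))) * q \<theta> / q \<theta>\<^sub>0)"
  shows "\<exists>K. \<forall>\<^sub>F n in sequentially. \<forall>t. \<bar>t - \<theta>\<^sub>0\<bar> \<le> C * (ln (real n) / sqrt (real n)) \<longrightarrow>
     t > 0 \<and> integrable lborel (f n t) \<and> integral\<^sup>L lborel (f n t) > 0 \<and>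
     (\<forall>A\<in>sets borel. \<bar>measure (density lborel (\<lambda>\<theta>. ennreal (f n t \<theta> / integral\<^sup>L lborel (f n t)))) A
        - measure (normal_measure t (2 * \<theta>\<^sub>0\<^sup>2 / real n)) A\<bar> \<le> K * (real n powr (- 1 / 2) * ln (real n) ^ 3))"
proof -
  define \<delta> where "\<delta> = (\<lambda>n::nat. ln (real n) / sqrt (real n))"
  define \<epsilon> where "\<epsilon> = (\<lambda>n::nat. real n powr (- 1 / 2) * ln (real n) ^ 3)"
  define K2 where "K2 = 163840 + 256 * real p + 640 * C / \<theta>\<^sub>0"
  define K3 where "K3 = L / q \<theta>\<^sub>0 * (16 * \<theta>\<^sub>0 + C)"
  \<comment> \<open>Three contributions to the L1 error relative to the Gaussian mass
    \<open>G\<close>: the window, the Gaussian tail with \<open>sqrt 2\<close> rounded up to 2, and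
    the prior tail, where \<open>G\<close> is of order
    \<open>2 * \<theta>\<^sub>0 / sqrt n\<close>.\<close>
  define K where "K = 4 * K2 + K3 + 2 + 1 / (2 * \<theta>\<^sub>0 * q \<theta>\<^sub>0)"
  have K23: "K2 \<ge> 0" "K3 \<ge> 0" using th C L q0 by (auto simp: K2_def K3_def)
  have d0: "\<delta> \<longlonglongrightarrow> 0" unfolding \<delta>_def by real_asymp
  have e0: "\<epsilon> \<longlonglongrightarrow> 0" unfolding \<epsilon>_def by real_asymp
  have ev_d: "\<forall>\<^sub>F n in sequentially. \<delta> n < c" if "c > 0" for c
    using order_tendstoD(2)[OF d0 that] .
  have ev_e: "\<forall>\<^sub>F n in sequentially. c * \<epsilon> n < 1" if "c \<ge> 0" for c
  proof -
    have "(\<lambda>n. c * \<epsilon> n) \<longlonglongrightarrow> c * 0" by (intro tendsto_mult tendsto_const e0)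
    then show ?thesis using order_tendstoD(2)[of "\<lambda>n. c * \<epsilon> n" 0 sequentially 1] by simp
  qed
  have Kp: "K \<ge> 0" using K23 th q0 by (simp add: K_def)
  have ev1: "\<forall>\<^sub>F n in sequentially. \<delta> n < 1 / 1280" by (rule ev_d) simp
  have ev2: "\<forall>\<^sub>F n in sequentially. \<delta> n < \<theta>\<^sub>0 / (2 * (C + 1))" by (rule ev_d) (use th C in auto)
  have ev3: "\<forall>\<^sub>F n in sequentially. \<delta> n < r / (16 * \<theta>\<^sub>0 + C + 1)" by (rule ev_d) (use th C r in auto)
  have "\<forall>\<^sub>F n in sequentially. \<forall>t. \<bar>t - \<theta>\<^sub>0\<bar> \<le> C * \<delta> n \<longrightarrow>
     t > 0 \<and> integrable lborel (f n t) \<and> integral\<^sup>L lborel (f n t) > 0 \<and>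
     (\<forall>A\<in>sets borel. \<bar>measure (density lborel (\<lambda>\<theta>. ennreal (f n t \<theta> / integral\<^sup>L lborel (f n t)))) A
        - measure (normal_measure t (2 * \<theta>\<^sub>0\<^sup>2 / real n)) A\<bar> \<le> 2 * K * \<epsilon> n)"
    using eventually_ge_at_top[of "max 3 (2 * p)"] ev1 ev2 ev3
      ev_e[OF K23(1)] ev_e[OF K23(2)] ev_e[OF Kp]
  proof eventually_elim
    case (elim n)
    have n: "real n \<ge> 1" "real n \<ge> 3" "2 * real p \<le> real n" using elim(1) by auto
    have ln1: "ln (real n) \<ge> 1"
    proof -
      have "exp 1 \<le> real n" using exp_le n by linarith
      then show ?thesis using n by (subst ln_ge_iff) auto
    qed
    have sq: "sqrt (real n) > 0" "sqrt (real n) \<ge> 1" "sqrt (real n) * sqrt (real n) = real n" using n by auto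
    define e where "e = \<epsilon> n"
    have dpos: "\<delta> n > 0" 
    proof -
      have "ln (real n) > 0" using ln1 by linarith
      then show ?thesis unfolding \<delta>_def using sq(1) by (rule divide_pos_pos)
    qed
    have nd2: "real n * (\<delta> n)\<^sup>2 = (ln (real n))\<^sup>2" using n by (simp add: \<delta>_def power_divide)
    have ln2: "(ln (real n))\<^sup>2 \<ge> ln (real n)" "(ln (real n))\<^sup>2 \<ge> 1"
      using ln1 mult_mono[of 1 "ln (real n)" 1 "ln (real n)"] mult_right_mono[of 1 "ln (real n)" "ln (real n)"] by (auto simp: power2_eq_square)
    have nd1: "real n * \<delta> n = sqrt (real n) * ln (real n)" 
      using sq by (simp add: \<delta>_def field_simps)
    have nd1': "real n * \<delta> n \<ge> 1" unfolding nd1 using mult_mono[of 1 "sqrt (real n)" 1 "ln (real n)"] sq ln1 by simp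
    have powr_n: "real n powr (- 1 / 2) = 1 / sqrt (real n)"
      using n by (simp add: powr_minus_divide powr_half_sqrt)
    have e_eq: "real n * \<delta> n ^ 3 = e"
    proof -
      have "real n * \<delta> n ^ 3 = (real n * (\<delta> n)\<^sup>2) * \<delta> n" by (simp add: power2_eq_square power3_eq_cube)
      also have "\<dots> = e" unfolding nd2 e_def \<epsilon>_def powr_n by (simp add: \<delta>_def power2_eq_square power3_eq_cube)
      finally show ?thesis .
    qed
    have Cd: "C * \<delta> n \<le> \<theta>\<^sub>0 / 2"
    proof -
      have "C * \<delta> n \<le> (C + 1) * \<delta> n" using dpos by (intro mult_right_mono) auto
      also have "\<dots> \<le> (C + 1) * (\<theta>\<^sub>0 / (2 * (C + 1)))" using elim(3) C th by (intro mult_left_mono) auto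
      also have "\<dots> = \<theta>\<^sub>0 / 2"
      proof -
        have c: "c * (x / (2 * c)) = x / 2" if "c > 0" for c x :: real using that by simp
        show ?thesis by (rule c) (use C in simp)
      qed
      finally show ?thesis .
    qed
    have rd: "(16 * \<theta>\<^sub>0 + C) * \<delta> n < r"
    proof -
      have "(16 * \<theta>\<^sub>0 + C) * \<delta> n \<le> (16 * \<theta>\<^sub>0 + C + 1) * \<delta> n" using dpos by (intro mult_right_mono) auto
      also have "\<dots> < (16 * \<theta>\<^sub>0 + C + 1) * (r / (16 * \<theta>\<^sub>0 + C + 1))" using elim(4) C th r by (intro mult_strict_left_mono) auto
      also have "\<dots> = r" using C th by simp
      finally show ?thesis .
    qed
    have ns: "1 / real n \<le> e" "1 / sqrt (real n) \<le> e"
    proof -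
      have "1 \<le> ln (real n) ^ 3" using ln1 by simp
      then show 1: "1 / sqrt (real n) \<le> e" unfolding e_def \<epsilon>_def powr_n using sq by (simp add: divide_right_mono)
      have "1 / real n \<le> 1 / sqrt (real n)"
        using sq n by (intro divide_left_mono) (auto simp: real_le_lsqrt self_le_power)
      then show "1 / real n \<le> e" using 1 by linarith
    qed
    show ?case
    proof (intro allI impI)
      fix t assume t: "\<bar>t - \<theta>\<^sub>0\<bar> \<le> C * \<delta> n"
      have t1: "\<theta>\<^sub>0 / 2 \<le> t" using t Cd by (auto simp: abs_le_iff)
      have t0: "t > 0" using t1 th by linarith
      define g where "g = (\<lambda>\<theta>. exp (- (real n * (\<theta> - t)\<^sup>2 / (4 * \<theta>\<^sub>0\<^sup>2))))"
      define g2 where "g2 = (\<lambda>\<theta>. exp (- (real n * (\<theta> - t)\<^sup>2 / (8 * \<theta>\<^sub>0\<^sup>2))))"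
      define G where "G = sqrt (2 * pi * (2 * \<theta>\<^sub>0\<^sup>2 / real n))"
      have v: "2 * \<theta>\<^sub>0\<^sup>2 / real n > 0" "4 * \<theta>\<^sub>0\<^sup>2 / real n > 0" using th n by auto
      have gg: "g \<theta> = exp (- ((\<theta> - t)\<^sup>2 / (2 * (2 * \<theta>\<^sub>0\<^sup>2 / real n))))" for \<theta>
        using n by (simp add: g_def field_simps)
      have gg2: "g2 \<theta> = exp (- ((\<theta> - t)\<^sup>2 / (2 * (4 * \<theta>\<^sub>0\<^sup>2 / real n))))" for \<theta>
        using n by (simp add: g2_def field_simps)
      have G: "G > 0" unfolding G_def using v(1) by (intro real_sqrt_gt_zero mult_pos_pos) auto
      have epos: "e \<ge> 0" 
      proof -
        have "0 \<le> 1 / sqrt (real n)" by simp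
        then show ?thesis using ns(2) by linarith
      qed
      have gi: "integrable lborel g" "integral\<^sup>L lborel g = G"
        unfolding gg[abs_def] G_def using gaussian_eq_normal_density(2,3)[OF v(1), of t] by auto
      have gi2: "integrable lborel g2" "integral\<^sup>L lborel g2 = sqrt 2 * G"
        unfolding gg2[abs_def] G_def using gaussian_eq_normal_density(2,3)[OF v(2), of t]
        by (auto simp: real_sqrt_mult[symmetric])
      have gn: "g \<theta> / G = normal_density t (sqrt (2 * \<theta>\<^sub>0\<^sup>2 / real n)) \<theta>" for \<theta>
        unfolding gg gaussian_eq_normal_density(1)[OF v(1)] G_def[symmetric]
        using G by (intro nonzero_mult_div_cancel_left) simp
      have fi: "integrable lborel (f n t)"
      proof (rule Bochner_Integration.integrable_bound)
        show "integrable lborel (\<lambda>\<theta>. indicator {0<..} \<theta> * q \<theta> / q \<theta>\<^sub>0)" using qi by (rule integrable_divide_zero)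
        have [measurable]: "(\<lambda>\<theta>. indicator {0<..} \<theta> * q \<theta>) \<in> borel_measurable borel" using qi by auto
        have "f n t = (\<lambda>\<theta>. exp (- ((real n - real p) / 2 * (ln (\<theta> / t) + 1 / (\<theta> / t) - 1))) * (indicator {0<..} \<theta> * q \<theta>) / q \<theta>\<^sub>0)"
          by (simp add: f_def fun_eq_iff)
        also have "\<dots> \<in> borel_measurable lborel" by measurable
        finally show "f n t \<in> borel_measurable lborel" .
        show "AE \<theta> in lborel. norm (f n t \<theta>) \<le> norm (indicator {0<..} \<theta> * q \<theta> / q \<theta>\<^sub>0)"
        proof (intro AE_I2)
          fix \<theta>
          show "norm (f n t \<theta>) \<le> norm (indicator {0<..} \<theta> * q \<theta> / q \<theta>\<^sub>0)"
          proof (cases "\<theta> > 0")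
            case True
            have "ln (\<theta> / t) + 1 / (\<theta> / t) - 1 \<ge> 0" using True t0 by (intro ln_plus_inverse_ge_1) auto
            then have "(real n - real p) / 2 * (ln (\<theta> / t) + 1 / (\<theta> / t) - 1) \<ge> 0"
              using n by (intro mult_nonneg_nonneg) auto
            then have "exp (- ((real n - real p) / 2 * (ln (\<theta> / t) + 1 / (\<theta> / t) - 1))) \<le> 1" by simp
            then show ?thesis using True q[OF True] q0 unfolding f_def
              by (simp add: abs_mult divide_right_mono mult_right_mono mult_left_le_one_le)
          qed (simp add: f_def)
        qed
      qed
      have f0: "f n t \<theta> \<ge> 0" for \<theta> using q[of \<theta>] q0 by (auto simp: f_def indicator_def)
      define a where "a = (4 * K2 + K3) * e"
      have a0: "a \<ge> 0" using K23 epos by (simp add: a_def)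
      have ptw: "\<bar>f n t \<theta> - g \<theta>\<bar> \<le> a * g \<theta> + 1 / real n * g2 \<theta> + 1 / real n * (indicator {0<..} \<theta> * q \<theta> / q \<theta>\<^sub>0)" for \<theta>
      proof (cases "\<theta> > 0")
        case True
        have "\<bar>exp (- ((real n - real p) / 2 * (ln (\<theta> / t) + 1 / (\<theta> / t) - 1))) * q \<theta> / q \<theta>\<^sub>0 - exp (- (real n * (\<theta> - t)\<^sup>2 / (4 * \<theta>\<^sub>0\<^sup>2)))\<bar>
          \<le> (4 * (163840 + 256 * real p + 640 * C / \<theta>\<^sub>0) + L / q \<theta>\<^sub>0 * (16 * \<theta>\<^sub>0 + C)) * (real n * \<delta> n ^ 3) * exp (- (real n * (\<theta> - t)\<^sup>2 / (4 * \<theta>\<^sub>0\<^sup>2)))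
             + 1 / real n * exp (- (real n * (\<theta> - t)\<^sup>2 / (8 * \<theta>\<^sub>0\<^sup>2))) + 1 / real n * (q \<theta> / q \<theta>\<^sub>0)"
        proof (rule laplace_pointwise)
          show "\<bar>q \<theta> - q \<theta>\<^sub>0\<bar> \<le> L * \<bar>\<theta> - \<theta>\<^sub>0\<bar>" if "\<bar>\<theta> - \<theta>\<^sub>0\<bar> \<le> (16 * \<theta>\<^sub>0 + C) * \<delta> n"
            using lip[OF True] that rd by linarith
          show "(163840 + 256 * real p + 640 * C / \<theta>\<^sub>0) * (real n * \<delta> n ^ 3) \<le> 1"
            unfolding e_eq using elim(5) by (simp add: K2_def e_def)
          show "L / q \<theta>\<^sub>0 * (16 * \<theta>\<^sub>0 + C) * (real n * \<delta> n ^ 3) \<le> 1"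
            unfolding e_eq using elim(6) by (simp add: K3_def e_def)
        qed (use th n dpos elim nd1' nd2 ln2 C Cd t q0 q[OF True] True L in auto)
        then show ?thesis using True unfolding e_eq by (simp add: f_def g_def g2_def a_def K2_def K3_def)
      next
        case False
        \<comment> \<open>On the negative half-line the posterior kernel vanishes and the Gaussian
          does not. Here \<theta> is at least \<open>\<theta>\<^sub>0 / 2\<close> from
          \<open>t\<close>, so half of the Gaussian exponent is at least \<open>n / 32\<close>,
          which exceeds \<open>ln n\<close>.\<close>
        have "\<theta>\<^sub>0 / 2 \<le> \<bar>\<theta> - t\<bar>" using False t1 by linarith
        then have "(\<theta>\<^sub>0 / 2)\<^sup>2 \<le> (\<theta> - t)\<^sup>2" using th abs_le_square_iff[of "\<theta>\<^sub>0 / 2" "\<theta> - t"] by simp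
        then have "real n * (\<theta>\<^sub>0 / 2)\<^sup>2 / (8 * \<theta>\<^sub>0\<^sup>2) \<le> real n * (\<theta> - t)\<^sup>2 / (8 * \<theta>\<^sub>0\<^sup>2)"
          using n by (intro divide_right_mono mult_left_mono) auto
        moreover have "real n * (\<theta>\<^sub>0 / 2)\<^sup>2 / (8 * \<theta>\<^sub>0\<^sup>2) = real n / 32" using th by (simp add: power_divide)
        moreover have "ln (real n) \<le> real n / 32"
        proof -
          have "ln (real n) \<le> real n * (\<delta> n)\<^sup>2" unfolding nd2 by (rule ln2)
          also have "\<dots> \<le> real n * (1 / 1280)\<^sup>2" using dpos elim(2) by (intro mult_left_mono power_mono) auto
          also have "\<dots> \<le> real n / 32" by (simp add: power_divide)
          finally show ?thesis .
        qed
        ultimately have "ln (real n) \<le> real n * (\<theta> - t)\<^sup>2 / (8 * \<theta>\<^sub>0\<^sup>2)" by linarith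
        then have "exp (- (real n * (\<theta> - t)\<^sup>2 / (8 * \<theta>\<^sub>0\<^sup>2))) \<le> exp (- ln (real n))" by simp
        also have "\<dots> = 1 / real n" using n by (simp add: exp_minus inverse_eq_divide)
        finally have "g2 \<theta> \<le> 1 / real n" by (simp add: g2_def)
        moreover have "g \<theta> = g2 \<theta> * g2 \<theta>" by (simp add: g_def g2_def exp_add[symmetric])
        moreover have "g2 \<theta> \<ge> 0" by (simp add: g2_def)
        ultimately have "g \<theta> \<le> 1 / real n * g2 \<theta>" by (simp only:) (intro mult_right_mono)
        moreover have "g \<theta> \<ge> 0" by (simp add: g_def)
        moreover from this have "a * g \<theta> \<ge> 0" using a0 by simp
        moreover have "f n t \<theta> = 0" "indicat_real {0<..} \<theta> = 0" using False by (auto simp: f_def)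
        ultimately show ?thesis by simp
      qed
      define D where "D = (LINT \<theta>|lborel. \<bar>f n t \<theta> - g \<theta>\<bar>)"
      have qi': "integrable lborel (\<lambda>\<theta>. indicator {0<..} \<theta> * q \<theta> / q \<theta>\<^sub>0)" using qi by (rule integrable_divide_zero)
      have bi: "integrable lborel (\<lambda>\<theta>. a * g \<theta> + 1 / real n * g2 \<theta> + 1 / real n * (indicator {0<..} \<theta> * q \<theta> / q \<theta>\<^sub>0))"
        by (intro Bochner_Integration.integrable_add integrable_mult_right gi gi2 qi')
      have "D \<le> (LINT \<theta>|lborel. a * g \<theta> + 1 / real n * g2 \<theta> + 1 / real n * (indicator {0<..} \<theta> * q \<theta> / q \<theta>\<^sub>0))"
        unfolding D_def using fi gi bi ptw by (intro integral_mono) auto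
      also have "\<dots> = a * G + 1 / real n * (sqrt 2 * G) + 1 / real n * (1 / q \<theta>\<^sub>0)"
      proof -
        have "(LINT \<theta>|lborel. indicator {0<..} \<theta> * q \<theta> / q \<theta>\<^sub>0) = 1 / q \<theta>\<^sub>0"
          unfolding integral_divide_zero q1 ..
        then show ?thesis
          by (subst Bochner_Integration.integral_add, intro Bochner_Integration.integrable_add integrable_mult_right gi gi2,
              intro integrable_mult_right qi', subst Bochner_Integration.integral_add)
             (intro integrable_mult_right gi gi2 | simp only: integral_mult_right_zero gi gi2)+
      qed
      also have "\<dots> \<le> K * e * G"
      proof -
        have "1 / real n * (sqrt 2 * G) \<le> e * (2 * G)"
          using ns G sqrt2_less_2 epos by (intro mult_mono) auto
        moreover have "1 / real n * (1 / q \<theta>\<^sub>0) \<le> 1 / (2 * \<theta>\<^sub>0 * q \<theta>\<^sub>0) * e * G"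
        proof -
          have "G = 2 * \<theta>\<^sub>0 * (sqrt pi / sqrt (real n))"
            using th by (simp add: G_def real_sqrt_divide real_sqrt_mult)
          then have "1 / (2 * \<theta>\<^sub>0 * q \<theta>\<^sub>0) * e * G = sqrt pi * (e * (1 / sqrt (real n))) * (1 / q \<theta>\<^sub>0)"
            using th by (simp add: mult_ac)
          moreover have "1 / real n \<le> sqrt pi * (e * (1 / sqrt (real n)))"
          proof -
            have "1 / real n = 1 / sqrt (real n) * (1 / sqrt (real n))" using sq by simp
            also have "\<dots> \<le> e * (1 / sqrt (real n))" using ns sq by (intro mult_right_mono) auto
            also have "\<dots> = 1 * (e * (1 / sqrt (real n)))" by simp
            also have "\<dots> \<le> sqrt pi * (e * (1 / sqrt (real n)))"
            proof (rule mult_right_mono)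
              show "1 \<le> sqrt pi" using pi_ge_two by simp
              have "0 \<le> 1 / sqrt (real n)" using sq by simp
              then show "0 \<le> e * (1 / sqrt (real n))" using ns by (intro mult_nonneg_nonneg) linarith+
            qed
            finally show ?thesis .
          qed
          ultimately show ?thesis using q0 by (simp only:) (intro mult_right_mono; simp)
        qed
        ultimately show ?thesis by (simp add: K_def a_def distrib_right)
      qed
      finally have D: "D \<le> K * e * G" .
      have "\<bar>integral\<^sup>L lborel (f n t) - G\<bar> \<le> D"
        unfolding D_def gi(2)[symmetric] Bochner_Integration.integral_diff[OF fi gi(1), symmetric] by (rule integral_abs_bound)
      \<comment> \<open>The L1 error is smaller than the Gaussian mass, so the posterior kernel has
        positive mass and can be normalised.\<close>
      moreover have "K * e * G < 1 * G" using elim(7) G unfolding e_def by (intro mult_strict_right_mono)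
      ultimately have F: "integral\<^sup>L lborel (f n t) > 0" using D by linarith
      have "\<bar>measure (density lborel (\<lambda>\<theta>. ennreal (f n t \<theta> / integral\<^sup>L lborel (f n t)))) A
        - measure (normal_measure t (2 * \<theta>\<^sub>0\<^sup>2 / real n)) A\<bar> \<le> 2 * K * \<epsilon> n" if A: "A \<in> sets borel" for A
      proof -
        have "normal_measure t (2 * \<theta>\<^sub>0\<^sup>2 / real n) = density lborel (\<lambda>\<theta>. ennreal (g \<theta> / integral\<^sup>L lborel g))"
          unfolding gi(2) gn using v by (simp add: normal_measure_def)
        then have "\<bar>measure (density lborel (\<lambda>\<theta>. ennreal (f n t \<theta> / integral\<^sup>L lborel (f n t)))) A
          - measure (normal_measure t (2 * \<theta>\<^sub>0\<^sup>2 / real n)) A\<bar> \<le> 2 * D / G"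
          using normalized_density_dist[OF fi gi(1) f0 _ F, of A] gi(2) G A unfolding D_def by (simp add: g_def)
        also have "\<dots> \<le> 2 * (K * e * G) / G" using D G by (intro divide_right_mono mult_left_mono) auto
        also have "\<dots> = 2 * K * \<epsilon> n" using G by (simp add: e_def)
        finally show ?thesis .
      qed
      then show "t > 0 \<and> integrable lborel (f n t) \<and> integral\<^sup>L lborel (f n t) > 0 \<and>
       (\<forall>A\<in>sets borel. \<bar>measure (density lborel (\<lambda>\<theta>. ennreal (f n t \<theta> / integral\<^sup>L lborel (f n t)))) A
        - measure (normal_measure t (2 * \<theta>\<^sub>0\<^sup>2 / real n)) A\<bar> \<le> 2 * K * \<epsilon> n)"
        using t0 fi F by blast
    qed
  qed
  then show ?thesis unfolding \<delta>_def \<epsilon>_def by blast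
qed

section \<open>Positive definite matrices and penalised least squares\<close>

text \<open>Cholesky factorisation by induction on the size: a positive pivot is eliminated through
  its Schur complement, while a zero pivot forces its whole row to vanish. Kernels indexed by
  numbers avoid the dimension bookkeeping of block matrices.\<close>

lemma psd_kernel_factor:
  fixes a :: "nat \<Rightarrow> nat \<Rightarrow> real"
  assumes "\<And>i j. i < n \<Longrightarrow> j < n \<Longrightarrow> a i j = a j i"
    and "\<And>x. 0 \<le> (\<Sum>i<n. \<Sum>j<n. a i j * x i * x j)"
  shows "\<exists>h. \<forall>i<n. \<forall>j<n. a i j = (\<Sum>k<n. h k i * h k j)"
  using assms
proof (induction n arbitrary: a)
  case 0
  then show ?case by auto
next
  case (Suc n)
  note sym = Suc.prems(1) and psd = Suc.prems(2)
  have expand: "(\<Sum>i<Suc n. \<Sum>j<Suc n. a i j * x i * x j)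
     = (\<Sum>i<n. \<Sum>j<n. a i j * x i * x j) + 2 * (\<Sum>i<n. a i n * x i) * x n + a n n * (x n)\<^sup>2" for x
  proof -
    have "(\<Sum>j<n. a n j * x n * x j) = (\<Sum>i<n. a i n * x i) * x n"
      by (simp add: sum_distrib_right) (rule sum.cong, auto simp: sym)
    moreover have "(\<Sum>i<n. a i n * x i * x n) = (\<Sum>i<n. a i n * x i) * x n"
      by (simp add: sum_distrib_right)
    ultimately show ?thesis
      by (simp add: sum.distrib power2_eq_square algebra_simps)
  qed
  have nn: "0 \<le> a n n"
    using psd[of "\<lambda>i. if i = n then 1 else 0"] unfolding expand by simp
  show ?case
  proof (cases "a n n = 0")
    case True
    have z: "a i n = 0" if "i < n" for i
    proof (rule ccontr)
      assume ne: "a i n \<noteq> 0"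
      \<comment> \<open>Chosen so that the form takes the value -1 on the vector with entry 1 at
        \<open>i\<close> and \<open>t\<close> at \<open>n\<close>.\<close>
      define t where "t = - (a i i + 1) / (2 * a i n)"
      define x where "x = (\<lambda>j. if j = n then t else if j = i then 1 else (0::real))"
      have "(\<Sum>k<n. \<Sum>j<n. a k j * x k * x j) = a i i"
      proof -
        have "(\<Sum>k<n. \<Sum>j<n. a k j * x k * x j) = (\<Sum>k<n. if k = i then (\<Sum>j<n. if j = i then a k j else 0) else 0)"
          using that by (intro sum.cong refl) (auto simp: x_def if_distrib[of "\<lambda>z. _ * z"] cong: if_cong intro!: sum.cong sum.neutral)
        also have "\<dots> = a i i" using that by (simp add: sum.delta)
        finally show ?thesis .
      qed
      moreover have "(\<Sum>k<n. a k n * x k) = a i n"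
      proof -
        have "(\<Sum>k<n. a k n * x k) = (\<Sum>k<n. if k = i then a k n else 0)"
          by (intro sum.cong refl) (auto simp: x_def)
        then show ?thesis using that by simp
      qed
      ultimately have "0 \<le> a i i + 2 * a i n * t"
        using psd[of x] unfolding expand by (simp add: True x_def)
      then show False using ne by (simp add: t_def)
    qed
    have "\<exists>h. \<forall>i<n. \<forall>j<n. a i j = (\<Sum>k<n. h k i * h k j)"
    proof (rule Suc.IH)
      fix x :: "nat \<Rightarrow> real"
      show "0 \<le> (\<Sum>i<n. \<Sum>j<n. a i j * x i * x j)"
        using psd[of x] unfolding expand by (simp add: True z)
    qed (auto simp: sym)
    then obtain h where h: "\<And>i j. i < n \<Longrightarrow> j < n \<Longrightarrow> a i j = (\<Sum>k<n. h k i * h k j)" by blast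
    define h' where "h' = (\<lambda>k i. if k < n \<and> i < n then h k i else 0)"
    have "a i j = (\<Sum>k<Suc n. h' k i * h' k j)" if "i < Suc n" "j < Suc n" for i j
    proof (cases "i < n \<and> j < n")
      case True
      then show ?thesis by (simp add: h'_def h)
    next
      case False
      then have "i = n \<or> j = n" using that by auto
      then show ?thesis using z sym[of i j] True that
        by (auto simp: h'_def less_Suc_eq)
    qed
    then show ?thesis by blast
  next
    case False
    then have p: "a n n > 0" using nn by simp
    define a' where "a' = (\<lambda>i j. a i j - a i n * a j n / a n n)"
    have "\<exists>h. \<forall>i<n. \<forall>j<n. a' i j = (\<Sum>k<n. h k i * h k j)"
    proof (rule Suc.IH)
      fix x :: "nat \<Rightarrow> real"
      define s where "s = (\<Sum>i<n. a i n * x i)"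
      \<comment> \<open>The last coordinate minimises the form for given \<open>x\<close>; the
        minimum is the Schur complement.\<close>
      define y where "y = x(n := - s / a n n)"
      have 1: "(\<Sum>i<n. \<Sum>j<n. a' i j * x i * x j) = (\<Sum>i<n. \<Sum>j<n. a i j * x i * x j) - s\<^sup>2 / a n n"
      proof -
        have "s\<^sup>2 / a n n = (\<Sum>i<n. \<Sum>j<n. a i n * a j n / a n n * x i * x j)"
          by (simp add: s_def power2_eq_square sum_product sum_divide_distrib mult_ac)
        then show ?thesis by (simp add: a'_def left_diff_distrib sum_subtractf)
      qed
      have "0 \<le> (\<Sum>i<Suc n. \<Sum>j<Suc n. a i j * y i * y j)" by (rule psd)
      also have "\<dots> = (\<Sum>i<n. \<Sum>j<n. a i j * x i * x j) + 2 * s * (- s / a n n) + a n n * (- s / a n n)\<^sup>2"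
        unfolding expand by (simp add: y_def s_def)
      also have "\<dots> = (\<Sum>i<n. \<Sum>j<n. a i j * x i * x j) - s\<^sup>2 / a n n"
        using p by (simp add: field_simps power2_eq_square)
      finally show "0 \<le> (\<Sum>i<n. \<Sum>j<n. a' i j * x i * x j)" unfolding 1 .
    qed (auto simp: sym a'_def)
    then obtain h where h: "\<And>i j. i < n \<Longrightarrow> j < n \<Longrightarrow> a' i j = (\<Sum>k<n. h k i * h k j)" by blast
    define h' where "h' = (\<lambda>k i. if k = n then a i n / sqrt (a n n) else if i < n then h k i else 0)"
    have sq: "a i n / sqrt (a n n) * (a j n / sqrt (a n n)) = a i n * a j n / a n n" for i j
      using p by simp
    have "a i j = (\<Sum>k<Suc n. h' k i * h' k j)" if "i < Suc n" "j < Suc n" for i j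
    proof (cases "i < n \<and> j < n")
      case True
      have "(\<Sum>k<Suc n. h' k i * h' k j) = (\<Sum>k<n. h k i * h k j) + a i n * a j n / a n n"
        using True sq by (simp add: h'_def)
      then show ?thesis using True h[of i j] by (simp add: a'_def)
    next
      case False
      then have *: "i = n \<or> j = n" using that by auto
      then have "(\<Sum>k<n. h' k i * h' k j) = 0"
        by (intro sum.neutral) (auto simp: h'_def)
      then have "(\<Sum>k<Suc n. h' k i * h' k j) = a i n * a j n / a n n"
        using sq by (simp add: h'_def)
      also have "\<dots> = a i j" using * p sym[of i j] that by auto
      finally show ?thesis ..
    qed
    then show ?thesis by blast
  qed
qed

lemma psd_mat_factor:
  assumes "psd_mat n A"
  shows "\<exists>K\<in>carrier_mat n n. A = K\<^sup>T * K"
proof -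
  have A: "A \<in> carrier_mat n n" and T: "A\<^sup>T = A" and psd: "\<And>x. x \<in> carrier_vec n \<Longrightarrow> 0 \<le> x \<bullet> (A *\<^sub>v x)"
    using assms by (auto simp: psd_mat_def)
  have "\<exists>h. \<forall>i<n. \<forall>j<n. A $$ (i, j) = (\<Sum>k<n. h k i * h k j)"
  proof (rule psd_kernel_factor)
    fix i j assume "i < n" "j < n"
    then show "A $$ (i, j) = A $$ (j, i)" using T A by (metis carrier_matD index_transpose_mat(1))
  next
    fix x :: "nat \<Rightarrow> real"
    have "0 \<le> vec n x \<bullet> (A *\<^sub>v vec n x)" by (rule psd) auto
    also have "\<dots> = (\<Sum>i<n. \<Sum>j<n. A $$ (i, j) * x i * x j)"
      using A by (auto simp: scalar_prod_def sum_distrib_left atLeast0LessThan mult_ac intro!: sum.cong)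
    finally show "0 \<le> (\<Sum>i<n. \<Sum>j<n. A $$ (i, j) * x i * x j)" .
  qed
  then obtain h where h: "\<And>i j. i < n \<Longrightarrow> j < n \<Longrightarrow> A $$ (i, j) = (\<Sum>k<n. h k i * h k j)" by blast
  define K where "K = mat n n (\<lambda>(k, i). h k i)"
  have "A = K\<^sup>T * K"
    using A by (intro eq_matI) (auto simp: K_def scalar_prod_def h atLeast0LessThan)
  then show ?thesis by (auto simp: K_def)
qed

text \<open>If A is the Gram matrix of K, positive definiteness makes K invertible, and the
  transpose \<open>L\<close> of its inverse whitens: a vector with covariance A is mapped by
  \<open>L\<close> to one with identity covariance.\<close>

lemma pd_mat_factor:
  assumes A: "psd_mat n A" and pd: "\<And>x. x \<in> carrier_vec n \<Longrightarrow> x \<bullet> (A *\<^sub>v x) = 0 \<Longrightarrow> x = 0\<^sub>v n"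
  obtains L where "L \<in> carrier_mat n n" "L * A * L\<^sup>T = 1\<^sub>m n" "minv A = L\<^sup>T * L" "A * (L\<^sup>T * L) = 1\<^sub>m n" "Determinant.det A > 0"
proof -
  obtain K where K: "K \<in> carrier_mat n n" and AK: "A = K\<^sup>T * K" using psd_mat_factor[OF A] by blast
  have "Determinant.det K \<noteq> 0"
  proof
    assume "Determinant.det K = 0"
    then obtain v where v: "v \<in> carrier_vec n" "v \<noteq> 0\<^sub>v n" "K *\<^sub>v v = 0\<^sub>v n"
      using det_0_iff_vec_prod_zero[OF K] by auto
    have "v \<bullet> (A *\<^sub>v v) = v \<bullet> (K\<^sup>T *\<^sub>v (K *\<^sub>v v))" using K v by (simp add: AK assoc_mult_mat_vec[of _ n n])
    also have "\<dots> = 0" using K v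
      by (simp add: scalar_prod_def) 
    finally show False using pd v by blast
  qed
  then have u: "K \<in> Units (ring_mat TYPE(real) n ())"
    by (rule det_non_zero_imp_unit[OF K])
  have "Determinant.det A = Determinant.det K * Determinant.det K"
    unfolding AK using K by (subst det_mult[of _ n]) (auto simp: det_transpose)
  then have dA: "Determinant.det A > 0"
    using \<open>Determinant.det K \<noteq> 0\<close> by (metis linorder_neqE mult_neg_neg mult_pos_pos)
  obtain J where J: "J \<in> carrier_mat n n" "K * J = 1\<^sub>m n" "J * K = 1\<^sub>m n"
    using u unfolding Units_def ring_mat_simps by auto
  define L where "L = J\<^sup>T"
  have L: "L \<in> carrier_mat n n" using J by (simp add: L_def)
  have LT: "L\<^sup>T = J" by (simp add: L_def)
  have LK: "L * K\<^sup>T = 1\<^sub>m n"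
    using J K by (simp add: L_def transpose_mult[symmetric, of _ n n])
  have KL: "K\<^sup>T * L = 1\<^sub>m n"
    using J K by (simp add: L_def transpose_mult[symmetric, of _ n n])
  have 1: "L * A * L\<^sup>T = 1\<^sub>m n"
  proof -
    have "L * A * L\<^sup>T = L * (K\<^sup>T * K) * J" by (simp add: AK LT)
    also have "\<dots> = (L * K\<^sup>T) * (K * J)" using L K J by (simp add: assoc_mult_mat[of _ n n _ n _ n])
    also have "\<dots> = 1\<^sub>m n" using LK J by simp
    finally show ?thesis .
  qed
  have 2: "A * (L\<^sup>T * L) = 1\<^sub>m n"
  proof -
    have "K * (J * L) = L"
      using J L K by (subst assoc_mult_mat[of K n n J n L n, symmetric]) auto
    moreover have "A * (L\<^sup>T * L) = K\<^sup>T * (K * (J * L))"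
      unfolding AK LT by (rule assoc_mult_mat[of _ n n _ n _ n]) (use L K J in auto)
    ultimately have "A * (L\<^sup>T * L) = K\<^sup>T * L" by simp
    also have "\<dots> = 1\<^sub>m n" by (rule KL)
    finally show ?thesis .
  qed
  have cA: "A \<in> carrier_mat n n" using A by (simp add: psd_mat_def)
  \<comment> \<open>\<open>minv\<close> takes the value out of an option. The inverse just
    constructed rules out the undefined case and, by uniqueness, is the value returned.\<close>
  have 3: "minv A = L\<^sup>T * L"
  proof (cases "mat_inverse A")
    case None
    then have "A \<notin> Units (ring_mat TYPE(real) n ())" using mat_inverse(1)[OF cA, where b="()"] by blast
    moreover have "L\<^sup>T * L * A = 1\<^sub>m n" using mat_mult_left_right_inverse[OF cA _ 2] L by auto
    ultimately show ?thesis using 2 cA L unfolding Units_def ring_mat_simps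
      by auto
  next
    case (Some B)
    then have B: "A * B = 1\<^sub>m n" "B * A = 1\<^sub>m n" "B \<in> carrier_mat n n" using mat_inverse(2)[OF cA Some] by auto
    have "B = B * (A * (L\<^sup>T * L))" using B 2 by simp
    also have "\<dots> = (B * A) * (L\<^sup>T * L)"
      by (rule assoc_mult_mat[symmetric, of _ n n _ n _ n]) (use B cA L in auto)
    also have "\<dots> = L\<^sup>T * L" using B L by simp
    finally show ?thesis using Some by simp
  qed
  show ?thesis using that L 1 2 3 dA by blast
qed

text \<open>Rank is the size of a maximal independent subset of the set of columns. Size
  \<open>p\<close> forces the columns to be distinct, which has to be known before a kernel vector
  can be read as a linear dependence of that set.\<close>

lemma full_column_rank_kernel:
  fixes A :: "real mat"
  assumes A: "A \<in> carrier_mat n p" and r: "vec_space.rank n A = p" and v: "v \<in> carrier_vec p" "A *\<^sub>v v = 0\<^sub>v n"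
  shows "v = 0\<^sub>v p"
proof (rule ccontr)
  interpret vec_space "TYPE(real)" n .
  assume ne: "v \<noteq> 0\<^sub>v p"
  obtain S where S: "maximal S (\<lambda>T. T \<subseteq> set (cols A) \<and> lin_indpt T)"
    using maximal_exists[of "(\<lambda>T. T \<subseteq> set (cols A) \<and> lin_indpt T)" "card (set (cols A))" "{}"]
    by (meson List.finite_set card_mono empty_iff empty_subsetI finite_lin_indpt2 rev_finite_subset)
  then have "card S \<le> card (set (cols A))" by (simp add: card_mono maximal_def)
  moreover have "card S = p" using rank_card_indpt[OF A S] r by simp
  moreover have "card (set (cols A)) \<le> length (cols A)" by (rule card_length)
  ultimately have "card (set (cols A)) = length (cols A)" using A by simp
  then have d: "distinct (cols A)" by (rule card_distinct)
  show False
    using lin_depI[OF A v(1) ne v(2) d] full_rank_lin_indpt[OF A r d] by blast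
qed

definition pd_mat :: "nat \<Rightarrow> real mat \<Rightarrow> bool" where
  "pd_mat n A \<longleftrightarrow> psd_mat n A \<and> (\<forall>x\<in>carrier_vec n. x \<bullet> (A *\<^sub>v x) = 0 \<longrightarrow> x = 0\<^sub>v n)"

lemma pd_matD:
  assumes "pd_mat n A"
  shows "A \<in> carrier_mat n n" "A\<^sup>T = A" "psd_mat n A" "\<And>x. x \<in> carrier_vec n \<Longrightarrow> 0 \<le> x \<bullet> (A *\<^sub>v x)"
    "\<And>x. x \<in> carrier_vec n \<Longrightarrow> x \<bullet> (A *\<^sub>v x) = 0 \<Longrightarrow> x = 0\<^sub>v n"
  using assms by (auto simp: pd_mat_def psd_mat_def)

lemma pd_mat_minv:
  assumes A: "pd_mat n A"
  obtains L where "L \<in> carrier_mat n n" "L * A * L\<^sup>T = 1\<^sub>m n" "minv A = L\<^sup>T * L" "A * minv A = 1\<^sub>m n" "minv A * A = 1\<^sub>m n"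
    "minv A \<in> carrier_mat n n" "(minv A)\<^sup>T = minv A"
proof -
  obtain L where L: "L \<in> carrier_mat n n" "L * A * L\<^sup>T = 1\<^sub>m n" "minv A = L\<^sup>T * L" "A * (L\<^sup>T * L) = 1\<^sub>m n"
    by (rule pd_mat_factor[OF pd_matD(3)[OF A] pd_matD(5)[OF A]])
  have c: "minv A \<in> carrier_mat n n" using L by simp
  have r: "A * minv A = 1\<^sub>m n" using L by simp
  have l: "minv A * A = 1\<^sub>m n" using mat_mult_left_right_inverse[OF pd_matD(1)[OF A] c r] .
  have "(minv A)\<^sup>T = minv A" unfolding L(3) using L(1) by (simp add: transpose_mult[of _ n n _ n])
  with that L c r l show ?thesis by blast
qed

lemma sym_mat_scalar_prod:
  fixes A :: "real mat"
  assumes A: "A \<in> carrier_mat n n" "A\<^sup>T = A" and x: "x \<in> carrier_vec n" "y \<in> carrier_vec n"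
  shows "x \<bullet> (A *\<^sub>v y) = y \<bullet> (A *\<^sub>v x)"
proof -
  have "x \<bullet> (A *\<^sub>v y) = (A\<^sup>T *\<^sub>v x) \<bullet> y" by (rule transpose_vec_mult_scalar[symmetric]) (use A x in auto)
  also have "\<dots> = y \<bullet> (A *\<^sub>v x)" unfolding A(2) by (rule comm_scalar_prod[of _ n]) (use A x in auto)
  finally show ?thesis .
qed

lemma quadratic_form_diff:
  fixes A :: "real mat"
  assumes A: "A \<in> carrier_mat n n" "A\<^sup>T = A" and x: "x \<in> carrier_vec n" "y \<in> carrier_vec n"
  shows "(x - y) \<bullet> (A *\<^sub>v (x - y)) = x \<bullet> (A *\<^sub>v x) - 2 * (x \<bullet> (A *\<^sub>v y)) + y \<bullet> (A *\<^sub>v y)"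
proof -
  have "(x - y) \<bullet> (A *\<^sub>v (x - y)) = (x - y) \<bullet> (A *\<^sub>v x) - (x - y) \<bullet> (A *\<^sub>v y)"
    using A x by (simp add: mult_minus_distrib_mat_vec[of _ n n] scalar_prod_minus_distrib[of _ n])
  also have "\<dots> = x \<bullet> (A *\<^sub>v x) - y \<bullet> (A *\<^sub>v x) - (x \<bullet> (A *\<^sub>v y) - y \<bullet> (A *\<^sub>v y))"
    using A x by (simp add: minus_scalar_prod_distrib[of _ n])
  finally show ?thesis using sym_mat_scalar_prod[OF A x] by simp
qed

text \<open>A strictly convex quadratic is smallest at \<open>minv H *\<^sub>v w\<close>. It is used
  with the penalised Gram matrix for the value of the least squares criterion, and with the
  unpenalised one for the lower bound.\<close>

lemma pd_complete_square:
  fixes H :: "real mat"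
  assumes H: "pd_mat p H" and g: "\<gamma> \<in> carrier_vec p" and w: "w \<in> carrier_vec p"
  shows "\<gamma> \<bullet> (H *\<^sub>v \<gamma>) - 2 * (\<gamma> \<bullet> w) \<ge> - (w \<bullet> (minv H *\<^sub>v w))"
    and "\<gamma> = minv H *\<^sub>v w \<Longrightarrow> \<gamma> \<bullet> (H *\<^sub>v \<gamma>) - 2 * (\<gamma> \<bullet> w) = - (w \<bullet> (minv H *\<^sub>v w))"
proof -
  obtain L where L: "L \<in> carrier_mat p p" "L * H * L\<^sup>T = 1\<^sub>m p" "minv H = L\<^sup>T * L" "H * minv H = 1\<^sub>m p" "minv H * H = 1\<^sub>m p"
    "minv H \<in> carrier_mat p p" "(minv H)\<^sup>T = minv H" by (rule pd_mat_minv[OF H])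
  note Hc = pd_matD(1,2)[OF H]
  define b where "b = minv H *\<^sub>v w"
  have b: "b \<in> carrier_vec p" using L w by (simp add: b_def)
  have Hb: "H *\<^sub>v b = w"
  proof -
    have "H *\<^sub>v (minv H *\<^sub>v w) = (H * minv H) *\<^sub>v w"
      by (rule assoc_mult_mat_vec[symmetric]) (use Hc L(6) w in auto)
    then show ?thesis unfolding b_def L(4) using w by simp
  qed
  have bw: "b \<bullet> w = w \<bullet> (minv H *\<^sub>v w)" unfolding b_def[symmetric] by (rule comm_scalar_prod[OF b w])
  have "0 \<le> (\<gamma> - b) \<bullet> (H *\<^sub>v (\<gamma> - b))" using g b by (intro pd_matD(4)[OF H]) auto
  also have "\<dots> = \<gamma> \<bullet> (H *\<^sub>v \<gamma>) - 2 * (\<gamma> \<bullet> w) + w \<bullet> (minv H *\<^sub>v w)"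
    unfolding quadratic_form_diff[OF Hc g b] Hb bw ..
  finally show "\<gamma> \<bullet> (H *\<^sub>v \<gamma>) - 2 * (\<gamma> \<bullet> w) \<ge> - (w \<bullet> (minv H *\<^sub>v w))" by linarith
  show "\<gamma> \<bullet> (H *\<^sub>v \<gamma>) - 2 * (\<gamma> \<bullet> w) = - (w \<bullet> (minv H *\<^sub>v w))" if "\<gamma> = minv H *\<^sub>v w"
    unfolding that b_def[symmetric] Hb using bw by (simp add: b_def)
qed

text \<open>\<open>y \<bullet> Q y\<close> is the minimum over \<open>\<gamma>\<close> of the penalised least squares criterion
  \<open>(y - M \<gamma>) \<bullet> R\<^sup>-\<^sup>1 (y - M \<gamma>) + \<gamma> \<bullet> \<Omega> \<gamma>\<close>; comparing with \<open>\<gamma> = \<beta>\<close> and with \<open>\<Omega> = 0\<close> gives the two bounds.\<close>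

lemma Q_mat_bounds:
  fixes R M \<Omega> :: "real mat"
  assumes R: "pd_mat n R" and M: "M \<in> carrier_mat n p" and ker: "\<And>v. v \<in> carrier_vec p \<Longrightarrow> M *\<^sub>v v = 0\<^sub>v n \<Longrightarrow> v = 0\<^sub>v p"
    and Om: "psd_mat p \<Omega>" and \<beta>: "\<beta> \<in> carrier_vec p"
  obtains u where "\<And>j. j < p \<Longrightarrow> u j \<in> carrier_vec n" "\<And>j. j < p \<Longrightarrow> u j \<bullet> (R *\<^sub>v u j) = 1"
    "\<And>x. x \<in> carrier_vec n \<Longrightarrow> (M *\<^sub>v \<beta> + x) \<bullet> (Q_mat R M \<Omega> *\<^sub>v (M *\<^sub>v \<beta> + x)) \<le> x \<bullet> (minv R *\<^sub>v x) + \<beta> \<bullet> (\<Omega> *\<^sub>v \<beta>)"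
    "\<And>x. x \<in> carrier_vec n \<Longrightarrow> (M *\<^sub>v \<beta> + x) \<bullet> (Q_mat R M \<Omega> *\<^sub>v (M *\<^sub>v \<beta> + x)) \<ge> x \<bullet> (minv R *\<^sub>v x) - (\<Sum>j<p. (u j \<bullet> x)\<^sup>2)"
proof -
  define K where "K = minv R"
  have RK: "R * K = 1\<^sub>m n" and K: "K \<in> carrier_mat n n" "K\<^sup>T = K"
    unfolding K_def by (rule pd_mat_minv[OF R], assumption)+
  note Rc = pd_matD(1,2)[OF R]
  have O: "\<Omega> \<in> carrier_mat p p" "\<Omega>\<^sup>T = \<Omega>" "\<And>x. x \<in> carrier_vec p \<Longrightarrow> 0 \<le> x \<bullet> (\<Omega> *\<^sub>v x)"
    using Om by (auto simp: psd_mat_def)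
  define G where "G = M\<^sup>T * K * M"
  have G: "G \<in> carrier_mat p p" using M K by (simp add: G_def)
  have GT: "G\<^sup>T = G"
    unfolding G_def using M K by (simp add: transpose_mult[of _ p n _ p] transpose_mult[of _ p n _ n] transpose_mult[of _ n n _ p])
  have Kx: "K *\<^sub>v x \<in> carrier_vec n" if "x \<in> carrier_vec n" for x using K that by simp
  have Mg: "M *\<^sub>v \<gamma> \<in> carrier_vec n" if "\<gamma> \<in> carrier_vec p" for \<gamma> using M that by simp
  have MT: "M\<^sup>T *\<^sub>v x \<in> carrier_vec p" if "x \<in> carrier_vec n" for x using M that by simp
  have Gv: "G *\<^sub>v \<gamma> = M\<^sup>T *\<^sub>v (K *\<^sub>v (M *\<^sub>v \<gamma>))" if "\<gamma> \<in> carrier_vec p" for \<gamma>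
    unfolding G_def using M K that by (simp add: assoc_mult_mat_vec[of _ p n _ p])
  have MTx: "\<gamma> \<bullet> (M\<^sup>T *\<^sub>v z) = (M *\<^sub>v \<gamma>) \<bullet> z" if "\<gamma> \<in> carrier_vec p" "z \<in> carrier_vec n" for \<gamma> z
    using transpose_vec_mult_scalar[OF M that] comm_scalar_prod[of \<gamma> p "M\<^sup>T *\<^sub>v z"] comm_scalar_prod[of z n "M *\<^sub>v \<gamma>"] Mg[OF that(1)] MT[OF that(2)] that by simp
  have GG: "\<gamma> \<bullet> (G *\<^sub>v \<gamma>) = (M *\<^sub>v \<gamma>) \<bullet> (K *\<^sub>v (M *\<^sub>v \<gamma>))" if "\<gamma> \<in> carrier_vec p" for \<gamma>
    unfolding Gv[OF that] by (rule MTx) (use that Kx Mg in auto)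
  have Kpos: "x \<bullet> (K *\<^sub>v x) \<ge> 0" "x \<bullet> (K *\<^sub>v x) = 0 \<Longrightarrow> x = 0\<^sub>v n" if x: "x \<in> carrier_vec n" for x
  proof -
    have "R *\<^sub>v (K *\<^sub>v x) = (R * K) *\<^sub>v x"
      by (rule assoc_mult_mat_vec[symmetric]) (use Rc K x in auto)
    then have "R *\<^sub>v (K *\<^sub>v x) = x" unfolding RK using x by simp
    then have eq: "x \<bullet> (K *\<^sub>v x) = (K *\<^sub>v x) \<bullet> (R *\<^sub>v (K *\<^sub>v x))" and x': "R *\<^sub>v (K *\<^sub>v x) = x"
      using comm_scalar_prod[OF x Kx[OF x]] by simp_all
    show "x \<bullet> (K *\<^sub>v x) \<ge> 0" unfolding eq by (rule pd_matD(4)[OF R Kx[OF x]])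
    show "x = 0\<^sub>v n" if "x \<bullet> (K *\<^sub>v x) = 0"
    proof -
      have "K *\<^sub>v x = 0\<^sub>v n" using that unfolding eq by (rule pd_matD(5)[OF R Kx[OF x]])
      then have "x = R *\<^sub>v 0\<^sub>v n" using x' by simp
      also have "\<dots> = 0\<^sub>v n" using Rc(1) by (intro eq_vecI) auto
      finally show ?thesis .
    qed
  qed
  have Gpd: "pd_mat p G"
    unfolding pd_mat_def psd_mat_def using G GT GG Kpos Mg ker by auto
  define H where "H = G + \<Omega>"
  have H: "H \<in> carrier_mat p p" using G O by (simp add: H_def)
  have Hv: "\<gamma> \<bullet> (H *\<^sub>v \<gamma>) = \<gamma> \<bullet> (G *\<^sub>v \<gamma>) + \<gamma> \<bullet> (\<Omega> *\<^sub>v \<gamma>)" if "\<gamma> \<in> carrier_vec p" for \<gamma>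
    unfolding H_def using G O that by (simp add: add_mult_distrib_mat_vec[of _ p p] scalar_prod_add_distrib[of _ p])
  have HT: "H\<^sup>T = H" unfolding H_def using G O GT by (simp add: transpose_add[of _ p p])
  have Hpd: "pd_mat p H"
    unfolding pd_mat_def psd_mat_def
  proof (intro conjI ballI impI)
    fix \<gamma> :: "real vec" assume g: "\<gamma> \<in> carrier_vec p"
    show "0 \<le> \<gamma> \<bullet> (H *\<^sub>v \<gamma>)" unfolding Hv[OF g] using pd_matD(4)[OF Gpd g] O(3)[OF g] by linarith
    assume "\<gamma> \<bullet> (H *\<^sub>v \<gamma>) = 0"
    then have "\<gamma> \<bullet> (G *\<^sub>v \<gamma>) = 0" unfolding Hv[OF g] using pd_matD(4)[OF Gpd g] O(3)[OF g] by linarith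
    then show "\<gamma> = 0\<^sub>v p" by (rule pd_matD(5)[OF Gpd g])
  qed (use H HT in auto)
  obtain LH where LH: "minv H \<in> carrier_mat p p" by (rule pd_mat_minv[OF Hpd]) (rule that)
  have gls: "gls_mat R M \<Omega> = H" by (simp add: gls_mat_def H_def G_def K_def)
  have Qy: "y \<bullet> (Q_mat R M \<Omega> *\<^sub>v y) = y \<bullet> (K *\<^sub>v y) - (M\<^sup>T *\<^sub>v (K *\<^sub>v y)) \<bullet> (minv H *\<^sub>v (M\<^sup>T *\<^sub>v (K *\<^sub>v y)))" if y: "y \<in> carrier_vec n" for y
  proof -
    let ?w = "M\<^sup>T *\<^sub>v (K *\<^sub>v y)"
    have w: "?w \<in> carrier_vec p" using Kx[OF y] MT by simp
    have Bw: "minv H *\<^sub>v ?w \<in> carrier_vec p" using LH w by simp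
    have "Q_mat R M \<Omega> *\<^sub>v y = K *\<^sub>v y - (K * M * minv H * M\<^sup>T * K) *\<^sub>v y"
      unfolding Q_mat_def gls K_def[symmetric] by (rule minus_mult_distrib_mat_vec[of _ n n]) (use K M LH y in auto)
    also have "(K * M * minv H * M\<^sup>T * K) *\<^sub>v y = K *\<^sub>v (M *\<^sub>v (minv H *\<^sub>v ?w))"
    proof -
      have 1: "K * M * minv H * M\<^sup>T * K = K * (M * (minv H * (M\<^sup>T * K)))"
      proof -
        have "K * M * minv H * M\<^sup>T * K = K * M * minv H * (M\<^sup>T * K)"
          by (rule assoc_mult_mat) (use K M LH in auto)
        also have "\<dots> = K * M * (minv H * (M\<^sup>T * K))" by (rule assoc_mult_mat) (use K M LH in auto)
        also have "\<dots> = K * (M * (minv H * (M\<^sup>T * K)))" by (rule assoc_mult_mat) (use K M LH in auto)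
        finally show ?thesis .
      qed
      have 2: "(M\<^sup>T * K) *\<^sub>v y = ?w" by (rule assoc_mult_mat_vec) (use K M y in auto)
      have 3: "(minv H * (M\<^sup>T * K)) *\<^sub>v y = minv H *\<^sub>v ?w"
        unfolding 2[symmetric] by (rule assoc_mult_mat_vec) (use LH K M y in auto)
      have 4: "(M * (minv H * (M\<^sup>T * K))) *\<^sub>v y = M *\<^sub>v (minv H *\<^sub>v ?w)"
        unfolding 3[symmetric] by (rule assoc_mult_mat_vec) (use LH K M y in auto)
      show ?thesis unfolding 1 4[symmetric] by (rule assoc_mult_mat_vec) (use LH K M y in auto)
    qed
    finally have "y \<bullet> (Q_mat R M \<Omega> *\<^sub>v y) = y \<bullet> (K *\<^sub>v y) - y \<bullet> (K *\<^sub>v (M *\<^sub>v (minv H *\<^sub>v ?w)))"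
      using scalar_prod_minus_distrib[OF y Kx[OF y] Kx[OF Mg[OF Bw]]] by simp
    also have "y \<bullet> (K *\<^sub>v (M *\<^sub>v (minv H *\<^sub>v ?w))) = (M *\<^sub>v (minv H *\<^sub>v ?w)) \<bullet> (K *\<^sub>v y)"
      by (rule sym_mat_scalar_prod[OF K y Mg[OF Bw]])
    also have "\<dots> = (minv H *\<^sub>v ?w) \<bullet> ?w" by (rule MTx[symmetric, OF Bw Kx[OF y]])
    also have "\<dots> = ?w \<bullet> (minv H *\<^sub>v ?w)" by (rule comm_scalar_prod[OF Bw w])
    finally show ?thesis .
  qed
  have crit: "(y - M *\<^sub>v \<gamma>) \<bullet> (K *\<^sub>v (y - M *\<^sub>v \<gamma>)) = y \<bullet> (K *\<^sub>v y) - 2 * (\<gamma> \<bullet> (M\<^sup>T *\<^sub>v (K *\<^sub>v y))) + \<gamma> \<bullet> (G *\<^sub>v \<gamma>)"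
    if y: "y \<in> carrier_vec n" and g: "\<gamma> \<in> carrier_vec p" for y \<gamma>
    unfolding quadratic_form_diff[OF K y Mg[OF g]] GG[OF g] MTx[OF g Kx[OF y]]
    using sym_mat_scalar_prod[OF K y Mg[OF g]] by simp
  obtain LG where LG: "LG \<in> carrier_mat p p" "LG * G * LG\<^sup>T = 1\<^sub>m p" "minv G = LG\<^sup>T * LG"
    by (rule pd_mat_minv[OF Gpd]) (rule that)
  \<comment> \<open>The rows of \<open>LG\<close> whiten the generalised least squares Gram matrix.
    The \<open>u j\<close> are the resulting weight vectors on the data, of unit length for
    \<open>R\<close>, and the fitted part becomes the sum of the squares of these \<open>p\<close>
    linear forms.\<close>
  define u where "u = (\<lambda>j. K *\<^sub>v (M *\<^sub>v row LG j))"
  have rowc: "row LG j \<in> carrier_vec p" if "j < p" for j using LG that by auto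
  have u: "u j \<in> carrier_vec n" if "j < p" for j unfolding u_def using Kx Mg rowc that by simp
  have u1: "u j \<bullet> (R *\<^sub>v u j) = 1" if j: "j < p" for j
  proof -
    let ?g = "row LG j"
    have g: "?g \<in> carrier_vec p" using rowc j by simp
    have "R *\<^sub>v u j = (R * K) *\<^sub>v (M *\<^sub>v ?g)"
      unfolding u_def by (rule assoc_mult_mat_vec[symmetric]) (use Rc K Mg[OF g] in auto)
    then have "R *\<^sub>v u j = M *\<^sub>v ?g" unfolding RK using Mg[OF g] by simp
    then have "u j \<bullet> (R *\<^sub>v u j) = (M *\<^sub>v ?g) \<bullet> (K *\<^sub>v (M *\<^sub>v ?g))"
      using comm_scalar_prod[OF u[OF j] Mg[OF g]] by (simp add: u_def)
    also have "\<dots> = ?g \<bullet> (G *\<^sub>v ?g)" by (rule GG[OF g, symmetric])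
    also have "\<dots> = (LG * G * LG\<^sup>T) $$ (j, j)"
    proof -
      have "LG * G * LG\<^sup>T = LG * (G * LG\<^sup>T)" by (rule assoc_mult_mat) (use LG(1) G in auto)
      moreover have "(LG * (G * LG\<^sup>T)) $$ (j, j) = ?g \<bullet> col (G * LG\<^sup>T) j" using LG(1) G j by (intro index_mult_mat(1)) auto
      moreover have "col (G * LG\<^sup>T) j = G *\<^sub>v col (LG\<^sup>T) j" using LG(1) G j by (intro col_mult2[of _ p p _ p]) auto
      moreover have "col (LG\<^sup>T) j = ?g" using LG(1) j by simp
      ultimately show ?thesis by (simp only:)
    qed
    also have "\<dots> = 1" unfolding LG(2) using j by simp
    finally show ?thesis .
  qed
  have wG: "w \<bullet> (minv G *\<^sub>v w) = (\<Sum>j<p. (row LG j \<bullet> w)\<^sup>2)" if w: "w \<in> carrier_vec p" for w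
  proof -
    have Lw: "LG *\<^sub>v w \<in> carrier_vec p" using LG w by simp
    have "minv G *\<^sub>v w = LG\<^sup>T *\<^sub>v (LG *\<^sub>v w)" unfolding LG(3) by (rule assoc_mult_mat_vec) (use LG w in auto)
    then have "w \<bullet> (minv G *\<^sub>v w) = (LG\<^sup>T *\<^sub>v (LG *\<^sub>v w)) \<bullet> w" using comm_scalar_prod[of w p] LG w by simp
    also have "\<dots> = (LG *\<^sub>v w) \<bullet> (LG *\<^sub>v w)" by (rule transpose_vec_mult_scalar[OF LG(1) w Lw])
    also have "\<dots> = (\<Sum>j<p. (row LG j \<bullet> w)\<^sup>2)"
      using LG by (simp add: scalar_prod_def[of "LG *\<^sub>v w"] atLeast0LessThan power2_eq_square)
    finally show ?thesis .
  qed
  have upper: "(M *\<^sub>v \<beta> + x) \<bullet> (Q_mat R M \<Omega> *\<^sub>v (M *\<^sub>v \<beta> + x)) \<le> x \<bullet> (minv R *\<^sub>v x) + \<beta> \<bullet> (\<Omega> *\<^sub>v \<beta>)"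
    and lower: "(M *\<^sub>v \<beta> + x) \<bullet> (Q_mat R M \<Omega> *\<^sub>v (M *\<^sub>v \<beta> + x)) \<ge> x \<bullet> (minv R *\<^sub>v x) - (\<Sum>j<p. (u j \<bullet> x)\<^sup>2)"
    if x: "x \<in> carrier_vec n" for x
  proof -
    define y where "y = M *\<^sub>v \<beta> + x"
    have y: "y \<in> carrier_vec n" using x Mg[OF \<beta>] by (simp add: y_def)
    define w where "w = M\<^sup>T *\<^sub>v (K *\<^sub>v y)"
    have w: "w \<in> carrier_vec p" unfolding w_def by (intro MT Kx y)
    have cancel: "a + x - a = x" if "a \<in> carrier_vec n" for a using that x by (intro eq_vecI) auto
    have yx: "y - M *\<^sub>v \<beta> = x" unfolding y_def by (rule cancel[OF Mg[OF \<beta>]])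
    have Q: "y \<bullet> (Q_mat R M \<Omega> *\<^sub>v y) = y \<bullet> (K *\<^sub>v y) - w \<bullet> (minv H *\<^sub>v w)" unfolding w_def by (rule Qy[OF y])
    have pen: "(y - M *\<^sub>v \<gamma>) \<bullet> (K *\<^sub>v (y - M *\<^sub>v \<gamma>)) + \<gamma> \<bullet> (\<Omega> *\<^sub>v \<gamma>) = y \<bullet> (K *\<^sub>v y) + (\<gamma> \<bullet> (H *\<^sub>v \<gamma>) - 2 * (\<gamma> \<bullet> w))" if "\<gamma> \<in> carrier_vec p" for \<gamma>
      unfolding crit[OF y that] Hv[OF that] w_def by simp
    show "(M *\<^sub>v \<beta> + x) \<bullet> (Q_mat R M \<Omega> *\<^sub>v (M *\<^sub>v \<beta> + x)) \<le> x \<bullet> (minv R *\<^sub>v x) + \<beta> \<bullet> (\<Omega> *\<^sub>v \<beta>)"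
      unfolding y_def[symmetric] Q K_def[symmetric]
      using pen[OF \<beta>] pd_complete_square(1)[OF Hpd \<beta> w] unfolding yx by linarith
    define \<gamma> where "\<gamma> = minv H *\<^sub>v w"
    have g: "\<gamma> \<in> carrier_vec p" using LH w by (simp add: \<gamma>_def)
    \<comment> \<open>Recentring at \<beta>: the residual at \<gamma> equals
      \<open>x - M *\<^sub>v \<delta>\<close>, so once the penalty is dropped the lower bound is an
      unpenalised problem for the noise alone.\<close>
    define \<delta> where "\<delta> = \<gamma> - \<beta>"
    have d: "\<delta> \<in> carrier_vec p" using g \<beta> by (simp add: \<delta>_def)
    define wx where "wx = M\<^sup>T *\<^sub>v (K *\<^sub>v x)"
    have wx: "wx \<in> carrier_vec p" unfolding wx_def by (intro MT Kx x)
    have yg: "y - M *\<^sub>v \<gamma> = x - M *\<^sub>v \<delta>"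
    proof -
      have "M *\<^sub>v \<delta> = M *\<^sub>v \<gamma> - M *\<^sub>v \<beta>" unfolding \<delta>_def by (rule mult_minus_distrib_mat_vec[OF M g \<beta>])
      moreover have "a + x - c = x - (c - a)" if "a \<in> carrier_vec n" "c \<in> carrier_vec n" for a c
        using that x by (intro eq_vecI) auto
      ultimately show ?thesis unfolding y_def using Mg[OF g] Mg[OF \<beta>] by simp
    qed
    have "y \<bullet> (Q_mat R M \<Omega> *\<^sub>v y) = (y - M *\<^sub>v \<gamma>) \<bullet> (K *\<^sub>v (y - M *\<^sub>v \<gamma>)) + \<gamma> \<bullet> (\<Omega> *\<^sub>v \<gamma>)"
      unfolding pen[OF g] Q using pd_complete_square(2)[OF Hpd g w \<gamma>_def] by linarith
    also have "\<dots> \<ge> x \<bullet> (K *\<^sub>v x) + (\<delta> \<bullet> (G *\<^sub>v \<delta>) - 2 * (\<delta> \<bullet> wx))"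
      unfolding yg crit[OF x d] wx_def using O(3)[OF g] by linarith
    finally have "y \<bullet> (Q_mat R M \<Omega> *\<^sub>v y) \<ge> x \<bullet> (K *\<^sub>v x) - wx \<bullet> (minv G *\<^sub>v wx)"
      using pd_complete_square(1)[OF Gpd d wx] by linarith
    moreover have "wx \<bullet> (minv G *\<^sub>v wx) = (\<Sum>j<p. (u j \<bullet> x)\<^sup>2)"
    proof -
      have "row LG j \<bullet> wx = u j \<bullet> x" if j: "j < p" for j
      proof -
        have "row LG j \<bullet> wx = (M *\<^sub>v row LG j) \<bullet> (K *\<^sub>v x)" unfolding wx_def by (rule MTx[OF rowc[OF j] Kx[OF x]])
        also have "\<dots> = x \<bullet> (K *\<^sub>v (M *\<^sub>v row LG j))" by (rule sym_mat_scalar_prod[OF K Mg[OF rowc[OF j]] x])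
        also have "\<dots> = u j \<bullet> x" unfolding u_def[symmetric] using comm_scalar_prod[OF x u[OF j]] by (simp add: u_def)
        finally show ?thesis .
      qed
      then show ?thesis unfolding wG[OF wx] by simp
    qed
    ultimately show "(M *\<^sub>v \<beta> + x) \<bullet> (Q_mat R M \<Omega> *\<^sub>v (M *\<^sub>v \<beta> + x)) \<ge> x \<bullet> (minv R *\<^sub>v x) - (\<Sum>j<p. (u j \<bullet> x)\<^sup>2)"
      by (simp add: y_def K_def)
  qed
  show ?thesis using that[OF u u1 upper lower] .
qed

section \<open>Gaussian quadratic forms\<close>

lemma prob_space_normal_measure [simp]: "prob_space (normal_measure \<mu> v)"
  by (auto simp: normal_measure_def prob_space_normal_density prob_space_return)

lemma sets_normal_measure [simp, measurable_cong]: "sets (normal_measure \<mu> v) = sets borel"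
  by (simp add: normal_measure_def)

lemma space_normal_measure [simp]: "space (normal_measure \<mu> v) = UNIV"
  by (simp add: normal_measure_def)

lemma distr_normal_measure_affine:
  assumes "v \<ge> 0"
  shows "distr (normal_measure \<mu> v) borel (\<lambda>x. a + c * x) = normal_measure (a + c * \<mu>) (c\<^sup>2 * v)"
proof (cases "v > 0 \<and> c \<noteq> 0")
  case True
  interpret prob_space "normal_measure \<mu> v" by simp
  have "distributed (normal_measure \<mu> v) lborel (\<lambda>x. x) (normal_density \<mu> (sqrt v))"
    using True by (auto simp: distributed_def normal_measure_def distr_id2)
  then have "distributed (normal_measure \<mu> v) lborel (\<lambda>x. a + c * x) (normal_density (a + c * \<mu>) (\<bar>c\<bar> * sqrt v))"
    using True by (intro normal_density_affine) auto
  then have "distr (normal_measure \<mu> v) lborel (\<lambda>x. a + c * x) = density lborel (normal_density (a + c * \<mu>) (\<bar>c\<bar> * sqrt v))"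
    by (simp add: distributed_def)
  moreover have "distr (normal_measure \<mu> v) lborel (\<lambda>x. a + c * x) = distr (normal_measure \<mu> v) borel (\<lambda>x. a + c * x)"
    by (intro distr_cong) auto
  moreover have "\<bar>c\<bar> * sqrt v = sqrt (c\<^sup>2 * v)" by (simp add: real_sqrt_mult)
  moreover have "c\<^sup>2 * v > 0" using True by simp
  ultimately show ?thesis by (simp add: normal_measure_def)
next
  case False
  then consider "v = 0" | "v > 0" "c = 0" using assms by linarith
  then show ?thesis
  proof cases
    case 1
    then show ?thesis by (simp add: normal_measure_def distr_return)
  next
    case 2
    interpret prob_space "normal_measure \<mu> v" by simp
    show ?thesis using 2 by (simp add: normal_measure_def[of a 0] distr_const)
  qed
qed

lemma normal_measure_eq_distr_std:
  assumes "v \<ge> 0"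
  shows "normal_measure \<mu> v = distr std_normal_distribution borel (\<lambda>x. \<mu> + sqrt v * x)"
  using distr_normal_measure_affine[of 1 0 \<mu> "sqrt v"] assms by (simp add: normal_measure_def)

text \<open>For complex \<open>w\<close> the real part is absorbed by completing the square, that
  is, by a real shift of the integration variable; the imaginary part is then a value of the
  characteristic function. No contour is moved.\<close>

lemma std_normal_exp_integrable: "integrable std_normal_distribution (\<lambda>x. exp (a * x))"
  and std_normal_cexp: "(CLINT x|std_normal_distribution. exp (w * complex_of_real x)) = exp (w\<^sup>2 / 2)"
proof -
  have eq: "std_normal_density x * exp (a * x) = exp (a\<^sup>2 / 2) * std_normal_density (- a + 1 * x)" for a x
  proof -
    have "- x\<^sup>2 / 2 + a * x = a\<^sup>2 / 2 + (- (- a + 1 * x)\<^sup>2 / 2)" by (simp add: power2_eq_square field_simps)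
    then show ?thesis unfolding std_normal_density_def by (simp add: exp_add[symmetric] del: minus_diff_eq)
  qed
  have i: "integrable lborel (\<lambda>x. exp (a\<^sup>2 / 2) * std_normal_density (- a + 1 * x))" for a
    proof -
    have *: "std_normal_density (- a + 1 * x) = normal_density a 1 x" for x
      by (simp add: normal_density_def)
    show ?thesis
      by (simp only: *) (intro integrable_mult_right integrable_normal_density, simp)
  qed
  show "integrable std_normal_distribution (\<lambda>x. exp (a * x))"
  proof -
    have "integrable lborel (\<lambda>x. std_normal_density x *\<^sub>R exp (a * x))"
      unfolding real_scaleR_def eq by (rule i)
    then show ?thesis by (subst integrable_density) auto
  qed
  define a b where "a = Re w" and "b = Im w"
  have w: "w = Complex a b" by (simp add: a_def b_def)
  let ?k = "complex_of_real (exp (a\<^sup>2 / 2)) * iexp (a * b)"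
  have "(CLINT x|std_normal_distribution. exp (w * complex_of_real x)) = (CLINT x|lborel. std_normal_density x *\<^sub>R exp (w * complex_of_real x))"
    by (subst integral_density) auto
  also have "\<dots> = (CLINT x|lborel. ?k * (std_normal_density (- a + 1 * x) *\<^sub>R iexp (b * (- a + 1 * x))))"
  proof (rule Bochner_Integration.integral_cong[OF refl])
    fix x :: real
    have "w * complex_of_real x = complex_of_real (a * x) + \<i> * complex_of_real (b * x)"
      by (simp add: w complex_eq_iff)
    then have 1: "exp (w * complex_of_real x) = complex_of_real (exp (a * x)) * iexp (b * x)"
      by (simp only: exp_add exp_of_real)
    have 2: "iexp (b * x) = iexp (a * b) * iexp (b * (- a + 1 * x))"
      by (simp only: exp_add[symmetric]) (simp add: algebra_simps)
    have "std_normal_density x *\<^sub>R exp (w * complex_of_real x) = complex_of_real (std_normal_density x * exp (a * x)) * iexp (b * x)"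
      unfolding 1 by (simp add: scaleR_conv_of_real)
    also have "\<dots> = ?k * (std_normal_density (- a + 1 * x) *\<^sub>R iexp (b * (- a + 1 * x)))"
      unfolding eq 2 by (simp add: scaleR_conv_of_real)
    finally show "std_normal_density x *\<^sub>R exp (w * complex_of_real x) = ?k * (std_normal_density (- a + 1 * x) *\<^sub>R iexp (b * (- a + 1 * x)))" .
  qed
  also have "\<dots> = ?k * (CLINT x|lborel. std_normal_density (- a + 1 * x) *\<^sub>R iexp (b * (- a + 1 * x)))"
    by (rule integral_mult_right_zero)
  also have "(CLINT x|lborel. std_normal_density (- a + 1 * x) *\<^sub>R iexp (b * (- a + 1 * x))) = (CLINT x|lborel. std_normal_density x *\<^sub>R iexp (b * x))"
    using lborel_integral_real_affine[of 1 "\<lambda>x. std_normal_density x *\<^sub>R iexp (b * x)" "- a"] by simp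
  also have "\<dots> = char std_normal_distribution b"
    unfolding char_def by (subst integral_density) auto
  also have "\<dots> = complex_of_real (exp (- (b\<^sup>2) / 2))" by (simp only: char_std_normal_distribution)
  also have "?k * complex_of_real (exp (- (b\<^sup>2) / 2)) = exp (w\<^sup>2 / 2)"
  proof -
    have "w\<^sup>2 / 2 = complex_of_real (a\<^sup>2 / 2) + \<i> * complex_of_real (a * b) + complex_of_real (- (b\<^sup>2) / 2)"
      by (simp add: w complex_eq_iff power2_eq_square field_simps)
    then show ?thesis by (simp only: exp_add exp_of_real)
  qed
  finally show "(CLINT x|std_normal_distribution. exp (w * complex_of_real x)) = exp (w\<^sup>2 / 2)" .
qed

lemma normal_exp_integrable: "v \<ge> 0 \<Longrightarrow> integrable (normal_measure 0 v) (\<lambda>x. exp (a * x))"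
  using std_normal_exp_integrable[of "a * sqrt v"]
  by (subst normal_measure_eq_distr_std) (auto simp: integrable_distr_eq mult.assoc)

lemma normal_cexp: "v \<ge> 0 \<Longrightarrow> (CLINT x|normal_measure 0 v. exp (w * complex_of_real x)) = exp (w\<^sup>2 * v / 2)"
  using std_normal_cexp[of "w * sqrt v"]
  by (subst normal_measure_eq_distr_std) (auto simp: integral_distr mult.assoc power_mult_distrib simp flip: of_real_power)

lemma normal_rexp: "v \<ge> 0 \<Longrightarrow> (LINT x|normal_measure 0 v. exp (a * x)) = exp (a\<^sup>2 * v / 2)"
proof -
  assume v: "v \<ge> 0"
  have "complex_of_real (LINT x|normal_measure 0 v. exp (a * x)) = (CLINT x|normal_measure 0 v. exp (complex_of_real a * complex_of_real x))"
    by (simp only: of_real_mult[symmetric] exp_of_real integral_complex_of_real)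
  also have "\<dots> = complex_of_real (exp (a\<^sup>2 * v / 2))"
  proof -
    have "(complex_of_real a)\<^sup>2 * complex_of_real v / 2 = complex_of_real (a\<^sup>2 * v / 2)" by simp
    then show ?thesis unfolding normal_cexp[OF v] by (simp only: exp_of_real)
  qed
  finally show ?thesis using of_real_eq_iff by blast
qed

text \<open>The law of \<open>Z\<close> enters only through its linear combinations: integrating
  \<open>exp (w * (\<Sum>k<n. x k * Z k))\<close> over an independent standard normal vector \<open>x\<close> produces the
  exponential of the quadratic form, and the two integrations may be interchanged.\<close>

abbreviation std_normal_product :: "nat \<Rightarrow> (nat \<Rightarrow> real) measure" where
  "std_normal_product n \<equiv> \<Pi>\<^sub>M i\<in>{..<n}. std_normal_distribution"

lemma real_distribution_std_normal: "real_distribution std_normal_distribution"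
  unfolding real_distribution_def real_distribution_axioms_def
  by (simp add: prob_space_normal_density)

lemma prob_space_std_normal_product: "prob_space (std_normal_product n)"
  by (intro prob_space_PiM) (simp add: prob_space_normal_density)

lemma std_normal_product_exp_linear:
  "integrable (std_normal_product n) (\<lambda>x. \<Prod>k<n. exp (w * complex_of_real (z k) * complex_of_real (x k)))"
  "(CLINT x|std_normal_product n. (\<Prod>k<n. exp (w * complex_of_real (z k) * complex_of_real (x k)))) = exp (w\<^sup>2 / 2 * complex_of_real (\<Sum>k<n. (z k)\<^sup>2))"
proof -
  interpret std: prob_space std_normal_distribution by (simp add: prob_space_normal_density)
  interpret product_sigma_finite "\<lambda>_::nat. std_normal_distribution" by standard
  have i: "integrable std_normal_distribution (\<lambda>x. exp (c * complex_of_real x))" for c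
  proof (rule Bochner_Integration.integrable_bound[OF std_normal_exp_integrable[of "Re c"]])
    have "(\<lambda>x. exp (c * complex_of_real x)) \<in> borel_measurable borel"
      by (intro borel_measurable_continuous_onI continuous_intros)
    then show "(\<lambda>x. exp (c * complex_of_real x)) \<in> borel_measurable std_normal_distribution" by simp
  qed (auto simp: norm_exp_eq_Re)
  show "integrable (std_normal_product n) (\<lambda>x. \<Prod>k<n. exp (w * complex_of_real (z k) * complex_of_real (x k)))"
    by (rule product_integrable_prod) (auto intro: i)
  have "(CLINT x|std_normal_product n. (\<Prod>k<n. exp (w * complex_of_real (z k) * complex_of_real (x k))))
     = (\<Prod>k<n. CLINT x|std_normal_distribution. exp (w * complex_of_real (z k) * complex_of_real x))"
    by (rule product_integral_prod) (auto intro: i)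
  also have "\<dots> = (\<Prod>k<n. exp ((w * complex_of_real (z k))\<^sup>2 / 2))"
    by (simp only: std_normal_cexp)
  also have "\<dots> = exp (\<Sum>k<n. (w * complex_of_real (z k))\<^sup>2 / 2)"
    by (simp add: exp_sum)
  also have "(\<Sum>k<n. (w * complex_of_real (z k))\<^sup>2 / 2) = w\<^sup>2 / 2 * complex_of_real (\<Sum>k<n. (z k)\<^sup>2)"
    by (simp add: sum_distrib_left power_mult_distrib)
  finally show "(CLINT x|std_normal_product n. (\<Prod>k<n. exp (w * complex_of_real (z k) * complex_of_real (x k)))) = exp (w\<^sup>2 / 2 * complex_of_real (\<Sum>k<n. (z k)\<^sup>2))" .
qed

lemma measurable_std_normal_product [measurable]: "k < n \<Longrightarrow> (\<lambda>x. x k) \<in> std_normal_product n \<rightarrow>\<^sub>M borel"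
  using measurable_component_singleton[of k "{..<n}" "\<lambda>_. std_normal_distribution"]
  by (simp cong: measurable_cong_sets)

lemma std_normal_exp_square:
  assumes s: "s < 1 / 2"
  shows "(\<integral>\<^sup>+ x. ennreal (exp (s * x\<^sup>2)) \<partial>std_normal_distribution) = ennreal (1 / sqrt (1 - 2 * s))"
proof -
  define v where "v = 1 / (1 - 2 * s)"
  have v: "v > 0" using s by (simp add: v_def)
  have eq: "std_normal_density x * exp (s * x\<^sup>2) = sqrt v * normal_density 0 (sqrt v) x" for x
  proof -
    have "- x\<^sup>2 / 2 + s * x\<^sup>2 = - (x - 0)\<^sup>2 / (2 * (sqrt v)\<^sup>2)"
      using s by (simp add: v_def field_simps)
    moreover have "1 / sqrt (2 * pi) = sqrt v * (1 / sqrt (2 * (pi * (sqrt v)\<^sup>2)))"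
      using v by (simp add: real_sqrt_mult)
    moreover have "std_normal_density x * exp (s * x\<^sup>2) = 1 / sqrt (2 * pi) * exp (- x\<^sup>2 / 2 + s * x\<^sup>2)"
      by (simp only: std_normal_density_def exp_add mult.assoc)
    ultimately show ?thesis by (simp only: normal_density_def mult.assoc)
  qed
  have "(\<integral>\<^sup>+ x. ennreal (exp (s * x\<^sup>2)) \<partial>std_normal_distribution) = (\<integral>\<^sup>+ x. ennreal (std_normal_density x * exp (s * x\<^sup>2)) \<partial>lborel)"
    by (subst nn_integral_density) (auto simp: ennreal_mult)
  also have "\<dots> = (\<integral>\<^sup>+ x. ennreal (sqrt v) * ennreal (normal_density 0 (sqrt v) x) \<partial>lborel)"
    unfolding eq using v by (simp add: ennreal_mult)
  also have "\<dots> = ennreal (sqrt v) * (\<integral>\<^sup>+ x. ennreal (normal_density 0 (sqrt v) x) \<partial>lborel)"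
    by (rule nn_integral_cmult) auto
  also have "(\<integral>\<^sup>+ x. ennreal (normal_density 0 (sqrt v) x) \<partial>lborel) = ennreal 1"
    using v by (subst nn_integral_eq_integral) auto
  finally show ?thesis by (simp add: v_def real_sqrt_divide)
qed

lemma std_normal_product_exp_square:
  assumes s: "s < 1 / 2"
  shows "(\<integral>\<^sup>+ x. ennreal (exp (s * (\<Sum>k<n. (x k)\<^sup>2))) \<partial>std_normal_product n) = ennreal ((1 / sqrt (1 - 2 * s)) ^ n)"
proof -
  interpret std: prob_space std_normal_distribution by (simp add: prob_space_normal_density)
  interpret product_sigma_finite "\<lambda>_::nat. std_normal_distribution" by standard
  have "(\<integral>\<^sup>+ x. ennreal (exp (s * (\<Sum>k<n. (x k)\<^sup>2))) \<partial>std_normal_product n) = (\<integral>\<^sup>+ x. (\<Prod>k<n. ennreal (exp (s * (x k)\<^sup>2))) \<partial>std_normal_product n)"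
    by (intro nn_integral_cong) (simp add: sum_distrib_left exp_sum prod_ennreal)
  also have "\<dots> = (\<Prod>k<n. \<integral>\<^sup>+ x. ennreal (exp (s * x\<^sup>2)) \<partial>std_normal_distribution)"
    by (rule product_nn_integral_prod) auto
  also have "\<dots> = ennreal ((1 / sqrt (1 - 2 * s)) ^ n)"
    unfolding std_normal_exp_square[OF s] using s by (simp add: ennreal_power)
  finally show ?thesis .
qed

text \<open>A standard normal vector in Cramer-Wold form. This is the form that a Gaussian process
  delivers; independence of the coordinates is not stated.\<close>

locale gaussian_coords = prob_space +
  fixes n :: nat and Z :: "nat \<Rightarrow> 'a \<Rightarrow> real"
  assumes Z_measurable [measurable]: "k < n \<Longrightarrow> Z k \<in> borel_measurable M"
    and Z_linear: "distr M borel (\<lambda>w. \<Sum>k<n. c k * Z k w) = normal_measure 0 (\<Sum>k<n. (c k)\<^sup>2)"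
begin

lemma exp_linear:
  "integrable M (\<lambda>w. exp (a * (\<Sum>k<n. c k * Z k w)))"
  "expectation (\<lambda>w. exp (a * (\<Sum>k<n. c k * Z k w))) = exp (a\<^sup>2 * (\<Sum>k<n. (c k)\<^sup>2) / 2)"
  "(CLINT w|M. exp (b * complex_of_real (\<Sum>k<n. c k * Z k w))) = exp (b\<^sup>2 * complex_of_real (\<Sum>k<n. (c k)\<^sup>2) / 2)"
proof -
  have [measurable]: "(\<lambda>w. \<Sum>k<n. c k * Z k w) \<in> borel_measurable M" by measurable
  have v: "(\<Sum>k<n. (c k)\<^sup>2) \<ge> 0" by (simp add: sum_nonneg)
  have [measurable]: "(\<lambda>x::real. exp (b * complex_of_real x)) \<in> borel_measurable borel"
    by (intro borel_measurable_continuous_onI continuous_intros)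
  show "integrable M (\<lambda>w. exp (a * (\<Sum>k<n. c k * Z k w)))"
    using normal_exp_integrable[OF v, of a] unfolding Z_linear[symmetric] by (subst (asm) integrable_distr_eq) auto
  show "expectation (\<lambda>w. exp (a * (\<Sum>k<n. c k * Z k w))) = exp (a\<^sup>2 * (\<Sum>k<n. (c k)\<^sup>2) / 2)"
    using normal_rexp[OF v, of a] unfolding Z_linear[symmetric] by (subst (asm) integral_distr) auto
  show "(CLINT w|M. exp (b * complex_of_real (\<Sum>k<n. c k * Z k w))) = exp (b\<^sup>2 * complex_of_real (\<Sum>k<n. (c k)\<^sup>2) / 2)"
    using normal_cexp[OF v, of b] unfolding Z_linear[symmetric] by (subst (asm) integral_distr) auto
qed

text \<open>The modulus of the linear exponential depends on \<open>Re b\<close> alone, and its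
  double integral is finite because \<open>(Re b)\<^sup>2 / 2\<close> is below the critical value
  1/2 for squares of standard normals; this justifies Fubini. Since \<open>b\<close> may be complex,
  \<open>b\<^sup>2 / 2\<close> can be a negative real number or a small imaginary one: the first
  gives lower tails, the second characteristic functions.\<close>

lemma hubbard_stratonovich:
  assumes w: "(Re b)\<^sup>2 < 1"
  shows "(CLINT w|M. exp (b\<^sup>2 / 2 * complex_of_real (\<Sum>k<n. (Z k w)\<^sup>2)))
       = (CLINT x|std_normal_product n. exp (b\<^sup>2 / 2 * complex_of_real (\<Sum>k<n. (x k)\<^sup>2)))"
proof -
  let ?N = "std_normal_product n"
  interpret N: prob_space ?N by (rule prob_space_std_normal_product)
  note sigma_M = sigma_finite_measure_axioms
  interpret pair_sigma_finite ?N M ..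
  define L where "L = (\<lambda>x w. \<Sum>k<n. x k * Z k w)"
  have [measurable]: "case_prod L \<in> borel_measurable (?N \<Otimes>\<^sub>M M)"
    unfolding L_def by measurable
  have [measurable]: "(\<lambda>x::real. exp (b * complex_of_real x)) \<in> borel_measurable borel"
    by (intro borel_measurable_continuous_onI continuous_intros)
  have meas: "(\<lambda>(x, w). exp (b * complex_of_real (L x w))) \<in> borel_measurable (?N \<Otimes>\<^sub>M M)"
    by measurable
  have int: "integrable (?N \<Otimes>\<^sub>M M) (\<lambda>(x, w). exp (b * complex_of_real (L x w)))"
  proof (rule integrableI_bounded[OF meas])
    have "(\<integral>\<^sup>+ p. ennreal (norm (case p of (x, w) \<Rightarrow> exp (b * complex_of_real (L x w)))) \<partial>(?N \<Otimes>\<^sub>M M))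
       = (\<integral>\<^sup>+ x. (\<integral>\<^sup>+ w. ennreal (exp (Re b * L x w)) \<partial>M) \<partial>?N)"
    proof -
      have "(\<lambda>p. ennreal (norm (case p of (x, w) \<Rightarrow> exp (b * complex_of_real (L x w))))) \<in> borel_measurable (?N \<Otimes>\<^sub>M M)"
        using meas by measurable
      from sigma_finite_measure.nn_integral_fst[OF sigma_M this]
      show ?thesis by (simp add: norm_exp_eq_Re)
    qed
    also have "\<dots> = (\<integral>\<^sup>+ x. ennreal (exp ((Re b)\<^sup>2 / 2 * (\<Sum>k<n. (x k)\<^sup>2))) \<partial>?N)"
    proof (intro nn_integral_cong)
      fix x
      have "(\<integral>\<^sup>+ w. ennreal (exp (Re b * L x w)) \<partial>M) = ennreal (expectation (\<lambda>w. exp (Re b * L x w)))"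
        unfolding L_def by (intro nn_integral_eq_integral exp_linear) auto
      then show "(\<integral>\<^sup>+ w. ennreal (exp (Re b * L x w)) \<partial>M) = ennreal (exp ((Re b)\<^sup>2 / 2 * (\<Sum>k<n. (x k)\<^sup>2)))"
        unfolding L_def exp_linear by simp
    qed
    also have "\<dots> < \<infinity>" using w by (subst std_normal_product_exp_square) auto
    finally show "(\<integral>\<^sup>+ p. ennreal (norm (case p of (x, w) \<Rightarrow> exp (b * complex_of_real (L x w)))) \<partial>(?N \<Otimes>\<^sub>M M)) < \<infinity>" .
  qed
  have "(CLINT w|M. exp (b\<^sup>2 / 2 * complex_of_real (\<Sum>k<n. (Z k w)\<^sup>2))) = (CLINT w|M. (CLINT x|?N. exp (b * complex_of_real (L x w))))"
  proof (intro Bochner_Integration.integral_cong refl)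
    fix w
    have "(CLINT x|?N. exp (b * complex_of_real (L x w))) = (CLINT x|?N. (\<Prod>k<n. exp (b * complex_of_real (Z k w) * complex_of_real (x k))))"
      by (simp add: L_def exp_sum[symmetric] sum_distrib_left mult_ac)
    then show "exp (b\<^sup>2 / 2 * complex_of_real (\<Sum>k<n. (Z k w)\<^sup>2)) = (CLINT x|?N. exp (b * complex_of_real (L x w)))"
      by (simp only: std_normal_product_exp_linear)
  qed
  also have "\<dots> = (CLINT x|?N. (CLINT w|M. exp (b * complex_of_real (L x w))))"
    by (rule Fubini_integral[OF int])
  also have "\<dots> = (CLINT x|?N. exp (b\<^sup>2 / 2 * complex_of_real (\<Sum>k<n. (x k)\<^sup>2)))"
    unfolding L_def exp_linear by simp
  finally show ?thesis .
qed

end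

text \<open>The left side is the exponential moment of a centred squared standard normal variable;
  the second-order bound for \<open>ln (1 - 2 * s)\<close> makes it sub-Gaussian for small
  \<open>s\<close>.\<close>

lemma exp_div_sqrt_le:
  fixes s :: real
  assumes "\<bar>s\<bar> \<le> 1 / 4"
  shows "exp (- s) / sqrt (1 - 2 * s) \<le> exp (4 * s\<^sup>2)"
proof -
  have p: "1 - 2 * s > 0" using assms by (auto simp: abs_le_iff)
  have "- ln (1 + (- 2 * s)) \<le> 2 * s + 2 * (2 * s)\<^sup>2"
  proof -
    have "\<bar>- 2 * s\<bar> \<le> 1 / 2" using assms by (simp add: abs_mult)
    from abs_ln_one_plus_x_minus_x_bound[OF this] show ?thesis by (simp add: abs_le_iff)
  qed
  then have "- s - ln (1 - 2 * s) / 2 \<le> 4 * s\<^sup>2" by (simp add: power2_eq_square)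
  then have "exp (- s - ln (1 - 2 * s) / 2) \<le> exp (4 * s\<^sup>2)" by simp
  moreover have "exp (- s - ln (1 - 2 * s) / 2) = exp (- s) / sqrt (1 - 2 * s)"
    using p by (simp add: exp_diff ln_sqrt[symmetric])
  ultimately show ?thesis by simp
qed

text \<open>The moment is a nonnegative integral, so that a bound for it can be used without proving
  integrability beforehand.\<close>

lemma (in prob_space) exponential_markov:
  assumes [measurable]: "F \<in> borel_measurable M" and c: "c \<ge> 0"
    and le: "(\<integral>\<^sup>+ w. ennreal (exp (F w)) \<partial>M) \<le> ennreal c"
  shows "prob {w\<in>space M. F w \<ge> t} \<le> c * exp (- t)"
proof -
  have "emeasure M {w\<in>space M. F w \<ge> t} \<le> emeasure M {w\<in>space M. 1 \<le> ennreal (exp (- t)) * ennreal (exp (F w))}"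
  proof (intro emeasure_mono subsetI)
    fix w assume "w \<in> {w\<in>space M. F w \<ge> t}"
    then have "w \<in> space M" "1 \<le> exp (- t) * exp (F w)" by (auto simp: exp_add[symmetric])
    then show "w \<in> {w\<in>space M. 1 \<le> ennreal (exp (- t)) * ennreal (exp (F w))}"
      by (simp add: ennreal_mult[symmetric])
  qed measurable
  also have "\<dots> \<le> ennreal (exp (- t)) * (\<integral>\<^sup>+ w. ennreal (exp (F w)) * indicator (space M) w \<partial>M)"
    by (rule nn_integral_Markov_inequality) auto
  also have "(\<integral>\<^sup>+ w. ennreal (exp (F w)) * indicator (space M) w \<partial>M) = (\<integral>\<^sup>+ w. ennreal (exp (F w)) \<partial>M)"
    by (intro nn_integral_cong) auto
  also have "ennreal (exp (- t)) * \<dots> \<le> ennreal (exp (- t)) * ennreal c" by (intro mult_left_mono le) auto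
  also have "\<dots> = ennreal (c * exp (- t))" using c by (simp add: ennreal_mult mult.commute)
  finally show ?thesis using c by (simp add: emeasure_eq_measure)
qed

context gaussian_coords
begin

lemma sum_square_measurable [measurable]: "(\<lambda>w. \<Sum>k<n. (Z k w)\<^sup>2) \<in> borel_measurable M"
  by measurable

text \<open>For nonnegative \<open>s\<close> the linearising coefficient \<open>sqrt (2 * s)\<close>
  is real, so all integrands are nonnegative and Tonelli applies before finiteness of the moment is
  known.\<close>

lemma sum_square_exp_nonneg:
  assumes s: "0 \<le> s" "s < 1 / 2"
  shows "(\<integral>\<^sup>+ w. ennreal (exp (s * (\<Sum>k<n. (Z k w)\<^sup>2))) \<partial>M) = ennreal ((1 / sqrt (1 - 2 * s)) ^ n)"
proof -
  let ?N = "std_normal_product n"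
  interpret std: prob_space std_normal_distribution by (simp add: prob_space_normal_density)
  interpret PS: product_sigma_finite "\<lambda>_::nat. std_normal_distribution" by standard
  interpret N: prob_space ?N by (rule prob_space_std_normal_product)
  interpret pair_sigma_finite ?N M ..
  define a where "a = sqrt (2 * s)"
  have a2: "a\<^sup>2 = 2 * s" using s by (simp add: a_def)
  have one: "(\<integral>\<^sup>+ x. ennreal (exp (c * x)) \<partial>std_normal_distribution) = ennreal (exp (c\<^sup>2 / 2))" for c
    using normal_rexp[of 1 c] std_normal_exp_integrable[of c]
    by (subst nn_integral_eq_integral) (auto simp: normal_measure_def)
  have inner: "(\<integral>\<^sup>+ x. ennreal (exp (a * (\<Sum>k<n. x k * Z k w))) \<partial>?N) = ennreal (exp (s * (\<Sum>k<n. (Z k w)\<^sup>2)))" for w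
  proof -
    have "(\<integral>\<^sup>+ x. ennreal (exp (a * (\<Sum>k<n. x k * Z k w))) \<partial>?N) = (\<integral>\<^sup>+ x. (\<Prod>k<n. ennreal (exp (a * Z k w * x k))) \<partial>?N)"
      by (intro nn_integral_cong) (simp add: sum_distrib_left exp_sum prod_ennreal mult_ac)
    also have "\<dots> = (\<Prod>k<n. \<integral>\<^sup>+ x. ennreal (exp (a * Z k w * x)) \<partial>std_normal_distribution)"
      by (rule PS.product_nn_integral_prod) auto
    also have "\<dots> = ennreal (\<Prod>k<n. exp ((a * Z k w)\<^sup>2 / 2))" unfolding one by (simp add: prod_ennreal)
    also have "(\<Prod>k<n. exp ((a * Z k w)\<^sup>2 / 2)) = exp (s * (\<Sum>k<n. (Z k w)\<^sup>2))"
      by (simp add: power_mult_distrib a2 sum_distrib_left exp_sum)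
    finally show ?thesis .
  qed
  have "(\<integral>\<^sup>+ w. ennreal (exp (s * (\<Sum>k<n. (Z k w)\<^sup>2))) \<partial>M) = (\<integral>\<^sup>+ w. (\<integral>\<^sup>+ x. ennreal (exp (a * (\<Sum>k<n. x k * Z k w))) \<partial>?N) \<partial>M)"
    by (simp only: inner)
  also have "\<dots> = (\<integral>\<^sup>+ x. (\<integral>\<^sup>+ w. ennreal (exp (a * (\<Sum>k<n. x k * Z k w))) \<partial>M) \<partial>?N)"
    by (rule Fubini') measurable
  also have "\<dots> = (\<integral>\<^sup>+ x. ennreal (exp (s * (\<Sum>k<n. (x k)\<^sup>2))) \<partial>?N)"
  proof (intro nn_integral_cong)
    fix x
    have "(\<integral>\<^sup>+ w. ennreal (exp (a * (\<Sum>k<n. x k * Z k w))) \<partial>M) = ennreal (expectation (\<lambda>w. exp (a * (\<Sum>k<n. x k * Z k w))))"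
      by (intro nn_integral_eq_integral exp_linear) auto
    then show "(\<integral>\<^sup>+ w. ennreal (exp (a * (\<Sum>k<n. x k * Z k w))) \<partial>M) = ennreal (exp (s * (\<Sum>k<n. (x k)\<^sup>2)))"
      unfolding exp_linear a2 by simp
  qed
  also have "\<dots> = ennreal ((1 / sqrt (1 - 2 * s)) ^ n)" by (rule std_normal_product_exp_square[OF s(2)])
  finally show ?thesis .
qed

text \<open>For negative \<open>s\<close> the linearising coefficient is purely imaginary, so the
  complex form is needed; its restriction on \<open>Re b\<close> is trivially met.\<close>

lemma sum_square_exp_nonpos:
  assumes s: "s \<le> 0"
  shows "(\<integral>\<^sup>+ w. ennreal (exp (s * (\<Sum>k<n. (Z k w)\<^sup>2))) \<partial>M) = ennreal ((1 / sqrt (1 - 2 * s)) ^ n)"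
proof -
  let ?N = "std_normal_product n"
  interpret N: prob_space ?N by (rule prob_space_std_normal_product)
  define b where "b = \<i> * complex_of_real (sqrt (- 2 * s))"
  have b2: "b\<^sup>2 / 2 = complex_of_real s"
    using s by (simp add: b_def power_mult_distrib flip: of_real_power)
  have b1: "(Re b)\<^sup>2 < 1" by (simp add: b_def)
  have c: "exp (complex_of_real s * complex_of_real y) = complex_of_real (exp (s * y))" for y
    by (simp only: of_real_mult[symmetric] exp_of_real)
  have [measurable]: "(\<lambda>x. \<Sum>k<n. (x k)\<^sup>2) \<in> borel_measurable ?N" by measurable
  have le1: "exp (s * (\<Sum>k<n. (y k)\<^sup>2)) \<le> 1" for y :: "nat \<Rightarrow> real"
    using s by (simp add: mult_nonpos_nonneg sum_nonneg)
  have iM: "integrable M (\<lambda>w. exp (s * (\<Sum>k<n. (Z k w)\<^sup>2)))"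
    by (rule integrable_const_bound[of _ 1]) (use le1 in auto)
  have iN: "integrable ?N (\<lambda>x. exp (s * (\<Sum>k<n. (x k)\<^sup>2)))"
    by (rule N.integrable_const_bound[of _ 1]) (use le1 in auto)
  have "complex_of_real (expectation (\<lambda>w. exp (s * (\<Sum>k<n. (Z k w)\<^sup>2)))) = complex_of_real (LINT x|?N. exp (s * (\<Sum>k<n. (x k)\<^sup>2)))"
    using hubbard_stratonovich[OF b1] unfolding b2 c integral_complex_of_real .
  then have eq: "expectation (\<lambda>w. exp (s * (\<Sum>k<n. (Z k w)\<^sup>2))) = (LINT x|?N. exp (s * (\<Sum>k<n. (x k)\<^sup>2)))"
    using of_real_eq_iff by blast
  have "(\<integral>\<^sup>+ w. ennreal (exp (s * (\<Sum>k<n. (Z k w)\<^sup>2))) \<partial>M) = (\<integral>\<^sup>+ x. ennreal (exp (s * (\<Sum>k<n. (x k)\<^sup>2))) \<partial>?N)"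
    by (subst nn_integral_eq_integral[OF iM], simp, subst nn_integral_eq_integral[OF iN], simp, simp only: eq)
  also have "\<dots> = ennreal ((1 / sqrt (1 - 2 * s)) ^ n)" using s by (intro std_normal_product_exp_square) auto
  finally show ?thesis .
qed

text \<open>Chernoff bounds with \<open>s\<close> equal to plus or minus
  \<open>1 / (4 * sqrt n)\<close>. At this size the centred exponential moment stays below
  \<open>exp (1 / 4)\<close>, while a deviation of \<open>12 * sqrt n * ln n\<close> produces the
  exponent \<open>3 * ln n\<close>, more than enough for summability.\<close>

lemma sum_square_deviation:
  assumes n: "n \<ge> 2"
  shows "prob {w\<in>space M. \<bar>(\<Sum>k<n. (Z k w)\<^sup>2) - real n\<bar> \<ge> 12 * (sqrt (real n) * ln (real n))} \<le> 2 * exp 1 / (real n)\<^sup>2"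
proof -
  define S where "S = (\<lambda>w. \<Sum>k<n. (Z k w)\<^sup>2)"
  have [measurable]: "S \<in> borel_measurable M" unfolding S_def by measurable
  have tail: "prob {w\<in>space M. s * (S w - real n) \<ge> 3 * ln (real n)} \<le> exp 1 / (real n)\<^sup>2"
    if s: "\<bar>s\<bar> = 1 / (4 * sqrt (real n))" for s
  proof -
    have s4: "\<bar>s\<bar> \<le> 1 / 4" unfolding s using n by (intro divide_left_mono) auto
    have s2: "real n * (4 * s\<^sup>2) = 1 / 4"
    proof -
      have "s\<^sup>2 = (1 / (4 * sqrt (real n)))\<^sup>2" using s by (metis power2_abs)
      then show ?thesis using n by (simp add: power_divide power_mult_distrib)
    qed
    have p: "1 - 2 * s > 0" using s4 by (auto simp: abs_le_iff)
    have "(\<integral>\<^sup>+ w. ennreal (exp (s * (S w - real n))) \<partial>M) = (\<integral>\<^sup>+ w. ennreal (exp (- s * real n)) * ennreal (exp (s * S w)) \<partial>M)"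
      by (intro nn_integral_cong) (simp add: ennreal_mult[symmetric] exp_add[symmetric] algebra_simps)
    also have "\<dots> = ennreal (exp (- s * real n)) * (\<integral>\<^sup>+ w. ennreal (exp (s * S w)) \<partial>M)"
      by (rule nn_integral_cmult) measurable
    also have "(\<integral>\<^sup>+ w. ennreal (exp (s * S w)) \<partial>M) = ennreal ((1 / sqrt (1 - 2 * s)) ^ n)"
      unfolding S_def using sum_square_exp_nonneg[of s] sum_square_exp_nonpos[of s] s4 by (cases "s \<ge> 0") auto
    also have "ennreal (exp (- s * real n)) * ennreal ((1 / sqrt (1 - 2 * s)) ^ n) = ennreal ((exp (- s) / sqrt (1 - 2 * s)) ^ n)"
      using p by (simp add: ennreal_mult[symmetric] power_divide exp_of_nat_mult[symmetric] mult.commute)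
    also have "\<dots> \<le> ennreal (exp (4 * s\<^sup>2) ^ n)"
      using exp_div_sqrt_le[OF s4] p by (intro ennreal_leI power_mono) auto
    also have "exp (4 * s\<^sup>2) ^ n = exp (1 / 4)"
      by (simp only: exp_of_nat_mult[symmetric] s2)
    finally have "prob {w\<in>space M. s * (S w - real n) \<ge> 3 * ln (real n)} \<le> exp (1 / 4) * exp (- (3 * ln (real n)))"
      by (intro exponential_markov) auto
    also have "\<dots> \<le> exp 1 * exp (- (2 * ln (real n)))" using n by (intro mult_mono) auto
    also have "exp (- (2 * ln (real n))) = 1 / (real n)\<^sup>2"
    proof -
      have "exp (2 * ln (real n)) = exp (ln (real n)) * exp (ln (real n))" by (simp only: mult_2 exp_add)
      then show ?thesis using n by (simp add: exp_minus inverse_eq_divide power2_eq_square)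
    qed
    finally show ?thesis by simp
  qed
  define s where "s = 1 / (4 * sqrt (real n))"
  have s: "s > 0" "s * (12 * (sqrt (real n) * ln (real n))) = 3 * ln (real n)" using n by (auto simp: s_def)
  have "{w\<in>space M. \<bar>S w - real n\<bar> \<ge> 12 * (sqrt (real n) * ln (real n))}
     \<subseteq> {w\<in>space M. s * (S w - real n) \<ge> 3 * ln (real n)} \<union> {w\<in>space M. (- s) * (S w - real n) \<ge> 3 * ln (real n)}"
  proof
    fix w assume w: "w \<in> {w\<in>space M. \<bar>S w - real n\<bar> \<ge> 12 * (sqrt (real n) * ln (real n))}"
    then have "s * \<bar>S w - real n\<bar> \<ge> s * (12 * (sqrt (real n) * ln (real n)))" using s by (intro mult_left_mono) auto
    then have "s * \<bar>S w - real n\<bar> \<ge> 3 * ln (real n)" unfolding s(2) .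
    then show "w \<in> {w\<in>space M. s * (S w - real n) \<ge> 3 * ln (real n)} \<union> {w\<in>space M. (- s) * (S w - real n) \<ge> 3 * ln (real n)}"
    proof (cases "S w - real n \<ge> 0")
      case True
      then show ?thesis using \<open>s * \<bar>S w - real n\<bar> \<ge> 3 * ln (real n)\<close> w by simp
    next
      case False
      then have "(- s) * (S w - real n) = s * \<bar>S w - real n\<bar>" by (simp add: abs_if algebra_simps)
      then show ?thesis using \<open>s * \<bar>S w - real n\<bar> \<ge> 3 * ln (real n)\<close> w by (simp only: mem_Collect_eq Un_iff) simp
    qed
  qed
  then have "prob {w\<in>space M. \<bar>S w - real n\<bar> \<ge> 12 * (sqrt (real n) * ln (real n))}
     \<le> prob ({w\<in>space M. s * (S w - real n) \<ge> 3 * ln (real n)} \<union> {w\<in>space M. (- s) * (S w - real n) \<ge> 3 * ln (real n)})"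
    by (intro finite_measure_mono) measurable
  also have "\<dots> \<le> prob {w\<in>space M. s * (S w - real n) \<ge> 3 * ln (real n)} + prob {w\<in>space M. (- s) * (S w - real n) \<ge> 3 * ln (real n)}"
    by (intro measure_Un_le) measurable
  also have "\<dots> \<le> exp 1 / (real n)\<^sup>2 + exp 1 / (real n)\<^sup>2"
    using s(1) by (intro add_mono tail) (auto simp: s_def)
  finally show ?thesis by (simp add: S_def)
qed

text \<open>The quadratic form has the characteristic function of a sum of independent centred
  squares, though the coordinates are known only through linear combinations. The range of
  \<open>t\<close> is small but sufficient, since the central limit theorem evaluates at
  \<open>t / sqrt n\<close>.\<close>

lemma char_sum_square:
  assumes t: "\<bar>t\<bar> < 1"
  shows "char (distr M borel (\<lambda>w. (\<Sum>k<n. (Z k w)\<^sup>2) - real n)) t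
       = char (distr std_normal_distribution borel (\<lambda>x. x\<^sup>2 - 1)) t ^ n"
proof -
  let ?N = "std_normal_product n"
  interpret std: prob_space std_normal_distribution by (simp add: prob_space_normal_density)
  interpret PS: product_sigma_finite "\<lambda>_::nat. std_normal_distribution" by standard
  \<comment> \<open>A square root of twice the imaginary number \<open>\<i> * t\<close>. Its real
    part is \<open>sqrt \<bar>t\<bar>\<close>, which is where the bound on \<open>t\<close> comes
    from.\<close>
  define b where "b = complex_of_real (sqrt \<bar>t\<bar>) * (1 + \<i> * complex_of_real (sgn t))"
  have b2: "b\<^sup>2 / 2 = \<i> * complex_of_real t"
  proof -
    have "(1 + \<i> * complex_of_real (sgn t))\<^sup>2 = 2 * \<i> * complex_of_real (sgn t)" if "t \<noteq> 0"
      using that by (auto simp: power2_eq_square sgn_if algebra_simps)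
    moreover have "(complex_of_real (sqrt \<bar>t\<bar>))\<^sup>2 = complex_of_real \<bar>t\<bar>" by (simp flip: of_real_power)
    ultimately show ?thesis by (cases "t = 0") (auto simp: b_def power_mult_distrib sgn_if)
  qed
  have b1: "(Re b)\<^sup>2 < 1" using t by (simp add: b_def)
  have [measurable]: "(\<lambda>x. iexp (t * x)) \<in> borel_measurable borel" for t
    by (intro borel_measurable_continuous_onI continuous_intros)
  have ci: "integrable std_normal_distribution (\<lambda>x. iexp (t * f x))" if [measurable]: "f \<in> borel_measurable borel" for f
    by (rule std.integrable_const_bound[of _ 1]) (auto simp: norm_exp_eq_Re)
  have shift: "exp (\<i> * complex_of_real t * complex_of_real y) * iexp (t * (- c)) = iexp (t * (y - c))" for y c
    by (simp only: exp_add[symmetric]) (simp add: algebra_simps)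
  have "char (distr M borel (\<lambda>w. (\<Sum>k<n. (Z k w)\<^sup>2) - real n)) t = (CLINT w|M. iexp (t * ((\<Sum>k<n. (Z k w)\<^sup>2) - real n)))"
    unfolding char_def by (subst integral_distr) auto
  also have "\<dots> = (CLINT w|M. exp (b\<^sup>2 / 2 * complex_of_real (\<Sum>k<n. (Z k w)\<^sup>2))) * iexp (t * (- real n))"
    unfolding b2 shift[symmetric] by (rule integral_mult_left_zero)
  also have "\<dots> = (CLINT x|?N. exp (b\<^sup>2 / 2 * complex_of_real (\<Sum>k<n. (x k)\<^sup>2))) * iexp (t * (- real n))"
    unfolding hubbard_stratonovich[OF b1] ..
  also have "\<dots> = (CLINT x|?N. iexp (t * ((\<Sum>k<n. (x k)\<^sup>2) - real n)))"
    unfolding b2 shift[symmetric] by (rule integral_mult_left_zero[symmetric])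
  also have "\<dots> = (CLINT x|?N. (\<Prod>k<n. iexp (t * ((x k)\<^sup>2 - 1))))"
  proof (intro Bochner_Integration.integral_cong refl)
    fix x :: "nat \<Rightarrow> real"
    have 1: "t * ((\<Sum>k<n. (x k)\<^sup>2) - real n) = (\<Sum>k<n. t * ((x k)\<^sup>2 - 1))"
      by (simp add: sum_subtractf sum_distrib_left right_diff_distrib)
    show "iexp (t * ((\<Sum>k<n. (x k)\<^sup>2) - real n)) = (\<Prod>k<n. iexp (t * ((x k)\<^sup>2 - 1)))"
      unfolding 1 of_real_sum sum_distrib_left by (rule exp_sum) simp
  qed
  also have "\<dots> = (\<Prod>k<n. CLINT x|std_normal_distribution. iexp (t * (x\<^sup>2 - 1)))"
  proof (rule PS.product_integral_prod)
    show "integrable std_normal_distribution (\<lambda>x. iexp (t * (x\<^sup>2 - 1)))" for k :: nat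
      by (rule ci) measurable
  qed simp
  also have "\<dots> = char (distr std_normal_distribution borel (\<lambda>x. x\<^sup>2 - 1)) t ^ n"
    unfolding char_def by (subst integral_distr) auto
  finally show ?thesis .
qed

end

text \<open>An auxiliary independent sequence on a product space supplies the limit of the powers of
  one fixed characteristic function. The quadratic forms to which this is applied need not live on
  that space or be related for different n. The summands have variance 2, whence the evaluation at
  \<open>sqrt 2 * t\<close>.\<close>

lemma chi_square_clt:
  "(\<lambda>n. char (distr std_normal_distribution borel (\<lambda>x. x\<^sup>2 - 1)) (t / sqrt (real n)) ^ n) \<longlonglongrightarrow> complex_of_real (exp (- (t\<^sup>2)))"
proof -
  interpret std: prob_space std_normal_distribution by (simp add: prob_space_normal_density)
  let ?P = "\<Pi>\<^sub>M i\<in>(UNIV :: nat set). std_normal_distribution"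
  note P = PiM_indep_coordinates[OF real_distribution_std_normal, of "UNIV :: nat set", simplified]
  interpret P: prob_space ?P by (intro prob_space_PiM) (simp add: prob_space_normal_density)
  define X where "X = (\<lambda>(i::nat) \<omega>. (\<omega> i)\<^sup>2 - 1 :: real)"
  have rv [measurable]: "(\<lambda>\<omega>. \<omega> i) \<in> borel_measurable ?P" for i using P(3) by simp
  have dX: "distr ?P borel (X i) = distr std_normal_distribution borel (\<lambda>x. x\<^sup>2 - 1)" for i
  proof -
    have "distr ?P borel (X i) = distr (distr ?P borel (\<lambda>\<omega>. \<omega> i)) borel (\<lambda>x. x\<^sup>2 - 1)"
      unfolding X_def by (subst distr_distr) (auto simp: comp_def)
    then show ?thesis unfolding P(2) .
  qed
  have indep: "P.indep_vars (\<lambda>i. borel) X UNIV"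
    unfolding X_def by (rule P.indep_vars_compose2[OF P(1)]) auto
  have [simp]: "std.prob UNIV = 1" using std.prob_space by simp
  have mom: "integrable std_normal_distribution (\<lambda>x. x ^ (2 * k))" "(LINT x|std_normal_distribution. x ^ (2 * k)) = fact (2 * k) / (2 ^ k * fact k)" for k
    using std_normal_moment_even[of k] by (auto simp: integrable_density integral_density has_bochner_integral_iff)
  have m2: "integrable std_normal_distribution (\<lambda>x. x\<^sup>2)" "(LINT x|std_normal_distribution. x\<^sup>2) = 1"
    using mom[of 1] by (auto simp: fact_numeral)
  have m4: "integrable std_normal_distribution (\<lambda>x. x ^ 4)" "(LINT x|std_normal_distribution. x ^ 4) = 3"
    using mom[of 2] by (auto simp: fact_numeral)
  have sq: "((x::real)\<^sup>2 - 1)\<^sup>2 = x ^ 4 - 2 * x\<^sup>2 + 1" for x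
    by (simp add: power2_eq_square power4_eq_xxxx algebra_simps)
  have s1: "integrable std_normal_distribution (\<lambda>x. x\<^sup>2 - 1)" "(LINT x|std_normal_distribution. x\<^sup>2 - 1) = 0"
    using m2 by (auto simp: std.prob_space)
  have s2: "integrable std_normal_distribution (\<lambda>x. (x\<^sup>2 - 1)\<^sup>2)" "(LINT x|std_normal_distribution. (x\<^sup>2 - 1)\<^sup>2) = 2"
    unfolding sq using m2 m4 by (auto simp: std.prob_space)
  have tr: "integrable ?P (\<lambda>\<omega>. h (\<omega> i)) \<longleftrightarrow> integrable std_normal_distribution h"
    "(LINT \<omega>|?P. h (\<omega> i)) = (LINT x|std_normal_distribution. h x)" if [measurable]: "h \<in> borel_measurable borel" for h :: "real \<Rightarrow> real" and i
    using integrable_distr_eq[of "\<lambda>\<omega>. \<omega> i" ?P borel h] integral_distr[of "\<lambda>\<omega>. \<omega> i" ?P borel h] unfolding P(2) by auto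
  have E: "P.expectation (X i) = 0" for i unfolding X_def using tr(2)[of "\<lambda>x. x\<^sup>2 - 1" i] s1 by simp
  have clt: "weak_conv_m (\<lambda>n. distr ?P borel (\<lambda>x. (\<Sum>i<n. X i x) / sqrt (real n * (sqrt 2)\<^sup>2))) std_normal_distribution"
  proof (rule P.central_limit_theorem_zero_mean[OF indep E _ _ _ dX])
    show "integrable ?P (\<lambda>x. (X i x)\<^sup>2)" for i
      unfolding X_def using tr(1)[of "\<lambda>x. (x\<^sup>2 - 1)\<^sup>2" i] s2 by simp
    show "P.variance (X i) = (sqrt 2)\<^sup>2" for i
      unfolding E using tr(2)[of "\<lambda>x. (x\<^sup>2 - 1)\<^sup>2" i] s2 by (simp add: X_def)
  qed simp
  have "(\<lambda>n. char (distr ?P borel (\<lambda>x. (\<Sum>i<n. X i x) / sqrt (real n * (sqrt 2)\<^sup>2))) (sqrt 2 * t)) \<longlonglongrightarrow> char std_normal_distribution (sqrt 2 * t)"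
  proof (rule levy_continuity1[OF _ _ clt])
    show "real_distribution (distr ?P borel (\<lambda>x. (\<Sum>i<n. X i x) / sqrt (real n * (sqrt 2)\<^sup>2)))" for n
      unfolding X_def by (intro P.real_distribution_distr) measurable
  qed (rule real_distribution_std_normal)
  moreover have "char std_normal_distribution (sqrt 2 * t) = complex_of_real (exp (- (t\<^sup>2)))"
    unfolding char_std_normal_distribution by (simp add: power_mult_distrib)
  moreover have "char (distr ?P borel (\<lambda>x. (\<Sum>i<n. X i x) / sqrt (real n * (sqrt 2)\<^sup>2))) (sqrt 2 * t)
      = char (distr std_normal_distribution borel (\<lambda>x. x\<^sup>2 - 1)) (t / sqrt (real n)) ^ n" for n
  proof -
    have mX [measurable]: "(\<lambda>x. \<Sum>i<n. X i x) \<in> borel_measurable ?P" unfolding X_def by measurable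
    have [measurable]: "(\<lambda>x. iexp (t * x)) \<in> borel_measurable borel" for t
      by (intro borel_measurable_continuous_onI continuous_intros)
    have "char (distr ?P borel (\<lambda>x. (\<Sum>i<n. X i x) / sqrt (real n * (sqrt 2)\<^sup>2))) (sqrt 2 * t)
       = (CLINT x|?P. iexp (sqrt 2 * t * ((\<Sum>i<n. X i x) / sqrt (real n * (sqrt 2)\<^sup>2))))"
      unfolding char_def by (subst integral_distr) auto
    also have "\<dots> = (CLINT x|?P. iexp (t / sqrt (real n) * (\<Sum>i<n. X i x)))"
    proof (intro Bochner_Integration.integral_cong refl)
      fix x
      have "sqrt 2 * t * ((\<Sum>i<n. X i x) / sqrt (real n * (sqrt 2)\<^sup>2)) = t / sqrt (real n) * (\<Sum>i<n. X i x)"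
        by (simp add: real_sqrt_mult)
      then show "iexp (sqrt 2 * t * ((\<Sum>i<n. X i x) / sqrt (real n * (sqrt 2)\<^sup>2))) = iexp (t / sqrt (real n) * (\<Sum>i<n. X i x))" by (simp only:)
    qed
    also have "\<dots> = char (distr ?P borel (\<lambda>x. \<Sum>i<n. X i x)) (t / sqrt (real n))"
      unfolding char_def by (subst integral_distr) auto
    also have "\<dots> = (\<Prod>i<n. char (distr ?P borel (X i)) (t / sqrt (real n)))"
      by (rule P.char_distr_sum) (rule P.indep_vars_subset[OF indep], simp)
    finally show ?thesis unfolding dX by simp
  qed
  ultimately show ?thesis by simp
qed

section \<open>Sums of squares of dependent normal variables\<close>

lemma normal_second_moment:
  assumes v: "v \<ge> 0"
  shows "integrable (normal_measure 0 v) (\<lambda>x. x\<^sup>2)" "(LINT x|normal_measure 0 v. x\<^sup>2) = v"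
proof -
  have "integrable std_normal_distribution (\<lambda>x. x\<^sup>2)" "(LINT x|std_normal_distribution. x\<^sup>2) = 1"
    using std_normal_moment_even[of 1] by (auto simp: integrable_density integral_density has_bochner_integral_iff fact_numeral)
  then show "integrable (normal_measure 0 v) (\<lambda>x. x\<^sup>2)" "(LINT x|normal_measure 0 v. x\<^sup>2) = v"
    using v unfolding normal_measure_eq_distr_std[OF v] by (auto simp: integrable_distr_eq integral_distr power_mult_distrib)
qed

lemma normal_exp_square:
  assumes v: "0 \<le> v" "v \<le> v'" "v' > 0"
  shows "(\<integral>\<^sup>+ x. ennreal (exp (x\<^sup>2 / (4 * v'))) \<partial>normal_measure 0 v) \<le> ennreal 2"
proof -
  have le: "1 - 2 * (v / (4 * v')) \<ge> 1 / 2" using v by (simp add: field_simps)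
  have "(\<integral>\<^sup>+ x. ennreal (exp (x\<^sup>2 / (4 * v'))) \<partial>normal_measure 0 v) = (\<integral>\<^sup>+ x. ennreal (exp (v / (4 * v') * x\<^sup>2)) \<partial>std_normal_distribution)"
    unfolding normal_measure_eq_distr_std[OF v(1)] using v by (subst nn_integral_distr) (auto simp: power_mult_distrib)
  also have "\<dots> = ennreal (1 / sqrt (1 - 2 * (v / (4 * v'))))"
    using le by (intro std_normal_exp_square) linarith
  also have "\<dots> \<le> ennreal 2"
  proof (rule ennreal_leI)
    have "sqrt (1 / 4) \<le> sqrt (1 - 2 * (v / (4 * v')))" using le by (intro real_sqrt_le_mono) linarith
    then have "1 / 2 \<le> sqrt (1 - 2 * (v / (4 * v')))" by (simp add: real_sqrt_divide)
    moreover have "1 / S \<le> 2" if "1 / 2 \<le> S" for S :: real using that by (simp add: divide_le_eq)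
    ultimately show "1 / sqrt (1 - 2 * (v / (4 * v'))) \<le> 2" by blast
  qed
  finally show ?thesis .
qed

text \<open>No independence: Jensen's inequality reduces the exponential moment of a sum of squares of
  normal variables to those of the summands.\<close>

lemma (in prob_space) sum_normal_squares_tail:
  fixes U :: "nat \<Rightarrow> 'a \<Rightarrow> real"
  assumes U: "\<And>k. k < N \<Longrightarrow> U k \<in> borel_measurable M" "\<And>k. k < N \<Longrightarrow> distr M borel (U k) = normal_measure 0 (v k)"
    and v: "\<And>k. k < N \<Longrightarrow> v k \<ge> 0" and V: "(\<Sum>k<N. v k) \<le> V" "V > 0" and N: "N \<ge> 1" and t: "t \<ge> 1"
  shows "prob {w\<in>space M. (\<Sum>k<N. (U k w)\<^sup>2) \<ge> 16 * V * ln t} \<le> 2 / t\<^sup>2"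
proof -
  have [measurable]: "k < N \<Longrightarrow> U k \<in> borel_measurable M" for k by (rule U)
  \<comment> \<open>Padding by \<open>V / N\<close> makes all variances positive, so that degenerate
    summands cause no division by zero, and at most doubles the total. Hence the 8 in the exponent:
    4 from \<open>normal_exp_square\<close>, 2 from the padding.\<close>
  define v' where "v' = (\<lambda>k. v k + V / N)"
  define W where "W = (\<Sum>k<N. v' k)"
  have v': "v' k > 0" "v k \<le> v' k" if "k < N" for k using v[OF that] V N by (auto simp: v'_def add_nonneg_pos)
  have W: "W \<le> 2 * V" using V N by (simp add: W_def v'_def sum.distrib)
  have ne: "{..<N} \<noteq> {}" using N by (auto simp: lessThan_empty_iff)
  have W0: "W > 0" unfolding W_def using v' ne by (intro sum_pos) auto
  define l where "l = (\<lambda>k. v' k / W)"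
  have l: "l k \<ge> 0" if "k < N" for k using v'[OF that] W0 by (simp add: l_def)
  have l1: "(\<Sum>k<N. l k) = 1" using W0 by (simp add: l_def sum_divide_distrib[symmetric] W_def)
  have jensen: "exp ((\<Sum>k<N. (U k w)\<^sup>2) / (8 * V)) \<le> (\<Sum>k<N. l k * exp ((U k w)\<^sup>2 / (4 * v' k)))" for w
  proof -
    have "(\<Sum>k<N. (U k w)\<^sup>2) / (8 * V) \<le> (\<Sum>k<N. (U k w)\<^sup>2) / (4 * W)"
      using W W0 V by (intro divide_left_mono) (auto intro!: sum_nonneg)
    also have "\<dots> = (\<Sum>k<N. l k *\<^sub>R ((U k w)\<^sup>2 / (4 * v' k)))"
      unfolding sum_divide_distrib using v' by (intro sum.cong) (auto simp: l_def less_imp_neq[symmetric])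
    finally have "exp ((\<Sum>k<N. (U k w)\<^sup>2) / (8 * V)) \<le> exp (\<Sum>k<N. l k *\<^sub>R ((U k w)\<^sup>2 / (4 * v' k)))" by simp
    also have "\<dots> \<le> (\<Sum>k<N. l k * exp ((U k w)\<^sup>2 / (4 * v' k)))"
      using convex_on_sum[of "{..<N}" UNIV exp l "\<lambda>k. (U k w)\<^sup>2 / (4 * v' k)"] l l1 ne exp_convex by auto
    finally show ?thesis .
  qed
  have "(\<integral>\<^sup>+ w. ennreal (exp ((\<Sum>k<N. (U k w)\<^sup>2) / (8 * V))) \<partial>M) \<le> (\<integral>\<^sup>+ w. ennreal (\<Sum>k<N. l k * exp ((U k w)\<^sup>2 / (4 * v' k))) \<partial>M)"
    by (intro nn_integral_mono ennreal_leI jensen)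
  also have "\<dots> = (\<integral>\<^sup>+ w. (\<Sum>k<N. ennreal (l k) * ennreal (exp ((U k w)\<^sup>2 / (4 * v' k)))) \<partial>M)"
    using l by (intro nn_integral_cong) (subst sum_ennreal[symmetric], auto simp: ennreal_mult)
  also have "\<dots> = (\<Sum>k<N. ennreal (l k) * (\<integral>\<^sup>+ w. ennreal (exp ((U k w)\<^sup>2 / (4 * v' k))) \<partial>M))"
    by (subst nn_integral_sum) (auto intro!: sum.cong nn_integral_cmult)
  also have "\<dots> \<le> (\<Sum>k<N. ennreal (l k) * ennreal 2)"
  proof (intro sum_mono mult_left_mono)
    fix k assume "k \<in> {..<N}"
    then have k: "k < N" by simp
    have "(\<integral>\<^sup>+ w. ennreal (exp ((U k w)\<^sup>2 / (4 * v' k))) \<partial>M) = (\<integral>\<^sup>+ x. ennreal (exp (x\<^sup>2 / (4 * v' k))) \<partial>distr M borel (U k))"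
      using k by (subst nn_integral_distr) auto
    also have "\<dots> \<le> ennreal 2" unfolding U(2)[OF k] using v[OF k] v'[OF k] by (intro normal_exp_square) auto
    finally show "(\<integral>\<^sup>+ w. ennreal (exp ((U k w)\<^sup>2 / (4 * v' k))) \<partial>M) \<le> ennreal 2" .
  qed auto
  also have "\<dots> = ennreal (\<Sum>k<N. l k * 2)" using l by (subst sum_ennreal[symmetric]) (auto simp: ennreal_mult)
  also have "(\<Sum>k<N. l k * 2) = 2" using l1 by (simp add: sum_distrib_right[symmetric])
  finally have "prob {w\<in>space M. (\<Sum>k<N. (U k w)\<^sup>2) / (8 * V) \<ge> 2 * ln t} \<le> 2 * exp (- (2 * ln t))"
    by (intro exponential_markov) auto
  also have "exp (- (2 * ln t)) = 1 / t\<^sup>2"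
  proof -
    have "exp (2 * ln t) = exp (ln t) * exp (ln t)" by (simp only: mult_2 exp_add)
    then show ?thesis using t by (simp add: exp_minus inverse_eq_divide power2_eq_square)
  qed
  also have "{w\<in>space M. (\<Sum>k<N. (U k w)\<^sup>2) / (8 * V) \<ge> 2 * ln t} = {w\<in>space M. (\<Sum>k<N. (U k w)\<^sup>2) \<ge> 16 * V * ln t}"
    using V by (auto simp: le_divide_eq mult_ac)
  finally show ?thesis by simp
qed

text \<open>An orthonormal basis, for the quadratic form \<open>V\<close>, of the weights on the
  first \<open>n\<close> points. It is dual to the data: the sum of the squared pairings of a data
  vector with the basis is the inverse quadratic form of \<open>V\<close>, and does not depend on
  the basis chosen.\<close>

definition dual_basis :: "nat \<Rightarrow> ((nat \<Rightarrow> real) \<Rightarrow> real) \<Rightarrow> (nat \<Rightarrow> nat \<Rightarrow> real) \<Rightarrow> bool" where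
  "dual_basis n V \<beta> \<longleftrightarrow>
     (\<forall>y. V (\<lambda>j. \<Sum>k<n. y k * \<beta> k j) = (\<Sum>k<n. (y k)\<^sup>2)) \<and>
     (\<forall>c. \<exists>y. \<forall>j<n. c j = (\<Sum>k<n. y k * \<beta> k j))"

abbreviation dot :: "nat \<Rightarrow> (nat \<Rightarrow> real) \<Rightarrow> (nat \<Rightarrow> real) \<Rightarrow> real" where
  "dot n c x \<equiv> \<Sum>j<n. c j * x j"

lemma dot_linear: "dot n (\<lambda>j. \<Sum>k<l. y k * \<beta> k j) x = (\<Sum>k<l. y k * dot n (\<beta> k) x)"
proof -
  have "dot n (\<lambda>j. \<Sum>k<l. y k * \<beta> k j) x = (\<Sum>j<n. \<Sum>k<l. y k * (\<beta> k j * x j))"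
    unfolding sum_distrib_right by (intro sum.cong refl) (simp add: mult_ac)
  also have "\<dots> = (\<Sum>k<l. \<Sum>j<n. y k * (\<beta> k j * x j))" by (rule sum.swap)
  finally show ?thesis by (simp add: sum_distrib_left)
qed

text \<open>Inversion reverses the order of positive definite forms. The sum of squares for
  \<open>V\<close> is the supremum of \<open>(dot n c x)\<^sup>2 / V c\<close>; at its maximiser
  \<open>c\<close>, the expansion of \<open>c\<close> in the basis for \<open>W\<close> and
  Cauchy-Schwarz give the comparison.\<close>

lemma dual_basis_antimono:
  assumes a: "dual_basis n V a" and b: "dual_basis n W b" and le: "\<And>c. W c \<le> V c"
    and ext: "\<And>c c'. (\<And>j. j < n \<Longrightarrow> c j = c' j) \<Longrightarrow> W c = W c'"
  shows "(\<Sum>k<n. (dot n (a k) x)\<^sup>2) \<le> (\<Sum>k<n. (dot n (b k) x)\<^sup>2)"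
proof -
  define P where "P = (\<Sum>k<n. (dot n (a k) x)\<^sup>2)"
  define Q where "Q = (\<Sum>k<n. (dot n (b k) x)\<^sup>2)"
  have PQ: "P \<ge> 0" "Q \<ge> 0" by (auto simp: P_def Q_def intro!: sum_nonneg)
  define c where "c = (\<lambda>j. \<Sum>k<n. dot n (a k) x * a k j)"
  have Va: "V (\<lambda>j. \<Sum>k<n. y k * a k j) = (\<Sum>k<n. (y k)\<^sup>2)" for y using a by (simp add: dual_basis_def)
  have Wb: "W (\<lambda>j. \<Sum>k<n. y k * b k j) = (\<Sum>k<n. (y k)\<^sup>2)" for y using b by (simp add: dual_basis_def)
  have Vc: "V c = P" unfolding c_def P_def by (rule Va)
  have cx: "dot n c x = P" unfolding c_def dot_linear P_def by (simp add: power2_eq_square)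
  obtain y where y: "\<And>j. j < n \<Longrightarrow> c j = (\<Sum>k<n. y k * b k j)" using b unfolding dual_basis_def by blast
  have "W c = W (\<lambda>j. \<Sum>k<n. y k * b k j)" by (rule ext) (rule y)
  also have "\<dots> = (\<Sum>k<n. (y k)\<^sup>2)" by (rule Wb)
  finally have yP: "(\<Sum>k<n. (y k)\<^sup>2) \<le> P" using le[of c] Vc by simp
  have "dot n c x = dot n (\<lambda>j. \<Sum>k<n. y k * b k j) x" using y by (intro sum.cong) auto
  then have "P = (\<Sum>k<n. y k * dot n (b k) x)" unfolding cx dot_linear .
  then have "P\<^sup>2 \<le> (\<Sum>k<n. (y k)\<^sup>2) * Q" unfolding Q_def using Cauchy_Schwarz_ineq_sum[of y "\<lambda>k. dot n (b k) x" "{..<n}"] by simp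
  also have "\<dots> \<le> P * Q" using yP PQ by (intro mult_right_mono) auto
  finally have "P * P \<le> P * Q" by (simp add: power2_eq_square)
  then show ?thesis using PQ unfolding P_def[symmetric] Q_def[symmetric]
    by (cases "P = 0") (auto simp: mult_le_cancel_left)
qed

section \<open>Restricted maximum likelihood under a misspecified scale\<close>

lemma matern_minus: "matern a \<nu> (- x) = matern a \<nu> x"
  by (simp add: matern_def)

lemma corr_mat_quadratic_form:
  assumes "x \<in> carrier_vec n"
  shows "x \<bullet> (corr_mat \<nu> n s a *\<^sub>v x) = (\<Sum>i<n. \<Sum>j<n. x $ i * x $ j * matern a \<nu> (s i - s j))"
  using assms by (auto simp: corr_mat_def scalar_prod_def sum_distrib_left atLeast0LessThan mult_ac intro!: sum.cong)

text \<open>The variance of the linear combination with weights \<open>c\<close> under inverse range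
  \<open>a\<close> and microergodic parameter \<theta>. The prefactor does not contain
  \<open>a\<close>, so at common \<theta> two such forms differ only through their spectral
  densities.\<close>

definition matern_energy :: "real \<Rightarrow> real \<Rightarrow> real \<Rightarrow> nat \<Rightarrow> (nat \<Rightarrow> 'a::euclidean_space) \<Rightarrow> (nat \<Rightarrow> real) \<Rightarrow> real" where
  "matern_energy \<theta> \<nu> a n s c =
     \<theta> * (Gamma (\<nu> + DIM('a) / 2) / (pi powr (DIM('a) / 2) * Gamma \<nu>)) * energy a (\<nu> + DIM('a) / 2) n s c"

lemma matern_energy_eq:
  assumes "a > 0" "\<nu> > 0"
  shows "matern_energy \<theta> \<nu> a n s c = \<theta> * a powr (- 2 * \<nu>) * (\<Sum>i<n. \<Sum>j<n. c i * c j * matern a \<nu> (s i - s j))"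
  using matern_quadratic_form[OF assms, of c s n] by (simp add: matern_energy_def mult.assoc)

lemma matern_energy_factor_pos:
  "\<theta> > 0 \<Longrightarrow> \<nu> > 0 \<Longrightarrow> \<theta> * (Gamma (\<nu> + real d / 2) / (pi powr (real d / 2) * Gamma \<nu>)) > 0"
  by (intro mult_pos_pos divide_pos_pos Gamma_real_pos) (auto intro: add_pos_nonneg)

lemma matern_energy_cong:
  assumes "a > 0" "\<nu> > 0" "\<And>j. j < n \<Longrightarrow> c j = c' j"
  shows "matern_energy \<theta> \<nu> a n s c = matern_energy \<theta> \<nu> a n s c'"
  unfolding matern_energy_eq[OF assms(1,2)] using assms(3) by (intro arg_cong2[where f="(*)"] sum.cong refl) auto

text \<open>The basis consists of the rows of the matrix \<open>L\<close> that whitens the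
  correlation matrix, rescaled by \<open>g = a powr \<nu> / sqrt \<theta>\<close> because the
  covariance is \<open>\<theta> * a powr (- 2 * \<nu>)\<close> times the correlation. The
  generalised least squares form of the data thereby becomes \<theta> times a sum of squared
  pairings.\<close>

lemma matern_dual_basis:
  fixes s :: "nat \<Rightarrow> 'a::euclidean_space"
  assumes a: "a > 0" and nu: "\<nu> > 0" and th: "\<theta> > 0" and inj: "inj_on s {..<n}"
  obtains \<beta> where "pd_mat n (corr_mat \<nu> n s a)" "dual_basis n (matern_energy \<theta> \<nu> a n s) \<beta>"
    "\<And>x. x \<in> carrier_vec n \<Longrightarrow> a powr (2 * \<nu>) * (x \<bullet> (minv (corr_mat \<nu> n s a) *\<^sub>v x)) = \<theta> * (\<Sum>k<n. (dot n (\<beta> k) (($) x))\<^sup>2)"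
proof -
  define R where "R = corr_mat \<nu> n s a"
  define b where "b = \<nu> + DIM('a) / 2"
  have b: "b > DIM('a) / 2" using nu by (simp add: b_def)
  have R: "R \<in> carrier_mat n n" by (simp add: R_def corr_mat_def)
  have RT: "R\<^sup>T = R"
  proof (rule eq_matI)
    fix i j assume "i < dim_row R" "j < dim_col R"
    then show "R\<^sup>T $$ (i, j) = R $$ (i, j)"
      using matern_minus[of a \<nu> "s i - s j"] by (simp add: R_def corr_mat_def)
  qed (use R in auto)
  have ap: "a powr (2 * \<nu>) > 0" "a powr (- 2 * \<nu>) = 1 / a powr (2 * \<nu>)"
    using a powr_minus_divide[of a "2 * \<nu>"] by auto
  have Rq: "matern_energy \<theta> \<nu> a n s (($) x) = \<theta> / a powr (2 * \<nu>) * (x \<bullet> (R *\<^sub>v x))" if "x \<in> carrier_vec n" for x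
    unfolding matern_energy_eq[OF a nu] R_def corr_mat_quadratic_form[OF that] ap(2) by simp
  have me: "matern_energy \<theta> \<nu> a n s c \<ge> 0" "matern_energy \<theta> \<nu> a n s c = 0 \<Longrightarrow> j < n \<Longrightarrow> c j = 0" for c j
  proof -
    note f = matern_energy_factor_pos[OF th nu, of "DIM('a)"]
    show "matern_energy \<theta> \<nu> a n s c \<ge> 0"
      unfolding matern_energy_def by (rule mult_nonneg_nonneg[OF less_imp_le[OF f] energy_nonneg])
    show "c j = 0" if z: "matern_energy \<theta> \<nu> a n s c = 0" "j < n"
    proof -
      have "energy a b n s c = 0" using z f unfolding matern_energy_def b_def by (metis mult_eq_0_iff less_irrefl)
      then show ?thesis using energy_eq_0D[OF a b inj] z by blast
    qed
  qed
  have pd: "pd_mat n R"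
    unfolding pd_mat_def psd_mat_def
  proof (intro conjI ballI impI)
    fix x :: "real vec" assume x: "x \<in> carrier_vec n"
    have q: "x \<bullet> (R *\<^sub>v x) = a powr (2 * \<nu>) / \<theta> * matern_energy \<theta> \<nu> a n s (($) x)"
      unfolding Rq[OF x] using th ap by simp
    show "0 \<le> x \<bullet> (R *\<^sub>v x)" unfolding q using me(1) th ap by simp
    assume "x \<bullet> (R *\<^sub>v x) = 0"
    then have "matern_energy \<theta> \<nu> a n s (($) x) = 0" unfolding q using th ap by simp
    from me(2)[OF this] show "x = 0\<^sub>v n" using x by (intro eq_vecI) auto
  qed (use R RT in auto)
  obtain L where L: "L \<in> carrier_mat n n" "L * R * L\<^sup>T = 1\<^sub>m n" "minv R = L\<^sup>T * L" "R * minv R = 1\<^sub>m n" "minv R * R = 1\<^sub>m n"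
    "minv R \<in> carrier_mat n n" by (rule pd_mat_minv[OF pd])
  define g where "g = a powr \<nu> / sqrt \<theta>"
  have g: "g > 0" "g\<^sup>2 = a powr (2 * \<nu>) / \<theta>"
    using a th by (auto simp: g_def power_divide power2_eq_square powr_add[symmetric])
  define \<beta> where "\<beta> = (\<lambda>k j. g * L $$ (k, j))"
  have LTy: "(L\<^sup>T *\<^sub>v y) $ j = (\<Sum>k<n. y $ k * L $$ (k, j))" if "y \<in> carrier_vec n" "j < n" for y j
    using L(1) that by (auto simp: scalar_prod_def atLeast0LessThan mult.commute intro!: sum.cong)
  have "dual_basis n (matern_energy \<theta> \<nu> a n s) \<beta>"
    unfolding dual_basis_def
  proof (intro conjI allI)
    fix y :: "nat \<Rightarrow> real"
    let ?y = "vec n y"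
    define z where "z = L\<^sup>T *\<^sub>v ?y"
    have z: "z \<in> carrier_vec n" using L(1) by (simp add: z_def)
    have RLy: "R *\<^sub>v z \<in> carrier_vec n" using R z by simp
    have "z \<bullet> (R *\<^sub>v z) = ?y \<bullet> (L *\<^sub>v (R *\<^sub>v z))"
      unfolding z_def using transpose_vec_mult_scalar[OF L(1) RLy, of ?y] by (simp add: z_def)
    also have "L *\<^sub>v (R *\<^sub>v z) = ?y"
    proof -
      have "L *\<^sub>v (R *\<^sub>v z) = (L * R) *\<^sub>v z" by (rule assoc_mult_mat_vec[symmetric]) (use L(1) R z in auto)
      also have "\<dots> = (L * R * L\<^sup>T) *\<^sub>v ?y" unfolding z_def by (rule assoc_mult_mat_vec[symmetric]) (use L(1) R in auto)
      finally show ?thesis unfolding L(2) by simp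
    qed
    also have "?y \<bullet> ?y = (\<Sum>k<n. (y k)\<^sup>2)" by (simp add: scalar_prod_def atLeast0LessThan power2_eq_square)
    finally have zz: "z \<bullet> (R *\<^sub>v z) = (\<Sum>k<n. (y k)\<^sup>2)" .
    have "matern_energy \<theta> \<nu> a n s (\<lambda>j. \<Sum>k<n. y k * \<beta> k j) = matern_energy \<theta> \<nu> a n s (($) (g \<cdot>\<^sub>v z))"
    proof (rule matern_energy_cong[OF a nu])
      fix j assume j: "j < n"
      have "(g \<cdot>\<^sub>v z) $ j = g * (\<Sum>k<n. y k * L $$ (k, j))"
      proof -
        have "(g \<cdot>\<^sub>v z) $ j = g * z $ j" using z j by simp
        also have "z $ j = (\<Sum>k<n. y k * L $$ (k, j))" unfolding z_def using LTy[of ?y j] j by simp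
        finally show ?thesis .
      qed
      then show "(\<Sum>k<n. y k * \<beta> k j) = (g \<cdot>\<^sub>v z) $ j"
        by (simp add: \<beta>_def sum_distrib_left mult_ac)
    qed
    also have "\<dots> = \<theta> / a powr (2 * \<nu>) * ((g \<cdot>\<^sub>v z) \<bullet> (R *\<^sub>v (g \<cdot>\<^sub>v z)))" by (rule Rq) (use z in simp)
    also have "R *\<^sub>v (g \<cdot>\<^sub>v z) = g \<cdot>\<^sub>v (R *\<^sub>v z)" by (rule mult_mat_vec[OF R z])
    also have "(g \<cdot>\<^sub>v z) \<bullet> (g \<cdot>\<^sub>v (R *\<^sub>v z)) = g\<^sup>2 * (z \<bullet> (R *\<^sub>v z))"
      using z RLy by (simp add: power2_eq_square)
    also have "\<theta> / a powr (2 * \<nu>) * (g\<^sup>2 * (z \<bullet> (R *\<^sub>v z))) = (\<Sum>k<n. (y k)\<^sup>2)"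
      unfolding g(2) zz using th ap by simp
    finally show "matern_energy \<theta> \<nu> a n s (\<lambda>j. \<Sum>k<n. y k * \<beta> k j) = (\<Sum>k<n. (y k)\<^sup>2)" .
  next
    fix c :: "nat \<Rightarrow> real"
    define y where "y = L *\<^sub>v (R *\<^sub>v vec n c)"
    have y: "y \<in> carrier_vec n" using L(1) R by (simp add: y_def)
    have "L\<^sup>T *\<^sub>v y = (L\<^sup>T * L) *\<^sub>v (R *\<^sub>v vec n c)" unfolding y_def by (rule assoc_mult_mat_vec[symmetric]) (use L(1) R in auto)
    also have "\<dots> = (minv R * R) *\<^sub>v vec n c" unfolding L(3)[symmetric] by (rule assoc_mult_mat_vec[symmetric]) (use L(6) R in auto)
    finally have Ly: "L\<^sup>T *\<^sub>v y = vec n c" unfolding L(5) by simp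
    show "\<exists>y. \<forall>j<n. c j = (\<Sum>k<n. y k * \<beta> k j)"
    proof (intro exI[of _ "\<lambda>k. y $ k / g"] allI impI)
      fix j assume j: "j < n"
      have "c j = (\<Sum>k<n. y $ k * L $$ (k, j))" using LTy[OF y j] j unfolding Ly by simp
      then show "c j = (\<Sum>k<n. y $ k / g * \<beta> k j)" using g by (simp add: \<beta>_def)
    qed
  qed
  moreover have "a powr (2 * \<nu>) * (x \<bullet> (minv R *\<^sub>v x)) = \<theta> * (\<Sum>k<n. (dot n (\<beta> k) (($) x))\<^sup>2)" if x: "x \<in> carrier_vec n" for x
  proof -
    have Lx: "L *\<^sub>v x \<in> carrier_vec n" using L(1) x by simp
    have "minv R *\<^sub>v x = L\<^sup>T *\<^sub>v (L *\<^sub>v x)" unfolding L(3) by (rule assoc_mult_mat_vec) (use L(1) x in auto)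
    then have "x \<bullet> (minv R *\<^sub>v x) = (L\<^sup>T *\<^sub>v (L *\<^sub>v x)) \<bullet> x" using comm_scalar_prod[of x n] L(1) x by simp
    also have "\<dots> = (L *\<^sub>v x) \<bullet> (L *\<^sub>v x)" by (rule transpose_vec_mult_scalar[OF L(1) x Lx])
    also have "\<dots> = (\<Sum>k<n. (dot n (\<lambda>j. L $$ (k, j)) (($) x))\<^sup>2)"
      using L(1) x by (auto simp: scalar_prod_def atLeast0LessThan power2_eq_square intro!: sum.cong)
    finally have 1: "x \<bullet> (minv R *\<^sub>v x) = (\<Sum>k<n. (dot n (\<lambda>j. L $$ (k, j)) (($) x))\<^sup>2)" .
    have "(dot n (\<beta> k) (($) x))\<^sup>2 = g\<^sup>2 * (dot n (\<lambda>j. L $$ (k, j)) (($) x))\<^sup>2" for k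
      by (simp add: \<beta>_def mult.assoc power_mult_distrib flip: sum_distrib_left)
    then have "\<theta> * (\<Sum>k<n. (dot n (\<beta> k) (($) x))\<^sup>2) = \<theta> * g\<^sup>2 * (x \<bullet> (minv R *\<^sub>v x))"
      unfolding 1 by (simp add: sum_distrib_left mult.assoc)
    then show ?thesis unfolding g(2) using th by simp
  qed
  ultimately show ?thesis using that pd unfolding R_def by blast
qed

lemma normal_measure_moments:
  assumes v: "v \<ge> 0"
  shows "integrable (normal_measure \<mu> v) (\<lambda>x. x)" "(LINT x|normal_measure \<mu> v. x) = \<mu>"
    "integrable (normal_measure \<mu> v) (\<lambda>x. x\<^sup>2)" "(LINT x|normal_measure \<mu> v. x\<^sup>2) = \<mu>\<^sup>2 + v"
proof -
  interpret N: prob_space "normal_measure 0 v" by simp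
  have [simp]: "N.prob UNIV = 1" using N.prob_space by simp
  have eq: "normal_measure \<mu> v = distr (normal_measure 0 v) borel (\<lambda>x. \<mu> + 1 * x)"
    using distr_normal_measure_affine[OF v, of 0 \<mu> 1] by simp
  have idm [measurable, simp]: "(\<lambda>x. x) \<in> borel_measurable (normal_measure 0 v)"
    by (rule measurable_ident_sets) simp
  note m2 = normal_second_moment[OF v]
  have m1: "integrable (normal_measure 0 v) (\<lambda>x. x)"
    by (rule N.square_integrable_imp_integrable[OF idm m2(1)])
  have m1': "(LINT x|normal_measure 0 v. x) = 0"
  proof -
    have "normal_measure 0 v = distr (normal_measure 0 v) borel (\<lambda>x. 0 + (-1) * x)"
      using distr_normal_measure_affine[OF v, of 0 0 "-1"] by simp
    then have "(LINT x|normal_measure 0 v. x) = (LINT x|distr (normal_measure 0 v) borel (\<lambda>x. 0 + (-1) * x). x)" by simp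
    also have "\<dots> = - (LINT x|normal_measure 0 v. x)" by (subst integral_distr) auto
    finally show ?thesis by simp
  qed
  have m: "(\<lambda>x. \<mu> + 1 * x) \<in> borel_measurable (normal_measure 0 v)"
    using measurable_compose[OF idm, of "\<lambda>x. \<mu> + 1 * x" borel] by simp
  have c: "integrable (normal_measure 0 v) (\<lambda>x. r)" "(LINT x|normal_measure 0 v. r) = r" for r :: real
    by (rule N.integrable_const) simp
  have i1: "integrable (normal_measure 0 v) (\<lambda>x. \<mu> + 1 * x)"
    by (rule Bochner_Integration.integrable_add[OF c(1) integrable_mult_right[OF m1]])
  have e1: "(LINT x|normal_measure 0 v. \<mu> + 1 * x) = \<mu>"
    unfolding Bochner_Integration.integral_add[OF c(1) integrable_mult_right[OF m1]] integral_mult_right_zero m1' c(2) by simp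
  show "integrable (normal_measure \<mu> v) (\<lambda>x. x)"
    by (subst eq, rule integrable_distr_eq[OF m, THEN iffD2]) (simp, rule i1)
  show "(LINT x|normal_measure \<mu> v. x) = \<mu>"
    by (subst eq, subst integral_distr[OF m]) (simp, rule e1)
  have sq: "(\<lambda>x. (\<mu> + 1 * x)\<^sup>2) = (\<lambda>x. \<mu>\<^sup>2 + (2 * \<mu> * x + x\<^sup>2))" by (simp add: power2_sum add_ac fun_eq_iff)
  note i3 = integrable_mult_right[OF m1, of "2 * \<mu>"]
  have i2: "integrable (normal_measure 0 v) (\<lambda>x. (\<mu> + 1 * x)\<^sup>2)"
    unfolding sq by (rule Bochner_Integration.integrable_add[OF c(1) Bochner_Integration.integrable_add[OF i3 m2(1)]])
  have e2: "(LINT x|normal_measure 0 v. (\<mu> + 1 * x)\<^sup>2) = \<mu>\<^sup>2 + v"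
    unfolding sq Bochner_Integration.integral_add[OF c(1) Bochner_Integration.integrable_add[OF i3 m2(1)]]
      Bochner_Integration.integral_add[OF i3 m2(1)] integral_mult_right_zero m1' c(2) m2(2) by simp
  show "integrable (normal_measure \<mu> v) (\<lambda>x. x\<^sup>2)"
    by (subst eq, rule integrable_distr_eq[OF m, THEN iffD2]) (simp, rule i2)
  show "(LINT x|normal_measure \<mu> v. x\<^sup>2) = \<mu>\<^sup>2 + v"
    by (subst eq, subst integral_distr[OF m]) (simp, rule e2)
qed

text \<open>The process provides some normal law for each combination; its parameters are then
  identified from the first two moments, which the mean and covariance hypotheses determine.\<close>

lemma gaussian_process_linear:
  fixes X :: "'b \<Rightarrow> 'w \<Rightarrow> real" and n :: nat
  assumes P: "prob_space P" and G: "gaussian_process P S X" and mean: "\<And>t. t \<in> S \<Longrightarrow> (LINT w|P. X t w) = 0"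
    and cov: "\<And>t u. t \<in> S \<Longrightarrow> u \<in> S \<Longrightarrow> covariance P (X t) (X u) = k t u"
    and s: "\<And>i. i < n \<Longrightarrow> s i \<in> S" and inj: "inj_on s {..<n}"
  shows "distr P borel (\<lambda>w. \<Sum>j<n. c j * X (s j) w) = normal_measure 0 (\<Sum>i<n. \<Sum>j<n. c i * c j * k (s i) (s j))"
proof -
  interpret prob_space P by fact
  have X [measurable]: "t \<in> S \<Longrightarrow> X t \<in> borel_measurable P" for t using G by (auto simp: gaussian_process_def)
  have lin: "\<exists>\<mu> v. 0 \<le> v \<and> distr P borel (\<lambda>w. \<Sum>t\<in>F. f t * X t w) = normal_measure \<mu> v" if "finite F" "F \<subseteq> S" for F and f :: "'b \<Rightarrow> real"
    using G that unfolding gaussian_process_def by blast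
  have mom: "\<mu> = (LINT w|P. U w) \<and> integrable P U \<and> integrable P (\<lambda>w. (U w)\<^sup>2) \<and> (LINT w|P. (U w)\<^sup>2) = \<mu>\<^sup>2 + v"
    if d: "distr P borel U = normal_measure \<mu> v" and [measurable]: "U \<in> borel_measurable P" and v: "v \<ge> 0" for U \<mu> v
    using normal_measure_moments[OF v, of \<mu>] unfolding d[symmetric] by (auto simp: integrable_distr_eq integral_distr)
  have X2: "integrable P (X t)" "integrable P (\<lambda>w. (X t w)\<^sup>2)" if t: "t \<in> S" for t
  proof -
    obtain \<mu> v where v: "0 \<le> v" "distr P borel (\<lambda>w. \<Sum>u\<in>{t}. 1 * X u w) = normal_measure \<mu> v" using lin[of "{t}" "\<lambda>_. 1"] t by auto
    then have "distr P borel (X t) = normal_measure \<mu> v" by simp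
    from mom[OF this X[OF t] v(1)] show "integrable P (X t)" "integrable P (\<lambda>w. (X t w)\<^sup>2)" by auto
  qed
  have XX: "integrable P (\<lambda>w. X t w * X u w)" if t: "t \<in> S" "u \<in> S" for t u
  proof (rule Bochner_Integration.integrable_bound[of P "\<lambda>w. (X t w)\<^sup>2 + (X u w)\<^sup>2"])
    show "integrable P (\<lambda>w. (X t w)\<^sup>2 + (X u w)\<^sup>2)" using X2 t by auto
    show "AE w in P. norm (X t w * X u w) \<le> norm ((X t w)\<^sup>2 + (X u w)\<^sup>2)"
    proof (intro AE_I2)
      fix w
      have "2 * \<bar>X t w\<bar> * \<bar>X u w\<bar> \<le> \<bar>X t w\<bar>\<^sup>2 + \<bar>X u w\<bar>\<^sup>2" by (rule sum_squares_bound)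
      then have "2 * (\<bar>X t w\<bar> * \<bar>X u w\<bar>) \<le> (X t w)\<^sup>2 + (X u w)\<^sup>2" by (simp add: mult.assoc)
      moreover have "0 \<le> \<bar>X t w\<bar> * \<bar>X u w\<bar>" by simp
      ultimately have "\<bar>X t w\<bar> * \<bar>X u w\<bar> \<le> (X t w)\<^sup>2 + (X u w)\<^sup>2" by linarith
      then show "norm (X t w * X u w) \<le> norm ((X t w)\<^sup>2 + (X u w)\<^sup>2)"
        unfolding real_norm_def abs_mult by simp
    qed
  qed (use t in measurable)
  have EXX: "(LINT w|P. X t w * X u w) = k t u" if "t \<in> S" "u \<in> S" for t u
    using cov[OF that] mean[OF that(1)] mean[OF that(2)] by (simp add: covariance_def)
  define U where "U = (\<lambda>w. \<Sum>j<n. c j * X (s j) w)"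
  have [measurable]: "U \<in> borel_measurable P" 
    unfolding U_def by (intro borel_measurable_sum borel_measurable_times borel_measurable_const X s) auto
  \<comment> \<open>Gaussian processes are specified through finite sets of points, the design
    through a list. As the points are distinct, the weights can be transported along the inverse of
    \<open>s\<close>.\<close>
  have "(\<lambda>w. \<Sum>t\<in>s ` {..<n}. c (the_inv_into {..<n} s t) * X t w) = U"
    unfolding U_def by (subst sum.reindex[OF inj]) (auto simp: the_inv_into_f_f[OF inj] intro!: ext sum.cong)
  moreover have "\<exists>\<mu> v. 0 \<le> v \<and> distr P borel (\<lambda>w. \<Sum>t\<in>s ` {..<n}. c (the_inv_into {..<n} s t) * X t w) = normal_measure \<mu> v"
    by (rule lin[of "s ` {..<n}" "\<lambda>t. c (the_inv_into {..<n} s t)"]) (use s in auto)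
  ultimately obtain \<mu> v where v: "0 \<le> v" "distr P borel U = normal_measure \<mu> v" by auto
  have m: "\<mu> = (LINT w|P. U w)" "(LINT w|P. (U w)\<^sup>2) = \<mu>\<^sup>2 + v" using mom[OF v(2) _ v(1)] by auto
  have "(LINT w|P. U w) = (\<Sum>j<n. c j * (LINT w|P. X (s j) w))"
    unfolding U_def using X2 s by (subst Bochner_Integration.integral_sum) auto
  then have mu0: "\<mu> = 0" using m(1) mean s by simp
  have "(LINT w|P. (U w)\<^sup>2) = (LINT w|P. (\<Sum>i<n. \<Sum>j<n. c i * c j * (X (s i) w * X (s j) w)))"
    unfolding U_def power2_eq_square sum_product by (simp add: mult_ac)
  also have "\<dots> = (\<Sum>i<n. \<Sum>j<n. c i * c j * (LINT w|P. X (s i) w * X (s j) w))"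
  proof -
    have i1: "integrable P (\<lambda>w. c i * c j * (X (s i) w * X (s j) w))" if "i < n" "j < n" for i j
      using XX s that by (intro integrable_mult_right) auto
    have "(LINT w|P. (\<Sum>i<n. \<Sum>j<n. c i * c j * (X (s i) w * X (s j) w))) = (\<Sum>i<n. LINT w|P. (\<Sum>j<n. c i * c j * (X (s i) w * X (s j) w)))"
      by (rule Bochner_Integration.integral_sum) (use i1 in \<open>auto intro!: Bochner_Integration.integrable_sum\<close>)
    also have "\<dots> = (\<Sum>i<n. \<Sum>j<n. LINT w|P. c i * c j * (X (s i) w * X (s j) w))"
      by (intro sum.cong refl Bochner_Integration.integral_sum) (use i1 in auto)
    finally show ?thesis by simp
  qed
  also have "\<dots> = (\<Sum>i<n. \<Sum>j<n. c i * c j * k (s i) (s j))" using EXX s by (intro sum.cong) auto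
  finally have "v = (\<Sum>i<n. \<Sum>j<n. c i * c j * k (s i) (s j))" using m(2) mu0 by simp
  then show ?thesis using v(2) mu0 by (simp add: U_def)
qed

text \<open>The two quadratic forms are ordered, so their difference is again a sum of squares of normal
  variables, with total variance equal to the difference of the expectations.\<close>

lemma (in prob_space) dual_forms_compare:
  fixes x :: "nat \<Rightarrow> 'a \<Rightarrow> real"
  assumes x: "\<And>j. j < n \<Longrightarrow> x j \<in> borel_measurable M"
    and lin: "\<And>c. distr M borel (\<lambda>w. dot n c (\<lambda>j. x j w)) = normal_measure 0 (V c)"
    and V0: "\<And>c. V c \<ge> 0"
    and a: "dual_basis n V a" and b: "dual_basis n W b"
    and le: "(\<forall>c. W c \<le> V c) \<or> (\<forall>c. V c \<le> W c)"
    and ext: "\<And>c c'. (\<And>j. j < n \<Longrightarrow> c j = c' j) \<Longrightarrow> W c = W c'" "\<And>c c'. (\<And>j. j < n \<Longrightarrow> c j = c' j) \<Longrightarrow> V c = V c'"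
    and T: "(\<Sum>k<n. \<bar>V (b k) - W (b k)\<bar>) \<le> T" "T > 0" and n: "n \<ge> 1"
  defines "D \<equiv> \<lambda>w. \<bar>(\<Sum>k<n. (dot n (b k) (\<lambda>j. x j w))\<^sup>2) - (\<Sum>k<n. (dot n (a k) (\<lambda>j. x j w))\<^sup>2)\<bar>"
  shows "integrable M D" "expectation D \<le> T" "prob {w\<in>space M. D w \<ge> 16 * T * ln (real n)} \<le> 2 / (real n)\<^sup>2"
    "gaussian_coords M n (\<lambda>k w. dot n (a k) (\<lambda>j. x j w))"
    "integrable M (\<lambda>w. \<Sum>k<n. (dot n (a k) (\<lambda>j. x j w))\<^sup>2)" "expectation (\<lambda>w. \<Sum>k<n. (dot n (a k) (\<lambda>j. x j w))\<^sup>2) = real n"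
proof -
  note x [measurable]
  have meas [measurable]: "(\<lambda>w. dot n c (\<lambda>j. x j w)) \<in> borel_measurable M" for c by measurable
  have Va: "V (\<lambda>j. \<Sum>k<n. y k * a k j) = (\<Sum>k<n. (y k)\<^sup>2)" for y using a by (simp add: dual_basis_def)
  have Wb: "W (\<lambda>j. \<Sum>k<n. y k * b k j) = (\<Sum>k<n. (y k)\<^sup>2)" for y using b by (simp add: dual_basis_def)
  have delta: "(\<lambda>j. \<Sum>l<n. (if l = k then 1 else 0) * \<beta> l j) = \<beta> k" "(\<Sum>l<n. (if l = k then 1 else 0)\<^sup>2) = (1::real)" if "k < n" for k and \<beta> :: "nat \<Rightarrow> nat \<Rightarrow> real"
    using that by (auto simp: if_distrib[of "\<lambda>x. x * _"] if_distrib[of "\<lambda>x. x\<^sup>2"] cong: if_cong)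
  have Va1: "V (a k) = 1" if "k < n" for k using Va[of "\<lambda>l. if l = k then 1 else 0"] unfolding delta[OF that] .
  have Wb1: "W (b k) = 1" if "k < n" for k using Wb[of "\<lambda>l. if l = k then 1 else 0"] unfolding delta[OF that] .
  have sq: "integrable M (\<lambda>w. (dot n c (\<lambda>j. x j w))\<^sup>2)" "expectation (\<lambda>w. (dot n c (\<lambda>j. x j w))\<^sup>2) = V c" for c
    using normal_second_moment[OF V0[of c]] unfolding lin[symmetric] by (auto simp: integrable_distr_eq integral_distr)
  define A where "A = (\<lambda>w. \<Sum>k<n. (dot n (a k) (\<lambda>j. x j w))\<^sup>2)"
  define B where "B = (\<lambda>w. \<Sum>k<n. (dot n (b k) (\<lambda>j. x j w))\<^sup>2)"
  have iA: "integrable M A" "expectation A = real n"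
    unfolding A_def using sq Va1 by (auto simp: Bochner_Integration.integral_sum)
  have iB: "integrable M B" "expectation B = (\<Sum>k<n. V (b k))"
    unfolding B_def using sq by (auto simp: Bochner_Integration.integral_sum)
  show "integrable M (\<lambda>w. \<Sum>k<n. (dot n (a k) (\<lambda>j. x j w))\<^sup>2)" "expectation (\<lambda>w. \<Sum>k<n. (dot n (a k) (\<lambda>j. x j w))\<^sup>2) = real n"
    using iA by (auto simp: A_def)
  show "gaussian_coords M n (\<lambda>k w. dot n (a k) (\<lambda>j. x j w))"
  proof unfold_locales
    show "distr M borel (\<lambda>w. \<Sum>k<n. c k * dot n (a k) (\<lambda>j. x j w)) = normal_measure 0 (\<Sum>k<n. (c k)\<^sup>2)" for c
      unfolding dot_linear[symmetric] lin Va ..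
  qed measurable
  have D: "D = (\<lambda>w. \<bar>B w - A w\<bar>)" by (simp add: D_def A_def B_def)
  show iD: "integrable M D" unfolding D using iA iB by auto
  \<comment> \<open>The sign \<sigma> records which of the two inverse forms is the larger, so that
    both orderings are treated at once.\<close>
  obtain \<sigma> :: real where sg: "\<sigma> = 1 \<or> \<sigma> = -1" and pos: "\<And>z. \<sigma> * ((\<Sum>k<n. (dot n (b k) z)\<^sup>2) - (\<Sum>k<n. (dot n (a k) z)\<^sup>2)) \<ge> 0"
    using le
  proof
    assume "\<forall>c. W c \<le> V c"
    then have "(\<Sum>k<n. (dot n (a k) z)\<^sup>2) \<le> (\<Sum>k<n. (dot n (b k) z)\<^sup>2)" for z
      by (intro dual_basis_antimono[OF a b _ ext(1)]) auto
    then show thesis by (intro that[of 1]) auto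
  next
    assume "\<forall>c. V c \<le> W c"
    then have "(\<Sum>k<n. (dot n (b k) z)\<^sup>2) \<le> (\<Sum>k<n. (dot n (a k) z)\<^sup>2)" for z
      by (intro dual_basis_antimono[OF b a _ ext(2)]) auto
    then show thesis by (intro that[of "-1"]) auto
  qed
  \<comment> \<open>The matrix of the signed difference of the two inverse forms. It is positive
    semidefinite, and its factor \<open>h\<close> turns the difference into squares of linear forms
    of the data, hence of normal variables.\<close>
  define d where "d = (\<lambda>i j. \<sigma> * ((\<Sum>k<n. b k i * b k j) - (\<Sum>k<n. a k i * a k j)))"
  have form: "(\<Sum>k<l. (dot n (\<beta> k) z)\<^sup>2) = (\<Sum>i<n. \<Sum>j<n. (\<Sum>k<l. \<beta> k i * \<beta> k j) * z i * z j)" for l and \<beta> :: "nat \<Rightarrow> nat \<Rightarrow> real" and z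
  proof -
    have "(\<Sum>k<l. (dot n (\<beta> k) z)\<^sup>2) = (\<Sum>k<l. \<Sum>i<n. \<Sum>j<n. \<beta> k i * \<beta> k j * z i * z j)"
      unfolding power2_eq_square sum_product by (simp add: mult_ac)
    also have "\<dots> = (\<Sum>i<n. \<Sum>k<l. \<Sum>j<n. \<beta> k i * \<beta> k j * z i * z j)" by (rule sum.swap)
    also have "\<dots> = (\<Sum>i<n. \<Sum>j<n. \<Sum>k<l. \<beta> k i * \<beta> k j * z i * z j)" by (intro sum.cong refl sum.swap)
    finally show ?thesis by (simp add: sum_distrib_right)
  qed
  have dform: "(\<Sum>i<n. \<Sum>j<n. d i j * z i * z j) = \<sigma> * ((\<Sum>k<n. (dot n (b k) z)\<^sup>2) - (\<Sum>k<n. (dot n (a k) z)\<^sup>2))" for z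
  proof -
    have "d i j * z i * z j = \<sigma> * ((\<Sum>k<n. b k i * b k j) * z i * z j) - \<sigma> * ((\<Sum>k<n. a k i * a k j) * z i * z j)" for i j
      by (simp only: d_def left_diff_distrib right_diff_distrib mult.assoc)
    then show ?thesis
      unfolding form by (simp only: sum_subtractf sum_distrib_left[symmetric] right_diff_distrib)
  qed
  have "\<exists>h. \<forall>i<n. \<forall>j<n. d i j = (\<Sum>k<n. h k i * h k j)"
  proof (rule psd_kernel_factor)
    show "d i j = d j i" for i j by (simp add: d_def mult.commute)
    show "0 \<le> (\<Sum>i<n. \<Sum>j<n. d i j * z i * z j)" for z unfolding dform by (rule pos)
  qed
  then obtain h where h: "\<And>i j. i < n \<Longrightarrow> j < n \<Longrightarrow> d i j = (\<Sum>k<n. h k i * h k j)" by blast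
  have Ds: "D w = \<sigma> * (B w - A w)" for w
    using sg pos[of "\<lambda>j. x j w"] unfolding D A_def B_def by (auto simp: abs_if)
  have Dh: "D w = (\<Sum>k<n. (dot n (h k) (\<lambda>j. x j w))\<^sup>2)" for w
  proof -
    have "D w = \<sigma> * (B w - A w)" by (rule Ds)
    also have "\<dots> = (\<Sum>i<n. \<Sum>j<n. d i j * x i w * x j w)" unfolding dform A_def B_def ..
    also have "\<dots> = (\<Sum>i<n. \<Sum>j<n. (\<Sum>k<n. h k i * h k j) * x i w * x j w)" using h by (intro sum.cong refl) auto
    finally show ?thesis unfolding form .
  qed
  have Eh: "expectation D = (\<Sum>k<n. V (h k))" unfolding Dh[abs_def] using sq by (simp add: Bochner_Integration.integral_sum)
  show ET: "expectation D \<le> T"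
  proof -
    have "expectation D = \<sigma> * (expectation B - expectation A)"
      unfolding Ds[abs_def] using iA iB by simp
    also have "\<dots> = \<sigma> * (\<Sum>k<n. V (b k) - W (b k))" unfolding iA iB using Wb1 by (simp add: sum_subtractf)
    also have "\<dots> \<le> \<bar>\<Sum>k<n. V (b k) - W (b k)\<bar>" using sg by auto
    also have "\<dots> \<le> (\<Sum>k<n. \<bar>V (b k) - W (b k)\<bar>)" by (rule sum_abs)
    finally show ?thesis using T by linarith
  qed
  show "prob {w\<in>space M. D w \<ge> 16 * T * ln (real n)} \<le> 2 / (real n)\<^sup>2"
    unfolding Dh
    by (rule sum_normal_squares_tail[where v="\<lambda>k. V (h k)"]) (use lin V0 ET Eh T n in auto)
qed

lemma C1_local_lipschitz:
  fixes q :: "real \<Rightarrow> real"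
  assumes "(q has_real_derivative D) (at x)"
  obtains r L where "r > 0" "L \<ge> 0" "\<And>y. \<bar>y - x\<bar> < r \<Longrightarrow> \<bar>q y - q x\<bar> \<le> L * \<bar>y - x\<bar>"
proof -
  have "((\<lambda>y. (q y - q x) / (y - x)) \<longlongrightarrow> D) (at x)"
    using assms by (simp add: has_field_derivative_iff)
  then have "\<forall>\<^sub>F y in at x. dist ((q y - q x) / (y - x)) D < 1" by (rule tendstoD) simp
  then obtain r where r: "r > 0" "\<And>y. y \<noteq> x \<Longrightarrow> dist y x < r \<Longrightarrow> dist ((q y - q x) / (y - x)) D < 1"
    unfolding eventually_at by auto
  have "\<bar>q y - q x\<bar> \<le> (\<bar>D\<bar> + 1) * \<bar>y - x\<bar>" if y: "\<bar>y - x\<bar> < r" for y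
  proof (cases "y = x")
    case False
    then have "\<bar>(q y - q x) / (y - x) - D\<bar> < 1" using r(2)[of y] y by (simp add: dist_real_def)
    then have "\<bar>(q y - q x) / (y - x)\<bar> \<le> \<bar>D\<bar> + 1" by linarith
    then show ?thesis using False by (simp add: divide_le_eq)
  qed simp
  then show ?thesis using that[of r "\<bar>D\<bar> + 1"] r(1) by auto
qed

text \<open>As a function of \<open>\<theta>\<close> alone, the restricted likelihood is an inverse gamma kernel in the REML.\<close>

lemma posterior_eq_normalized:
  fixes \<alpha> \<nu> \<theta>\<^sub>0 :: real and y :: "real vec" and \<Omega> :: "real mat" and s :: "nat \<Rightarrow> 'a::euclidean_space"
    and m :: "nat \<Rightarrow> 'a \<Rightarrow> real" and prior :: "real \<Rightarrow> real \<Rightarrow> real" and n p :: nat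
  assumes a: "\<alpha> > 0" and np: "n > p" and q0: "prior \<theta>\<^sub>0 \<alpha> > 0"
  defines "t \<equiv> reml \<nu> p m \<Omega> n s y \<alpha>"
  defines "f \<equiv> \<lambda>\<theta>. indicator {0<..} \<theta> * (exp (- ((real n - real p) / 2 * (ln (\<theta> / t) + 1 / (\<theta> / t) - 1))) * prior \<theta> \<alpha> / prior \<theta>\<^sub>0 \<alpha>)"
  assumes t: "t > 0"
  shows "posterior \<nu> p m \<Omega> prior n s y \<alpha> = density lborel (\<lambda>\<theta>. ennreal (f \<theta> / integral\<^sup>L lborel f))"
proof -
  define N where "N = real n - real p"
  have N: "N > 0" using np by (simp add: N_def)
  define k where "k = \<alpha> powr (2 * \<nu>)"
  have k: "k > 0" using a by (simp add: k_def)
  define Y where "Y = y \<bullet> (Q_mat (corr_mat \<nu> n s \<alpha>) (design_mat p m n s) \<Omega> *\<^sub>v y)"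
  have tY: "k * Y = N * t" using N by (simp add: t_def reml_def k_def Y_def N_def)
  define c where "c = 1 / 2 * ln (Determinant.det (corr_mat \<nu> n s \<alpha>)) + 1 / 2 * ln (Determinant.det (gls_mat (corr_mat \<nu> n s \<alpha>) (design_mat p m n s) \<Omega>))"
  \<comment> \<open>Everything in the log-likelihood that is free of \<theta>, together with the
    minimum \<open>N / 2 * (ln t + 1)\<close>. It cancels in the normalised density.\<close>
  define C where "C = N / 2 * ln k - c - N / 2 * (ln t + 1)"
  define \<kappa> where "\<kappa> = exp C * prior \<theta>\<^sub>0 \<alpha>"
  have \<kappa>: "\<kappa> > 0" using q0 by (simp add: \<kappa>_def)
  have L: "exp (restricted_loglik \<nu> p m \<Omega> n s y (\<theta> / \<alpha> powr (2 * \<nu>)) \<alpha>) * prior \<theta> \<alpha> = \<kappa> * f \<theta>" if th: "\<theta> > 0" for \<theta>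
  proof -
    have "restricted_loglik \<nu> p m \<Omega> n s y (\<theta> / k) \<alpha> = - (1 / (2 * (\<theta> / k)) * Y) - N / 2 * ln (\<theta> / k) - c"
      by (simp add: restricted_loglik_def Let_def Y_def N_def c_def)
    also have "1 / (2 * (\<theta> / k)) * Y = N / 2 * (t / \<theta>)" using tY k th by (simp add: field_simps)
    also have "ln (\<theta> / k) = ln \<theta> - ln k" using th k by (simp add: ln_div)
    also have "- (N / 2 * (t / \<theta>)) - N / 2 * (ln \<theta> - ln k) - c = C - N / 2 * (ln (\<theta> / t) + 1 / (\<theta> / t) - 1)"
      using th t by (simp add: C_def ln_div right_diff_distrib distrib_left diff_divide_distrib)
    finally have "restricted_loglik \<nu> p m \<Omega> n s y (\<theta> / \<alpha> powr (2 * \<nu>)) \<alpha> = C - N / 2 * (ln (\<theta> / t) + 1 / (\<theta> / t) - 1)" by (simp add: k_def)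
    then have E: "exp (restricted_loglik \<nu> p m \<Omega> n s y (\<theta> / \<alpha> powr (2 * \<nu>)) \<alpha>) = exp C * exp (- (N / 2 * (ln (\<theta> / t) + 1 / (\<theta> / t) - 1)))"
      by (simp only: exp_add[symmetric] diff_conv_add_uminus)
    show ?thesis unfolding E using th q0 by (simp add: f_def \<kappa>_def N_def)
  qed
  have "(LBINT t:{0<..}. exp (restricted_loglik \<nu> p m \<Omega> n s y (t / \<alpha> powr (2 * \<nu>)) \<alpha>) * prior t \<alpha>) = (LINT \<theta>|lborel. \<kappa> * f \<theta>)"
    unfolding set_lebesgue_integral_def
  proof (intro Bochner_Integration.integral_cong refl)
    fix \<theta> :: real
    show "indicator {0<..} \<theta> *\<^sub>R (exp (restricted_loglik \<nu> p m \<Omega> n s y (\<theta> / \<alpha> powr (2 * \<nu>)) \<alpha>) * prior \<theta> \<alpha>) = \<kappa> * f \<theta>"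
      using L[of \<theta>] by (cases "\<theta> > 0") (auto simp: f_def)
  qed
  then have Z: "(LBINT t:{0<..}. exp (restricted_loglik \<nu> p m \<Omega> n s y (t / \<alpha> powr (2 * \<nu>)) \<alpha>) * prior t \<alpha>) = \<kappa> * integral\<^sup>L lborel f" by simp
  have "indicator {0<..} \<theta> * posterior_density \<nu> p m \<Omega> prior n s y \<alpha> \<theta> = f \<theta> / integral\<^sup>L lborel f" for \<theta>
  proof (cases "\<theta> > 0")
    case True
    then show ?thesis unfolding posterior_density_def Z L[OF True] using \<kappa> by simp
  qed (simp add: f_def)
  then show ?thesis unfolding posterior_def by simp
qed

text \<open>A real supremum is meaningful only for a bounded set, so the bound is also what
  justifies nonnegativity.\<close>

lemma tv_dist_le:
  assumes "\<And>A. A \<in> sets P \<Longrightarrow> \<bar>measure P A - measure Q A\<bar> \<le> c"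
  shows "tv_dist P Q \<le> c" "tv_dist P Q \<ge> 0"
proof -
  show "tv_dist P Q \<le> c" unfolding tv_dist_def by (rule cSUP_least) (use assms in auto)
  have "\<bar>measure P {} - measure Q {}\<bar> \<le> tv_dist P Q"
    unfolding tv_dist_def by (rule cSUP_upper) (use assms in \<open>auto intro!: bdd_aboveI[of _ c]\<close>)
  then show "tv_dist P Q \<ge> 0" by simp
qed

lemma iexp_diff_le: "cmod (iexp a - iexp b) \<le> \<bar>a - b\<bar>"
proof -
  have "iexp a - iexp b = iexp b * (iexp (a - b) - 1)"
    by (simp add: right_diff_distrib mult_exp_exp)
  then have "cmod (iexp a - iexp b) = cmod (iexp (a - b) - 1)" by (simp add: norm_mult)
  also have "\<dots> \<le> \<bar>a - b\<bar>" using iexp_approx1[of "a - b" 0] by simp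
  finally show ?thesis .
qed

text \<open>The map \<open>x \<mapsto> iexp (t * x)\<close> is Lipschitz with constant |t|, so
  closeness in mean carries over to characteristic functions and plays the role of Slutsky's
  theorem.\<close>

lemma (in prob_space) char_diff_le:
  assumes [measurable]: "U \<in> borel_measurable M" "V \<in> borel_measurable M" and i: "integrable M (\<lambda>w. \<bar>U w - V w\<bar>)"
  shows "cmod (char (distr M borel U) t - char (distr M borel V) t) \<le> \<bar>t\<bar> * expectation (\<lambda>w. \<bar>U w - V w\<bar>)"
proof -
  have [measurable]: "(\<lambda>x. iexp (t * x)) \<in> borel_measurable borel"
    by (intro borel_measurable_continuous_onI continuous_intros)
  have mU: "(\<lambda>w. iexp (t * U w)) \<in> borel_measurable M" "(\<lambda>w. iexp (t * V w)) \<in> borel_measurable M"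
    using measurable_compose[of U M borel "\<lambda>x. iexp (t * x)" borel] measurable_compose[of V M borel "\<lambda>x. iexp (t * x)" borel] by auto
  have iU: "integrable M (\<lambda>w. iexp (t * U w))" "integrable M (\<lambda>w. iexp (t * V w))"
    using mU by (auto intro!: integrable_const_bound[of _ 1] simp: norm_exp_eq_Re)
  have "char (distr M borel U) t - char (distr M borel V) t = (CLINT w|M. iexp (t * U w) - iexp (t * V w))"
    unfolding char_def using iU by (simp add: integral_distr Bochner_Integration.integral_diff)
  also have "cmod \<dots> \<le> (LINT w|M. cmod (iexp (t * U w) - iexp (t * V w)))" by (rule integral_norm_bound)
  also have "\<dots> \<le> (LINT w|M. \<bar>t\<bar> * \<bar>U w - V w\<bar>)"
  proof (rule integral_mono)
    show "integrable M (\<lambda>w. cmod (iexp (t * U w) - iexp (t * V w)))" using iU by auto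
    show "integrable M (\<lambda>w. \<bar>t\<bar> * \<bar>U w - V w\<bar>)" using i by auto
    show "cmod (iexp (t * U w) - iexp (t * V w)) \<le> \<bar>t\<bar> * \<bar>U w - V w\<bar>" for w
      using iexp_diff_le[of "t * U w" "t * V w"] by (simp add: abs_mult[symmetric] right_diff_distrib)
  qed
  finally show ?thesis by simp
qed

lemma (in prob_space) borel_cantelli_eventually:
  assumes meas: "\<And>n. n \<ge> n0 \<Longrightarrow> F n \<in> borel_measurable M"
    and le: "\<And>n. n \<ge> n0 \<Longrightarrow> prob {w\<in>space M. F n w \<ge> (b n :: real)} \<le> K / (real n)\<^sup>2"
  shows "AE w in M. \<forall>\<^sub>F n in sequentially. F n w < b n"
proof -
  \<comment> \<open>Empty before \<open>n0\<close>: both measurability and the tail bound are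
    assumed from there on only.\<close>
  define A where "A = (\<lambda>n. if n \<ge> n0 then {w\<in>space M. F n w \<ge> b n} else {})"
  have [measurable]: "A n \<in> sets M" for n using meas[of n] by (auto simp: A_def)
  have "AE w in M. \<forall>\<^sub>F n in sequentially. w \<in> space M - A n"
  proof (rule borel_cantelli_AE1)
    show "emeasure M (A n) < \<infinity>" for n by (simp add: emeasure_eq_measure)
    have s: "summable (\<lambda>n. K * (1 / (real n)\<^sup>2))"
      using inverse_power_summable[of 2, where 'a=real] by (intro summable_mult) (simp add: inverse_eq_divide)
    have "\<forall>\<^sub>F n in sequentially. norm (prob (A n)) \<le> K * (1 / (real n)\<^sup>2)"
      by (intro eventually_sequentiallyI[of n0]) (use le in \<open>auto simp: A_def\<close>)
    then show "summable (\<lambda>n. prob (A n))"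
      by (rule summable_comparison_test_ev[OF _ s])
  qed simp
  then show ?thesis
  proof eventually_elim
    case (elim w)
    then show ?case using eventually_ge_at_top[of n0] by eventually_elim (auto simp: A_def)
  qed
qed

lemma matern_energy_mono:
  fixes s :: "nat \<Rightarrow> 'a::euclidean_space"
  assumes a: "0 < a'" "a' \<le> a" and nu: "\<nu> > 0" and th: "\<theta> > 0"
  shows "matern_energy \<theta> \<nu> a n s c \<le> matern_energy \<theta> \<nu> a' n s c"
proof -
  let ?b = "\<nu> + real DIM('a) / 2"
  have "energy a ?b n s c \<le> 1 * energy a' ?b n s c"
    by (rule energy_mono) (use a nu in \<open>auto intro!: spec_antimono add_nonneg_nonneg\<close>)
  then show ?thesis
    unfolding matern_energy_def using less_imp_le[OF matern_energy_factor_pos[OF th nu, of "DIM('a)"]]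
    by (intro mult_left_mono) auto
qed

text \<open>Meant for the regression directions: they are normalised with the working correlation
  matrix, whereas their variance is taken under the true one. Unlike the sharper difference bound,
  this costs a constant factor, which is harmless for \<open>p\<close> variables.\<close>

lemma matern_energy_comparable:
  fixes s :: "nat \<Rightarrow> 'a::euclidean_space"
  assumes a: "a > 0" "a' > 0" and nu: "\<nu> > 0" and th: "\<theta> > 0"
  shows "matern_energy \<theta> \<nu> a n s c \<le> max 1 ((a' / a) powr (2 * (\<nu> + real DIM('a) / 2))) * matern_energy \<theta> \<nu> a' n s c"
proof -
  let ?b = "\<nu> + real DIM('a) / 2" and ?K = "max 1 ((a' / a) powr (2 * (\<nu> + real DIM('a) / 2)))"
  let ?f = "\<theta> * (Gamma ?b / (pi powr (real DIM('a) / 2) * Gamma \<nu>))"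
  have b: "?b > real DIM('a) / 2" "?b \<ge> 0" using nu by auto
  have "energy a ?b n s c \<le> ?K * energy a' ?b n s c"
    by (rule energy_mono[OF spec_comparable[OF a b(2)] a b(1)])
  then have "?f * energy a ?b n s c \<le> ?f * (?K * energy a' ?b n s c)"
    using less_imp_le[OF matern_energy_factor_pos[OF th nu, of "DIM('a)"]] by (intro mult_left_mono) auto
  then show ?thesis unfolding matern_energy_def by (simp only: mult.left_commute)
qed

lemma matern_energy_diff_bound:
  fixes T a a' \<nu> \<theta> :: real
  assumes T: "T \<ge> 0" and a: "a > 0" "a' > 0" and nu: "\<nu> > 0" and th: "\<theta> > 0" and d: "DIM('a::euclidean_space) \<le> 3"
  obtains C where "C > 0" "\<And>n (s :: nat \<Rightarrow> 'a) \<beta>. n \<ge> 1 \<Longrightarrow> (\<forall>j<n. \<forall>e\<in>Basis. \<bar>inner (s j) e\<bar> \<le> T) \<Longrightarrow>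
     dual_basis n (matern_energy \<theta> \<nu> a n s) \<beta> \<Longrightarrow>
     (\<Sum>k<n. \<bar>matern_energy \<theta> \<nu> a' n s (\<beta> k) - matern_energy \<theta> \<nu> a n s (\<beta> k)\<bar>) \<le> C * real n powr (3 / 7)"
proof -
  let ?b = "\<nu> + real DIM('a) / 2"
  have b: "?b > real DIM('a) / 2" using nu by simp
  show ?thesis
  proof (rule energy_orthonormal_diff_bound[OF T a b d matern_energy_factor_pos[OF th nu, of "DIM('a)"]])
    fix C :: real
    assume C: "C > 0" and bound: "\<And>n (s :: nat \<Rightarrow> 'a) \<beta>. n \<ge> 1 \<Longrightarrow> (\<forall>j<n. \<forall>e\<in>Basis. \<bar>inner (s j) e\<bar> \<le> T) \<Longrightarrow>
     (\<And>y. (\<theta> * (Gamma ?b / (pi powr (real DIM('a) / 2) * Gamma \<nu>))) * energy a ?b n s (\<lambda>j. \<Sum>k<n. y k * \<beta> k j) = (\<Sum>k<n. (y k)\<^sup>2)) \<Longrightarrow>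
     (\<Sum>k<n. \<bar>(\<theta> * (Gamma ?b / (pi powr (real DIM('a) / 2) * Gamma \<nu>))) * energy a' ?b n s (\<beta> k)
        - (\<theta> * (Gamma ?b / (pi powr (real DIM('a) / 2) * Gamma \<nu>))) * energy a ?b n s (\<beta> k)\<bar>) \<le> C * real n powr (3 / 7)"
    show ?thesis
    proof (rule that[OF C])
      fix n and s :: "nat \<Rightarrow> 'a" and \<beta>
      assume n: "n \<ge> 1" and s: "\<forall>j<n. \<forall>e\<in>Basis. \<bar>inner (s j) e\<bar> \<le> T" and db: "dual_basis n (matern_energy \<theta> \<nu> a n s) \<beta>"
      have "\<theta> * (Gamma ?b / (pi powr (real DIM('a) / 2) * Gamma \<nu>)) * energy a ?b n s (\<lambda>j. \<Sum>k<n. y k * \<beta> k j) = (\<Sum>k<n. (y k)\<^sup>2)" for y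
        using db by (simp add: dual_basis_def matern_energy_def)
      from bound[OF n s this]
      show "(\<Sum>k<n. \<bar>matern_energy \<theta> \<nu> a' n s (\<beta> k) - matern_energy \<theta> \<nu> a n s (\<beta> k)\<bar>) \<le> C * real n powr (3 / 7)"
        unfolding matern_energy_def .
    qed
  qed
qed

text \<open>Everything needed about one sample size. \<open>Sq\<close> is the chi-square form
  obtained by whitening with the true scale, \<open>D\<close> the change caused by whitening with
  \<alpha>, and \<open>PR\<close> the squares of the regression directions. The bounds
  \<open>T\<close> and \<open>VP\<close> are parameters, so that they can be chosen without
  reference to the design.\<close>

lemma (in prob_space) reml_form_compare:
  fixes s :: "nat \<Rightarrow> 'b::euclidean_space" and x :: "nat \<Rightarrow> 'a \<Rightarrow> real" and M\<^sub>n \<Omega> :: "real mat"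
  assumes a: "\<alpha> > 0" "\<alpha>\<^sub>0 > 0" and nu: "\<nu> > 0" and th: "\<theta> > 0" and n: "n \<ge> 2" and p: "p \<ge> 1" and inj: "inj_on s {..<n}"
    and x: "\<And>j. j < n \<Longrightarrow> x j \<in> borel_measurable M"
    and lin: "\<And>c. distr M borel (\<lambda>w. dot n c (\<lambda>j. x j w)) = normal_measure 0 (matern_energy \<theta> \<nu> \<alpha>\<^sub>0 n s c)"
    and T: "\<And>\<beta>. dual_basis n (matern_energy \<theta> \<nu> \<alpha> n s) \<beta> \<Longrightarrow>
       (\<Sum>k<n. \<bar>matern_energy \<theta> \<nu> \<alpha>\<^sub>0 n s (\<beta> k) - matern_energy \<theta> \<nu> \<alpha> n s (\<beta> k)\<bar>) \<le> T" "T > 0"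
    and M\<^sub>n: "M\<^sub>n \<in> carrier_mat n p" and ker: "\<And>v. v \<in> carrier_vec p \<Longrightarrow> M\<^sub>n *\<^sub>v v = 0\<^sub>v n \<Longrightarrow> v = 0\<^sub>v p"
    and Om: "psd_mat p \<Omega>" and b0: "\<beta>\<^sub>0 \<in> carrier_vec p"
    and VP: "VP = real p * (max 1 ((\<alpha> / \<alpha>\<^sub>0) powr (2 * (\<nu> + real DIM('b) / 2))) * (\<theta> * \<alpha> powr (- 2 * \<nu>)))"
  defines "y \<equiv> \<lambda>w. M\<^sub>n *\<^sub>v \<beta>\<^sub>0 + vec n (\<lambda>j. x j w)"
  obtains Sq D PR where
    "\<And>w. \<bar>\<alpha> powr (2 * \<nu>) * (y w \<bullet> (Q_mat (corr_mat \<nu> n s \<alpha>) M\<^sub>n \<Omega> *\<^sub>v y w)) - \<theta> * Sq w\<bar> \<le> \<theta> * D w + \<alpha> powr (2 * \<nu>) * (PR w + \<beta>\<^sub>0 \<bullet> (\<Omega> *\<^sub>v \<beta>\<^sub>0))"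
    "integrable M Sq" "expectation Sq = real n" "\<And>w. Sq w \<ge> 0"
    "prob {w\<in>space M. \<bar>Sq w - real n\<bar> \<ge> 12 * (sqrt (real n) * ln (real n))} \<le> 2 * exp 1 / (real n)\<^sup>2"
    "\<And>t. \<bar>t\<bar> < 1 \<Longrightarrow> char (distr M borel (\<lambda>w. Sq w - real n)) t = char (distr std_normal_distribution borel (\<lambda>x. x\<^sup>2 - 1)) t ^ n"
    "integrable M D" "expectation D \<le> T" "prob {w\<in>space M. D w \<ge> 16 * T * ln (real n)} \<le> 2 / (real n)\<^sup>2"
    "integrable M PR" "expectation PR \<le> VP" "prob {w\<in>space M. PR w \<ge> 16 * VP * ln (real n)} \<le> 2 / (real n)\<^sup>2"
proof -
  let ?V = "matern_energy \<theta> \<nu> \<alpha>\<^sub>0 n s" and ?W = "matern_energy \<theta> \<nu> \<alpha> n s"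
  let ?R = "corr_mat \<nu> n s \<alpha>" and ?k = "\<alpha> powr (2 * \<nu>)"
  have k: "?k > 0" using a by simp
  obtain \<beta> where pd: "pd_mat n ?R" and db: "dual_basis n ?W \<beta>"
    and q: "\<And>z. z \<in> carrier_vec n \<Longrightarrow> ?k * (z \<bullet> (minv ?R *\<^sub>v z)) = \<theta> * (\<Sum>k<n. (dot n (\<beta> k) (($) z))\<^sup>2)"
    by (rule matern_dual_basis[OF a(1) nu th inj]) (rule that)
  obtain \<beta>' where db': "dual_basis n ?V \<beta>'"
    by (rule matern_dual_basis[OF a(2) nu th inj]) (rule that)
  have V0: "?V c \<ge> 0" for c
    unfolding matern_energy_def by (rule mult_nonneg_nonneg[OF less_imp_le[OF matern_energy_factor_pos[OF th nu, of "DIM('b)"]] energy_nonneg])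
  have le: "(\<forall>c. ?W c \<le> ?V c) \<or> (\<forall>c. ?V c \<le> ?W c)"
    using matern_energy_mono[OF a(1) _ nu th, of \<alpha>\<^sub>0 n s] matern_energy_mono[OF a(2) _ nu th, of \<alpha> n s]
    by (cases "\<alpha> \<le> \<alpha>\<^sub>0") auto
  define Sq where "Sq = (\<lambda>w. \<Sum>k<n. (dot n (\<beta>' k) (\<lambda>j. x j w))\<^sup>2)"
  define D where "D = (\<lambda>w. \<bar>(\<Sum>k<n. (dot n (\<beta> k) (\<lambda>j. x j w))\<^sup>2) - (\<Sum>k<n. (dot n (\<beta>' k) (\<lambda>j. x j w))\<^sup>2)\<bar>)"
  have n1: "n \<ge> 1" using n by simp
  note cmp = dual_forms_compare[OF x lin V0 db' db le matern_energy_cong[OF a(1) nu] matern_energy_cong[OF a(2) nu] T(1)[OF db] T(2) n1]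
  have gc: "gaussian_coords M n (\<lambda>k w. dot n (\<beta>' k) (\<lambda>j. x j w))" by (rule cmp(4))
  obtain u where u: "\<And>j. j < p \<Longrightarrow> u j \<in> carrier_vec n" "\<And>j. j < p \<Longrightarrow> u j \<bullet> (?R *\<^sub>v u j) = 1"
    and up: "\<And>z. z \<in> carrier_vec n \<Longrightarrow> (M\<^sub>n *\<^sub>v \<beta>\<^sub>0 + z) \<bullet> (Q_mat ?R M\<^sub>n \<Omega> *\<^sub>v (M\<^sub>n *\<^sub>v \<beta>\<^sub>0 + z)) \<le> z \<bullet> (minv ?R *\<^sub>v z) + \<beta>\<^sub>0 \<bullet> (\<Omega> *\<^sub>v \<beta>\<^sub>0)"
    and lo: "\<And>z. z \<in> carrier_vec n \<Longrightarrow> (M\<^sub>n *\<^sub>v \<beta>\<^sub>0 + z) \<bullet> (Q_mat ?R M\<^sub>n \<Omega> *\<^sub>v (M\<^sub>n *\<^sub>v \<beta>\<^sub>0 + z)) \<ge> z \<bullet> (minv ?R *\<^sub>v z) - (\<Sum>j<p. (u j \<bullet> z)\<^sup>2)"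
  proof (rule Q_mat_bounds[OF pd M\<^sub>n _ Om b0])
    show "v = 0\<^sub>v p" if "v \<in> carrier_vec p" "M\<^sub>n *\<^sub>v v = 0\<^sub>v n" for v using that by (rule ker)
  qed (rule that)
  define PR where "PR = (\<lambda>w. \<Sum>j<p. (dot n (($) (u j)) (\<lambda>i. x i w))\<^sup>2)"
  have vu: "?V (($) (u j)) \<le> VP / real p" if j: "j < p" for j
  proof -
    have "?W (($) (u j)) = \<theta> * \<alpha> powr (- 2 * \<nu>) * (u j \<bullet> (?R *\<^sub>v u j))"
      unfolding matern_energy_eq[OF a(1) nu] corr_mat_quadratic_form[OF u(1)[OF j]] ..
    also have "\<dots> = \<theta> * \<alpha> powr (- 2 * \<nu>)" unfolding u(2)[OF j] by simp
    finally show ?thesis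
      using matern_energy_comparable[OF a(2) a(1) nu th, of n s "($) (u j)"] p unfolding VP by simp
  qed
  have VPpos: "VP > 0" unfolding VP using p th a by (intro mult_pos_pos) (auto simp: max_def)
  have sumV: "(\<Sum>j<p. ?V (($) (u j))) \<le> VP"
  proof -
    have "(\<Sum>j<p. ?V (($) (u j))) \<le> (\<Sum>j<p. VP / real p)" using vu by (intro sum_mono) auto
    then show ?thesis using p by simp
  qed
  have meas: "(\<lambda>w. dot n c (\<lambda>j. x j w)) \<in> borel_measurable M" for c
    by (intro borel_measurable_sum borel_measurable_times borel_measurable_const x) auto
  have sq: "integrable M (\<lambda>w. (dot n c (\<lambda>j. x j w))\<^sup>2)" "expectation (\<lambda>w. (dot n c (\<lambda>j. x j w))\<^sup>2) = ?V c" for c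
    using normal_second_moment[OF V0[of c]] meas[of c] unfolding lin[symmetric] by (auto simp: integrable_distr_eq integral_distr)
  have PRi: "integrable M PR" unfolding PR_def using sq by (intro Bochner_Integration.integrable_sum) auto
  have PRe: "expectation PR \<le> VP" unfolding PR_def using sq sumV by (subst Bochner_Integration.integral_sum) auto
  have PRp: "prob {w\<in>space M. PR w \<ge> 16 * VP * ln (real n)} \<le> 2 / (real n)\<^sup>2"
    unfolding PR_def
    by (rule sum_normal_squares_tail[where v="\<lambda>j. ?V (($) (u j))"]) (use meas lin V0 sumV VPpos p n in auto)
  have main: "\<bar>?k * (y w \<bullet> (Q_mat ?R M\<^sub>n \<Omega> *\<^sub>v y w)) - \<theta> * Sq w\<bar> \<le> \<theta> * D w + ?k * (PR w + \<beta>\<^sub>0 \<bullet> (\<Omega> *\<^sub>v \<beta>\<^sub>0))" for w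
  proof -
    let ?z = "vec n (\<lambda>j. x j w)"
    have z: "?z \<in> carrier_vec n" by simp
    have dz: "dot n c (($) ?z) = dot n c (\<lambda>j. x j w)" for c by (intro sum.cong) auto
    have kq: "?k * (?z \<bullet> (minv ?R *\<^sub>v ?z)) = \<theta> * (\<Sum>k<n. (dot n (\<beta> k) (\<lambda>j. x j w))\<^sup>2)" unfolding q[OF z] dz ..
    have uz: "(\<Sum>j<p. (u j \<bullet> ?z)\<^sup>2) = PR w"
      unfolding PR_def using u(1) by (intro sum.cong refl) (auto simp: scalar_prod_def atLeast0LessThan intro!: arg_cong[where f="\<lambda>r. r\<^sup>2"] sum.cong)
    have O0: "\<beta>\<^sub>0 \<bullet> (\<Omega> *\<^sub>v \<beta>\<^sub>0) \<ge> 0" using Om b0 by (auto simp: psd_mat_def)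
    have PR0: "PR w \<ge> 0" by (simp add: PR_def sum_nonneg)
    have "?k * (y w \<bullet> (Q_mat ?R M\<^sub>n \<Omega> *\<^sub>v y w)) \<le> ?k * (?z \<bullet> (minv ?R *\<^sub>v ?z) + \<beta>\<^sub>0 \<bullet> (\<Omega> *\<^sub>v \<beta>\<^sub>0))"
      unfolding y_def using k by (intro mult_left_mono up[OF z]) auto
    then have 1: "?k * (y w \<bullet> (Q_mat ?R M\<^sub>n \<Omega> *\<^sub>v y w)) \<le> \<theta> * (\<Sum>k<n. (dot n (\<beta> k) (\<lambda>j. x j w))\<^sup>2) + ?k * (\<beta>\<^sub>0 \<bullet> (\<Omega> *\<^sub>v \<beta>\<^sub>0))"
      unfolding distrib_left kq .
    have "?k * (?z \<bullet> (minv ?R *\<^sub>v ?z) - PR w) \<le> ?k * (y w \<bullet> (Q_mat ?R M\<^sub>n \<Omega> *\<^sub>v y w))"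
      unfolding y_def uz[symmetric] using k by (intro mult_left_mono lo[OF z]) auto
    then have 2: "\<theta> * (\<Sum>k<n. (dot n (\<beta> k) (\<lambda>j. x j w))\<^sup>2) - ?k * PR w \<le> ?k * (y w \<bullet> (Q_mat ?R M\<^sub>n \<Omega> *\<^sub>v y w))"
      unfolding right_diff_distrib kq .
    have 3: "\<bar>\<theta> * (\<Sum>k<n. (dot n (\<beta> k) (\<lambda>j. x j w))\<^sup>2) - \<theta> * Sq w\<bar> = \<theta> * D w"
      using th by (simp add: D_def Sq_def abs_mult right_diff_distrib[symmetric])
    have "?k * PR w \<ge> 0" "?k * (\<beta>\<^sub>0 \<bullet> (\<Omega> *\<^sub>v \<beta>\<^sub>0)) \<ge> 0" using k PR0 O0 by auto
    then show ?thesis using 1 2 3 unfolding distrib_left by linarith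
  qed
  show ?thesis
  proof (rule that[of Sq D PR])
    show "prob {w\<in>space M. \<bar>Sq w - real n\<bar> \<ge> 12 * (sqrt (real n) * ln (real n))} \<le> 2 * exp 1 / (real n)\<^sup>2"
      unfolding Sq_def by (rule gaussian_coords.sum_square_deviation[OF gc n])
    show "char (distr M borel (\<lambda>w. Sq w - real n)) t = char (distr std_normal_distribution borel (\<lambda>x. x\<^sup>2 - 1)) t ^ n" if "\<bar>t\<bar> < 1" for t
      unfolding Sq_def by (rule gaussian_coords.char_sum_square[OF gc that])
    show "Sq w \<ge> 0" for w by (simp add: Sq_def sum_nonneg)
    show "integrable M D" "expectation D \<le> T" "prob {w\<in>space M. D w \<ge> 16 * T * ln (real n)} \<le> 2 / (real n)\<^sup>2"
      "integrable M Sq" "expectation Sq = real n"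
      using cmp(1,2,3,5,6) by (simp_all add: D_def Sq_def)
  qed (use main PRi PRe PRp in auto)
qed

text \<open>The REML equals \<open>\<theta> * Sq n / (n - p)\<close>, with \<open>Sq n\<close> a chi-square variable with \<open>n\<close> degrees of freedom, up to the
  error \<open>D n\<close> from the misspecified scale parameter and \<open>PR n\<close> from the regression.\<close>

locale reml_expansion = prob_space M for M :: "'a measure" +
  fixes \<theta> \<kappa> c\<^sub>0 c\<^sub>1 v :: real and p n\<^sub>0 :: nat and rm Sq D PR :: "nat \<Rightarrow> 'a \<Rightarrow> real"
  assumes pos: "\<theta> > 0" "\<kappa> > 0" and n0: "n\<^sub>0 \<ge> 2" "n\<^sub>0 > 2 * p"
    and rm_measurable: "\<And>n. rm n \<in> borel_measurable M"
    and rm_bound: "\<And>n w. n \<ge> n\<^sub>0 \<Longrightarrow> w \<in> space M \<Longrightarrow>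
      \<bar>(real n - real p) * rm n w - \<theta> * Sq n w\<bar> \<le> \<theta> * D n w + \<kappa> * (PR n w + c\<^sub>0)"
    and Sq: "\<And>n. n \<ge> n\<^sub>0 \<Longrightarrow> integrable M (Sq n)" "\<And>n. n \<ge> n\<^sub>0 \<Longrightarrow> expectation (Sq n) = real n" "\<And>n w. n \<ge> n\<^sub>0 \<Longrightarrow> Sq n w \<ge> 0"
      "\<And>n. n \<ge> n\<^sub>0 \<Longrightarrow> prob {w\<in>space M. \<bar>Sq n w - real n\<bar> \<ge> 12 * (sqrt (real n) * ln (real n))} \<le> 2 * exp 1 / (real n)\<^sup>2"
      "\<And>n t. n \<ge> n\<^sub>0 \<Longrightarrow> \<bar>t\<bar> < 1 \<Longrightarrow>
        char (distr M borel (\<lambda>w. Sq n w - real n)) t = char (distr std_normal_distribution borel (\<lambda>x. x\<^sup>2 - 1)) t ^ n"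
    and D: "\<And>n. n \<ge> n\<^sub>0 \<Longrightarrow> integrable M (D n)" "\<And>n. n \<ge> n\<^sub>0 \<Longrightarrow> expectation (D n) \<le> c\<^sub>1 * real n powr (3 / 7)"
      "\<And>n. n \<ge> n\<^sub>0 \<Longrightarrow> prob {w\<in>space M. D n w \<ge> 16 * (c\<^sub>1 * real n powr (3 / 7)) * ln (real n)} \<le> 2 / (real n)\<^sup>2"
    and PR: "\<And>n. n \<ge> n\<^sub>0 \<Longrightarrow> integrable M (PR n)" "\<And>n. n \<ge> n\<^sub>0 \<Longrightarrow> expectation (PR n) \<le> v"
      "\<And>n. n \<ge> n\<^sub>0 \<Longrightarrow> prob {w\<in>space M. PR n w \<ge> 16 * v * ln (real n)} \<le> 2 / (real n)\<^sup>2"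
begin

text \<open>The condition on \<open>n\<^sub>0\<close> gives \<open>n - p\<close> at least
  \<open>n / 2\<close>. Replacing \<open>n - p\<close> by \<open>n\<close> in the denominator then
  costs the last term, which has mean of order \<open>1 / sqrt n\<close> because \<open>Sq n\<close>
  has mean n.\<close>

lemma scaled_deviation:
  assumes n: "n \<ge> n\<^sub>0" and w: "w \<in> space M"
  shows "\<bar>sqrt (real n) * (rm n w - \<theta>) - \<theta> * (Sq n w - real n) / sqrt (real n)\<bar>
    \<le> 2 / sqrt (real n) * (\<theta> * D n w + \<kappa> * (PR n w + c\<^sub>0)) + 2 * \<theta> * real p / (real n * sqrt (real n)) * Sq n w"
proof -
  define N where "N = real n - real p"
  define s where "s = sqrt (real n)"
  define e where "e = N * rm n w - \<theta> * Sq n w"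
  have N: "N > 0" "2 * N \<ge> real n" using n n0 by (auto simp: N_def)
  have s: "s > 0" "real n = s * s" using n n0 by (auto simp: s_def)
  have nN: "s * s = N + real p" using s by (simp add: N_def)
  have rm: "rm n w = (e + \<theta> * Sq n w) / N" using N by (simp add: e_def)
  have "s * (rm n w - \<theta>) - \<theta> * (Sq n w - real n) / s = s * rm n w - \<theta> * Sq n w / s"
    using s by (simp add: field_simps)
  also have "\<dots> = s / N * e + \<theta> * Sq n w * (s / N - 1 / s)" unfolding rm using N s by (simp add: field_simps)
  also have "s / N - 1 / s = real p / (N * s)" using N s nN by (simp add: field_simps)
  finally have eq: "s * (rm n w - \<theta>) - \<theta> * (Sq n w - real n) / s = s / N * e + \<theta> * Sq n w * (real p / (N * s))" .
  have e: "\<bar>e\<bar> \<le> \<theta> * D n w + \<kappa> * (PR n w + c\<^sub>0)" using rm_bound[OF n w] by (simp add: e_def N_def)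
  have sN: "s / N \<le> 2 / s" using N s by (simp add: divide_le_eq le_divide_eq)
  have pN: "real p / (N * s) \<le> real p * 2 / (real n * s)"
  proof -
    have "1 / N \<le> 2 / real n" using N s n n0 by (simp add: divide_le_eq le_divide_eq)
    then have "real p / s * (1 / N) \<le> real p / s * (2 / real n)" using s by (intro mult_left_mono) auto
    then show ?thesis by (simp add: mult.commute)
  qed
  have "\<bar>s / N * e + \<theta> * Sq n w * (real p / (N * s))\<bar> \<le> s / N * \<bar>e\<bar> + \<theta> * Sq n w * (real p / (N * s))"
    using N s pos Sq(3)[OF n, of w] by (intro order_trans[OF abs_triangle_ineq] add_mono) (auto simp: abs_mult)
  also have "\<dots> \<le> 2 / s * (\<theta> * D n w + \<kappa> * (PR n w + c\<^sub>0)) + \<theta> * Sq n w * (real p * 2 / (real n * s))"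
    using e sN pN s N pos Sq(3)[OF n, of w] by (intro add_mono mult_mono mult_left_mono) auto
  also have "\<theta> * Sq n w * (real p * 2 / (real n * s)) = 2 * \<theta> * real p / (real n * s) * Sq n w" by simp
  finally show ?thesis using eq by (simp only: s_def)
qed

text \<open>With \<open>n powr (3 / 7)\<close> divided by \<open>sqrt n\<close>, the right side is
  of order \<open>n powr (- 1 / 14)\<close>: the margin left by the choice of the exponent
  7/4.\<close>

lemma mean_deviation:
  assumes n: "n \<ge> n\<^sub>0"
  defines "\<Delta> \<equiv> \<lambda>w. \<bar>sqrt (real n) * (rm n w - \<theta>) - \<theta> * (Sq n w - real n) / sqrt (real n)\<bar>"
  shows "integrable M \<Delta>"
    and "expectation \<Delta> \<le> 2 / sqrt (real n) * (\<theta> * (c\<^sub>1 * real n powr (3 / 7)) + \<kappa> * (v + c\<^sub>0) + \<theta> * real p)"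
proof -
  note i = Sq(1)[OF n] D(1)[OF n] PR(1)[OF n]
  have mb: "rm n \<in> borel_measurable M" "Sq n \<in> borel_measurable M" using rm_measurable i by auto
  have mD: "\<Delta> \<in> borel_measurable M" unfolding \<Delta>_def by (intro borel_measurable_abs borel_measurable_divide borel_measurable_times borel_measurable_diff borel_measurable_const mb)
  define B where "B = (\<lambda>w. 2 / sqrt (real n) * (\<theta> * D n w + \<kappa> * (PR n w + c\<^sub>0)) + 2 * \<theta> * real p / (real n * sqrt (real n)) * Sq n w)"
  have iB: "integrable M B" unfolding B_def using i by (intro Bochner_Integration.integrable_add integrable_mult_right) auto
  have le: "\<Delta> w \<le> B w" if "w \<in> space M" for w using scaled_deviation[OF n that] by (simp add: \<Delta>_def B_def)
  show iD: "integrable M \<Delta>"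
  proof (rule Bochner_Integration.integrable_bound[OF iB mD], intro AE_I2)
    fix w assume "w \<in> space M"
    from le[OF this] show "norm (\<Delta> w) \<le> norm (B w)" by (simp add: \<Delta>_def)
  qed
  have n0': "real n > 0" using n n0 by simp
  have "expectation \<Delta> \<le> expectation B" using iD iB le by (intro integral_mono) auto
  also have "expectation B = 2 / sqrt (real n) * (\<theta> * expectation (D n) + \<kappa> * (expectation (PR n) + c\<^sub>0)) + 2 * \<theta> * real p / (real n * sqrt (real n)) * real n"
    unfolding B_def using i Sq(2)[OF n] by (simp add: prob_space)
  also have "2 * \<theta> * real p / (real n * sqrt (real n)) * real n = 2 / sqrt (real n) * (\<theta> * real p)" using n0' by simp
  also have "2 / sqrt (real n) * (\<theta> * expectation (D n) + \<kappa> * (expectation (PR n) + c\<^sub>0)) + 2 / sqrt (real n) * (\<theta> * real p)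
      = 2 / sqrt (real n) * (\<theta> * expectation (D n) + \<kappa> * (expectation (PR n) + c\<^sub>0) + \<theta> * real p)" by (simp only: distrib_left)
  also have "\<dots> \<le> 2 / sqrt (real n) * (\<theta> * (c\<^sub>1 * real n powr (3 / 7)) + \<kappa> * (v + c\<^sub>0) + \<theta> * real p)"
    using D(2)[OF n] PR(2)[OF n] pos by (intro mult_left_mono add_mono) auto
  finally show "expectation \<Delta> \<le> 2 / sqrt (real n) * (\<theta> * (c\<^sub>1 * real n powr (3 / 7)) + \<kappa> * (v + c\<^sub>0) + \<theta> * real p)" .
qed

text \<open>By Levy continuity it is enough to follow characteristic functions. That of the scaled
  REML differs by at most \<open>\<bar>t\<bar> * r n\<close> from a power of a fixed characteristic
  function, for which the limit is known.\<close>

lemma asymptotic_normality: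
  "weak_conv_m (\<lambda>n. distr M borel (\<lambda>w. sqrt (real n) * (rm n w - \<theta>))) (normal_measure 0 (2 * \<theta>\<^sup>2))"
proof (rule levy_continuity)
  show "real_distribution (distr M borel (\<lambda>w. sqrt (real n) * (rm n w - \<theta>)))" for n
    by (intro real_distribution_distr borel_measurable_times borel_measurable_diff borel_measurable_const rm_measurable)
  interpret N: prob_space "normal_measure 0 (2 * \<theta>\<^sup>2)" by simp
  show "real_distribution (normal_measure 0 (2 * \<theta>\<^sup>2))" by unfold_locales auto
  fix t :: real
  define \<Phi> where "\<Phi> = char (distr std_normal_distribution borel (\<lambda>x. x\<^sup>2 - 1))"
  define U where "U = (\<lambda>n w. sqrt (real n) * (rm n w - \<theta>))"
  define V where "V = (\<lambda>n w. \<theta> * (Sq n w - real n) / sqrt (real n))"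
  define r where "r = (\<lambda>n::nat. 2 / sqrt (real n) * (\<theta> * (c\<^sub>1 * real n powr (3 / 7)) + \<kappa> * (v + c\<^sub>0) + \<theta> * real p))"
  have lim: "char (normal_measure 0 (2 * \<theta>\<^sup>2)) t = complex_of_real (exp (- ((t * \<theta>)\<^sup>2)))"
    using normal_cexp[of "2 * \<theta>\<^sup>2" "\<i> * complex_of_real t"]
    by (simp add: char_def mult.assoc power_mult_distrib exp_of_real[symmetric])
  have "(\<lambda>n. \<Phi> (t * \<theta> / sqrt (real n)) ^ n) \<longlonglongrightarrow> complex_of_real (exp (- ((t * \<theta>)\<^sup>2)))"
    unfolding \<Phi>_def by (rule chi_square_clt)
  moreover have "(\<lambda>n. char (distr M borel (U n)) t - \<Phi> (t * \<theta> / sqrt (real n)) ^ n) \<longlonglongrightarrow> 0"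
  proof (rule Lim_null_comparison)
    show "\<forall>\<^sub>F n in sequentially. norm (char (distr M borel (U n)) t - \<Phi> (t * \<theta> / sqrt (real n)) ^ n) \<le> \<bar>t\<bar> * r n"
    proof -
      \<comment> \<open>The argument eventually enters the interval on which the characteristic
        function of the quadratic form is known.\<close>
      have "(\<lambda>n. \<bar>t * \<theta> / sqrt (real n)\<bar>) \<longlonglongrightarrow> 0" by (rule tendsto_rabs_zero) real_asymp
      then have "\<forall>\<^sub>F n in sequentially. \<bar>t * \<theta> / sqrt (real n)\<bar> < 1" by (rule order_tendstoD) simp
      then show ?thesis using eventually_ge_at_top[of n\<^sub>0]
      proof eventually_elim
        case (elim n)
        have m: "rm n \<in> borel_measurable M" "Sq n \<in> borel_measurable M" using rm_measurable Sq(1)[OF elim(2)] by auto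
        have mU: "U n \<in> borel_measurable M" unfolding U_def by (intro borel_measurable_times borel_measurable_diff borel_measurable_const m)
        have mV: "V n \<in> borel_measurable M" unfolding V_def by (intro borel_measurable_divide borel_measurable_times borel_measurable_diff borel_measurable_const m)
        have mS: "(\<lambda>w. Sq n w - real n) \<in> borel_measurable M" by (intro borel_measurable_diff borel_measurable_const m)
        have mc: "(\<lambda>x. iexp (u * x)) \<in> borel_measurable borel" for u :: real
          by (intro borel_measurable_continuous_onI continuous_intros)
        have "char (distr M borel (V n)) t = (CLINT w|M. iexp (t * V n w))"
          unfolding char_def by (rule integral_distr[OF mV mc])
        also have "\<dots> = (CLINT w|M. iexp ((t * \<theta> / sqrt (real n)) * (Sq n w - real n)))"
          by (simp add: V_def mult.assoc)
        also have "\<dots> = char (distr M borel (\<lambda>w. Sq n w - real n)) (t * \<theta> / sqrt (real n))"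
          unfolding char_def by (rule integral_distr[OF mS mc, symmetric])
        also have "\<dots> = \<Phi> (t * \<theta> / sqrt (real n)) ^ n"
          unfolding \<Phi>_def by (rule Sq(5)[OF elim(2) elim(1)])
        finally have cV: "\<Phi> (t * \<theta> / sqrt (real n)) ^ n = char (distr M borel (V n)) t" ..
        have "cmod (char (distr M borel (U n)) t - char (distr M borel (V n)) t) \<le> \<bar>t\<bar> * expectation (\<lambda>w. \<bar>U n w - V n w\<bar>)"
          by (rule char_diff_le[OF mU mV]) (use mean_deviation(1)[OF elim(2)] in \<open>simp add: U_def V_def\<close>)
        also have "\<dots> \<le> \<bar>t\<bar> * r n"
          unfolding U_def V_def r_def by (intro mult_left_mono mean_deviation(2)[OF elim(2)]) auto
        finally show ?case unfolding cV .
      qed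
    qed
    have "(\<lambda>n::nat. 2 / sqrt (real n) * (real n powr (3 / 7))) \<longlonglongrightarrow> 0" "(\<lambda>n::nat. 2 / sqrt (real n)) \<longlonglongrightarrow> 0" by real_asymp+
    from tendsto_add[OF tendsto_mult_left[OF this(1), of "\<theta> * c\<^sub>1"] tendsto_mult_left[OF this(2), of "\<kappa> * (v + c\<^sub>0) + \<theta> * real p"]]
    have "r \<longlonglongrightarrow> 0" by (simp add: r_def algebra_simps)
    then show "(\<lambda>n. \<bar>t\<bar> * r n) \<longlonglongrightarrow> 0" by (rule tendsto_mult_right_zero)
  qed
  ultimately have "(\<lambda>n. (char (distr M borel (U n)) t - \<Phi> (t * \<theta> / sqrt (real n)) ^ n) + \<Phi> (t * \<theta> / sqrt (real n)) ^ n)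
      \<longlonglongrightarrow> 0 + complex_of_real (exp (- ((t * \<theta>)\<^sup>2)))" by (intro tendsto_add)
  then show "(\<lambda>n. char (distr M borel (\<lambda>w. sqrt (real n) * (rm n w - \<theta>))) t) \<longlonglongrightarrow> char (normal_measure 0 (2 * \<theta>\<^sup>2)) t"
    unfolding lim U_def by simp
qed

text \<open>Among the terms of \<open>h\<close> the chi-square fluctuation dominates and fixes the
  rate; the logarithm is the price of summable tails. The resulting scale
  \<open>ln n / sqrt n\<close> is also the window scale of the Laplace approximation, so the centre
  of the posterior moves only by a multiple of the window.\<close>

lemma almost_sure_rate:
  obtains C where "C \<ge> 0" "AE w in M. \<forall>\<^sub>F n in sequentially. \<bar>rm n w - \<theta>\<bar> \<le> C * (ln (real n) / sqrt (real n))"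
proof -
  define g where "g = (\<lambda>n::nat. ln (real n) / sqrt (real n))"
  define h where "h = (\<lambda>n::nat. (12 * \<theta>) * (ln (real n) / sqrt (real n)) + (2 * \<theta> * (16 * c\<^sub>1)) * (real n powr (3 / 7) * ln (real n) / real n)
     + (2 * \<kappa> * (16 * v)) * (ln (real n) / real n) + (2 * \<kappa> * c\<^sub>0) * (1 / real n)
     + (2 * \<theta> * real p) * ((real n + 12 * (sqrt (real n) * ln (real n))) / (real n * real n)))"
  have "h \<in> O(g)"
  proof -
    have "(\<lambda>n::nat. ln (real n) / sqrt (real n)) \<in> O(g)" "(\<lambda>n::nat. real n powr (3 / 7) * ln (real n) / real n) \<in> O(g)"
      "(\<lambda>n::nat. ln (real n) / real n) \<in> O(g)" "(\<lambda>n::nat. 1 / real n) \<in> O(g)"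
      "(\<lambda>n::nat. (real n + 12 * (sqrt (real n) * ln (real n))) / (real n * real n)) \<in> O(g)"
      unfolding g_def by real_asymp+
    note terms = this
    have cm: "(\<lambda>n. c * f n) \<in> O(g)" if "f \<in> O(g)" for c :: real and f :: "nat \<Rightarrow> real"
      using that by (cases "c = 0") auto
    show ?thesis unfolding h_def by (intro sum_in_bigo cm terms)
  qed
  then obtain C where C: "C > 0" "\<forall>\<^sub>F n in sequentially. norm (h n) \<le> C * norm (g n)" by (rule landau_o.bigE)
  have b: "AE w in M. \<forall>\<^sub>F n in sequentially. \<bar>Sq n w - real n\<bar> < 12 * (sqrt (real n) * ln (real n))"
    "AE w in M. \<forall>\<^sub>F n in sequentially. D n w < 16 * (c\<^sub>1 * real n powr (3 / 7)) * ln (real n)"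
    "AE w in M. \<forall>\<^sub>F n in sequentially. PR n w < 16 * v * ln (real n)"
  proof -
    show "AE w in M. \<forall>\<^sub>F n in sequentially. \<bar>Sq n w - real n\<bar> < 12 * (sqrt (real n) * ln (real n))"
    proof (rule borel_cantelli_eventually[of n\<^sub>0, OF _ Sq(4)])
      fix n assume "n \<ge> n\<^sub>0"
      then have "Sq n \<in> borel_measurable M" using Sq(1) by auto
      then show "(\<lambda>w. \<bar>Sq n w - real n\<bar>) \<in> borel_measurable M" by (intro borel_measurable_abs borel_measurable_diff borel_measurable_const)
    qed
    show "AE w in M. \<forall>\<^sub>F n in sequentially. D n w < 16 * (c\<^sub>1 * real n powr (3 / 7)) * ln (real n)"
      by (rule borel_cantelli_eventually[of n\<^sub>0, OF _ D(3)]) (use D(1) in auto)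
    show "AE w in M. \<forall>\<^sub>F n in sequentially. PR n w < 16 * v * ln (real n)"
      by (rule borel_cantelli_eventually[of n\<^sub>0, OF _ PR(3)]) (use PR(1) in auto)
  qed
  have "AE w in M. \<forall>\<^sub>F n in sequentially. \<bar>rm n w - \<theta>\<bar> \<le> C * (ln (real n) / sqrt (real n))"
    using b AE_space
  proof eventually_elim
    case (elim w)
    from elim(1-3) C(2) eventually_ge_at_top[of n\<^sub>0] show ?case
    proof eventually_elim
      case (elim n)
      define s where "s = sqrt (real n)"
      define l where "l = ln (real n)"
      have s: "s > 0" "real n = s * s" using elim(5) n0 by (auto simp: s_def)
      have l: "l \<ge> 0" using elim(5) n0 by (simp add: l_def)
      have "\<bar>sqrt (real n) * (rm n w - \<theta>)\<bar> \<le> \<bar>\<theta> * (Sq n w - real n) / sqrt (real n)\<bar> + (2 / sqrt (real n) * (\<theta> * D n w + \<kappa> * (PR n w + c\<^sub>0)) + 2 * \<theta> * real p / (real n * sqrt (real n)) * Sq n w)"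
        using scaled_deviation[OF elim(5) \<open>w \<in> space M\<close>] by linarith
      then have "s * \<bar>rm n w - \<theta>\<bar> \<le> \<theta> / s * \<bar>Sq n w - real n\<bar> + (2 / s * (\<theta> * D n w + \<kappa> * (PR n w + c\<^sub>0)) + 2 * \<theta> * real p / (real n * s) * Sq n w)"
        unfolding s_def[symmetric] using s pos by (simp add: abs_mult)
      also have "\<dots> \<le> \<theta> / s * (12 * (s * l)) + (2 / s * (\<theta> * (16 * (c\<^sub>1 * real n powr (3 / 7)) * l) + \<kappa> * (16 * v * l + c\<^sub>0)) + 2 * \<theta> * real p / (real n * s) * (real n + 12 * (s * l)))"
        using elim(1-3) pos s unfolding s_def[symmetric] l_def[symmetric]
        by (intro add_mono mult_left_mono) auto
      also have "\<dots> = s * h n"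
      proof -
        define q where "q = real n powr (3 / 7)"
        define B where "B = real n + 12 * (s * l)"
        have e: "\<theta> / s * (12 * (s * l)) = s * ((12 * \<theta>) * (l / s))"
          "2 / s * (\<theta> * (16 * (c\<^sub>1 * q) * l)) = s * ((2 * \<theta> * (16 * c\<^sub>1)) * (q * l / (s * s)))"
          "2 / s * (\<kappa> * (16 * v * l)) = s * ((2 * \<kappa> * (16 * v)) * (l / (s * s)))"
          "2 / s * (\<kappa> * c\<^sub>0) = s * ((2 * \<kappa> * c\<^sub>0) * (1 / (s * s)))"
          "2 * \<theta> * real p / (s * s * s) * B = s * ((2 * \<theta> * real p) * (B / (s * s * (s * s))))"
          using s(1) by simp_all
        show ?thesis
          unfolding h_def s_def[symmetric] l_def[symmetric] q_def[symmetric] B_def[symmetric] unfolding s(2)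
          by (simp only: distrib_left e add.assoc)
      qed
      finally have "s * \<bar>rm n w - \<theta>\<bar> \<le> s * h n" .
      then have "\<bar>rm n w - \<theta>\<bar> \<le> h n" using s by simp
      also have "\<dots> \<le> C * norm (g n)" using elim(4) by simp
      also have "norm (g n) = ln (real n) / sqrt (real n)" using s(1) l by (simp add: g_def s_def l_def)
      finally show ?case .
    qed
  qed
  with C(1) show ?thesis by (intro that[of C]) auto
qed

end

text \<open>A deterministic statement, uniform in the design and the data: randomness enters only
  through the distance from the REML to \<open>\<theta>\<^sub>0\<close>, so one \<open>K\<close>
  serves all outcomes.\<close>

lemma posterior_tv_rate:
  fixes \<alpha> \<nu> \<theta>\<^sub>0 C :: real and \<Omega> :: "real mat" and m :: "nat \<Rightarrow> 'a::euclidean_space \<Rightarrow> real" and prior :: "real \<Rightarrow> real \<Rightarrow> real" and p :: nat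
  assumes a: "\<alpha> > 0" and th: "\<theta>\<^sub>0 > 0" and C: "C \<ge> 0" and nonneg: "\<And>\<theta>. \<theta> > 0 \<Longrightarrow> prior \<theta> \<alpha> \<ge> 0"
    and proper: "(\<integral>\<^sup>+ \<theta>\<in>{0<..}. ennreal (prior \<theta> \<alpha>) \<partial>lborel) = 1"
    and diff: "\<And>\<theta>. \<theta> > 0 \<Longrightarrow> ((\<lambda>t. prior t \<alpha>) has_real_derivative prior' \<theta>) (at \<theta>)" and pos: "prior \<theta>\<^sub>0 \<alpha> > 0"
  shows "\<exists>K. \<forall>\<^sub>F n in sequentially. \<forall>s y. \<bar>reml \<nu> p m \<Omega> n s y \<alpha> - \<theta>\<^sub>0\<bar> \<le> C * (ln (real n) / sqrt (real n)) \<longrightarrow>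
     0 \<le> tv_dist (posterior \<nu> p m \<Omega> prior n s y \<alpha>) (normal_measure (reml \<nu> p m \<Omega> n s y \<alpha>) (2 * \<theta>\<^sub>0\<^sup>2 / real n)) \<and>
     tv_dist (posterior \<nu> p m \<Omega> prior n s y \<alpha>) (normal_measure (reml \<nu> p m \<Omega> n s y \<alpha>) (2 * \<theta>\<^sub>0\<^sup>2 / real n))
       \<le> K * (real n powr (- 1 / 2) * ln (real n) ^ 3)"
proof -
  let ?q = "\<lambda>\<theta>. prior \<theta> \<alpha>"
  have "continuous_on {0<..} ?q"
    using diff by (intro continuous_at_imp_continuous_on ballI) (auto intro: DERIV_isCont)
  then have meas: "(\<lambda>\<theta>. indicator {0<..} \<theta> * ?q \<theta>) \<in> borel_measurable lborel"
    using borel_measurable_continuous_on_indicator[of "{0<..}" ?q] by simp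
  have nn: "(\<integral>\<^sup>+ \<theta>. ennreal (indicator {0<..} \<theta> * ?q \<theta>) \<partial>lborel) = 1"
    unfolding proper[symmetric] by (intro nn_integral_cong) (auto simp: indicator_def)
  have pos': "0 \<le> indicator {0<..} \<theta> * ?q \<theta>" for \<theta> using nonneg[of \<theta>] by (auto simp: indicator_def)
  have qi: "integrable lborel (\<lambda>\<theta>. indicator {0<..} \<theta> * ?q \<theta>)"
    by (rule integrableI_nonneg[OF meas]) (use pos' nn in auto)
  have q1: "(LINT \<theta>|lborel. indicator {0<..} \<theta> * ?q \<theta>) = 1"
    using integral_eq_nn_integral[OF meas] pos' nn by simp
  obtain r L where rL: "r > 0" "L \<ge> 0" "\<And>\<theta>. \<bar>\<theta> - \<theta>\<^sub>0\<bar> < r \<Longrightarrow> \<bar>?q \<theta> - ?q \<theta>\<^sub>0\<bar> \<le> L * \<bar>\<theta> - \<theta>\<^sub>0\<bar>"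
    by (rule C1_local_lipschitz[OF diff[OF th]]) (rule that)
  define f where "f = (\<lambda>(n::nat) t \<theta>. indicator {0<..} \<theta> * (exp (- ((real n - real p) / 2 * (ln (\<theta> / t) + 1 / (\<theta> / t) - 1))) * ?q \<theta> / ?q \<theta>\<^sub>0))"
  obtain K where K: "\<forall>\<^sub>F n in sequentially. \<forall>t. \<bar>t - \<theta>\<^sub>0\<bar> \<le> C * (ln (real n) / sqrt (real n)) \<longrightarrow>
     t > 0 \<and> integrable lborel (f n t) \<and> 0 < integral\<^sup>L lborel (f n t) \<and>
     (\<forall>A\<in>sets borel. \<bar>measure (density lborel (\<lambda>\<theta>. ennreal (f n t \<theta> / integral\<^sup>L lborel (f n t)))) A
        - measure (normal_measure t (2 * \<theta>\<^sub>0\<^sup>2 / real n)) A\<bar> \<le> K * (real n powr (- 1 / 2) * ln (real n) ^ 3))"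
    using laplace_tv[OF th C nonneg qi q1 pos rL(1,2) rL(3), of p] unfolding f_def by blast
  show ?thesis
  proof (intro exI[of _ K], use K eventually_gt_at_top[of p] in eventually_elim, intro allI impI)
    fix n and s :: "nat \<Rightarrow> 'a" and y
    let ?t = "reml \<nu> p m \<Omega> n s y \<alpha>"
    let ?P = "posterior \<nu> p m \<Omega> prior n s y \<alpha>" and ?N = "normal_measure ?t (2 * \<theta>\<^sub>0\<^sup>2 / real n)"
    assume K: "\<forall>t. \<bar>t - \<theta>\<^sub>0\<bar> \<le> C * (ln (real n) / sqrt (real n)) \<longrightarrow>
     t > 0 \<and> integrable lborel (f n t) \<and> 0 < integral\<^sup>L lborel (f n t) \<and>
     (\<forall>A\<in>sets borel. \<bar>measure (density lborel (\<lambda>\<theta>. ennreal (f n t \<theta> / integral\<^sup>L lborel (f n t)))) A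
        - measure (normal_measure t (2 * \<theta>\<^sub>0\<^sup>2 / real n)) A\<bar> \<le> K * (real n powr (- 1 / 2) * ln (real n) ^ 3))"
      and n: "p < n" and close: "\<bar>?t - \<theta>\<^sub>0\<bar> \<le> C * (ln (real n) / sqrt (real n))"
    note K' = K[rule_format, OF close]
    have eq: "?P = density lborel (\<lambda>\<theta>. ennreal (f n ?t \<theta> / integral\<^sup>L lborel (f n ?t)))"
      unfolding f_def by (rule posterior_eq_normalized[where prior=prior and \<theta>\<^sub>0=\<theta>\<^sub>0, OF a n pos conjunct1[OF K']])
    have "\<bar>measure ?P A - measure ?N A\<bar> \<le> K * (real n powr (- 1 / 2) * ln (real n) ^ 3)" if "A \<in> sets ?P" for A
    proof -
      have "A \<in> sets borel" using that by (simp add: posterior_def)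
      then show ?thesis unfolding eq by (rule bspec[OF conjunct2[OF conjunct2[OF conjunct2[OF K']]]])
    qed
    from tv_dist_le[OF this] show "0 \<le> tv_dist ?P ?N \<and> tv_dist ?P ?N \<le> K * (real n powr (- 1 / 2) * ln (real n) ^ 3)"
      by blast
  qed
qed

text \<open>This is needed for every n, including those below \<open>p\<close>, where the matrix
  inverted inside \<open>Q_mat\<close> may be singular and its \<open>minv\<close> unspecified. The
  row count of \<open>Q_mat\<close> comes from \<open>minv\<close> of the correlation matrix alone,
  and the pairings sum over the length of the data vector, so the REML is a fixed quadratic
  polynomial in the data whatever that inner inverse is.\<close>

lemma reml_measurable:
  fixes s :: "nat \<Rightarrow> 'a::euclidean_space" and y :: "'w \<Rightarrow> real Matrix.vec"
  assumes a: "\<alpha> > 0" and nu: "\<nu> > 0" and inj: "inj_on s {..<n}"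
    and dim: "\<And>w. dim_vec (y w) = n" and y: "\<And>i. i < n \<Longrightarrow> (\<lambda>w. y w $ i) \<in> borel_measurable M"
  shows "(\<lambda>w. reml \<nu> p m \<Omega> n s (y w) \<alpha>) \<in> borel_measurable M"
proof -
  have one: "(0::real) < 1" by simp
  have "pd_mat n (corr_mat \<nu> n s \<alpha>)" by (rule matern_dual_basis[OF a nu one inj])
  then have R: "minv (corr_mat \<nu> n s \<alpha>) \<in> carrier_mat n n" by (rule pd_mat_minv)
  let ?Q = "Q_mat (corr_mat \<nu> n s \<alpha>) (design_mat p m n s) \<Omega>"
  have Q: "dim_row ?Q = n" using R by (simp add: Q_mat_def)
  have "reml \<nu> p m \<Omega> n s (y w) \<alpha> = \<alpha> powr (2 * \<nu>) / (real n - real p) * (\<Sum>i<n. y w $ i * (\<Sum>j<n. row ?Q i $ j * y w $ j))" for w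
    using Q dim[of w] by (simp add: reml_def scalar_prod_def atLeast0LessThan)
  then have eq: "(\<lambda>w. reml \<nu> p m \<Omega> n s (y w) \<alpha>)
      = (\<lambda>w. \<alpha> powr (2 * \<nu>) / (real n - real p) * (\<Sum>i<n. y w $ i * (\<Sum>j<n. row ?Q i $ j * y w $ j)))" by (rule ext)
  have inner: "(\<lambda>w. \<Sum>j<n. c j * y w $ j) \<in> borel_measurable M" for c
  proof (rule borel_measurable_sum)
    fix j assume "j \<in> {..<n}"
    then show "(\<lambda>w. c j * y w $ j) \<in> borel_measurable M" using borel_measurable_times[OF borel_measurable_const y] by simp
  qed
  have "(\<lambda>w. \<Sum>i<n. y w $ i * (\<Sum>j<n. row ?Q i $ j * y w $ j)) \<in> borel_measurable M"
  proof (rule borel_measurable_sum)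
    fix i assume "i \<in> {..<n}"
    then show "(\<lambda>w. y w $ i * (\<Sum>j<n. row ?Q i $ j * y w $ j)) \<in> borel_measurable M" using borel_measurable_times[OF y inner] by simp
  qed
  then show ?thesis unfolding eq by (rule borel_measurable_times[OF borel_measurable_const])
qed

text \<open>Members of a Sobolev space are classes modulo null sets, while the design matrix uses
  values at points; continuity of the \<open>m j\<close> selects the representative. The double
  index of \<open>s\<close> allows an unrelated design for each n. The quotient under the limit
  superior is formed for every n; its finitely many values with a vanishing denominator do not
  affect the limit.\<close>

theorem theorem1:
  fixes T \<nu> \<alpha> \<alpha>\<^sub>0 \<sigma>sq\<^sub>0 \<theta>\<^sub>0 :: real
    and p :: nat
    and S :: "(real ^ 'd::finite) set"
    and m :: "nat \<Rightarrow> real ^ 'd \<Rightarrow> real"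
    and \<beta>\<^sub>0 :: "real vec"
    and \<Omega> :: "real mat"
    and s :: "nat \<Rightarrow> nat \<Rightarrow> real ^ 'd"
    and P :: "'w measure"
    and X Y :: "real ^ 'd \<Rightarrow> 'w \<Rightarrow> real"
    and Yn :: "nat \<Rightarrow> 'w \<Rightarrow> real vec"
    and prior :: "real \<Rightarrow> real \<Rightarrow> real"
  assumes dim: "CARD('d) \<in> {1, 2, 3}"
    and params: "T > 0" "\<nu> > 0" "\<alpha> > 0" "\<alpha>\<^sub>0 > 0" "\<sigma>sq\<^sub>0 > 0" "p \<ge> 1"
    and S_def: "S = cbox 0 (\<chi> i. T)"
    and theta0_def: "\<theta>\<^sub>0 = \<sigma>sq\<^sub>0 * \<alpha>\<^sub>0 powr (2 * \<nu>)"
    and beta0: "\<beta>\<^sub>0 \<in> carrier_vec p"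
    and m_sobolev: "\<And>j. j < p \<Longrightarrow> m j \<in> sobolev_space (\<nu> + real CARD('d) / 2) S"
    and m_continuous_representative: "\<And>j. j < p \<Longrightarrow> continuous_on S (m j)"
    and prob: "prob_space P"
    and X_gaussian: "gaussian_process P S X"
    and X_mean: "\<And>t. t \<in> S \<Longrightarrow> (LINT w|P. X t w) = 0"
    and X_cov: "\<And>t u. t \<in> S \<Longrightarrow> u \<in> S \<Longrightarrow>
                  covariance P (X t) (X u) = \<sigma>sq\<^sub>0 * matern \<alpha>\<^sub>0 \<nu> (t - u)"
    and Y_def: "\<And>t w. t \<in> S \<Longrightarrow> w \<in> space P \<Longrightarrow> Y t w = vec p (\<lambda>j. m j t) \<bullet> \<beta>\<^sub>0 + X t w"
    and s_in: "\<And>n i. i < n \<Longrightarrow> s n i \<in> S"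
    and s_distinct: "\<And>n. inj_on (s n) {..<n}"
    and Yn_def: "\<And>n w. Yn n w = vec n (\<lambda>i. Y (s n i) w)"
    and full_rank: "\<And>n. n \<ge> p \<Longrightarrow> vec_space.rank n (design_mat p m n (s n)) = p"
    and Omega: "psd_mat p \<Omega>"
    and prior_nonneg: "\<And>\<theta> a. \<theta> > 0 \<Longrightarrow> a > 0 \<Longrightarrow> prior \<theta> a \<ge> 0"
    and prior_proper: "\<And>a. a > 0 \<Longrightarrow> (\<integral>\<^sup>+ \<theta>\<in>{0<..}. ennreal (prior \<theta> a) \<partial>lborel) = 1"
    and prior_C1: "\<And>a. a > 0 \<Longrightarrow>
                    \<exists>prior'. (\<forall>\<theta>>0. ((\<lambda>t. prior t a) has_real_derivative prior' \<theta>) (at \<theta>)) \<and>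
                             continuous_on {0<..} prior'"
    and prior_cont_alpha: "\<And>\<theta>. \<theta> > 0 \<Longrightarrow> continuous_on {0<..} (\<lambda>a. prior \<theta> a)"
    and prior_pos: "\<And>a. a > 0 \<Longrightarrow> prior \<theta>\<^sub>0 a > 0"
  shows "weak_conv_m
           (\<lambda>n. distr P borel
              (\<lambda>w. sqrt (real n) * (reml \<nu> p m \<Omega> n (s n) (Yn n w) \<alpha> - \<theta>\<^sub>0)))
           (normal_measure 0 (2 * \<theta>\<^sub>0\<^sup>2))
       \<and> (AE w in P.
            limsup (\<lambda>n. ereal
              (tv_dist (posterior \<nu> p m \<Omega> prior n (s n) (Yn n w) \<alpha>)
                       (normal_measure (reml \<nu> p m \<Omega> n (s n) (Yn n w) \<alpha>) (2 * \<theta>\<^sub>0\<^sup>2 / real n))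
               / (real n powr (- 1 / 2) * (ln (real n)) ^ 3))) < \<infinity>
          \<and> (\<lambda>n. tv_dist (posterior \<nu> p m \<Omega> prior n (s n) (Yn n w) \<alpha>)
                        (normal_measure (reml \<nu> p m \<Omega> n (s n) (Yn n w) \<alpha>) (2 * \<theta>\<^sub>0\<^sup>2 / real n)))
              \<longlonglongrightarrow> 0)"
proof -
  interpret P: prob_space P by fact
  note T = params(1) and nu = params(2) and a = params(3) and a0 = params(4) and p = params(6)
  have th: "\<theta>\<^sub>0 > 0" unfolding theta0_def using params by simp
  have X: "t \<in> S \<Longrightarrow> X t \<in> borel_measurable P" for t using X_gaussian by (auto simp: gaussian_process_def)
  have S_bound: "\<forall>j<n. \<forall>e\<in>Basis. \<bar>inner (s n j) e\<bar> \<le> T" for n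
  proof (intro allI impI ballI)
    fix j and e :: "real ^ 'd" assume j: "j < n" and e: "e \<in> Basis"
    have "0 \<le> s n j $ i \<and> s n j $ i \<le> T" for i using s_in[OF j] by (simp add: S_def mem_box_cart)
    moreover obtain i where "e = axis i 1" using e by (auto simp: Basis_vec_def)
    ultimately show "\<bar>inner (s n j) e\<bar> \<le> T" by (simp add: inner_axis)
  qed
  have d3: "DIM(real ^ 'd) \<le> 3" using dim by auto
  have dm: "design_mat p m n (s n) \<in> carrier_mat n p" for n by (simp add: design_mat_def)
  have Yn: "Yn n w = design_mat p m n (s n) *\<^sub>v \<beta>\<^sub>0 + vec n (\<lambda>j. X (s n j) w)" if w: "w \<in> space P" for n w
  proof (rule eq_vecI)
    fix i assume "i < dim_vec (design_mat p m n (s n) *\<^sub>v \<beta>\<^sub>0 + vec n (\<lambda>j. X (s n j) w))"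
    then have i: "i < n" by simp
    have "row (design_mat p m n (s n)) i = vec p (\<lambda>j. m j (s n i))" using i by (intro eq_vecI) (auto simp: design_mat_def)
    then show "Yn n w $ i = (design_mat p m n (s n) *\<^sub>v \<beta>\<^sub>0 + vec n (\<lambda>j. X (s n j) w)) $ i"
      using i dm[of n] Y_def[OF s_in[OF i] w] by (simp add: Yn_def)
  qed (use dm[of n] in \<open>simp add: Yn_def\<close>)
  have lin: "distr P borel (\<lambda>w. \<Sum>j<n. c j * X (s n j) w) = normal_measure 0 (matern_energy \<theta>\<^sub>0 \<nu> \<alpha>\<^sub>0 n (s n) c)" for n c
  proof -
    have "\<theta>\<^sub>0 * \<alpha>\<^sub>0 powr (- 2 * \<nu>) = \<sigma>sq\<^sub>0" unfolding theta0_def using a0 by (simp add: powr_minus field_simps)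
    then have "(\<Sum>i<n. \<Sum>j<n. c i * c j * (\<sigma>sq\<^sub>0 * matern \<alpha>\<^sub>0 \<nu> (s n i - s n j))) = matern_energy \<theta>\<^sub>0 \<nu> \<alpha>\<^sub>0 n (s n) c"
      unfolding matern_energy_eq[OF a0 nu] by (simp add: sum_distrib_left mult_ac)
    with gaussian_process_linear[OF prob X_gaussian X_mean X_cov s_in s_distinct, of n c] show ?thesis by simp
  qed
  obtain c\<^sub>1 where c1: "c\<^sub>1 > 0" "\<And>n (s :: nat \<Rightarrow> real ^ 'd) \<beta>. n \<ge> 1 \<Longrightarrow> (\<forall>j<n. \<forall>e\<in>Basis. \<bar>inner (s j) e\<bar> \<le> T) \<Longrightarrow>
     dual_basis n (matern_energy \<theta>\<^sub>0 \<nu> \<alpha> n s) \<beta> \<Longrightarrow>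
     (\<Sum>k<n. \<bar>matern_energy \<theta>\<^sub>0 \<nu> \<alpha>\<^sub>0 n s (\<beta> k) - matern_energy \<theta>\<^sub>0 \<nu> \<alpha> n s (\<beta> k)\<bar>) \<le> c\<^sub>1 * real n powr (3 / 7)"
    by (rule matern_energy_diff_bound[OF less_imp_le[OF T] a a0 nu th d3]) (rule that)
  define \<kappa> where "\<kappa> = \<alpha> powr (2 * \<nu>)"
  define c\<^sub>0 where "c\<^sub>0 = \<beta>\<^sub>0 \<bullet> (\<Omega> *\<^sub>v \<beta>\<^sub>0)"
  define v where "v = real p * (max 1 ((\<alpha> / \<alpha>\<^sub>0) powr (2 * (\<nu> + real DIM(real ^ 'd) / 2))) * (\<theta>\<^sub>0 * \<alpha> powr (- 2 * \<nu>)))"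
  define rm where "rm = (\<lambda>n w. reml \<nu> p m \<Omega> n (s n) (Yn n w) \<alpha>)"
  \<comment> \<open>Large enough for full column rank, for \<open>n - p\<close> to be at least half
    of n, and for the tail bounds that require n to be at least 2.\<close>
  define n\<^sub>0 where "n\<^sub>0 = 2 * p + 2"
  \<comment> \<open>All properties of the three variables at one sample size in a single predicate,
    so that one application of choice turns them into sequences to which the expansion
    applies.\<close>
  define \<Phi> where "\<Phi> = (\<lambda>n Sq D PR. (\<forall>w\<in>space P. \<bar>(real n - real p) * rm n w - \<theta>\<^sub>0 * Sq w\<bar> \<le> \<theta>\<^sub>0 * D w + \<kappa> * (PR w + c\<^sub>0)) \<and>
     integrable P Sq \<and> P.expectation Sq = real n \<and> (\<forall>w. Sq w \<ge> 0) \<and>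
     P.prob {w\<in>space P. \<bar>Sq w - real n\<bar> \<ge> 12 * (sqrt (real n) * ln (real n))} \<le> 2 * exp 1 / (real n)\<^sup>2 \<and>
     (\<forall>t. \<bar>t\<bar> < 1 \<longrightarrow> char (distr P borel (\<lambda>w. Sq w - real n)) t = char (distr std_normal_distribution borel (\<lambda>x. x\<^sup>2 - 1)) t ^ n) \<and>
     integrable P D \<and> P.expectation D \<le> c\<^sub>1 * real n powr (3 / 7) \<and>
     P.prob {w\<in>space P. D w \<ge> 16 * (c\<^sub>1 * real n powr (3 / 7)) * ln (real n)} \<le> 2 / (real n)\<^sup>2 \<and>
     integrable P PR \<and> P.expectation PR \<le> v \<and> P.prob {w\<in>space P. PR w \<ge> 16 * v * ln (real n)} \<le> 2 / (real n)\<^sup>2)"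
  have "\<exists>Sq D PR. \<Phi> n Sq D PR" if n: "n \<ge> n\<^sub>0" for n
  proof -
    have n': "n \<ge> 2" "n \<ge> 1" "n \<ge> p" "real n - real p \<noteq> 0" using n by (auto simp: n\<^sub>0_def)
    have mX: "j < n \<Longrightarrow> X (s n j) \<in> borel_measurable P" for j using X s_in by auto
    have cp: "c\<^sub>1 * real n powr (3 / 7) > 0" using c1(1) n' by simp
    have ker: "u = 0\<^sub>v p" if "u \<in> carrier_vec p" "design_mat p m n (s n) *\<^sub>v u = 0\<^sub>v n" for u
      by (rule full_column_rank_kernel[OF dm full_rank[OF n'(3)] that])
    note cmp = P.reml_form_compare[OF a a0 nu th n'(1) p s_distinct mX lin c1(2)[OF n'(2) S_bound] cp dm _ Omega beta0 v_def]
    show ?thesis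
    proof (rule cmp)
      show "u = 0\<^sub>v p" if "u \<in> carrier_vec p" "design_mat p m n (s n) *\<^sub>v u = 0\<^sub>v n" for u using that by (rule ker)
      fix Sq D PR
      assume 1: "\<And>w. \<bar>\<alpha> powr (2 * \<nu>) * ((design_mat p m n (s n) *\<^sub>v \<beta>\<^sub>0 + vec n (\<lambda>j. X (s n j) w)) \<bullet>
           (Q_mat (corr_mat \<nu> n (s n) \<alpha>) (design_mat p m n (s n)) \<Omega> *\<^sub>v (design_mat p m n (s n) *\<^sub>v \<beta>\<^sub>0 + vec n (\<lambda>j. X (s n j) w)))) - \<theta>\<^sub>0 * Sq w\<bar>
           \<le> \<theta>\<^sub>0 * D w + \<alpha> powr (2 * \<nu>) * (PR w + \<beta>\<^sub>0 \<bullet> (\<Omega> *\<^sub>v \<beta>\<^sub>0))"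
        and 2: "integrable P Sq" "P.expectation Sq = real n" "\<And>w. Sq w \<ge> 0"
          "P.prob {w\<in>space P. \<bar>Sq w - real n\<bar> \<ge> 12 * (sqrt (real n) * ln (real n))} \<le> 2 * exp 1 / (real n)\<^sup>2"
          "\<And>t. \<bar>t\<bar> < 1 \<Longrightarrow> char (distr P borel (\<lambda>w. Sq w - real n)) t = char (distr std_normal_distribution borel (\<lambda>x. x\<^sup>2 - 1)) t ^ n"
          "integrable P D" "P.expectation D \<le> c\<^sub>1 * real n powr (3 / 7)"
          "P.prob {w\<in>space P. D w \<ge> 16 * (c\<^sub>1 * real n powr (3 / 7)) * ln (real n)} \<le> 2 / (real n)\<^sup>2"
          "integrable P PR" "P.expectation PR \<le> v" "P.prob {w\<in>space P. PR w \<ge> 16 * v * ln (real n)} \<le> 2 / (real n)\<^sup>2"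
      have "\<bar>(real n - real p) * rm n w - \<theta>\<^sub>0 * Sq w\<bar> \<le> \<theta>\<^sub>0 * D w + \<kappa> * (PR w + c\<^sub>0)" if w: "w \<in> space P" for w
      proof -
        have "(real n - real p) * rm n w = \<alpha> powr (2 * \<nu>) * (Yn n w \<bullet> (Q_mat (corr_mat \<nu> n (s n) \<alpha>) (design_mat p m n (s n)) \<Omega> *\<^sub>v Yn n w))"
          using n'(4) by (simp add: rm_def reml_def)
        then show ?thesis using 1[of w] unfolding Yn[OF w] \<kappa>_def c\<^sub>0_def by simp
      qed
      then have "\<Phi> n Sq D PR" unfolding \<Phi>_def using 2 by blast
      then show ?thesis by blast
    qed
  qed
  then obtain Sq D PR where \<Phi>: "\<And>n. n \<ge> n\<^sub>0 \<Longrightarrow> \<Phi> n (Sq n) (D n) (PR n)" by metis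
  have rm_measurable: "rm n \<in> borel_measurable P" for n
    unfolding rm_def
  proof (rule reml_measurable[OF a nu s_distinct])
    show "dim_vec (Yn n w) = n" for w by (simp add: Yn_def)
    fix i assume i: "i < n"
    have "(\<lambda>w. vec p (\<lambda>j. m j (s n i)) \<bullet> \<beta>\<^sub>0 + X (s n i) w) \<in> borel_measurable P"
      by (intro borel_measurable_add borel_measurable_const X s_in i)
    moreover have "Yn n w $ i = vec p (\<lambda>j. m j (s n i)) \<bullet> \<beta>\<^sub>0 + X (s n i) w" if "w \<in> space P" for w
      using i Y_def[OF s_in[OF i] that] by (simp add: Yn_def)
    ultimately show "(\<lambda>w. Yn n w $ i) \<in> borel_measurable P" by (subst measurable_cong) auto
  qed
  interpret R: reml_expansion P \<theta>\<^sub>0 \<kappa> c\<^sub>0 c\<^sub>1 v p n\<^sub>0 rm Sq D PR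
  proof
    show "0 < \<theta>\<^sub>0" "0 < \<kappa>" "2 \<le> n\<^sub>0" "2 * p < n\<^sub>0" using th a by (auto simp: \<kappa>_def n\<^sub>0_def)
    show "rm n \<in> borel_measurable P" for n by (rule rm_measurable)
  qed (use \<Phi> in \<open>simp_all add: \<Phi>_def\<close>)
  obtain C where C: "C \<ge> 0" "AE w in P. \<forall>\<^sub>F n in sequentially. \<bar>rm n w - \<theta>\<^sub>0\<bar> \<le> C * (ln (real n) / sqrt (real n))"
    by (rule R.almost_sure_rate)
  obtain prior' where prior': "\<And>\<theta>. \<theta> > 0 \<Longrightarrow> ((\<lambda>t. prior t \<alpha>) has_real_derivative prior' \<theta>) (at \<theta>)" using prior_C1[OF a] by blast
  define tv where "tv = (\<lambda>n w. tv_dist (posterior \<nu> p m \<Omega> prior n (s n) (Yn n w) \<alpha>) (normal_measure (rm n w) (2 * \<theta>\<^sub>0\<^sup>2 / real n)))"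
  define \<rho> where "\<rho> = (\<lambda>n::nat. real n powr (- 1 / 2) * ln (real n) ^ 3)"
  obtain K where K: "\<forall>\<^sub>F n in sequentially. \<forall>w. \<bar>rm n w - \<theta>\<^sub>0\<bar> \<le> C * (ln (real n) / sqrt (real n)) \<longrightarrow> 0 \<le> tv n w \<and> tv n w \<le> K * \<rho> n"
  proof -
    obtain K where "\<forall>\<^sub>F n in sequentially. \<forall>s y. \<bar>reml \<nu> p m \<Omega> n s y \<alpha> - \<theta>\<^sub>0\<bar> \<le> C * (ln (real n) / sqrt (real n)) \<longrightarrow>
     0 \<le> tv_dist (posterior \<nu> p m \<Omega> prior n s y \<alpha>) (normal_measure (reml \<nu> p m \<Omega> n s y \<alpha>) (2 * \<theta>\<^sub>0\<^sup>2 / real n)) \<and>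
     tv_dist (posterior \<nu> p m \<Omega> prior n s y \<alpha>) (normal_measure (reml \<nu> p m \<Omega> n s y \<alpha>) (2 * \<theta>\<^sub>0\<^sup>2 / real n))
       \<le> K * (real n powr (- 1 / 2) * ln (real n) ^ 3)"
      using posterior_tv_rate[where prior=prior, OF a th C(1) prior_nonneg[OF _ a] prior_proper[OF a] prior' prior_pos[OF a], of \<nu> p m \<Omega>] by blast
    then show ?thesis by (intro that[of K], eventually_elim) (simp add: rm_def tv_def \<rho>_def)
  qed
  have "AE w in P. limsup (\<lambda>n. ereal (tv n w / \<rho> n)) < \<infinity> \<and> (\<lambda>n. tv n w) \<longlonglongrightarrow> 0"
    using C(2)
  proof eventually_elim
    case (elim w)
    from elim K have bnd: "\<forall>\<^sub>F n in sequentially. 0 \<le> tv n w \<and> tv n w \<le> K * \<rho> n" by eventually_elim blast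
    have "\<forall>\<^sub>F n in sequentially. \<rho> n > 0" using eventually_ge_at_top[of 3]
      by eventually_elim (auto simp: \<rho>_def intro!: mult_pos_pos zero_less_power ln_gt_zero)
    with bnd have "\<forall>\<^sub>F n in sequentially. ereal (tv n w / \<rho> n) \<le> ereal K"
      by eventually_elim (simp add: divide_le_eq)
    from Limsup_bounded[OF this] have "limsup (\<lambda>n. ereal (tv n w / \<rho> n)) \<le> ereal K" .
    then have "limsup (\<lambda>n. ereal (tv n w / \<rho> n)) < \<infinity>" by (rule order_le_less_trans) simp
    moreover have "(\<lambda>n. tv n w) \<longlonglongrightarrow> 0"
    proof (rule Lim_null_comparison)
      show "\<forall>\<^sub>F n in sequentially. norm (tv n w) \<le> K * \<rho> n" using bnd by eventually_elim auto
      have "\<rho> \<longlonglongrightarrow> 0" unfolding \<rho>_def by real_asymp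
      then show "(\<lambda>n. K * \<rho> n) \<longlonglongrightarrow> 0" by (rule tendsto_mult_right_zero)
    qed
    ultimately show ?case ..
  qed
  then show ?thesis using R.asymptotic_normality unfolding tv_def \<rho>_def rm_def by blast
qed

end
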